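(* Let $R$ be a local Gorenstein ring with infinite residue field and let $I$ be a Cohen-Macaulay $R$-ideal of positive codimension. Let $x\in R$ be regular on $R$ and on $R/I$. Then $$\int (I,x) = \Big(\int I,\ x\Big).$$
   Context: All rings are commutative and Noetherian. A proper ideal $I$ of a local ring $R$ is Cohen-Macaulay (CM) if $R/I$ is a Cohen-Macaulay ring, and unmixed if all its associated primes have the same height. An element $x$ is regular on a module $M$ if it is a nonzerodivisor on $M$ and $xM\neq M$. A complete intersection is a proper ideal generated by a regular sequence. Two proper ideals $I,J$ of a local Gorenstein ring are directly linked if there is a complete intersection $(\underline{\alpha})\subseteq I\cap J$ with $I=(\underline{\alpha}):J$ and $J=(\underline{\alpha}):I$. The equivalence relation on unmixed ideals generated by direct linkage is called linkage (CI-liaison); its classes are linkage classes. An ideal is licci if it lies in the linkage class of a complete intersection. For an unmixed $R$-ideal $I$, the ideal $\int I$ is defined as the sum of all ideals in the linkage class of $I$ if $I$ is not licci, and as the unit ideal $R$ if $I$ is licci. *)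

theory Defs
  imports
    "HOL-Algebra.Ring_Divisibility"
    "HOL-Algebra.Module"
    "HOL-Library.Extended_Nat"
begin

section \<open>Noetherian local rings\<close>

definition noetherian_local :: "('a, 'm) ring_scheme \<Rightarrow> bool" where
  "noetherian_local R \<longleftrightarrow> cring R \<and> noetherian_ring R \<and> (\<exists>!M. maximalideal M R)"

definition max_ideal :: "('a, 'm) ring_scheme \<Rightarrow> 'a set" where
  "max_ideal R = (THE M. maximalideal M R)"

definition residue_field :: "('a, 'm) ring_scheme \<Rightarrow> 'a set ring" where
  "residue_field R = R Quot max_ideal R"

definition proper_ideal :: "('a, 'm) ring_scheme \<Rightarrow> 'a set \<Rightarrow> bool" where
  "proper_ideal R I \<longleftrightarrow> ideal I R \<and> I \<noteq> carrier R"

definition ideal_colon :: "('a, 'm) ring_scheme \<Rightarrow> 'a set \<Rightarrow> 'a set \<Rightarrow> 'a set" where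
  "ideal_colon R I J = {r \<in> carrier R. \<forall>j\<in>J. r \<otimes>\<^bsub>R\<^esub> j \<in> I}"


section \<open>Modules and regular elements\<close>

text \<open>The record type of modules extends that of rings; the components \<open>mult\<close> and \<open>one\<close>
  of a module record carry no information.\<close>

definition self_module :: "('a, 'm) ring_scheme \<Rightarrow> ('a, 'a) module" where
  "self_module R =
    \<lparr>carrier = carrier R, mult = mult R, one = one R, zero = zero R, add = add R, smult = mult R\<rparr>"

definition quot_module :: "('a, 'm) ring_scheme \<Rightarrow> 'a set \<Rightarrow> ('a, 'a set) module" where
  "quot_module R I =
    \<lparr>carrier = carrier (R Quot I), mult = mult (R Quot I), one = one (R Quot I),
     zero = zero (R Quot I), add = add (R Quot I),
     smult = (\<lambda>r C. (I +>\<^bsub>R\<^esub> r) \<otimes>\<^bsub>R Quot I\<^esub> C)\<rparr>"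

definition regular_on :: "('a, 'm) ring_scheme \<Rightarrow> ('a, 'b, 'n) module_scheme \<Rightarrow> 'a \<Rightarrow> bool" where
  "regular_on R M x \<longleftrightarrow> x \<in> carrier R \<and>
     (\<forall>m\<in>carrier M. x \<odot>\<^bsub>M\<^esub> m = \<zero>\<^bsub>M\<^esub> \<longrightarrow> m = \<zero>\<^bsub>M\<^esub>) \<and>
     (\<lambda>m. x \<odot>\<^bsub>M\<^esub> m) ` carrier M \<noteq> carrier M"

definition regular_sequence :: "('a, 'm) ring_scheme \<Rightarrow> 'a list \<Rightarrow> bool" where
  "regular_sequence R xs \<longleftrightarrow> set xs \<subseteq> carrier R \<and>
     (\<forall>i<length xs. regular_on R (quot_module R (genideal R (set (take i xs)))) (xs ! i))"

text \<open>The empty sequence is allowed: the zero ideal of a nonzero ring is a complete intersection.\<close>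

definition complete_intersection :: "('a, 'm) ring_scheme \<Rightarrow> 'a set \<Rightarrow> bool" where
  "complete_intersection R I \<longleftrightarrow> proper_ideal R I \<and>
     (\<exists>xs. regular_sequence R xs \<and> I = genideal R (set xs))"


section \<open>Dimension, height and depth\<close>

definition krull_dim :: "('a, 'm) ring_scheme \<Rightarrow> enat" where
  "krull_dim R = Sup {enat n | n. \<exists>P :: nat \<Rightarrow> 'a set.
     (\<forall>i\<le>n. primeideal (P i) R) \<and> (\<forall>i<n. P i \<subset> P (Suc i))}"

definition prime_height :: "('a, 'm) ring_scheme \<Rightarrow> 'a set \<Rightarrow> enat" where
  "prime_height R Q = Sup {enat n | n. \<exists>P :: nat \<Rightarrow> 'a set.
     (\<forall>i\<le>n. primeideal (P i) R) \<and> (\<forall>i<n. P i \<subset> P (Suc i)) \<and> P n = Q}"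

definition codim :: "('a, 'm) ring_scheme \<Rightarrow> 'a set \<Rightarrow> enat" where
  "codim R I = Inf {prime_height R P | P. primeideal P R \<and> I \<subseteq> P}"

definition ring_depth :: "('a, 'm) ring_scheme \<Rightarrow> enat" where
  "ring_depth R = Sup {enat (length xs) | xs. regular_sequence R xs \<and> set xs \<subseteq> max_ideal R}"


section \<open>Cohen--Macaulay and unmixed ideals\<close>

definition cohen_macaulay_local :: "('a, 'm) ring_scheme \<Rightarrow> bool" where
  "cohen_macaulay_local R \<longleftrightarrow> noetherian_local R \<and> ring_depth R = krull_dim R"

definition cohen_macaulay_ideal :: "('a, 'm) ring_scheme \<Rightarrow> 'a set \<Rightarrow> bool" where
  "cohen_macaulay_ideal R I \<longleftrightarrow> proper_ideal R I \<and> cohen_macaulay_local (R Quot I)"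

definition associated_primes ::
  "('a, 'm) ring_scheme \<Rightarrow> ('a, 'b, 'n) module_scheme \<Rightarrow> 'a set set" where
  "associated_primes R M =
     {P. primeideal P R \<and> (\<exists>m\<in>carrier M. P = {r \<in> carrier R. r \<odot>\<^bsub>M\<^esub> m = \<zero>\<^bsub>M\<^esub>})}"

text \<open>The associated primes of an ideal \<open>I\<close> are those of the module \<open>R/I\<close>.\<close>

definition unmixed :: "('a, 'm) ring_scheme \<Rightarrow> 'a set \<Rightarrow> bool" where
  "unmixed R I \<longleftrightarrow> proper_ideal R I \<and>
     (\<forall>P\<in>associated_primes R (quot_module R I). \<forall>Q\<in>associated_primes R (quot_module R I).
        prime_height R P = prime_height R Q)"


section \<open>Gorenstein local rings\<close>

definition mod_hom ::
  "('a, 'm) ring_scheme \<Rightarrow> ('a, 'b, 'n) module_scheme \<Rightarrow> ('a, 'c, 'k) module_scheme \<Rightarrow> ('b \<Rightarrow> 'c) set" where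
  "mod_hom R M N = {f \<in> hom (add_monoid M) (add_monoid N).
     \<forall>r\<in>carrier R. \<forall>m\<in>carrier M. f (r \<odot>\<^bsub>M\<^esub> m) = r \<odot>\<^bsub>N\<^esub> f m}"

text \<open>The test modules \<open>M\<close> and \<open>N\<close> range over the modules carried by subsets of the type of
  ring elements. These include \<open>R\<close> and all its ideals, so by Baer's criterion this is
  injectivity with respect to all \<open>R\<close>-modules.\<close>

definition injective_module :: "('a, 'm) ring_scheme \<Rightarrow> ('a, 'b, 'n) module_scheme \<Rightarrow> bool" where
  "injective_module R E \<longleftrightarrow> module R E \<and>
     (\<forall>(M :: ('a, 'a) module) (N :: ('a, 'a) module) f g.
        module R M \<and> module R N \<and> f \<in> mod_hom R M N \<and> inj_on f (carrier M) \<and> g \<in> mod_hom R M E \<longrightarrow>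
        (\<exists>h\<in>mod_hom R N E. \<forall>m\<in>carrier M. h (f m) = g m))"

text \<open>An injective resolution \<open>0 \<rightarrow> M \<rightarrow> E\<^sub>0 \<rightarrow> \<dots> \<rightarrow> E\<^sub>n \<rightarrow> 0\<close>.\<close>

definition injective_resolution ::
  "('a, 'm) ring_scheme \<Rightarrow> ('a, 'b, 'n) module_scheme \<Rightarrow> nat \<Rightarrow>
   (nat \<Rightarrow> ('a, 'c) module) \<Rightarrow> ('b \<Rightarrow> 'c) \<Rightarrow> (nat \<Rightarrow> 'c \<Rightarrow> 'c) \<Rightarrow> bool" where
  "injective_resolution R M n E \<epsilon> d \<longleftrightarrow>
     (\<forall>i. injective_module R (E i)) \<and>
     (\<forall>i>n. carrier (E i) = {\<zero>\<^bsub>E i\<^esub>}) \<and>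
     \<epsilon> \<in> mod_hom R M (E 0) \<and> inj_on \<epsilon> (carrier M) \<and>
     (\<forall>i. d i \<in> mod_hom R (E i) (E (Suc i))) \<and>
     \<epsilon> ` carrier M = a_kernel (E 0) (E 1) (d 0) \<and>
     (\<forall>i. d i ` carrier (E i) = a_kernel (E (Suc i)) (E (Suc (Suc i))) (d (Suc i)))"

text \<open>A Gorenstein local ring is a Noetherian local ring of finite injective dimension over
  itself. Taking the terms of the resolution inside the type of ring elements is no restriction.
  If the injective dimension is finite, the terms of the minimal injective resolution are direct
  sums, over distinct primes, of injective hulls \<open>E(R/P)\<close>. Each \<open>E(R/P)\<close> is a countable union of
  finite length modules over the localization at \<open>P\<close>. For infinite \<open>R\<close> both the number of primes
  and the cardinality of each hull are therefore at most that of \<open>R\<close>; a finite \<open>R\<close> is Artinian,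
  and then \<open>R\<close> itself is injective.\<close>

definition gorenstein_local :: "('a, 'm) ring_scheme \<Rightarrow> bool" where
  "gorenstein_local R \<longleftrightarrow> noetherian_local R \<and>
     (\<exists>n (E :: nat \<Rightarrow> ('a, 'a) module) \<epsilon> d. injective_resolution R (self_module R) n E \<epsilon> d)"


section \<open>Linkage\<close>

definition directly_linked :: "('a, 'm) ring_scheme \<Rightarrow> 'a set \<Rightarrow> 'a set \<Rightarrow> bool" where
  "directly_linked R I J \<longleftrightarrow> proper_ideal R I \<and> proper_ideal R J \<and>
     (\<exists>A. complete_intersection R A \<and> A \<subseteq> I \<inter> J \<and> I = ideal_colon R A J \<and> J = ideal_colon R A I)"

definition linked :: "('a, 'm) ring_scheme \<Rightarrow> 'a set \<Rightarrow> 'a set \<Rightarrow> bool" where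
  "linked R I J \<longleftrightarrow> unmixed R I \<and> unmixed R J \<and>
     equivclp (\<lambda>K L. unmixed R K \<and> unmixed R L \<and> directly_linked R K L) I J"

definition linkage_class :: "('a, 'm) ring_scheme \<Rightarrow> 'a set \<Rightarrow> 'a set set" where
  "linkage_class R I = {J. linked R I J}"

definition licci :: "('a, 'm) ring_scheme \<Rightarrow> 'a set \<Rightarrow> bool" where
  "licci R I \<longleftrightarrow> (\<exists>C. complete_intersection R C \<and> I \<in> linkage_class R C)"

text \<open>The sum of a family of ideals is the ideal generated by its union.\<close>

definition linkage_integral :: "('a, 'm) ring_scheme \<Rightarrow> 'a set \<Rightarrow> 'a set" where
  "linkage_integral R I =
     (if licci R I then carrier R else genideal R (\<Union> (linkage_class R I)))"

end

theory Submission
  imports Defs "HOL-Computational_Algebra.Polynomial"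
begin

text \<open>Linkage respects hyperplane sections: if \<open>I\<close> is linked to \<open>L\<close> by a regular
  sequence \<open>\<alpha>\<close> that stays regular together with \<open>x\<close>, then \<open>(I, x)\<close> is linked to \<open>(L, x)\<close> by \<open>(\<alpha>, x)\<close>. A given link need
  not be of this form, but it can be moved into such a position: over \<open>R[T]\<close> a generator \<open>b\<close> of the linking
  complete intersection is replaced by \<open>b + T c\<close>, and the rest of the chain of links is carried along. For
  all but finitely many residue classes of \<open>t\<close> the specialization \<open>T = t\<close> is again a chain of links, and induction
  applies to it. If infinitely many specializations \<open>F(t)\<close> of a polynomial lie in an ideal \<open>Z\<close>, with the \<open>t\<close> distinct modulo the
  maximal ideal, then interpolation gives \<open>F(0) \<in> Z\<close>; so the end of the original chain lies in every ideal that contains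
  the ends of the specialized ones.

  All this takes place in a commutative ring \<open>S\<close> of type class \<open>comm_ring_1\<close> with a surjection \<open>p\<close> onto \<open>R\<close>. An ideal of
  \<open>R\<close> is represented by its preimage in \<open>S\<close>, so that a residue ring of \<open>R\<close> is just an ideal of \<open>S\<close> containing the kernel \<open>n\<close> of \<open>p\<close>.\<close>

text \<open>Chains of links can only be moved if linking commutes with reduction modulo a regular
  element, be it \<open>x\<close> or T - t. Since (B : K)/B is Hom(S/K, S/B), this rests on
  Ext^1(S/K, S/B) = 0 for Cohen-Macaulay K of the height of B. The definition of a Gorenstein ring
  supplies only a finite injective resolution. Rees' shift turns it into one of S/B over S/B for
  every complete intersection B; at an associated prime Q of B the localization has depth zero,
  where finite injective dimension forces self-injectivity. Localizations and Ext are never formed: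
  a statement at Q reads "after multiplication by some u outside Q", and finite generation reads "in
  every sequence some term lies in the span of its predecessors". Licci ideals are the second
  difficulty, since a specialized chain may run into a complete intersection. So the containment of
  the end of a chain and the claim that it is not a complete intersection are proved together, by
  induction on the length of the chain. The type class matters because polynomials and their
  evaluation live over a \<open>comm_ring_1\<close>.\<close>

definition idl :: "'b::comm_ring_1 set \<Rightarrow> bool" where
  "idl I \<longleftrightarrow> 0 \<in> I \<and> (\<forall>a\<in>I. \<forall>b\<in>I. a + b \<in> I) \<and> (\<forall>a\<in>I. \<forall>r. r * a \<in> I)"

definition adj :: "'b::comm_ring_1 set \<Rightarrow> 'b \<Rightarrow> 'b set" where
  "adj B y = {b + y * r | b r. b \<in> B}"

primrec gen :: "'b::comm_ring_1 set \<Rightarrow> 'b list \<Rightarrow> 'b set" where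
  "gen B [] = B"
| "gen B (y # ys) = gen (adj B y) ys"

definition quo :: "'b::comm_ring_1 set \<Rightarrow> 'b \<Rightarrow> 'b set" where
  "quo B b = {r. r * b \<in> B}"

definition colon :: "'b::comm_ring_1 set \<Rightarrow> 'b set \<Rightarrow> 'b set" where
  "colon B K = {r. \<forall>k\<in>K. r * k \<in> B}"

definition nzd :: "'b::comm_ring_1 set \<Rightarrow> 'b \<Rightarrow> bool" where
  "nzd B x \<longleftrightarrow> (\<forall>r. x * r \<in> B \<longrightarrow> r \<in> B)"

text \<open>Weakly regular: no residue ring is required to be nonzero, and modulo the unit ideal
  every element satisfies \<open>nzd\<close>. For B inside \<open>m\<close> and entries in
  \<open>m\<close> the residue rings are nonzero anyway.\<close>

primrec rs :: "'b::comm_ring_1 set \<Rightarrow> 'b list \<Rightarrow> bool" where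
  "rs B [] = True"
| "rs B (y # ys) = (nzd B y \<and> rs (adj B y) ys)"

definition prm :: "'b::comm_ring_1 set \<Rightarrow> bool" where
  "prm P \<longleftrightarrow> idl P \<and> 1 \<notin> P \<and> (\<forall>a b. a * b \<in> P \<longrightarrow> a \<in> P \<or> b \<in> P)"

text \<open>\<open>dge P r B\<close> bounds the grade of \<open>P\<close> on \<open>S/B\<close> from below by \<open>r\<close>; \<open>mhom J B\<close> are the \<open>S\<close>-linear maps \<open>J/B \<rightarrow> S/B\<close>, given by representatives.\<close>

definition dge :: "'b::comm_ring_1 set \<Rightarrow> nat \<Rightarrow> 'b set \<Rightarrow> bool" where
  "dge P r B \<longleftrightarrow> (\<exists>ys. length ys = r \<and> set ys \<subseteq> P \<and> rs B ys)"

definition mhom :: "'b::comm_ring_1 set \<Rightarrow> 'b set \<Rightarrow> ('b \<Rightarrow> 'b) \<Rightarrow> bool" where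
  "mhom K B \<phi> \<longleftrightarrow> (\<forall>a\<in>K. \<forall>b\<in>K. \<phi> (a + b) - (\<phi> a + \<phi> b) \<in> B) \<and>
     (\<forall>a\<in>K. \<forall>r. \<phi> (r * a) - r * \<phi> a \<in> B) \<and> (\<forall>b\<in>B. \<phi> b \<in> B)"

section \<open>Calculus of ideals, colons and regular sequences\<close>

lemma idl_0 [simp]: "idl I \<Longrightarrow> 0 \<in> I"
  by (simp add: idl_def)

lemma idl_add: "idl I \<Longrightarrow> a \<in> I \<Longrightarrow> b \<in> I \<Longrightarrow> a + b \<in> I"
  by (simp add: idl_def)

lemma idl_mult: "idl I \<Longrightarrow> a \<in> I \<Longrightarrow> r * a \<in> I"
  by (simp add: idl_def)

lemma idl_mult2: "idl I \<Longrightarrow> a \<in> I \<Longrightarrow> a * r \<in> I"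
  by (metis idl_mult mult.commute)

lemma idl_uminus: "idl I \<Longrightarrow> a \<in> I \<Longrightarrow> - a \<in> I"
  using idl_mult[of I a "-1"] by simp

lemma idl_diff: "idl I \<Longrightarrow> a \<in> I \<Longrightarrow> b \<in> I \<Longrightarrow> a - b \<in> I"
  using idl_add[of I a "-b"] idl_uminus by auto

lemma idl_add_cancel: "idl I \<Longrightarrow> b \<in> I \<Longrightarrow> a + b \<in> I \<longleftrightarrow> a \<in> I"
  by (metis add_diff_cancel_right' idl_add idl_diff)

lemma idl_cong: "idl I \<Longrightarrow> a - b \<in> I \<Longrightarrow> a \<in> I \<longleftrightarrow> b \<in> I"
  by (metis diff_add_cancel idl_add_cancel add.commute)

lemma idl_sum: "idl I \<Longrightarrow> (\<And>i. i \<in> A \<Longrightarrow> f i \<in> I) \<Longrightarrow> sum f A \<in> I"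
  by (induction A rule: infinite_finite_induct) (auto simp: idl_add)

lemma adjI: "b \<in> B \<Longrightarrow> b + y * r \<in> adj B y"
  by (auto simp: adj_def)

lemma adjE: assumes "a \<in> adj B y" obtains b r where "a = b + y * r" "b \<in> B"
  using assms by (auto simp: adj_def)

lemma idl_adj [simp, intro]: assumes "idl B" shows "idl (adj B y)"
  unfolding idl_def
proof (intro conjI ballI allI)
  show "0 \<in> adj B y" using adjI[of 0 B y 0] assms by simp
next
  fix a b assume "a \<in> adj B y" "b \<in> adj B y"
  then obtain a1 r b1 s where *: "a = a1 + y * r" "b = b1 + y * s" "a1 \<in> B" "b1 \<in> B"
    by (meson adjE)
  then have "a + b = (a1 + b1) + y * (r + s)" by (simp add: algebra_simps)
  then show "a + b \<in> adj B y" using adjI * idl_add assms by metis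
next
  fix a t assume "a \<in> adj B y"
  then obtain a1 r where *: "a = a1 + y * r" "a1 \<in> B"
    by (meson adjE)
  then have "t * a = t * a1 + y * (t * r)" by (simp add: algebra_simps)
  then show "t * a \<in> adj B y" using adjI * idl_mult assms by metis
qed

lemma sub_adj: "B \<subseteq> adj B y"
  using adjI[of _ B y 0] by auto

lemma adj_self: "idl B \<Longrightarrow> y \<in> adj B y"
  using adjI[of 0 B y 1] by auto

lemma adj_least: "idl I \<Longrightarrow> B \<subseteq> I \<Longrightarrow> y \<in> I \<Longrightarrow> adj B y \<subseteq> I"
  by (auto simp: adj_def intro!: idl_add idl_mult2)

lemma adj_mono: "B \<subseteq> C \<Longrightarrow> adj B y \<subseteq> adj C y"
  by (auto simp: adj_def)

lemma adj_swap: "adj (adj B y) z = adj (adj B z) y"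
  by (auto simp: adj_def) (metis (no_types, lifting) add.assoc add.commute)+

lemma adj_cong:
  assumes B: "idl B" and "y - z \<in> B" shows "adj B y = adj B z"
proof -
  have "y \<in> adj B z" "z \<in> adj B y"
    using assms adjI[of "y - z" B z 1] adjI[of "- (y - z)" B y 1] idl_uminus[OF B assms(2)] by auto
  then show ?thesis using B by (meson adj_least idl_adj sub_adj subset_antisym)
qed

lemma adj_memb_cong:
  assumes "idl B" "a \<in> adj B y" obtains r where "a - y * r \<in> B"
  using assms adjE by (metis add_diff_cancel_right')

lemma adj_memI: "idl B \<Longrightarrow> a - y * r \<in> B \<Longrightarrow> a \<in> adj B y"
  using adjI[of "a - y * r" B y r] by simp

lemma idl_gen [simp, intro]: "idl B \<Longrightarrow> idl (gen B ys)"
  by (induction ys arbitrary: B) auto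

lemma sub_gen: "B \<subseteq> gen B ys"
  by (induction ys arbitrary: B) (use sub_adj in fastforce)+

lemma gen_set: "idl B \<Longrightarrow> set ys \<subseteq> gen B ys"
proof (induction ys arbitrary: B)
  case (Cons y ys)
  then show ?case using adj_self sub_gen by (metis gen.simps(2) idl_adj insert_subset list.simps(15) subsetD)
qed auto

lemma gen_least: "idl I \<Longrightarrow> B \<subseteq> I \<Longrightarrow> set ys \<subseteq> I \<Longrightarrow> gen B ys \<subseteq> I"
  by (induction ys arbitrary: B) (auto simp: adj_least)

lemma gen_mono: "B \<subseteq> C \<Longrightarrow> gen B ys \<subseteq> gen C ys"
  by (induction ys arbitrary: B C) (auto simp: adj_mono)

lemma gen_append: "gen B (xs @ ys) = gen (gen B xs) ys"
  by (induction xs arbitrary: B) auto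

lemma gen_eqI:
  assumes "idl B" "set ys \<subseteq> gen B zs" "set zs \<subseteq> gen B ys"
  shows "gen B ys = gen B zs"
  using assms by (meson gen_least idl_gen sub_gen subset_antisym)

lemma gen_adj: "gen (adj B y) ys = adj (gen B ys) y"
  by (induction ys arbitrary: B) (auto simp: adj_swap)

lemma rs_append: "rs B (xs @ ys) \<longleftrightarrow> rs B xs \<and> rs (gen B xs) ys"
  by (induction xs arbitrary: B) auto

lemma idl_quo [simp, intro]: "idl B \<Longrightarrow> idl (quo B b)"
  by (auto simp: idl_def quo_def algebra_simps)

lemma idl_colon [simp, intro]: "idl B \<Longrightarrow> idl (colon B K)"
  by (simp add: idl_def colon_def distrib_right mult.assoc)

lemma quo_sub: "idl B \<Longrightarrow> B \<subseteq> quo B b"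
  by (auto simp: quo_def idl_mult2)

lemma colon_sub: "idl B \<Longrightarrow> B \<subseteq> colon B K"
  by (auto simp: colon_def idl_mult2)

lemma quo_1: "idl B \<Longrightarrow> 1 \<in> quo B b \<longleftrightarrow> b \<in> B"
  by (auto simp: quo_def)

lemma colon_colon: "K \<subseteq> colon B (colon B K)"
  by (auto simp: colon_def mult.commute)

lemma nzd_iff_cong:
  assumes "idl B" "x - y \<in> B" shows "nzd B x \<longleftrightarrow> nzd B y"
proof -
  have "x * r \<in> B \<longleftrightarrow> y * r \<in> B" for r
    using assms idl_cong[of B "x * r" "y * r"] idl_mult2[of B "x - y" r] by (simp add: algebra_simps)
  then show ?thesis by (simp add: nzd_def)
qed

text \<open>This half of the permutability of regular sequences involves no Nakayama argument: y r =
  z q modulo B gives q = y s, and cancelling y gives r = z s. That z is regular modulo B itself is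
  the other half, in \<open>nzd_perm\<close>.\<close>

lemma nzd_swap:
  assumes B: "idl B" and "nzd B y" "nzd (adj B y) z"
  shows "nzd (adj B z) y"
  unfolding nzd_def
proof (intro allI impI)
  fix r assume "y * r \<in> adj B z"
  then obtain q where q: "y * r - z * q \<in> B" using B adj_memb_cong by blast
  then have "z * q - y * r \<in> B" using B idl_uminus by fastforce
  then have "z * q \<in> adj B y" using B adj_memI by blast
  then obtain s where s: "q - y * s \<in> B" using assms(3) B adj_memb_cong unfolding nzd_def by blast
  have "y * (r - z * s) = (y * r - z * q) + z * (q - y * s)" by (simp add: algebra_simps)
  then have "y * (r - z * s) \<in> B" using q s B by (simp add: idl_add idl_mult)
  then have "r - z * s \<in> B" using assms(2) by (simp add: nzd_def)
  then show "r \<in> adj B z" using B adj_memI by blast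
qed

lemma prm_idl: "prm P \<Longrightarrow> idl P" and prm_1: "prm P \<Longrightarrow> 1 \<notin> P"
  and prm_mult: "prm P \<Longrightarrow> a * b \<in> P \<Longrightarrow> a \<in> P \<or> b \<in> P"
  by (auto simp: prm_def)

lemma dge_0 [simp]: "dge P 0 B"
  by (auto simp: dge_def)

lemma dge_Suc: "dge P (Suc r) B \<longleftrightarrow> (\<exists>y\<in>P. nzd B y \<and> dge P r (adj B y))"
proof
  assume "dge P (Suc r) B"
  then obtain y ys where "length (y # ys) = Suc r" "set (y # ys) \<subseteq> P" "rs B (y # ys)"
    unfolding dge_def by (metis Suc_length_conv)
  then show "\<exists>y\<in>P. nzd B y \<and> dge P r (adj B y)" unfolding dge_def by auto
next
  assume "\<exists>y\<in>P. nzd B y \<and> dge P r (adj B y)"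
  then obtain y ys where "y \<in> P" "nzd B y" "length ys = r" "set ys \<subseteq> P" "rs (adj B y) ys"
    unfolding dge_def by blast
  then show "dge P (Suc r) B" unfolding dge_def by (intro exI[of _ "y # ys"]) auto
qed

lemma dge_mono: "dge P r B \<Longrightarrow> k \<le> r \<Longrightarrow> dge P k B"
proof (induction k arbitrary: r B)
  case (Suc k)
  then obtain r' where "r = Suc r'" by (metis Suc_le_D)
  then show ?case using Suc by (metis Suc_le_mono dge_Suc)
qed simp

lemma dge_sub: "dge P r B \<Longrightarrow> P \<subseteq> Q \<Longrightarrow> dge Q r B"
  unfolding dge_def by blast

section \<open>Noetherian and local rings\<close>

text \<open>S will be a free ring on all elements of a type, which is rarely Noetherian; so the
  maximum condition speaks only of ideals above n, that is of S/n.\<close>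

locale nring =
  fixes n :: "'b::comm_ring_1 set"
  assumes idl_n: "idl n"
    and max_ex: "F \<noteq> {} \<Longrightarrow> (\<And>I. I \<in> F \<Longrightarrow> idl I \<and> n \<subseteq> I) \<Longrightarrow> \<exists>M\<in>F. \<forall>I\<in>F. M \<subseteq> I \<longrightarrow> I = M"
begin

lemma chain_stable:
  assumes "\<And>i::nat. idl (f i)" "\<And>i. n \<subseteq> f i" "\<And>i. f i \<subseteq> f (Suc i)"
  shows "\<exists>k. \<forall>m\<ge>k. f m = f k"
proof -
  have "\<exists>M\<in>range f. \<forall>I\<in>range f. M \<subseteq> I \<longrightarrow> I = M"
    by (rule max_ex) (use assms in auto)
  then obtain k where k: "\<forall>I\<in>range f. f k \<subseteq> I \<longrightarrow> I = f k" by blast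
  have "f k \<subseteq> f m" if "m \<ge> k" for m
    using lift_Suc_mono_le[of f] that assms(3) by blast
  then show ?thesis using k by blast
qed

text \<open>The form in which finite generation is used throughout: the ideals generated by the
  initial segments form a stationary chain. It names no submodule, so the same form carries over to
  modules of homomorphisms.\<close>

lemma seqN:
  assumes B: "idl B" "n \<subseteq> B"
  shows "\<exists>k::nat. a k \<in> gen B (map a [0..<k])"
proof -
  have "\<exists>k. \<forall>m\<ge>k. gen B (map a [0..<m]) = gen B (map a [0..<k])"
  proof (rule chain_stable)
    show "gen B (map a [0..<i]) \<subseteq> gen B (map a [0..<Suc i])" for i
      by (simp add: gen_append sub_adj)
    show "n \<subseteq> gen B (map a [0..<i])" for i using B sub_gen by blast
  qed (use B in blast)
  then obtain k where "\<And>m. m \<ge> k \<Longrightarrow> gen B (map a [0..<m]) = gen B (map a [0..<k])" by blast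
  then have "gen B (map a [0..<Suc k]) = gen B (map a [0..<k])" by (metis le_add2 plus_1_eq_Suc)
  moreover have "a k \<in> gen B (map a [0..<Suc k])" using B gen_set[of B "map a [0..<Suc k]"] by auto
  ultimately show ?thesis by blast
qed

lemma fg:
  assumes I: "idl I" and B: "idl B" "n \<subseteq> B" "B \<subseteq> I"
  shows "\<exists>ys. set ys \<subseteq> I \<and> I = gen B ys"
proof -
  let ?F = "{gen B ys | ys. set ys \<subseteq> I}"
  have 1: "B \<in> ?F" by (rule CollectI, rule exI[of _ "[]"]) auto
  have "\<exists>M\<in>?F. \<forall>J\<in>?F. M \<subseteq> J \<longrightarrow> J = M"
  proof (rule max_ex)
    show "?F \<noteq> {}" using 1 by blast
    show "idl J \<and> n \<subseteq> J" if "J \<in> ?F" for J using that B sub_gen[of B] by auto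
  qed
  then obtain M where M: "M \<in> ?F" "\<And>J. J \<in> ?F \<Longrightarrow> M \<subseteq> J \<Longrightarrow> J = M" by meson
  then obtain ys where ys: "set ys \<subseteq> I" "M = gen B ys" by auto
  have "M \<subseteq> I" using ys gen_least I B by blast
  moreover have "x \<in> M" if "x \<in> I" for x
  proof -
    have *: "gen B (ys @ [x]) = adj M x" using ys by (simp add: gen_append)
    have "gen B (ys @ [x]) \<in> ?F" using ys that by (intro CollectI exI[of _ "ys @ [x]"]) auto
    then have "adj M x = M" using M(2)[of "adj M x"] sub_adj[of M x] * by simp
    then show ?thesis using adj_self[of M x] ys B by auto
  qed
  ultimately show ?thesis using ys by blast
qed

text \<open>N is an arbitrary set. Iterating the hypothesis gives x = y^i z_i modulo B; by
  \<open>seqN\<close> some z_k is a combination of z_0, ..., z_(k-1), each of which is a multiple of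
  y z_k. Hence some 1 - y a kills z_k, and x with it.\<close>

lemma nak_elem:
  assumes B: "idl B" "n \<subseteq> B" and N: "\<And>x. x \<in> N \<Longrightarrow> \<exists>z\<in>N. x - y * z \<in> B" and x: "x \<in> N"
  obtains a where "(1 - y * a) * x \<in> B"
proof -
  have "\<exists>s. \<forall>x\<in>N. s x \<in> N \<and> x - y * s x \<in> B"
    by (rule bchoice) (use N in blast)
  then obtain s where s: "\<And>x. x \<in> N \<Longrightarrow> s x \<in> N" "\<And>x. x \<in> N \<Longrightarrow> x - y * s x \<in> B"
    by blast
  define z where "z i = (s ^^ i) x" for i
  have z: "z i \<in> N" for i by (induction i) (auto simp: z_def x s(1))
  have zs: "z i - y * z (Suc i) \<in> B" for i using s(2)[OF z[of i]] by (simp add: z_def)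
  have x_z: "\<exists>c. x - c * z i \<in> B" for i
  proof (induction i)
    case 0 show ?case using B by (intro exI[of _ 1]) (simp add: z_def)
  next
    case (Suc i)
    then obtain c where c: "x - c * z i \<in> B" by blast
    have "x - (c * y) * z (Suc i) = (x - c * z i) + c * (z i - y * z (Suc i))" by (simp add: algebra_simps)
    then show ?case using c zs B by (metis idl_add idl_mult)
  qed
  obtain k where k: "z k \<in> gen B (map z [0..<k])" using seqN[OF B] by blast
  have zz: "z i \<in> adj B (y * z k)" if "i < k" for i
    using that
  proof (induction "k - i" arbitrary: i)
    case 0 then show ?case by simp
  next
    case (Suc d)
    show ?case
    proof (cases "Suc i = k")
      case True then show ?thesis using adj_memI[of B "z i" "y * z k" 1] zs[of i] B by auto
    next
      case False
      then have "z (Suc i) \<in> adj B (y * z k)" using Suc.hyps(1)[of "Suc i"] Suc.hyps(2) Suc.prems by linarith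
      then have "y * z (Suc i) \<in> adj B (y * z k)" using B by (simp add: idl_mult)
      moreover have "z i - y * z (Suc i) \<in> adj B (y * z k)" using zs sub_adj by blast
      ultimately show ?thesis using B idl_cong idl_adj by blast
    qed
  qed
  have "gen B (map z [0..<k]) \<subseteq> adj B (y * z k)"
  proof (rule gen_least[OF idl_adj[OF B(1)] sub_adj])
    show "set (map z [0..<k]) \<subseteq> adj B (y * z k)" using zz by auto
  qed
  then obtain a where "z k - y * z k * a \<in> B" using k B adj_memb_cong by blast
  then have a: "(1 - y * a) * z k \<in> B" by (simp add: algebra_simps)
  obtain c where c: "x - c * z k \<in> B" using x_z by blast
  have "(1 - y * a) * x = (1 - y * a) * (x - c * z k) + c * ((1 - y * a) * z k)" by (simp add: algebra_simps)
  then have "(1 - y * a) * x \<in> B" using a c B by (metis idl_add idl_mult)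
  then show thesis using that by blast
qed

text \<open>Finitely many generators allow one common a, because a product of two factors 1 - y a is
  again of this form.\<close>

lemma nak:
  assumes B: "idl B" "n \<subseteq> B" "B \<subseteq> N" and N: "idl N" "\<And>x. x \<in> N \<Longrightarrow> \<exists>z\<in>N. x - y * z \<in> B"
  obtains a where "\<And>x. x \<in> N \<Longrightarrow> (1 - y * a) * x \<in> B"
proof -
  obtain xs where xs: "set xs \<subseteq> N" "N = gen B xs" using fg[OF N(1) B] by auto
  have "\<exists>a. \<forall>x\<in>gen B zs. (1 - y * a) * x \<in> B" if "set zs \<subseteq> N" for zs
    using that
  proof (induction zs rule: rev_induct)
    case Nil then show ?case using B by (intro exI[of _ 0]) auto
  next
    case (snoc z zs)
    then obtain a where a: "\<forall>x\<in>gen B zs. (1 - y * a) * x \<in> B" by auto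
    obtain b where b: "(1 - y * b) * z \<in> B" using nak_elem[OF B(1,2) N(2)] snoc by auto
    define c where "c = a + b - y * a * b"
    have c: "1 - y * c = (1 - y * a) * (1 - y * b)" by (simp add: c_def algebra_simps)
    have "(1 - y * c) * x \<in> B" if x: "x \<in> gen B (zs @ [z])" for x
    proof -
      obtain w r where w: "x = w + z * r" "w \<in> gen B zs"
        using adjE[of x "gen B zs" z] x by (auto simp: gen_append)
      have "(1 - y * c) * x = (1 - y * b) * ((1 - y * a) * w) + (1 - y * a) * r * ((1 - y * b) * z)"
        unfolding c w by (simp add: algebra_simps)
      then show ?thesis using a b w B by (metis idl_add idl_mult)
    qed
    then show ?case by blast
  qed
  then show thesis using xs that by blast
qed


text \<open>An eigenvector argument. Otherwise there are infinitely many separated t_k and nonzero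
  m_k killed by a + t_k b, and some m_k is a combination of its predecessors. The product of the a +
  t_i b with i < k kills these, hence m_k; but on m_k each factor acts as (t_i - t_k) b, which is
  regular. The map \<open>\<tau>\<close> lets the parameters come from S when the ring is
  S[T].\<close>

lemma nzd_cofinite:
  assumes B: "idl B" "n \<subseteq> B" and b: "nzd B b"
    and good: "\<And>t x. good t x \<Longrightarrow> \<exists>v. (\<tau> t - \<tau> x) * v - 1 \<in> n"
  shows "\<exists>X. finite X \<and> (\<forall>t. (\<forall>x\<in>X. good t x) \<longrightarrow> nzd B (a + \<tau> t * b))"
proof (rule ccontr)
  assume "\<not> ?thesis"
  then have "\<And>X. finite X \<Longrightarrow> \<exists>t. (\<forall>x\<in>X. good t x) \<and> \<not> nzd B (a + \<tau> t * b)" by blast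
  then have "\<And>xs. \<exists>t. (\<forall>x\<in>set xs. good t x) \<and> \<not> nzd B (a + \<tau> t * b)" by simp
  then obtain g where g: "\<And>xs. (\<forall>x\<in>set xs. good (g xs) x) \<and> \<not> nzd B (a + \<tau> (g xs) * b)" by metis
  define l where "l k = ((\<lambda>xs. xs @ [g xs]) ^^ k) []" for k
  define t where "t k = g (l k)" for k
  have l: "l k = map t [0..<k]" for k
    by (induction k) (simp_all add: l_def t_def)
  have t: "good (t k) (t i)" if "i < k" for i k
    using g[of "l k"] that unfolding t_def[symmetric] unfolding l by simp
  have "\<exists>m. (a + \<tau> (t k) * b) * m \<in> B \<and> m \<notin> B" for k
    using g[of "l k"] unfolding t_def[symmetric] nzd_def by blast
  then obtain m where m: "\<And>k. (a + \<tau> (t k) * b) * m k \<in> B" "\<And>k. m k \<notin> B" by metis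
  obtain k where k: "m k \<in> gen B (map m [0..<k])" using seqN[OF B] by blast
  define p where "p = (\<Prod>i<k. a + \<tau> (t i) * b)"
  have "gen B (map m [0..<k]) \<subseteq> quo B p"
  proof (rule gen_least)
    show "set (map m [0..<k]) \<subseteq> quo B p"
    proof
      fix x assume "x \<in> set (map m [0..<k])"
      then obtain i where i: "x = m i" "i < k" by auto
      have "p = (a + \<tau> (t i) * b) * (\<Prod>j\<in>{..<k}-{i}. a + \<tau> (t j) * b)"
        unfolding p_def using i by (subst prod.remove[of _ i]) auto
      then have "x * p = (\<Prod>j\<in>{..<k}-{i}. a + \<tau> (t j) * b) * ((a + \<tau> (t i) * b) * m i)"
        using i by (simp add: algebra_simps)
      then show "x \<in> quo B p" using B m idl_mult by (metis (no_types, lifting) mem_Collect_eq quo_def)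
    qed
  qed (use B quo_sub in auto)
  then have mk: "m k * p \<in> B" using k by (auto simp: quo_def)
  have "m k * (\<Prod>i\<in>A. (\<tau> (t i) - \<tau> (t k)) * b) \<in> B" if "A \<subseteq> {..<k}" "m k * (\<Prod>i\<in>A. a + \<tau> (t i) * b) \<in> B" for A
  proof -
    have "finite A" using that finite_subset by blast
    have "m k * (\<Prod>i\<in>A. (\<tau> (t i) - \<tau> (t k)) * b) - m k * (\<Prod>i\<in>A. a + \<tau> (t i) * b) \<in> B"
      using \<open>finite A\<close>
    proof (induction A)
      case empty then show ?case using B by simp
    next
      case (insert i A)
      define P Q where "P = (\<Prod>i\<in>A. (\<tau> (t i) - \<tau> (t k)) * b)" and "Q = (\<Prod>i\<in>A. a + \<tau> (t i) * b)"
      have "m k * (((\<tau> (t i) - \<tau> (t k)) * b) * P) - m k * ((a + \<tau> (t i) * b) * Q)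
        = (a + \<tau> (t i) * b) * (m k * P - m k * Q) - P * ((a + \<tau> (t k) * b) * m k)"
        by (simp add: algebra_simps)
      then have "m k * (((\<tau> (t i) - \<tau> (t k)) * b) * P) - m k * ((a + \<tau> (t i) * b) * Q) \<in> B"
        using insert.IH m(1) B by (simp add: P_def Q_def idl_diff idl_mult)
      then show ?case using insert.hyps by (simp add: P_def Q_def)
    qed
    then show ?thesis using that(2) B idl_cong by blast
  qed
  then have mk2: "m k * (\<Prod>i<k. (\<tau> (t i) - \<tau> (t k)) * b) \<in> B" using mk p_def by auto
  have "m k \<in> B" if "A \<subseteq> {..<k}" "m k * (\<Prod>i\<in>A. (\<tau> (t i) - \<tau> (t k)) * b) \<in> B" for A
  proof -
    have "finite A" using that finite_subset by blast
    then show ?thesis using that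
    proof (induction A)
      case empty then show ?case by simp
    next
      case (insert i A)
      define P where "P = (\<Prod>i\<in>A. (\<tau> (t i) - \<tau> (t k)) * b)"
      have "good (t k) (t i)" using insert.prems t by auto
      then obtain v where v: "(\<tau> (t k) - \<tau> (t i)) * v - 1 \<in> n" using good by blast
      have "m k * ((\<tau> (t i) - \<tau> (t k)) * b * P) \<in> B" using insert.prems(2) insert.hyps by (simp add: P_def)
      then have "b * ((\<tau> (t k) - \<tau> (t i)) * (m k * P)) \<in> B"
        using B idl_uminus[of B "m k * ((\<tau> (t i) - \<tau> (t k)) * b * P)"] by (simp add: algebra_simps)
      then have *: "(\<tau> (t k) - \<tau> (t i)) * (m k * P) \<in> B" using b by (auto simp: nzd_def)
      have eq: "m k * P = v * ((\<tau> (t k) - \<tau> (t i)) * (m k * P)) - (m k * P) * ((\<tau> (t k) - \<tau> (t i)) * v - 1)"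
        by (simp add: algebra_simps)
      moreover have "v * ((\<tau> (t k) - \<tau> (t i)) * (m k * P)) - (m k * P) * ((\<tau> (t k) - \<tau> (t i)) * v - 1) \<in> B"
        by (rule idl_diff[OF B(1) idl_mult[OF B(1) *] idl_mult[OF B(1) subsetD[OF B(2) v]]])
      ultimately have "m k * P \<in> B" by (subst eq)
      then show ?case using insert.IH insert.prems(1) unfolding P_def by blast
    qed
  qed
  then show False using mk2 m(2) by blast
qed

end

section \<open>Submodules of Hom(K/B, S/B), on representatives\<close>

inductive_set hspan :: "'b::comm_ring_1 set \<Rightarrow> 'b set \<Rightarrow> ('b \<Rightarrow> 'b) set \<Rightarrow> ('b \<Rightarrow> 'b) set"
  for B K V where
  base: "f \<in> V \<Longrightarrow> f \<in> hspan B K V"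
| zero: "(\<lambda>_. 0) \<in> hspan B K V"
| add: "f \<in> hspan B K V \<Longrightarrow> g \<in> hspan B K V \<Longrightarrow> (\<lambda>x. f x + g x) \<in> hspan B K V"
| scale: "f \<in> hspan B K V \<Longrightarrow> (\<lambda>x. r * f x) \<in> hspan B K V"
| cong: "f \<in> hspan B K V \<Longrightarrow> (\<And>x. x \<in> K \<Longrightarrow> g x - f x \<in> B) \<Longrightarrow> g \<in> hspan B K V"

lemma hspan_trans:
  assumes "f \<in> hspan B K V" "V \<subseteq> hspan B K W" shows "f \<in> hspan B K W"
  using assms by (induction) (auto intro: hspan.intros)

lemma hspan_mono: "V \<subseteq> W \<Longrightarrow> f \<in> hspan B K V \<Longrightarrow> f \<in> hspan B K W"
  using hspan_trans[of f B K V W] hspan.base by blast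

lemma mhom_zero: "idl B \<Longrightarrow> mhom K B (\<lambda>_. 0)"
  by (simp add: mhom_def)

lemma mhom_add:
  assumes B: "idl B" and "mhom K B f" "mhom K B g" shows "mhom K B (\<lambda>x. f x + g x)"
proof -
  have 1: "f (a + b) + g (a + b) - (f a + g a + (f b + g b)) = (f (a + b) - (f a + f b)) + (g (a + b) - (g a + g b))"
    and 2: "f (r * a) + g (r * a) - r * (f a + g a) = (f (r * a) - r * f a) + (g (r * a) - r * g a)" for a b r
    by (simp_all add: algebra_simps)
  show ?thesis unfolding mhom_def 1 2 using assms by (simp add: mhom_def idl_add)
qed

lemma mhom_scale:
  assumes B: "idl B" and "mhom K B f" shows "mhom K B (\<lambda>x. s * f x)"
proof -
  have 1: "s * f (a + b) - (s * f a + s * f b) = s * (f (a + b) - (f a + f b))"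
    and 2: "s * f (r * a) - r * (s * f a) = s * (f (r * a) - r * f a)" for a b r
    by (simp_all add: algebra_simps)
  show ?thesis unfolding mhom_def 1 2 using assms by (simp add: mhom_def idl_mult)
qed

lemma mhom_cong:
  assumes B: "idl B" "B \<subseteq> K" and K: "idl K" and f: "mhom K B f" and g: "\<And>x. x \<in> K \<Longrightarrow> g x - f x \<in> B"
  shows "mhom K B g"
  unfolding mhom_def
proof (intro conjI ballI allI)
  fix a b assume "a \<in> K" "b \<in> K"
  then have "f (a + b) - (f a + f b) \<in> B" "g (a + b) - f (a + b) \<in> B" "g a - f a \<in> B" "g b - f b \<in> B"
    using f g K by (auto simp: mhom_def idl_add)
  moreover have "g (a + b) - (g a + g b) = (g (a + b) - f (a + b)) + (f (a + b) - (f a + f b)) - (g a - f a) - (g b - f b)"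
    by (simp add: algebra_simps)
  ultimately show "g (a + b) - (g a + g b) \<in> B" using B by (metis idl_add idl_diff)
next
  fix a r assume "a \<in> K"
  then have "f (r * a) - r * f a \<in> B" "g (r * a) - f (r * a) \<in> B" "r * (g a - f a) \<in> B"
    using f g K B by (auto simp: mhom_def idl_mult)
  moreover have "g (r * a) - r * g a = (g (r * a) - f (r * a)) + (f (r * a) - r * f a) - r * (g a - f a)"
    by (simp add: algebra_simps)
  ultimately show "g (r * a) - r * g a \<in> B" using B by (metis idl_add idl_diff)
next
  fix b assume "b \<in> B"
  then show "g b \<in> B" using g[of b] f B idl_cong[of B "g b" "f b"] by (auto simp: mhom_def)
qed

lemma mhom_mult: "idl B \<Longrightarrow> mhom K B (\<lambda>x. h * x)"
  by (simp add: mhom_def algebra_simps idl_mult idl_mult2)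

lemma mhom_sub:
  assumes "mhom K B f" "K' \<subseteq> K" shows "mhom K' B f"
  using assms by (auto simp: mhom_def subset_iff)

lemma hspan_mhom:
  assumes B: "idl B" "B \<subseteq> K" and K: "idl K" and V: "\<And>f. f \<in> V \<Longrightarrow> mhom K B f" and f: "f \<in> hspan B K V"
  shows "mhom K B f"
  using f
proof induction
  case (base f) then show ?case using V by blast
next
  case zero then show ?case using mhom_zero B by blast
next
  case (add f g) then show ?case using mhom_add B by blast
next
  case (scale f r) then show ?case using mhom_scale B by blast
next
  case (cong f g) then show ?case using mhom_cong B K by blast
qed

text \<open>The same coefficients are used on K and on K'. This carries the induction on the
  generators of K.\<close>

lemma hspan_lift:
  assumes B: "idl B" and "f \<in> hspan B K' V"
  shows "\<exists>f'\<in>hspan B K V. \<forall>x\<in>K'. f' x - f x \<in> B"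
  using assms(2)
proof induction
  case (base f) then show ?case using B by (intro bexI[of _ f]) (auto intro: hspan.base)
next
  case zero then show ?case using B by (intro bexI[of _ "\<lambda>_. 0"]) (auto intro: hspan.zero)
next
  case (add f g)
  then obtain f' g' where *: "f' \<in> hspan B K V" "g' \<in> hspan B K V"
    "\<forall>x\<in>K'. f' x - f x \<in> B" "\<forall>x\<in>K'. g' x - g x \<in> B" by blast
  have "f' x + g' x - (f x + g x) \<in> B" if "x \<in> K'" for x
    using * that idl_add[OF B, of "f' x - f x" "g' x - g x"] by (simp add: algebra_simps)
  then show ?case using * by (intro bexI[of _ "\<lambda>x. f' x + g' x"]) (auto intro: hspan.add)
next
  case (scale f r)
  then obtain f' where *: "f' \<in> hspan B K V" "\<forall>x\<in>K'. f' x - f x \<in> B" by blast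
  have "r * f' x - r * f x \<in> B" if "x \<in> K'" for x
    using * that idl_mult[OF B, of "f' x - f x" r] by (simp add: algebra_simps)
  then show ?case using * by (intro bexI[of _ "\<lambda>x. r * f' x"]) (auto intro: hspan.scale)
next
  case (cong f g)
  then obtain f' where *: "f' \<in> hspan B K V" "\<forall>x\<in>K'. f' x - f x \<in> B" by blast
  have "f' x - g x \<in> B" if "x \<in> K'" for x
    using * cong.hyps that idl_diff[OF B, of "f' x - f x" "g x - f x"] by (simp add: algebra_simps)
  then show ?case using * by blast
qed

text \<open>Such a map is determined by the single ring element w z, which brings the Noetherian
  property of Hom down to that of S/B.\<close>

lemma mhom_adj_zero:
  assumes B: "idl B" "B \<subseteq> K'" and K': "idl K'" and w: "mhom (adj K' z) B w" and 0: "\<And>x. x \<in> K' \<Longrightarrow> w x \<in> B"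
    and k: "k \<in> K'"
  shows "w (k + z * r) - r * w z \<in> B"
proof -
  have m: "k \<in> adj K' z" "z \<in> adj K' z" "r * z \<in> adj K' z"
    using k subsetD[OF sub_adj] adj_self[OF K'] idl_mult[OF idl_adj[OF K']] by simp_all
  then have "w (k + r * z) - (w k + w (r * z)) \<in> B" "w (r * z) - r * w z \<in> B" "w k \<in> B"
    using w 0 k by (auto simp: mhom_def)
  moreover have "w (k + z * r) - r * w z = (w (k + r * z) - (w k + w (r * z))) + (w (r * z) - r * w z) + w k"
    by (simp add: algebra_simps)
  ultimately show ?thesis using B by (metis idl_add)
qed

lemma gen_hspan:
  assumes B: "idl B" and "x \<in> gen B (map (\<lambda>g. g z) gs)" "set gs \<subseteq> hspan B K V"
  shows "\<exists>g\<in>hspan B K V. x - g z \<in> B"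
  using assms(2,3)
proof (induction gs arbitrary: x rule: rev_induct)
  case Nil then show ?case by (intro bexI[of _ "\<lambda>_. 0"]) (auto intro: hspan.zero)
next
  case (snoc g gs)
  obtain w r where w: "x = w + g z * r" "w \<in> gen B (map (\<lambda>g. g z) gs)"
    using snoc.prems(1) adjE[of x "gen B (map (\<lambda>g. g z) gs)" "g z"] by (auto simp: gen_append)
  then obtain h where h: "h \<in> hspan B K V" "w - h z \<in> B" using snoc by auto
  have "(\<lambda>x. h x + r * g x) \<in> hspan B K V"
    by (rule hspan.add[OF h(1) hspan.scale]) (use snoc.prems in auto)
  moreover have "x - (h z + r * g z) \<in> B" using h w by (simp add: algebra_simps)
  ultimately show ?case by (metis (mono_tags, lifting))
qed

context nring
begin

text \<open>The module of homomorphisms \<open>K/B \<rightarrow> S/B\<close> is Noetherian, phrased without mentioning that module.\<close>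

lemma mhom_seqN:
  assumes B: "idl B" "n \<subseteq> B" and "\<And>i::nat. mhom (gen B ks) B (\<phi> i)"
  shows "\<exists>k. \<phi> k \<in> hspan B (gen B ks) (\<phi> ` {..<k})"
  using assms(3)
proof (induction ks arbitrary: \<phi> rule: rev_induct)
  case Nil
  have "\<phi> 0 \<in> hspan B (gen B []) (\<phi> ` {..<0})"
    by (rule hspan.cong[OF hspan.zero]) (use Nil in \<open>auto simp: mhom_def\<close>)
  then show ?case by blast
next
  case (snoc z ks)
  define K' K where "K' = gen B ks" and "K = adj K' z"
  have K': "idl K'" "B \<subseteq> K'" "idl K" "B \<subseteq> K" "K' \<subseteq> K" "z \<in> K"
    using B sub_gen[of B ks] sub_adj[of K' z] adj_self[of K' z] by (auto simp: K'_def K_def)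
  have \<phi>: "\<And>i. mhom K B (\<phi> i)" using snoc.prems by (simp add: K_def K'_def gen_append)
  \<comment> \<open>The induction hypothesis on K' is applied to the tail from N on: subtracting a
    combination of earlier members from \<open>\<phi> k\<close> leaves a map w that vanishes on
    K'.\<close>
  have step: "\<exists>k w. N \<le> k \<and> mhom K B w \<and> (\<forall>x\<in>K'. w x \<in> B) \<and> w \<in> hspan B K (\<phi> ` {..k})
      \<and> (\<lambda>x. \<phi> k x - w x) \<in> hspan B K (\<phi> ` {..<k})" for N
  proof -
    have "\<And>i. mhom (gen B ks) B (\<phi> (N + i))" using mhom_sub[OF \<phi>] K' K'_def by blast
    then obtain k where k: "\<phi> (N + k) \<in> hspan B K' ((\<lambda>i. \<phi> (N + i)) ` {..<k})"
      using snoc.IH[of "\<lambda>i. \<phi> (N + i)"] K'_def by blast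
    then have "\<phi> (N + k) \<in> hspan B K' (\<phi> ` {..<N + k})"
      by (rule hspan_mono[rotated]) auto
    then obtain f where f: "f \<in> hspan B K (\<phi> ` {..<N + k})" "\<forall>x\<in>K'. f x - \<phi> (N + k) x \<in> B"
      using hspan_lift B by blast
    define w where "w x = \<phi> (N + k) x + (-1) * f x" for x
    have fm: "mhom K B f" using hspan_mhom[OF B(1) K'(4) K'(3) _ f(1)] \<phi> by blast
    have "mhom K B w" unfolding w_def by (intro mhom_add mhom_scale B \<phi> fm)
    moreover have "\<forall>x\<in>K'. w x \<in> B"
      using f(2) idl_uminus[OF B(1)] by (fastforce simp: w_def)
    moreover have "w \<in> hspan B K (\<phi> ` {..N + k})" unfolding w_def
      by (intro hspan.add hspan.scale hspan.base[of "\<phi> (N + k)"] hspan_mono[OF _ f(1)]) auto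
    moreover have "(\<lambda>x. \<phi> (N + k) x - w x) \<in> hspan B K (\<phi> ` {..<N + k})"
      using f(1) by (simp add: w_def)
    ultimately show ?thesis by (meson le_add1)
  qed
  define Q where "Q N k w \<longleftrightarrow> N \<le> k \<and> mhom K B w \<and> (\<forall>x\<in>K'. w x \<in> B) \<and> w \<in> hspan B K (\<phi> ` {..k})
      \<and> (\<lambda>x. \<phi> k x - w x) \<in> hspan B K (\<phi> ` {..<k})" for N k w
  have "\<forall>N. \<exists>k w. Q N k w" using step unfolding Q_def by blast
  then obtain kk ww where Q: "\<And>N. Q N (kk N) (ww N)" by metis
  have kw: "\<And>N. N \<le> kk N" "\<And>N. mhom K B (ww N)" "\<And>N x. x \<in> K' \<Longrightarrow> ww N x \<in> B"
    "\<And>N. ww N \<in> hspan B K (\<phi> ` {..kk N})" "\<And>N. (\<lambda>x. \<phi> (kk N) x - ww N x) \<in> hspan B K (\<phi> ` {..<kk N})"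
    using Q unfolding Q_def by blast+
  \<comment> \<open>The starting points are spread so that \<open>ww (N j)\<close> with j < i
    involves only \<open>\<phi>\<close> of index below \<open>kk (N i)\<close>.\<close>
  define N where "N i = ((\<lambda>N. Suc (kk N)) ^^ i) 0" for i
  have N_Suc: "N (Suc i) = Suc (kk (N i))" for i by (simp add: N_def)
  have N_mono: "Suc (kk (N i)) \<le> N j" if "i < j" for i j
    using that
  proof (induction j)
    case (Suc j)
    then show ?case using N_Suc kw(1)[of "N j"] by (metis Suc_leD le_Suc_eq le_trans less_Suc_eq)
  qed simp
  obtain i where i: "ww (N i) z \<in> gen B (map (\<lambda>j. ww (N j) z) [0..<i])"
    using seqN[OF B, of "\<lambda>j. ww (N j) z"] by blast
  have "map (\<lambda>j. ww (N j) z) [0..<i] = map (\<lambda>g. g z) (map (\<lambda>j. ww (N j)) [0..<i])" by simp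
  moreover have "set (map (\<lambda>j. ww (N j)) [0..<i]) \<subseteq> hspan B K ((\<lambda>j. ww (N j)) ` {..<i})"
    by (auto intro!: hspan.base)
  ultimately have "\<exists>g\<in>hspan B K ((\<lambda>j. ww (N j)) ` {..<i}). ww (N i) z - g z \<in> B"
    using i by (intro gen_hspan[OF B(1), where gs = "map (\<lambda>j. ww (N j)) [0..<i]"]) (simp_all add: comp_def)
  then obtain g where g: "g \<in> hspan B K ((\<lambda>j. ww (N j)) ` {..<i})" "ww (N i) z - g z \<in> B" by blast
  have g0: "g x \<in> B" if "x \<in> K'" for x
  proof -
    have "f x \<in> B" if "f \<in> hspan B K ((\<lambda>j. ww (N j)) ` {..<i})" for f
      using that
    proof induction
      case (cong f h)
      then have "h x - f x \<in> B" using \<open>x \<in> K'\<close> K' by blast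
      then show ?case using cong B idl_cong by blast
    qed (use kw(3) \<open>x \<in> K'\<close> B in \<open>auto simp: idl_add idl_mult\<close>)
    then show ?thesis using g by blast
  qed
  have gm: "mhom K B g" using hspan_mhom[OF B(1) K'(4) K'(3) _ g(1)] kw(2) by blast
  have "ww (N i) x - g x \<in> B" if x: "x \<in> K" for x
  proof -
    obtain k r where k: "x = k + z * r" "k \<in> K'" using x adjE K_def by blast
    have "ww (N i) x - r * ww (N i) z \<in> B" "g x - r * g z \<in> B"
      unfolding k using mhom_adj_zero[OF B(1) K'(2) K'(1), of z] kw(2,3) g0 gm k(2) K_def by auto
    moreover have "ww (N i) x - g x = (ww (N i) x - r * ww (N i) z) - (g x - r * g z) + r * (ww (N i) z - g z)"
      by (simp add: algebra_simps)
    ultimately show ?thesis using g(2) B by (metis idl_add idl_diff idl_mult)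
  qed
  then have "ww (N i) \<in> hspan B K ((\<lambda>j. ww (N j)) ` {..<i})" using hspan.cong g(1) by blast
  moreover have "(\<lambda>j. ww (N j)) ` {..<i} \<subseteq> hspan B K (\<phi> ` {..<kk (N i)})"
  proof
    fix f assume "f \<in> (\<lambda>j. ww (N j)) ` {..<i}"
    then obtain j where j: "f = ww (N j)" "j < i" by blast
    have "kk (N j) < kk (N i)" using N_mono[OF j(2)] kw(1)[of "N i"] by linarith
    then have "\<phi> ` {..kk (N j)} \<subseteq> \<phi> ` {..<kk (N i)}" by auto
    then show "f \<in> hspan B K (\<phi> ` {..<kk (N i)})" using hspan_mono kw(4) j by blast
  qed
  ultimately have "ww (N i) \<in> hspan B K (\<phi> ` {..<kk (N i)})" using hspan_trans by blast
  then have "(\<lambda>x. (\<phi> (kk (N i)) x - ww (N i) x) + ww (N i) x) \<in> hspan B K (\<phi> ` {..<kk (N i)})"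
    using hspan.add[OF kw(5)] by blast
  then show ?case by (auto simp: K_def K'_def gen_append)
qed

text \<open>Nakayama for the homomorphisms modulo the multiplications, an Ext^1 of S/K. If \<phi> is
  multiplication by h modulo y, then (\<phi> - h)/y is again a homomorphism because y is regular, so
  this module equals y times itself. The factor 1 - y a is the price for not assuming a local ring;
  it is a unit for y in \<open>m\<close>, and becomes 1 for y = T - t after specialization.\<close>

lemma mhom_nak:
  assumes B: "idl B" "n \<subseteq> B" "B \<subseteq> K" and K: "idl K" and y: "nzd B y"
    and red: "\<And>\<phi>. mhom K B \<phi> \<Longrightarrow> \<exists>h. \<forall>k\<in>K. \<phi> k - h * k \<in> adj B y"
    and \<phi>: "mhom K B \<phi>"
  shows "\<exists>a h. \<forall>k\<in>K. (1 - y * a) * \<phi> k - h * k \<in> B"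
proof -
  have step: "\<exists>\<phi>'. mhom K B \<phi>' \<and> (\<exists>h. \<forall>k\<in>K. \<phi> k - (h * k + y * \<phi>' k) \<in> B)" if \<phi>: "mhom K B \<phi>" for \<phi>
  proof -
    obtain h where h: "\<forall>k\<in>K. \<phi> k - h * k \<in> adj B y" using red \<phi> by blast
    have "\<forall>k\<in>K. \<exists>q. \<phi> k - h * k - y * q \<in> B" using h adj_memb_cong[OF B(1)] by blast
    then obtain q where q: "\<And>k. k \<in> K \<Longrightarrow> \<phi> k - h * k - y * q k \<in> B" by metis
    define \<psi> where "\<psi> k = \<phi> k + (-1) * (h * k)" for k
    have \<psi>: "mhom K B \<psi>" unfolding \<psi>_def by (rule mhom_add[OF B(1) \<phi> mhom_scale[OF B(1) mhom_mult[OF B(1)]]])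
    have q': "\<psi> k - y * q k \<in> B" if "k \<in> K" for k using q[OF that] by (simp add: \<psi>_def)
    have "mhom K B q"
      unfolding mhom_def
    proof (intro conjI ballI allI)
      fix a b assume ab: "a \<in> K" "b \<in> K"
      have "y * (q (a + b) - (q a + q b)) = (\<psi> (a + b) - (\<psi> a + \<psi> b)) - (\<psi> (a + b) - y * q (a + b))
        + (\<psi> a - y * q a) + (\<psi> b - y * q b)" by (simp add: algebra_simps)
      also have "\<dots> \<in> B"
      proof -
        have "\<psi> (a + b) - (\<psi> a + \<psi> b) \<in> B" "a + b \<in> K" using \<psi> ab K by (auto simp: mhom_def idl_add)
        then show ?thesis using q'[OF ab(1)] q'[OF ab(2)] q'[of "a + b"] B by (simp only: idl_add idl_diff)
      qed
      finally show "q (a + b) - (q a + q b) \<in> B" using y nzd_def by blast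
    next
      fix a r assume ab: "a \<in> K"
      have "y * (q (r * a) - r * q a) = (\<psi> (r * a) - r * \<psi> a) - (\<psi> (r * a) - y * q (r * a))
        + r * (\<psi> a - y * q a)" by (simp add: algebra_simps)
      also have "\<dots> \<in> B"
      proof -
        have "\<psi> (r * a) - r * \<psi> a \<in> B" "r * a \<in> K" using \<psi> ab K by (auto simp: mhom_def idl_mult)
        then show ?thesis using q'[OF ab] q'[of "r * a"] B by (simp only: idl_add idl_diff idl_mult)
      qed
      finally show "q (r * a) - r * q a \<in> B" using y nzd_def by blast
    next
      fix b assume b: "b \<in> B"
      have "\<psi> b \<in> B" "\<psi> b - y * q b \<in> B" using b q'[of b] \<psi> B by (auto simp: mhom_def)
      then have "\<psi> b - (\<psi> b - y * q b) \<in> B" by (rule idl_diff[OF B(1)])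
      then have "y * q b \<in> B" by simp
      then show "q b \<in> B" using y nzd_def by blast
    qed
    moreover have "\<forall>k\<in>K. \<phi> k - (h * k + y * q k) \<in> B" using q by (simp add: algebra_simps)
    ultimately show ?thesis by blast
  qed
  define s where "s \<phi> = (SOME \<phi>'. mhom K B \<phi>' \<and> (\<exists>h. \<forall>k\<in>K. \<phi> k - (h * k + y * \<phi>' k) \<in> B))" for \<phi>
  have s: "mhom K B (s \<phi>) \<and> (\<exists>h. \<forall>k\<in>K. \<phi> k - (h * k + y * s \<phi> k) \<in> B)" if "mhom K B \<phi>" for \<phi>
    unfolding s_def by (rule someI_ex[OF step[OF that]])
  define F where "F i = (s ^^ i) \<phi>" for i
  have F: "mhom K B (F i)" for i by (induction i) (auto simp: F_def \<phi> s)
  have Fs: "\<exists>h. \<forall>k\<in>K. F i k - (h * k + y * F (Suc i) k) \<in> B" for i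
    using s[OF F[of i]] by (simp add: F_def)
  obtain ks where ks: "K = gen B ks" using fg[OF K B] by blast
  obtain k where k: "F k \<in> hspan B K (F ` {..<k})"
    using mhom_seqN[OF B(1,2), of ks F] F ks by auto
  \<comment> \<open>Each earlier F i is a multiple of y F k up to a multiplication. Inserted into
    the expression of F k by its predecessors this makes (1 - y c) F k a multiplication.\<close>
  have low: "\<exists>c h. \<forall>x\<in>K. F i x - (h * x + y * c * F k x) \<in> B" if "i < k" for i
    using that
  proof (induction "k - i" arbitrary: i)
    case 0 then show ?case by simp
  next
    case (Suc d)
    obtain h where h: "\<forall>x\<in>K. F i x - (h * x + y * F (Suc i) x) \<in> B" using Fs by blast
    show ?case
    proof (cases "Suc i = k")
      case True
      then have "\<forall>x\<in>K. F i x - (h * x + y * 1 * F k x) \<in> B" using h by simp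
      then show ?thesis by blast
    next
      case False
      have "d = k - Suc i" "Suc i < k" using False Suc.hyps(2) Suc.prems by auto
      then obtain c g where c: "\<forall>x\<in>K. F (Suc i) x - (g * x + y * c * F k x) \<in> B"
        using Suc.hyps(1) by blast
      have "F i x - ((h + y * g) * x + y * (y * c) * F k x) \<in> B" if "x \<in> K" for x
      proof -
        have "F i x - ((h + y * g) * x + y * (y * c) * F k x) =
          (F i x - (h * x + y * F (Suc i) x)) + y * (F (Suc i) x - (g * x + y * c * F k x))"
          by (simp add: algebra_simps)
        then show ?thesis using h c that B by (metis idl_add idl_mult)
      qed
      then show ?thesis by blast
    qed
  qed
  have "\<exists>c h. \<forall>x\<in>K. f x - (h * x + y * c * F k x) \<in> B" if "f \<in> hspan B K (F ` {..<k})" for f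
    using that
  proof induction
    case (base f) then show ?case using low by auto
  next
    case zero show ?case using B by (intro exI[of _ 0]) auto
  next
    case (add f g)
    then obtain c h c' h' where *: "\<forall>x\<in>K. f x - (h * x + y * c * F k x) \<in> B" "\<forall>x\<in>K. g x - (h' * x + y * c' * F k x) \<in> B"
      by blast
    have "f x + g x - ((h + h') * x + y * (c + c') * F k x) \<in> B" if "x \<in> K" for x
    proof -
      have "f x + g x - ((h + h') * x + y * (c + c') * F k x) = (f x - (h * x + y * c * F k x)) + (g x - (h' * x + y * c' * F k x))"
        by (simp add: algebra_simps)
      then show ?thesis using * that B by (metis idl_add)
    qed
    then show ?case by blast
  next
    case (scale f r)
    then obtain c h where *: "\<forall>x\<in>K. f x - (h * x + y * c * F k x) \<in> B" by blast
    have "r * f x - ((r * h) * x + y * (r * c) * F k x) \<in> B" if "x \<in> K" for x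
    proof -
      have "r * f x - ((r * h) * x + y * (r * c) * F k x) = r * (f x - (h * x + y * c * F k x))"
        by (simp add: algebra_simps)
      then show ?thesis using * that B by (metis idl_mult)
    qed
    then show ?case by blast
  next
    case (cong f g)
    then obtain c h where *: "\<forall>x\<in>K. f x - (h * x + y * c * F k x) \<in> B" by blast
    have "g x - (h * x + y * c * F k x) \<in> B" if "x \<in> K" for x
    proof -
      have "g x - (h * x + y * c * F k x) = (g x - f x) + (f x - (h * x + y * c * F k x))"
        by (simp add: algebra_simps)
      then show ?thesis using * cong.hyps that B by (metis idl_add)
    qed
    then show ?case by blast
  qed
  then obtain c h where ch: "\<forall>x\<in>K. F k x - (h * x + y * c * F k x) \<in> B" using k by blast
  obtain c' h' where ch': "\<forall>x\<in>K. F 0 x - (h' * x + c' * F k x) \<in> B"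
  proof (cases "k = 0")
    case True
    then have "\<forall>x\<in>K. F 0 x - (0 * x + 1 * F k x) \<in> B" using B by simp
    then show ?thesis using that by blast
  next
    case False
    then show ?thesis using low[of 0] that by auto
  qed
  have "(1 - y * c) * \<phi> x - ((1 - y * c) * h' + c' * h) * x \<in> B" if "x \<in> K" for x
  proof -
    have "(1 - y * c) * F 0 x - ((1 - y * c) * h' + c' * h) * x =
      (1 - y * c) * (F 0 x - (h' * x + c' * F k x)) + c' * (F k x - (h * x + y * c * F k x))"
      by (simp add: algebra_simps)
    also have "\<dots> \<in> B" using ch ch' that B by (metis idl_add idl_mult)
    finally show ?thesis by (simp add: F_def)
  qed
  then show ?thesis by blast
qed

end

section \<open>Local rings with infinite residue field\<close>

locale nloc = nring +
  fixes m :: "'b::comm_ring_1 set"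
  assumes idl_m: "idl m" and m1: "1 \<notin> m" and n_m: "n \<subseteq> m"
    and unit_ex: "u \<notin> m \<Longrightarrow> \<exists>v. 1 - u * v \<in> n"
    and inf_res: "finite X \<Longrightarrow> \<exists>t. \<forall>x\<in>X. t - x \<notin> m"
begin

text \<open>\<open>cofin G\<close>: \<open>G t\<close> holds whenever \<open>t\<close> avoids finitely many residue classes modulo \<open>m\<close>.\<close>

definition cofin :: "('b \<Rightarrow> bool) \<Rightarrow> bool" where
  "cofin G \<longleftrightarrow> (\<exists>X. finite X \<and> (\<forall>t. (\<forall>x\<in>X. t - x \<notin> m) \<longrightarrow> G t))"

lemma cofin_conj: "cofin G \<Longrightarrow> cofin H \<Longrightarrow> cofin (\<lambda>t. G t \<and> H t)"
  unfolding cofin_def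
proof (elim exE conjE)
  fix X Y assume *: "finite X" "\<forall>t. (\<forall>x\<in>X. t - x \<notin> m) \<longrightarrow> G t" "finite Y" "\<forall>t. (\<forall>x\<in>Y. t - x \<notin> m) \<longrightarrow> H t"
  show "\<exists>X. finite X \<and> (\<forall>t. (\<forall>x\<in>X. t - x \<notin> m) \<longrightarrow> G t \<and> H t)"
    by (rule exI[of _ "X \<union> Y"]) (use * in auto)
qed

lemma cofin_mono: "cofin G \<Longrightarrow> (\<And>t. G t \<Longrightarrow> H t) \<Longrightarrow> cofin H"
  unfolding cofin_def by blast

lemma cofin_ex: "cofin G \<Longrightarrow> \<exists>t. G t"
  unfolding cofin_def using inf_res by blast

lemma cofin_True: "cofin (\<lambda>_. True)"
  unfolding cofin_def by blast

lemma cofin_ne: "cofin (\<lambda>t. t - x \<notin> m)"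
  unfolding cofin_def by (rule exI[of _ "{x}"]) auto

lemma cofin_ball: "finite A \<Longrightarrow> (\<And>a. a \<in> A \<Longrightarrow> cofin (G a)) \<Longrightarrow> cofin (\<lambda>t. \<forall>a\<in>A. G a t)"
proof (induction A rule: finite_induct)
  case empty then show ?case using cofin_True by (auto elim: cofin_mono)
next
  case (insert a A)
  then have "cofin (\<lambda>t. G a t \<and> (\<forall>a\<in>A. G a t))" by (intro cofin_conj) auto
  then show ?case by (rule cofin_mono) auto
qed

lemma unit_cancel:
  assumes B: "idl B" "n \<subseteq> B" and u: "u \<notin> m" "u * r \<in> B" shows "r \<in> B"
proof -
  obtain v where v: "1 - u * v \<in> n" using unit_ex u by blast
  have eq: "r = (1 - u * v) * r + v * (u * r)" by (simp add: algebra_simps)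
  show ?thesis by (subst eq) (rule idl_add[OF B(1) idl_mult2[OF B(1) subsetD[OF B(2) v]] idl_mult[OF B(1) u(2)]])
qed

lemma unit_nzd: "idl B \<Longrightarrow> n \<subseteq> B \<Longrightarrow> u \<notin> m \<Longrightarrow> nzd B u"
  unfolding nzd_def using unit_cancel by blast

lemma proper_sub_m:
  assumes "idl J" "n \<subseteq> J" "1 \<notin> J" shows "J \<subseteq> m"
proof
  fix u assume "u \<in> J"
  then show "u \<in> m" using unit_cancel[of J u 1] assms by auto
qed

lemma one_minus_unit: "y \<in> m \<Longrightarrow> 1 - y * a \<notin> m"
proof
  assume "y \<in> m" "1 - y * a \<in> m"
  then have "(1 - y * a) + y * a \<in> m" using idl_m idl_add idl_mult2 by blast
  then show False using m1 by simp
qed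

lemma m_prime: "a \<notin> m \<Longrightarrow> b \<notin> m \<Longrightarrow> a * b \<notin> m"
  using unit_cancel[OF idl_m n_m] by blast

lemma prm_m: "prm m"
  using idl_m m1 m_prime by (auto simp: prm_def)

lemma loc_nak:
  assumes B: "idl B" "n \<subseteq> B" "B \<subseteq> N" and N: "idl N" "\<And>x. x \<in> N \<Longrightarrow> \<exists>z\<in>N. x - y * z \<in> B" and y: "y \<in> m"
  shows "N \<subseteq> B"
proof
  fix x assume x: "x \<in> N"
  obtain a where a: "(1 - y * a) * x \<in> B" by (rule nak_elem[OF B(1,2) N(2) x])
  show "x \<in> B" by (rule unit_cancel[OF B(1,2) one_minus_unit[OF y] a])
qed

lemma unit_differences: "t - x \<notin> m \<Longrightarrow> \<exists>v. (t - x) * v - 1 \<in> n"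
proof -
  assume "t - x \<notin> m"
  then obtain v where "1 - (t - x) * v \<in> n" using unit_ex by blast
  then have "- (1 - (t - x) * v) \<in> n" using idl_n idl_uminus by blast
  then show ?thesis by (intro exI[of _ v]) (simp add: algebra_simps)
qed

lemma nzd_cofin:
  assumes "idl B" "n \<subseteq> B" "nzd B b" shows "cofin (\<lambda>t. nzd B (a + t * b))"
  using nzd_cofinite[of B b "\<lambda>t x. t - x \<notin> m" "\<lambda>t. t" a] assms unit_differences unfolding cofin_def by blast

lemma cofin_unit:
  assumes u: "u \<notin> m" shows "cofin (\<lambda>t. u + t * v \<notin> m)"
proof (cases "v \<in> m")
  case True
  then have "u + t * v \<notin> m" for t using u idl_m idl_add_cancel idl_mult by blast
  then show ?thesis using cofin_True by (auto elim: cofin_mono)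
next
  case False
  then obtain w where w: "1 - v * w \<in> m" using unit_ex n_m by blast
  have "u + t * v \<notin> m" if t: "t - (- u * w) \<notin> m" for t
  proof
    assume "u + t * v \<in> m"
    then have "w * (u + t * v) + t * (1 - v * w) \<in> m" using w idl_m by (simp only: idl_add idl_mult)
    then show False using t by (simp add: algebra_simps)
  qed
  then show ?thesis by (rule cofin_mono[OF cofin_ne[of "- u * w"]])
qed

text \<open>In place of the usual combinatorial argument a generic x + t a is taken: a prime Q
  inside \<open>m\<close> that does not contain both x and a excludes at most one residue class of
  t.\<close>

lemma avoid:
  assumes "finite \<P>" "\<And>P. P \<in> \<P> \<Longrightarrow> prm P \<and> P \<subseteq> m" and I: "idl I" "\<And>P. P \<in> \<P> \<Longrightarrow> \<not> I \<subseteq> P"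
  shows "\<exists>x\<in>I. \<forall>P\<in>\<P>. x \<notin> P"
  using assms(1,2,4)
proof (induction \<P> rule: finite_induct)
  case empty then show ?case using I(1) idl_0 by blast
next
  case (insert P \<P>)
  then obtain x where x: "x \<in> I" "\<forall>P\<in>\<P>. x \<notin> P" by auto
  obtain a where a: "a \<in> I" "a \<notin> P" using insert.prems(2)[of P] by blast
  have one: "cofin (\<lambda>t. x + t * a \<notin> Q)" if Q: "prm Q" "Q \<subseteq> m" "x \<notin> Q \<or> a \<notin> Q" for Q
  proof (cases "\<exists>s. x + s * a \<in> Q")
    case True
    then obtain s where s: "x + s * a \<in> Q" by blast
    have "x + t * a \<notin> Q" if t: "t - s \<notin> m" for t
    proof
      assume "x + t * a \<in> Q"
      then have "(x + t * a) - (x + s * a) \<in> Q" using s Q prm_idl idl_diff by blast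
      then have "(t - s) * a \<in> Q" by (simp add: algebra_simps)
      then have aQ: "a \<in> Q" using prm_mult[OF Q(1)] t Q(2) by blast
      then have "(x + s * a) - s * a \<in> Q" using s Q prm_idl idl_diff idl_mult by blast
      then show False using aQ Q(3) by simp
    qed
    then show ?thesis by (rule cofin_mono[OF cofin_ne[of s]])
  next
    case False then show ?thesis using cofin_True by (auto elim: cofin_mono)
  qed
  have "cofin (\<lambda>t. \<forall>Q\<in>insert P \<P>. x + t * a \<notin> Q)"
  proof (rule cofin_ball)
    fix Q assume "Q \<in> insert P \<P>"
    then show "cofin (\<lambda>t. x + t * a \<notin> Q)" using one[of Q] insert.prems(1)[of Q] x a by blast
  qed (use insert.hyps in auto)
  then obtain t where "\<forall>Q\<in>insert P \<P>. x + t * a \<notin> Q" using cofin_ex by blast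
  moreover have "x + t * a \<in> I" using x a I by (simp add: idl_add idl_mult)
  ultimately show ?case by blast
qed

text \<open>A maximal annihilator (B : c) is prime: if u is not in it, then u c is nonzero modulo B
  and (B : u c) is the same ideal.\<close>

lemma quo_prime:
  assumes B: "idl B" "n \<subseteq> B" and b: "b \<notin> B"
  shows "\<exists>c. c \<notin> B \<and> quo B b \<subseteq> quo B c \<and> prm (quo B c) \<and> (\<forall>d. d \<notin> B \<longrightarrow> quo B c \<subseteq> quo B d \<longrightarrow> quo B d = quo B c)"
proof -
  let ?F = "{quo B c | c. c \<notin> B \<and> quo B b \<subseteq> quo B c}"
  have "\<exists>M\<in>?F. \<forall>J\<in>?F. M \<subseteq> J \<longrightarrow> J = M"
  proof (rule max_ex)
    show "?F \<noteq> {}" using b by blast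
    show "idl J \<and> n \<subseteq> J" if "J \<in> ?F" for J using that B quo_sub[OF B(1)] by auto
  qed
  then obtain M where M: "M \<in> ?F" "\<And>J. J \<in> ?F \<Longrightarrow> M \<subseteq> J \<Longrightarrow> J = M" by meson
  then obtain c where c: "c \<notin> B" "quo B b \<subseteq> quo B c" "M = quo B c" by blast
  have mx: "quo B d = quo B c" if "d \<notin> B" "quo B c \<subseteq> quo B d" for d
    using M(2)[of "quo B d"] that c by blast
  have "v \<in> quo B c" if uv: "u * v \<in> quo B c" and u: "u \<notin> quo B c" for u v
  proof -
    have "u * c \<notin> B" using u by (simp add: quo_def)
    moreover have "quo B c \<subseteq> quo B (u * c)"
    proof
      fix r assume "r \<in> quo B c"
      then have "u * (r * c) \<in> B" using B idl_mult by (auto simp: quo_def)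
      then show "r \<in> quo B (u * c)" by (simp add: quo_def algebra_simps)
    qed
    ultimately have "quo B (u * c) = quo B c" using mx by blast
    moreover have "v \<in> quo B (u * c)" using uv by (simp add: quo_def algebra_simps)
    ultimately show ?thesis by blast
  qed
  then have "prm (quo B c)" unfolding prm_def using B c by (auto simp: quo_1)
  then show ?thesis using c mx by blast
qed

text \<open>The maximal associated primes of S/B. Their union is already the set of zero divisors,
  and maximality keeps the finiteness proof short.\<close>

definition mass :: "'b set \<Rightarrow> 'b set set" where
  "mass B = {quo B c | c. c \<notin> B \<and> prm (quo B c) \<and> (\<forall>d. d \<notin> B \<longrightarrow> quo B c \<subseteq> quo B d \<longrightarrow> quo B d = quo B c)}"

text \<open>For distinct P_i = (B : c_i) some c_k is a combination of its predecessors. If no P_i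
  with i < k were inside P_k, a product of elements of these P_i outside P_k would kill c_k and so
  lie in P_k.\<close>

lemma finite_mass:
  assumes B: "idl B" "n \<subseteq> B" shows "finite (mass B)"
proof (rule ccontr)
  assume "infinite (mass B)"
  then obtain P :: "nat \<Rightarrow> 'b set" where P: "inj P" "range P \<subseteq> mass B"
    using infinite_countable_subset by blast
  then have "\<forall>i. \<exists>c. P i = quo B c \<and> c \<notin> B \<and> prm (quo B c) \<and> (\<forall>d. d \<notin> B \<longrightarrow> quo B c \<subseteq> quo B d \<longrightarrow> quo B d = quo B c)"
    unfolding mass_def by blast
  then obtain c where c: "\<And>i. P i = quo B (c i)" "\<And>i. c i \<notin> B" "\<And>i. prm (P i)"
    "\<And>i d. d \<notin> B \<Longrightarrow> P i \<subseteq> quo B d \<Longrightarrow> quo B d = P i" by metis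
  obtain k where k: "c k \<in> gen B (map c [0..<k])" using seqN[OF B, of c] by blast
  have "\<exists>i<k. P i \<subseteq> P k"
  proof (rule ccontr)
    assume "\<not> ?thesis"
    then have "\<forall>i\<in>{..<k}. \<exists>r. r \<in> P i \<and> r \<notin> P k" by blast
    then obtain r where r: "\<And>i. i < k \<Longrightarrow> r i \<in> P i \<and> r i \<notin> P k" by (metis lessThan_iff)
    define p where "p = prod r {..<k}"
    have "p \<notin> P k"
    proof -
      have "prod r A \<notin> P k" if "A \<subseteq> {..<k}" for A
        using finite_subset[OF that finite_lessThan] that
      proof (induction A rule: finite_induct)
        case empty then show ?case using c(3) prm_1 by auto
      next
        case (insert x F) then show ?case using r[of x] prm_mult[OF c(3)[of k], of "r x" "prod r F"] by auto
      qed
      then show ?thesis by (simp add: p_def)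
    qed
    moreover have "gen B (map c [0..<k]) \<subseteq> quo B p"
    proof (rule gen_least[OF idl_quo[OF B(1)] quo_sub[OF B(1)]])
      show "set (map c [0..<k]) \<subseteq> quo B p"
      proof
        fix x assume "x \<in> set (map c [0..<k])"
        then obtain i where i: "i < k" "x = c i" by auto
        have "p = r i * prod r ({..<k} - {i})" unfolding p_def using i by (subst prod.remove[of _ i]) auto
        moreover have "r i * c i \<in> B" using r[OF i(1)] c(1) by (auto simp: quo_def)
        then have "prod r ({..<k} - {i}) * (r i * c i) \<in> B" using B idl_mult by blast
        ultimately show "x \<in> quo B p" using i by (simp add: quo_def algebra_simps)
      qed
    qed
    ultimately show False using k c(1) by (auto simp: quo_def algebra_simps)
  qed
  then obtain i where "i < k" "P i \<subseteq> P k" by blast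
  then have "P k = P i" using c(4)[of "c k" i] c(1,2) by simp
  then show False using P(1) \<open>i < k\<close> by (metis injD less_irrefl)
qed

lemma nzd_mass:
  assumes B: "idl B" "n \<subseteq> B" shows "nzd B x \<longleftrightarrow> (\<forall>P\<in>mass B. x \<notin> P)"
proof
  assume "nzd B x"
  then show "\<forall>P\<in>mass B. x \<notin> P" by (auto simp: mass_def quo_def nzd_def)
next
  assume *: "\<forall>P\<in>mass B. x \<notin> P"
  show "nzd B x" unfolding nzd_def
  proof (intro allI impI, rule ccontr)
    fix r assume r: "x * r \<in> B" "r \<notin> B"
    obtain c where c: "c \<notin> B" "quo B r \<subseteq> quo B c" "prm (quo B c)"
      "\<forall>d. d \<notin> B \<longrightarrow> quo B c \<subseteq> quo B d \<longrightarrow> quo B d = quo B c" using quo_prime[OF B r(2)] by blast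
    have "x \<in> quo B c" using r c by (auto simp: quo_def)
    moreover have "quo B c \<in> mass B" using c unfolding mass_def by blast
    ultimately show False using * by blast
  qed
qed

lemma mass_prm: "idl B \<Longrightarrow> n \<subseteq> B \<Longrightarrow> P \<in> mass B \<Longrightarrow> prm P \<and> P \<subseteq> m"
proof -
  assume B: "idl B" "n \<subseteq> B" and P: "P \<in> mass B"
  then obtain c where c: "P = quo B c" "prm P" by (auto simp: mass_def)
  then show ?thesis using proper_sub_m[of P] B quo_sub[of B c] prm_idl prm_1 by auto
qed

lemma common_nzd:
  assumes "finite \<B>" "\<And>B. B \<in> \<B> \<Longrightarrow> idl B \<and> n \<subseteq> B \<and> (\<exists>x\<in>I. nzd B x)" and I: "idl I"
  shows "\<exists>x\<in>I. \<forall>B\<in>\<B>. nzd B x"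
proof -
  have "\<exists>x\<in>I. \<forall>P\<in>\<Union>(mass ` \<B>). x \<notin> P"
  proof (rule avoid[OF _ _ I])
    show "finite (\<Union>(mass ` \<B>))" using assms finite_mass by blast
    show "prm P \<and> P \<subseteq> m" if "P \<in> \<Union>(mass ` \<B>)" for P using that assms mass_prm by blast
    show "\<not> I \<subseteq> P" if P: "P \<in> \<Union>(mass ` \<B>)" for P
    proof -
      obtain B where B: "B \<in> \<B>" "P \<in> mass B" using P by blast
      then obtain x where "x \<in> I" "nzd B x" using assms by blast
      then show ?thesis using nzd_mass[of B x] B assms(2) by blast
    qed
  qed
  then show ?thesis using nzd_mass assms(2) by (metis UN_I)
qed

lemma no_nzd:
  assumes B: "idl B" "n \<subseteq> B" and I: "idl I" and "\<not> (\<exists>x\<in>I. nzd B x)"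
  shows "\<exists>c. c \<notin> B \<and> prm (quo B c) \<and> I \<subseteq> quo B c"
proof (rule ccontr)
  assume *: "\<not> ?thesis"
  have "\<exists>x\<in>I. \<forall>P\<in>mass B. x \<notin> P"
  proof (rule avoid[OF finite_mass[OF B] mass_prm[OF B] I])
    show "\<not> I \<subseteq> P" if "P \<in> mass B" for P using that * unfolding mass_def by blast
  qed auto
  then show False using nzd_mass[OF B] assms(4) by blast
qed

text \<open>Independence of the grade from the chosen sequence, without Ext. The given y is compared
  with the first element z of a long sequence through an element w of P that is regular modulo B,
  (B, y) and (B, z) at once; the induction hypothesis is used for (B, z) and for (B, w).\<close>

lemma dge_adj:
  assumes "idl B" "n \<subseteq> B" "idl P" "dge P (Suc r) B" "y \<in> P" "nzd B y"
  shows "dge P r (adj B y)"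
  using assms(1,2,4,5,6)
proof (induction r arbitrary: B y)
  case (Suc r)
  note B = Suc.prems(1,2) and P = \<open>idl P\<close>
  obtain z where z: "z \<in> P" "nzd B z" "dge P (Suc r) (adj B z)" using Suc.prems(3) dge_Suc by blast
  obtain w1 where w1: "w1 \<in> P" "nzd (adj B z) w1" using z(3) dge_Suc by blast
  have n_adj: "n \<subseteq> adj B v" for v using B sub_adj by blast
  \<comment> \<open>If P killed b modulo (B, y), then z b = y c, and c would be killed by P modulo
    (B, z), in particular by the regular element w1. So c lies in (B, z) and b in (B, y).\<close>
  have ex_y: "\<exists>w\<in>P. nzd (adj B y) w"
  proof (rule ccontr)
    assume no: "\<not> ?thesis"
    have "\<exists>b. b \<notin> adj B y \<and> prm (quo (adj B y) b) \<and> P \<subseteq> quo (adj B y) b"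
      by (rule no_nzd[OF idl_adj[OF B(1)] n_adj P no])
    then obtain b where b: "b \<notin> adj B y" "P \<subseteq> quo (adj B y) b" by blast
    then have "z * b \<in> adj B y" using z by (auto simp: quo_def)
    then obtain c where c: "z * b - y * c \<in> B" using adj_memb_cong[OF B(1)] by blast
    have "p * c \<in> adj B z" if "p \<in> P" for p
    proof -
      have "p * b \<in> adj B y" using b that by (auto simp: quo_def)
      then obtain e where e: "p * b - y * e \<in> B" using adj_memb_cong[OF B(1)] by blast
      have "y * (p * c - z * e) = z * (p * b - y * e) - p * (z * b - y * c)" by (simp add: algebra_simps)
      also have "\<dots> \<in> B" using c e B by (simp only: idl_diff idl_mult)
      finally have "p * c - z * e \<in> B" using Suc.prems(5) nzd_def by blast
      then show ?thesis using adj_memI[OF B(1)] by blast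
    qed
    then have "w1 * c \<in> adj B z" using w1 by blast
    then have "c \<in> adj B z" using w1 nzd_def by blast
    then obtain f where f: "c - z * f \<in> B" using adj_memb_cong[OF B(1)] by blast
    have "z * (b - y * f) = (z * b - y * c) + y * (c - z * f)" by (simp add: algebra_simps)
    also have "\<dots> \<in> B" using c f B by (simp only: idl_add idl_mult)
    finally have "b - y * f \<in> B" using z nzd_def by blast
    then show False using b adj_memI[OF B(1)] by blast
  qed
  have "\<exists>w\<in>P. \<forall>B'\<in>{B, adj B y, adj B z}. nzd B' w"
    by (rule common_nzd) (use B n_adj ex_y w1 z P in auto)
  then obtain w where w: "w \<in> P" "nzd B w" "nzd (adj B y) w" "nzd (adj B z) w" by blast
  have "dge P r (adj (adj B z) w)"
    using Suc.IH[OF idl_adj[OF B(1)] n_adj z(3) w(1) w(4)] .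
  moreover have "nzd (adj B w) z" by (rule nzd_swap[OF B(1) z(2) w(4)])
  ultimately have "dge P (Suc r) (adj B w)" unfolding dge_Suc using z(1) by (metis adj_swap)
  moreover have "nzd (adj B w) y" by (rule nzd_swap[OF B(1) Suc.prems(5) w(3)])
  ultimately have "dge P r (adj (adj B w) y)" using Suc.IH[OF idl_adj[OF B(1)] n_adj _ Suc.prems(4)] by blast
  then show ?case unfolding dge_Suc using w adj_swap by metis
qed simp

lemma dge_gen:
  assumes "idl B" "n \<subseteq> B" "idl P" "dge P (length ys + r) B" "set ys \<subseteq> P" "rs B ys"
  shows "dge P r (gen B ys)"
  using assms(1,2,4-)
proof (induction ys arbitrary: B)
  case (Cons y ys)
  have "dge P (length ys + r) (adj B y)" using Cons.prems dge_adj[OF Cons.prems(1,2) assms(3)] by simp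
  then show ?case using Cons.IH[of "adj B y"] Cons.prems sub_adj[of B y] by auto
qed simp

text \<open>The elements that z multiplies into B form an ideal N with N = y N modulo B, so N lies
  in B by Nakayama.\<close>

lemma nzd_perm:
  assumes B: "idl B" "n \<subseteq> B" and y: "y \<in> m" "nzd B y" and z: "nzd (adj B y) z"
  shows "nzd B z" "nzd (adj B z) y"
proof -
  let ?N = "{r. z * r \<in> B}"
  have "?N \<subseteq> B"
  proof (rule loc_nak[OF B _ _ _ y(1)])
    show "B \<subseteq> ?N" using B idl_mult by blast
    show "idl ?N" using idl_quo[OF B(1), of z] by (simp add: quo_def mult.commute)
    fix x assume "x \<in> ?N"
    then have zx: "z * x \<in> B" by simp
    then have "x \<in> adj B y" using z sub_adj unfolding nzd_def by blast
    then obtain w where w: "x - y * w \<in> B" using adj_memb_cong[OF B(1)] by blast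
    have "y * (z * w) = z * x - z * (x - y * w)" by (simp add: algebra_simps)
    also have "\<dots> \<in> B" using zx w B by (simp only: idl_diff idl_mult)
    finally have "w \<in> ?N" using y nzd_def by blast
    then show "\<exists>w\<in>?N. x - y * w \<in> B" using w by blast
  qed
  then show "nzd B z" by (auto simp: nzd_def)
  show "nzd (adj B z) y" by (rule nzd_swap[OF B(1) y(2) z])
qed

lemma rs_rotate:
  assumes "idl B" "n \<subseteq> B" "set xs \<subseteq> m" "z \<in> m"
  shows "rs B (xs @ [z]) \<longleftrightarrow> rs B (z # xs)"
  using assms(1-3)
proof (induction xs arbitrary: B)
  case (Cons x xs)
  have B: "idl (adj B x)" "n \<subseteq> adj B x" using Cons.prems sub_adj[of B x] by auto
  have "rs B ((x # xs) @ [z]) \<longleftrightarrow> nzd B x \<and> nzd (adj B x) z \<and> rs (adj (adj B x) z) xs"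
    using Cons.IH[OF B] Cons.prems by simp
  also have "\<dots> \<longleftrightarrow> nzd B z \<and> nzd (adj B z) x \<and> rs (adj (adj B x) z) xs"
  proof -
    have "x \<in> m" using Cons.prems by simp
    have "nzd B x \<and> nzd (adj B x) z \<longleftrightarrow> nzd B z \<and> nzd (adj B z) x"
      using nzd_perm[OF Cons.prems(1,2) \<open>x \<in> m\<close>, of z] nzd_perm[OF Cons.prems(1,2) assms(4), of x] by blast
    then show ?thesis by blast
  qed
  finally show ?case by (simp add: adj_swap[of B x z])
qed simp

text \<open>The first generator a is replaced by a generic a + t b with b in I regular;
  \<open>dge_adj\<close> keeps the grade in step with the number of remaining generators.\<close>

lemma gens_regular:
  assumes "idl B" "n \<subseteq> B" "gen B as = I" "dge I (length as) B"
  shows "\<exists>bs. length bs = length as \<and> rs B bs \<and> gen B bs = I"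
  using assms
proof (induction as arbitrary: B)
  case Nil then show ?case by (intro exI[of _ "[]"]) auto
next
  case (Cons a as)
  note B = Cons.prems(1,2)
  have I: "idl I" using Cons.prems by (metis idl_gen)
  have aI: "a \<in> I" using gen_set[of B "a # as"] B Cons.prems by auto
  obtain b where b: "b \<in> I" "nzd B b" using Cons.prems(4) dge_Suc by (metis length_Cons)
  have "I = adj (gen B as) a" using Cons.prems(3) by (simp add: gen_adj)
  then obtain c v where c: "b = c + a * v" "c \<in> gen B as" using b adjE by blast
  \<comment> \<open>With b = c + a v the new generator is (1 + t v) a + t c, so a is recovered from
    it and the remaining generators when 1 + t v is a unit.\<close>
  have "cofin (\<lambda>t. nzd B (a + t * b) \<and> 1 + t * v \<notin> m)"
    by (intro cofin_conj nzd_cofin B b cofin_unit m1)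
  then obtain t where t: "nzd B (a + t * b)" "1 + t * v \<notin> m" using cofin_ex by blast
  define d where "d = a + t * b"
  have dI: "d \<in> I" using aI b I by (simp add: d_def idl_add idl_mult)
  have B': "idl (adj B d)" "n \<subseteq> adj B d" using B sub_adj[of B d] by auto
  have "gen (adj B d) as = I"
  proof
    have "B \<subseteq> I" "set as \<subseteq> I" using Cons.prems sub_gen[of B "a # as"] gen_set[of B "a # as"] by auto
    then show "gen (adj B d) as \<subseteq> I" using I dI by (intro gen_least adj_least) auto
    have c': "c \<in> gen (adj B d) as" using c gen_mono[OF sub_adj] by blast
    have "d \<in> gen (adj B d) as" using adj_self[OF B(1)] sub_gen by blast
    then have "d - t * c \<in> gen (adj B d) as" using c' B' by (simp add: idl_diff idl_mult)
    moreover have "d - t * c = (1 + t * v) * a" by (simp add: d_def c algebra_simps)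
    ultimately have "(1 + t * v) * a \<in> gen (adj B d) as" by simp
    then have "a \<in> gen (adj B d) as" using unit_cancel[OF idl_gen[OF B'(1)] _ t(2)] B'(2) sub_gen by blast
    then have "gen B (a # as) \<subseteq> gen (adj B d) as"
      using B' sub_gen[of "adj B d" as] sub_adj[of B d] gen_set[OF B'(1)] by (intro gen_least) auto
    then show "I \<subseteq> gen (adj B d) as" using Cons.prems(3) by blast
  qed
  moreover have "dge I (length as) (adj B d)"
    using dge_adj[OF B I] Cons.prems(4) dI t(1) by (simp add: d_def)
  ultimately obtain bs where "length bs = length as" "rs (adj B d) bs" "gen (adj B d) bs = I"
    using Cons.IH[OF B'] by blast
  then show ?case using t(1) by (intro exI[of _ "d # bs"]) (simp add: d_def)
qed

end

section \<open>Modules of finite injective dimension\<close>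

definition subm :: "('a, 'm) ring_scheme \<Rightarrow> ('a, 'c, 'k) module_scheme \<Rightarrow> 'c set \<Rightarrow> bool" where
  "subm R M C \<longleftrightarrow> C \<subseteq> carrier M \<and> \<zero>\<^bsub>M\<^esub> \<in> C \<and> (\<forall>x\<in>C. \<forall>y\<in>C. x \<oplus>\<^bsub>M\<^esub> y \<in> C) \<and>
     (\<forall>r\<in>carrier R. \<forall>x\<in>C. r \<odot>\<^bsub>M\<^esub> x \<in> C)"

locale present =
  fixes R :: "('a, 'm) ring_scheme" and p :: "'b::comm_ring_1 \<Rightarrow> 'a"
  assumes cring_R: "cring R"
    and p_closed [simp]: "p r \<in> carrier R"
    and p_surj: "x \<in> carrier R \<Longrightarrow> \<exists>r. p r = x"
    and p_add: "p (r + s) = p r \<oplus>\<^bsub>R\<^esub> p s"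
    and p_mult: "p (r * s) = p r \<otimes>\<^bsub>R\<^esub> p s"
    and p_1: "p 1 = \<one>\<^bsub>R\<^esub>"
begin

lemma p_0: "p 0 = \<zero>\<^bsub>R\<^esub>"
proof -
  interpret cring R by (rule cring_R)
  have "p 0 \<oplus>\<^bsub>R\<^esub> p 0 = p 0" using p_add[of 0 0] by simp
  then show ?thesis by (metis add.l_cancel_one p_closed)
qed

lemma p_uminus: "p (- r) = \<ominus>\<^bsub>R\<^esub> p r"
proof -
  interpret cring R by (rule cring_R)
  have "p r \<oplus>\<^bsub>R\<^esub> p (- r) = \<zero>\<^bsub>R\<^esub>" using p_add[of r "- r"] p_0 by simp
  then show ?thesis by (metis a_comm minus_equality p_closed)
qed

lemma p_diff: "p (r - s) = p r \<ominus>\<^bsub>R\<^esub> p s"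
  using p_add[of r "- s"] p_uminus[of s] by (simp add: a_minus_def)

definition act :: "('a, 'c, 'k) module_scheme \<Rightarrow> 'b \<Rightarrow> 'c \<Rightarrow> 'c" where
  "act M r x = p r \<odot>\<^bsub>M\<^esub> x"

definition sub :: "('a, 'c, 'k) module_scheme \<Rightarrow> 'c \<Rightarrow> 'c \<Rightarrow> 'c" where
  "sub M x y = x \<oplus>\<^bsub>M\<^esub> act M (- 1) y"

definition lin :: "('a, 'c, 'k) module_scheme \<Rightarrow> ('a, 'd, 'l) module_scheme \<Rightarrow> ('c \<Rightarrow> 'd) \<Rightarrow> bool" where
  "lin M N f \<longleftrightarrow> (\<forall>x\<in>carrier M. f x \<in> carrier N) \<and>
     (\<forall>x\<in>carrier M. \<forall>y\<in>carrier M. f (x \<oplus>\<^bsub>M\<^esub> y) = f x \<oplus>\<^bsub>N\<^esub> f y) \<and>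
     (\<forall>r. \<forall>x\<in>carrier M. f (act M r x) = act N r (f x))"

lemma mod_add_closed: "module R M \<Longrightarrow> x \<in> carrier M \<Longrightarrow> y \<in> carrier M \<Longrightarrow> x \<oplus>\<^bsub>M\<^esub> y \<in> carrier M"
  and mod_zero: "module R M \<Longrightarrow> \<zero>\<^bsub>M\<^esub> \<in> carrier M"
  and mod_assoc: "module R M \<Longrightarrow> x \<in> carrier M \<Longrightarrow> y \<in> carrier M \<Longrightarrow> z \<in> carrier M \<Longrightarrow>
     (x \<oplus>\<^bsub>M\<^esub> y) \<oplus>\<^bsub>M\<^esub> z = x \<oplus>\<^bsub>M\<^esub> (y \<oplus>\<^bsub>M\<^esub> z)"
  and mod_comm: "module R M \<Longrightarrow> x \<in> carrier M \<Longrightarrow> y \<in> carrier M \<Longrightarrow> x \<oplus>\<^bsub>M\<^esub> y = y \<oplus>\<^bsub>M\<^esub> x"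
  and mod_lcomm: "module R M \<Longrightarrow> x \<in> carrier M \<Longrightarrow> y \<in> carrier M \<Longrightarrow> z \<in> carrier M \<Longrightarrow>
     x \<oplus>\<^bsub>M\<^esub> (y \<oplus>\<^bsub>M\<^esub> z) = y \<oplus>\<^bsub>M\<^esub> (x \<oplus>\<^bsub>M\<^esub> z)"
  and mod_r_zero: "module R M \<Longrightarrow> x \<in> carrier M \<Longrightarrow> x \<oplus>\<^bsub>M\<^esub> \<zero>\<^bsub>M\<^esub> = x"
  and mod_l_zero: "module R M \<Longrightarrow> x \<in> carrier M \<Longrightarrow> \<zero>\<^bsub>M\<^esub> \<oplus>\<^bsub>M\<^esub> x = x"
proof -
  assume "module R M"
  then interpret M: abelian_group M by (rule module.axioms)
  show "x \<in> carrier M \<Longrightarrow> y \<in> carrier M \<Longrightarrow> x \<oplus>\<^bsub>M\<^esub> y \<in> carrier M" by simp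
  show "\<zero>\<^bsub>M\<^esub> \<in> carrier M" by simp
  show "x \<in> carrier M \<Longrightarrow> y \<in> carrier M \<Longrightarrow> z \<in> carrier M \<Longrightarrow>
     (x \<oplus>\<^bsub>M\<^esub> y) \<oplus>\<^bsub>M\<^esub> z = x \<oplus>\<^bsub>M\<^esub> (y \<oplus>\<^bsub>M\<^esub> z)" by (simp add: M.a_assoc)
  show "x \<in> carrier M \<Longrightarrow> y \<in> carrier M \<Longrightarrow> x \<oplus>\<^bsub>M\<^esub> y = y \<oplus>\<^bsub>M\<^esub> x" by (simp add: M.a_comm)
  show "x \<in> carrier M \<Longrightarrow> y \<in> carrier M \<Longrightarrow> z \<in> carrier M \<Longrightarrow>
     x \<oplus>\<^bsub>M\<^esub> (y \<oplus>\<^bsub>M\<^esub> z) = y \<oplus>\<^bsub>M\<^esub> (x \<oplus>\<^bsub>M\<^esub> z)" by (simp add: M.a_lcomm)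
  show "x \<in> carrier M \<Longrightarrow> x \<oplus>\<^bsub>M\<^esub> \<zero>\<^bsub>M\<^esub> = x" by simp
  show "x \<in> carrier M \<Longrightarrow> \<zero>\<^bsub>M\<^esub> \<oplus>\<^bsub>M\<^esub> x = x" by simp
qed

lemma act_closed: "module R M \<Longrightarrow> x \<in> carrier M \<Longrightarrow> act M r x \<in> carrier M"
  by (simp add: act_def module.smult_closed)

lemma act_add: "module R M \<Longrightarrow> x \<in> carrier M \<Longrightarrow> y \<in> carrier M \<Longrightarrow> act M r (x \<oplus>\<^bsub>M\<^esub> y) = act M r x \<oplus>\<^bsub>M\<^esub> act M r y"
  by (simp add: act_def module.smult_r_distr)

lemma act_add_left: "module R M \<Longrightarrow> x \<in> carrier M \<Longrightarrow> act M (r + s) x = act M r x \<oplus>\<^bsub>M\<^esub> act M s x"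
  by (simp add: act_def p_add module.smult_l_distr)

lemma act_mult: "module R M \<Longrightarrow> x \<in> carrier M \<Longrightarrow> act M (r * s) x = act M r (act M s x)"
  by (simp add: act_def p_mult module.smult_assoc1)

lemma act_1: "module R M \<Longrightarrow> x \<in> carrier M \<Longrightarrow> act M 1 x = x"
  by (simp add: act_def p_1 module.smult_one)

lemma act_0: "module R M \<Longrightarrow> x \<in> carrier M \<Longrightarrow> act M 0 x = \<zero>\<^bsub>M\<^esub>"
  by (simp add: act_def p_0 module.smult_l_null)

lemma act_zero: "module R M \<Longrightarrow> act M r \<zero>\<^bsub>M\<^esub> = \<zero>\<^bsub>M\<^esub>"
  by (simp add: act_def module.smult_r_null)

lemma act_swap: "module R M \<Longrightarrow> x \<in> carrier M \<Longrightarrow> act M r (act M s x) = act M s (act M r x)"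
  by (metis act_mult mult.commute)

lemma sub_closed: "module R M \<Longrightarrow> x \<in> carrier M \<Longrightarrow> y \<in> carrier M \<Longrightarrow> sub M x y \<in> carrier M"
  by (simp add: sub_def act_closed mod_add_closed)

lemma sub_self: "module R M \<Longrightarrow> x \<in> carrier M \<Longrightarrow> sub M x x = \<zero>\<^bsub>M\<^esub>"
  using act_add_left[of M x 1 "-1"] by (simp add: sub_def act_1 act_0)

lemma sub_add: assumes "module R M" "x \<in> carrier M" "y \<in> carrier M" shows "sub M x y \<oplus>\<^bsub>M\<^esub> y = x"
proof -
  have "act M (-1) y \<oplus>\<^bsub>M\<^esub> y = \<zero>\<^bsub>M\<^esub>"
    using act_add_left[of M y "-1" 1] assms by (simp add: act_1 act_0)
  then show ?thesis using assms by (simp add: sub_def mod_assoc act_closed mod_r_zero)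
qed

lemma sub_0_iff: "module R M \<Longrightarrow> x \<in> carrier M \<Longrightarrow> y \<in> carrier M \<Longrightarrow> sub M x y = \<zero>\<^bsub>M\<^esub> \<longleftrightarrow> x = y"
  using sub_add[of M x y] sub_self[of M y] mod_l_zero[of M y] by auto

lemma sub_zero: "module R M \<Longrightarrow> x \<in> carrier M \<Longrightarrow> sub M x \<zero>\<^bsub>M\<^esub> = x"
  by (simp add: sub_def act_zero mod_r_zero)

lemma act_sub: "module R M \<Longrightarrow> x \<in> carrier M \<Longrightarrow> y \<in> carrier M \<Longrightarrow> act M r (sub M x y) = sub M (act M r x) (act M r y)"
  by (simp add: sub_def act_add act_closed act_swap)

lemma act_diff_left: "module R M \<Longrightarrow> x \<in> carrier M \<Longrightarrow> act M (r - s) x = sub M (act M r x) (act M s x)"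
  using act_add_left[of M x r "- s"] act_mult[of M x "-1" s] by (simp add: sub_def)

lemma lin_closed: "lin M N f \<Longrightarrow> x \<in> carrier M \<Longrightarrow> f x \<in> carrier N"
  and lin_add: "lin M N f \<Longrightarrow> x \<in> carrier M \<Longrightarrow> y \<in> carrier M \<Longrightarrow> f (x \<oplus>\<^bsub>M\<^esub> y) = f x \<oplus>\<^bsub>N\<^esub> f y"
  and lin_act: "lin M N f \<Longrightarrow> x \<in> carrier M \<Longrightarrow> f (act M r x) = act N r (f x)"
  by (simp_all add: lin_def)

lemma lin_zero: "module R M \<Longrightarrow> module R N \<Longrightarrow> lin M N f \<Longrightarrow> f \<zero>\<^bsub>M\<^esub> = \<zero>\<^bsub>N\<^esub>"
  using lin_act[of M N f "\<zero>\<^bsub>M\<^esub>" 0] act_0[of N "f \<zero>\<^bsub>M\<^esub>"] lin_closed[of M N f "\<zero>\<^bsub>M\<^esub>"]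
    mod_zero[of M] act_zero[of M 0] by simp

lemma lin_sub: "module R M \<Longrightarrow> lin M N f \<Longrightarrow> x \<in> carrier M \<Longrightarrow> y \<in> carrier M \<Longrightarrow> f (sub M x y) = sub N (f x) (f y)"
  by (simp add: sub_def lin_add lin_act act_closed)

lemma lin_comp: "lin L M f \<Longrightarrow> lin M N g \<Longrightarrow> lin L N (\<lambda>x. g (f x))"
  by (simp add: lin_def)

lemma lin_diff:
  assumes M: "module R M" and N: "module R N" and "lin M N f" "lin M N g"
  shows "lin M N (\<lambda>x. sub N (f x) (g x))"
  unfolding lin_def
proof (intro conjI ballI allI)
  show "sub N (f x) (g x) \<in> carrier N" if "x \<in> carrier M" for x
    using assms that by (simp add: sub_closed lin_closed)
  show "sub N (f (x \<oplus>\<^bsub>M\<^esub> y)) (g (x \<oplus>\<^bsub>M\<^esub> y)) = sub N (f x) (g x) \<oplus>\<^bsub>N\<^esub> sub N (f y) (g y)"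
    if "x \<in> carrier M" "y \<in> carrier M" for x y
  proof -
    have c: "f x \<in> carrier N" "f y \<in> carrier N" "g x \<in> carrier N" "g y \<in> carrier N"
      "act N (-1) (g x) \<in> carrier N" "act N (-1) (g y) \<in> carrier N"
      using assms that by (auto simp: lin_closed act_closed)
    show ?thesis using assms(3,4) that c N
      by (simp add: sub_def lin_add act_add mod_assoc mod_lcomm mod_add_closed)
  qed
  show "sub N (f (act M r x)) (g (act M r x)) = act N r (sub N (f x) (g x))" if "x \<in> carrier M" for r x
    using assms that by (simp add: lin_act act_sub lin_closed)
qed

lemma submI:
  assumes "C \<subseteq> carrier M" "\<zero>\<^bsub>M\<^esub> \<in> C" "\<And>x y. x \<in> C \<Longrightarrow> y \<in> C \<Longrightarrow> x \<oplus>\<^bsub>M\<^esub> y \<in> C" "\<And>r x. x \<in> C \<Longrightarrow> act M r x \<in> C"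
  shows "subm R M C"
proof -
  have "r \<odot>\<^bsub>M\<^esub> x \<in> C" if "r \<in> carrier R" "x \<in> C" for r x
    using p_surj[OF that(1)] assms(4)[OF that(2)] by (auto simp: act_def)
  then show ?thesis using assms by (auto simp: subm_def)
qed

lemma subm_act: "subm R M C \<Longrightarrow> x \<in> C \<Longrightarrow> act M r x \<in> C"
  by (simp add: subm_def act_def)

lemma subm_module:
  assumes M: "module R M" and C: "subm R M C"
  shows "module R (M\<lparr>carrier := C\<rparr>)"
proof -
  interpret M: module R M by (rule M)
  have neg: "\<ominus>\<^bsub>M\<^esub> x \<in> C" if "x \<in> C" for x
  proof -
    have x: "x \<in> carrier M" using C that by (auto simp: subm_def)
    have "act M (-1) x \<oplus>\<^bsub>M\<^esub> x = \<zero>\<^bsub>M\<^esub>"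
      using sub_add[OF M mod_zero[OF M] x] M x by (simp add: sub_def mod_l_zero act_closed)
    then have "act M (-1) x = \<ominus>\<^bsub>M\<^esub> x" using x M by (metis M.minus_equality act_closed)
    then show ?thesis using subm_act[OF C that] by metis
  qed
  have "submodule C R M"
    by (rule M.submoduleI) (use C neg in \<open>auto simp: subm_def\<close>)
  then show ?thesis using submodule.submodule_is_module M by blast
qed

lemma act_restrict [simp]: "act (M\<lparr>carrier := C\<rparr>) = act M"
  by (intro ext) (simp add: act_def)

lemma sub_restrict [simp]: "sub (M\<lparr>carrier := C\<rparr>) = sub M"
  by (intro ext) (simp add: sub_def)

text \<open>Injective as a module over \<open>S/B\<close>: the extension property is only asked for maps that kill \<open>B N\<close>.\<close>

definition INJ :: "'b set \<Rightarrow> ('a, 'a) module \<Rightarrow> bool" where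
  "INJ B E \<longleftrightarrow> module R E \<and> (\<forall>b\<in>B. \<forall>x\<in>carrier E. act E b x = \<zero>\<^bsub>E\<^esub>) \<and>
     (\<forall>(N :: ('a, 'a) module) S g. module R N \<and> subm R N S \<and> lin (N\<lparr>carrier := S\<rparr>) E g \<and>
        (\<forall>b\<in>B. \<forall>x\<in>carrier N. act N b x \<in> S \<and> g (act N b x) = \<zero>\<^bsub>E\<^esub>) \<longrightarrow>
        (\<exists>h. lin N E h \<and> (\<forall>x\<in>S. h x = g x)))"

text \<open>The S-linear maps from J/B to a submodule C of M. Unlike in \<open>mhom\<close>, values
  are module elements and the equations hold exactly.\<close>

definition hm :: "'b set \<Rightarrow> ('a, 'c, 'k) module_scheme \<Rightarrow> 'b set \<Rightarrow> 'c set \<Rightarrow> ('b \<Rightarrow> 'c) \<Rightarrow> bool" where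
  "hm B M J C \<phi> \<longleftrightarrow> (\<forall>a\<in>J. \<phi> a \<in> C) \<and> (\<forall>a\<in>J. \<forall>b\<in>J. \<phi> (a + b) = \<phi> a \<oplus>\<^bsub>M\<^esub> \<phi> b) \<and>
     (\<forall>r. \<forall>a\<in>J. \<phi> (r * a) = act M r (\<phi> a)) \<and> (\<forall>b\<in>B. \<phi> b = \<zero>\<^bsub>M\<^esub>)"

lemma INJ_module: "INJ B E \<Longrightarrow> module R E" and INJ_kill: "INJ B E \<Longrightarrow> b \<in> B \<Longrightarrow> x \<in> carrier E \<Longrightarrow> act E b x = \<zero>\<^bsub>E\<^esub>"
  by (auto simp: INJ_def)

lemma INJ_ext:
  "INJ B E \<Longrightarrow> module R (N :: ('a, 'a) module) \<Longrightarrow> subm R N S \<Longrightarrow> lin (N\<lparr>carrier := S\<rparr>) E g \<Longrightarrow>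
    (\<And>b x. b \<in> B \<Longrightarrow> x \<in> carrier N \<Longrightarrow> act N b x \<in> S \<and> g (act N b x) = \<zero>\<^bsub>E\<^esub>) \<Longrightarrow> \<exists>h. lin N E h \<and> (\<forall>x\<in>S. h x = g x)"
  unfolding INJ_def by blast

lemma self_module: "module R (self_module R)"
proof -
  interpret cring R by (rule cring_R)
  have "abelian_group (self_module R)"
    by (rule abelian_groupI) (auto simp: self_module_def a_ac intro!: bexI[of _ "\<ominus>\<^bsub>R\<^esub> _"] l_neg)
  then show ?thesis
    by (rule moduleI[OF cring_R]) (auto simp: self_module_def l_distr r_distr m_assoc)
qed

text \<open>As B contains the kernel of p, the map \<phi> factors through p(J), a submodule of R,
  with \<open>l\<close> picking preimages. Its extension to R is evaluated at 1.\<close>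

lemma baer:
  assumes E: "INJ B E" and J: "idl J" "idl B" "B \<subseteq> J" and n: "\<And>r. p r = \<zero>\<^bsub>R\<^esub> \<Longrightarrow> r \<in> B"
    and \<phi>: "hm B E J (carrier E) \<phi>"
  shows "\<exists>x\<in>carrier E. \<forall>a\<in>J. \<phi> a = act E a x"
proof -
  interpret cring R by (rule cring_R)
  note M = INJ_module[OF E]
  let ?N = "self_module R" and ?S = "p ` J"
  have act_self: "act ?N r x = p r \<otimes>\<^bsub>R\<^esub> x" for r x by (simp add: act_def self_module_def)
  define l where "l x = (SOME a. a \<in> J \<and> p a = x)" for x
  have l: "l (p a) \<in> J" "p (l (p a)) = p a" if "a \<in> J" for a
    unfolding l_def using someI[of "\<lambda>c. c \<in> J \<and> p c = p a" a] that by auto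
  have \<phi>l: "\<phi> (l (p a)) = \<phi> a" if a: "a \<in> J" for a
  proof -
    have "p (l (p a) - a) = \<zero>\<^bsub>R\<^esub>" using l(2)[OF a] by (simp add: p_diff)
    then have b: "l (p a) - a \<in> B" using n by blast
    then have "\<phi> (l (p a) - a) = \<zero>\<^bsub>E\<^esub>" using \<phi> by (simp add: hm_def)
    moreover have "l (p a) - a \<in> J" using b J by blast
    then have "\<phi> ((l (p a) - a) + a) = \<phi> (l (p a) - a) \<oplus>\<^bsub>E\<^esub> \<phi> a"
      using \<phi> a unfolding hm_def by blast
    ultimately show ?thesis using \<phi> a by (simp add: hm_def mod_l_zero[OF M])
  qed
  define g where "g x = \<phi> (l x)" for x
  have g: "g (p a) = \<phi> a" if "a \<in> J" for a using \<phi>l that g_def by simp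
  have S: "subm R ?N ?S"
  proof (rule submI)
    show "?S \<subseteq> carrier ?N" by (auto simp: self_module_def)
    show "\<zero>\<^bsub>?N\<^esub> \<in> ?S" using J(1) p_0 by (auto simp: self_module_def intro!: image_eqI[of _ _ 0])
    fix x y r assume "x \<in> ?S"
    then obtain a where a: "x = p a" "a \<in> J" by blast
    then have "act ?N r x = p (r * a)" by (simp add: act_self p_mult)
    then show "act ?N r x \<in> ?S" using J a idl_mult by blast
    assume "y \<in> ?S"
    then obtain b where b: "y = p b" "b \<in> J" by blast
    then have "x \<oplus>\<^bsub>?N\<^esub> y = p (a + b)" using a by (simp add: p_add self_module_def)
    then show "x \<oplus>\<^bsub>?N\<^esub> y \<in> ?S" using J a b idl_add by blast
  qed
  have "lin (?N\<lparr>carrier := ?S\<rparr>) E g"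
    unfolding lin_def
  proof (intro conjI ballI allI; simp)
    show "g x \<in> carrier E" if "x \<in> ?S" for x using that g \<phi> by (auto simp: hm_def)
    show "g (x \<oplus>\<^bsub>?N\<^esub> y) = g x \<oplus>\<^bsub>E\<^esub> g y" if xy: "x \<in> ?S" "y \<in> ?S" for x y
    proof -
      obtain a b where ab: "x = p a" "a \<in> J" "y = p b" "b \<in> J" using xy by blast
      then have "x \<oplus>\<^bsub>?N\<^esub> y = p (a + b)" by (simp add: p_add self_module_def)
      moreover have "a + b \<in> J" using ab J idl_add by blast
      ultimately show ?thesis using ab g \<phi> by (simp add: hm_def)
    qed
    show "g (act ?N r x) = act E r (g x)" if x: "x \<in> ?S" for r x
    proof -
      obtain a where a: "x = p a" "a \<in> J" using x by blast
      then have "act ?N r x = p (r * a)" by (simp add: p_mult act_self)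
      moreover have "r * a \<in> J" using a J idl_mult by blast
      ultimately show ?thesis using a g \<phi> by (simp add: hm_def)
    qed
  qed
  moreover have "act ?N b x \<in> ?S \<and> g (act ?N b x) = \<zero>\<^bsub>E\<^esub>" if b: "b \<in> B" and x: "x \<in> carrier ?N" for b x
  proof -
    obtain r where r: "p r = x" using p_surj[of x] x by (auto simp: self_module_def)
    then have "act ?N b x = p (b * r)" by (simp add: p_mult act_self)
    moreover have "b * r \<in> B" using b J idl_mult2 by blast
    ultimately show ?thesis using g[of "b * r"] J \<phi> by (auto simp: hm_def)
  qed
  ultimately obtain h where h: "lin ?N E h" "\<forall>x\<in>?S. h x = g x"
    using INJ_ext[OF E self_module S] by blast
  have 1: "\<one>\<^bsub>R\<^esub> \<in> carrier ?N" by (simp add: self_module_def)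
  have "\<phi> a = act E a (h \<one>\<^bsub>R\<^esub>)" if "a \<in> J" for a
  proof -
    have "act ?N a \<one>\<^bsub>R\<^esub> = p a" by (simp add: act_self)
    then have "h (p a) = act E a (h \<one>\<^bsub>R\<^esub>)" using lin_act[OF h(1) 1, of a] by simp
    then show ?thesis using g[OF that] h(2) that by simp
  qed
  then show ?thesis using lin_closed[OF h(1) 1] by blast
qed

text \<open>An injective resolution of \<open>S/B\<close> over \<open>S/B\<close> of length at most \<open>k\<close>; the element \<open>e\<close> is the image of \<open>1\<close>.\<close>

definition PR :: "'b set \<Rightarrow> nat \<Rightarrow> (nat \<Rightarrow> ('a, 'a) module) \<Rightarrow> 'a \<Rightarrow> (nat \<Rightarrow> 'a \<Rightarrow> 'a) \<Rightarrow> bool" where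
  "PR B k E e d \<longleftrightarrow> (\<forall>i. INJ B (E i)) \<and> (\<forall>i. lin (E i) (E (Suc i)) (d i)) \<and> e \<in> carrier (E 0) \<and>
     (\<forall>r. act (E 0) r e = \<zero>\<^bsub>E 0\<^esub> \<longleftrightarrow> r \<in> B) \<and>
     (\<forall>v\<in>carrier (E 0). d 0 v = \<zero>\<^bsub>E 1\<^esub> \<longleftrightarrow> (\<exists>r. v = act (E 0) r e)) \<and>
     (\<forall>i. \<forall>v\<in>carrier (E (Suc i)). d (Suc i) v = \<zero>\<^bsub>E (Suc (Suc i))\<^esub> \<longleftrightarrow> (\<exists>u\<in>carrier (E i). v = d i u)) \<and>
     (\<forall>i>k. carrier (E i) = {\<zero>\<^bsub>E i\<^esub>})"

text \<open>The element k + z r goes to f k + r t. The coefficient r is determined only up to (K' :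
  z), and the second part of hypothesis \<open>t\<close> says that f and t agree there.\<close>

lemma hm_extend:
  assumes M: "module R M" and C: "subm R M C" and K': "idl K'" "B \<subseteq> K'" and f: "hm B M K' C f"
    and t: "t \<in> C" "\<And>r. r * z \<in> K' \<Longrightarrow> f (r * z) = act M r t"
  shows "\<exists>g. hm B M (adj K' z) C g \<and> (\<forall>a\<in>K'. g a = f a) \<and> g z = t"
proof -
  let ?J = "adj K' z"
  have tM: "t \<in> carrier M" using t(1) C by (auto simp: subm_def)
  have fM: "f a \<in> carrier M" "f a \<in> C" if "a \<in> K'" for a using f C that by (auto simp: hm_def subm_def)
  define c where "c a = (SOME r. a - z * r \<in> K')" for a
  have c: "a - z * c a \<in> K'" if a: "a \<in> ?J" for a
  proof -
    have "\<exists>r. a - z * r \<in> K'" using adj_memb_cong[OF K'(1) a] by blast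
    then show ?thesis unfolding c_def by (rule someI_ex)
  qed
  define g where "g a = f (a - z * c a) \<oplus>\<^bsub>M\<^esub> act M (c a) t" for a
  have g: "g a = f (a - z * r) \<oplus>\<^bsub>M\<^esub> act M r t" if a: "a \<in> ?J" and r: "a - z * r \<in> K'" for a r
  proof -
    have "(a - z * c a) - (a - z * r) \<in> K'" using r c[OF a] K' idl_diff by blast
    then have rc: "(r - c a) * z \<in> K'" by (simp add: algebra_simps)
    have "f ((a - z * r) + (r - c a) * z) = f (a - z * r) \<oplus>\<^bsub>M\<^esub> f ((r - c a) * z)"
      using f r rc by (simp add: hm_def)
    moreover have "(a - z * r) + (r - c a) * z = a - z * c a" by (simp add: algebra_simps)
    ultimately have "f (a - z * c a) = f (a - z * r) \<oplus>\<^bsub>M\<^esub> act M (r - c a) t" using t(2)[OF rc] by simp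
    then have "g a = f (a - z * r) \<oplus>\<^bsub>M\<^esub> (act M (r - c a) t \<oplus>\<^bsub>M\<^esub> act M (c a) t)"
      unfolding g_def using mod_assoc[OF M fM(1)[OF r] act_closed[OF M tM] act_closed[OF M tM]] by simp
    then show ?thesis using act_add_left[OF M tM, of "r - c a" "c a"] by simp
  qed
  have "hm B M ?J C g"
    unfolding hm_def
  proof (intro conjI ballI allI)
    show "g a \<in> C" if "a \<in> ?J" for a
      using fM(2)[OF c[OF that]] subm_act[OF C t(1)] C by (simp add: g_def subm_def)
    show "g (a + b) = g a \<oplus>\<^bsub>M\<^esub> g b" if ab: "a \<in> ?J" "b \<in> ?J" for a b
    proof -
      have "(a - z * c a) + (b - z * c b) \<in> K'" using c ab K' idl_add by blast
      moreover have eq: "(a - z * c a) + (b - z * c b) = (a + b) - z * (c a + c b)" by (simp add: algebra_simps)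
      ultimately have m: "(a + b) - z * (c a + c b) \<in> K'" by simp
      have "g (a + b) = f ((a + b) - z * (c a + c b)) \<oplus>\<^bsub>M\<^esub> act M (c a + c b) t"
        by (rule g[OF _ m]) (use ab K' in \<open>simp add: idl_add\<close>)
      then have "g (a + b) = f ((a - z * c a) + (b - z * c b)) \<oplus>\<^bsub>M\<^esub> act M (c a + c b) t"
        by (simp only: eq)
      also have "f ((a - z * c a) + (b - z * c b)) = f (a - z * c a) \<oplus>\<^bsub>M\<^esub> f (b - z * c b)"
        using f c ab unfolding hm_def by blast
      finally show ?thesis
        unfolding g_def using fM(1)[OF c[OF ab(1)]] fM(1)[OF c[OF ab(2)]] act_closed[OF M tM]
        by (simp add: act_add_left[OF M tM] mod_assoc[OF M] mod_lcomm[OF M] mod_add_closed[OF M])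
    qed
    show "g (r * a) = act M r (g a)" if a: "a \<in> ?J" for r a
    proof -
      have "r * (a - z * c a) \<in> K'" using c a K' idl_mult by blast
      moreover have eq: "r * (a - z * c a) = r * a - z * (r * c a)" by (simp add: algebra_simps)
      ultimately have m: "r * a - z * (r * c a) \<in> K'" by simp
      have "g (r * a) = f (r * a - z * (r * c a)) \<oplus>\<^bsub>M\<^esub> act M (r * c a) t"
        by (rule g[OF _ m]) (use a K' in \<open>simp add: idl_mult\<close>)
      then have "g (r * a) = f (r * (a - z * c a)) \<oplus>\<^bsub>M\<^esub> act M (r * c a) t"
        by (simp only: eq)
      also have "f (r * (a - z * c a)) = act M r (f (a - z * c a))"
        using f c a unfolding hm_def by blast
      finally show ?thesis
        unfolding g_def using fM(1)[OF c[OF a]] act_closed[OF M tM]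
        by (simp add: act_mult[OF M tM] act_add[OF M])
    qed
    show "g b = \<zero>\<^bsub>M\<^esub>" if b: "b \<in> B" for b
      using g[of b 0] b sub_adj[of K' z] K' f by (auto simp: act_0[OF M tM] hm_def mod_l_zero[OF M] mod_zero[OF M])
  qed
  moreover have "g a = f a" if "a \<in> K'" for a
    using g[of a 0] that sub_adj[of K' z] fM(1)[OF that] by (auto simp: act_0[OF M tM] mod_r_zero[OF M])
  moreover have "g z = t"
  proof -
    have "f 0 = \<zero>\<^bsub>M\<^esub>" using t(2)[of 0] K'(1) by (simp add: act_0[OF M tM])
    then show ?thesis using g[OF adj_self[OF K'(1)], of 1] K'(1) by (simp add: act_1[OF M tM] mod_l_zero[OF M tM])
  qed
  ultimately show ?thesis by blast
qed

lemma hm_zero: "module R M \<Longrightarrow> subm R M C \<Longrightarrow> hm B M J C (\<lambda>_. \<zero>\<^bsub>M\<^esub>)"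
  by (simp add: hm_def subm_def mod_l_zero mod_zero act_zero)

lemma subm_carrier: "module R M \<Longrightarrow> subm R M (carrier M)"
  by (simp add: subm_def mod_zero mod_add_closed module.smult_closed)

text \<open>Baer's criterion for the map on (B, y) that kills B and sends y to u; the condition on
  annihilators makes it well defined.\<close>

lemma divisible:
  assumes E: "INJ B E" and B: "idl B" and n: "\<And>r. p r = \<zero>\<^bsub>R\<^esub> \<Longrightarrow> r \<in> B"
    and u: "u \<in> carrier E" "\<And>r. y * r \<in> B \<Longrightarrow> act E r u = \<zero>\<^bsub>E\<^esub>"
  shows "\<exists>e\<in>carrier E. act E y e = u"
proof -
  note M = INJ_module[OF E]
  have "\<exists>g. hm B E (adj B y) (carrier E) g \<and> (\<forall>a\<in>B. g a = \<zero>\<^bsub>E\<^esub>) \<and> g y = u"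
    by (rule hm_extend[OF M subm_carrier[OF M] B order_refl hm_zero[OF M subm_carrier[OF M]] u(1)])
      (use u(2) in \<open>simp add: mult.commute\<close>)
  then obtain g where g: "hm B E (adj B y) (carrier E) g" "g y = u" by blast
  then obtain x where "x \<in> carrier E" "\<forall>a\<in>adj B y. g a = act E a x"
    using baer[OF E idl_adj[OF B] B sub_adj n] by blast
  then show ?thesis using g(2) adj_self[OF B] by metis
qed

text \<open>The submodule is Hom(S/y, E). A map that kills y N extends to E, and the values of the
  extension are killed by y automatically.\<close>

lemma INJ_killed:
  assumes E: "INJ B E" and B: "idl B"
  shows "INJ (adj B y) (E\<lparr>carrier := {x \<in> carrier E. act E y x = \<zero>\<^bsub>E\<^esub>}\<rparr>)" (is "INJ _ ?E'")
proof -
  note M = INJ_module[OF E]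
  have M': "module R ?E'"
    by (rule subm_module[OF M submI])
      (auto simp: mod_zero[OF M] act_zero[OF M] mod_add_closed[OF M] act_add[OF M] act_closed[OF M]
         act_swap[OF M, of _ y] mod_l_zero[OF M])
  have k: "act E b x = \<zero>\<^bsub>E\<^esub>" if b: "b \<in> adj B y" and x: "x \<in> carrier E" "act E y x = \<zero>\<^bsub>E\<^esub>" for b x
  proof -
    obtain c r where c: "b = c + y * r" "c \<in> B" using b adjE by blast
    have "act E b x = act E c x \<oplus>\<^bsub>E\<^esub> act E r (act E y x)"
      unfolding c(1) using act_add_left[OF M x(1), of c "r * y"] act_mult[OF M x(1), of r y] by (simp add: mult.commute)
    then show ?thesis using x INJ_kill[OF E c(2) x(1)] by (simp add: act_zero[OF M] mod_l_zero[OF M] mod_zero[OF M])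
  qed
  have "\<exists>h. lin N ?E' h \<and> (\<forall>x\<in>S. h x = g x)"
    if N: "module R N" "subm R N S" and g: "lin (N\<lparr>carrier := S\<rparr>) ?E' g"
      and 0: "\<forall>b\<in>adj B y. \<forall>x\<in>carrier N. act N b x \<in> S \<and> g (act N b x) = \<zero>\<^bsub>?E'\<^esub>"
    for N :: "('a, 'a) module" and S g
  proof -
    have "lin (N\<lparr>carrier := S\<rparr>) E g" using g by (auto simp: lin_def)
    moreover have "act N b x \<in> S \<and> g (act N b x) = \<zero>\<^bsub>E\<^esub>" if "b \<in> B" "x \<in> carrier N" for b x
      using 0 that sub_adj[of B y] by auto
    ultimately obtain h where h: "lin N E h" "\<forall>x\<in>S. h x = g x" using INJ_ext[OF E N] by blast
    have "act E y (h x) = \<zero>\<^bsub>E\<^esub>" if x: "x \<in> carrier N" for x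
    proof -
      have "act E y (h x) = h (act N y x)" using lin_act[OF h(1) x] by simp
      also have "\<dots> = g (act N y x)" using h(2) 0 x adj_self[OF B] by auto
      also have "\<dots> = \<zero>\<^bsub>E\<^esub>" using 0 x adj_self[OF B] by auto
      finally show ?thesis .
    qed
    then have "lin N ?E' h" using h(1) by (auto simp: lin_def)
    then show ?thesis using h by blast
  qed
  then show ?thesis unfolding INJ_def using M' k by auto
qed

lemma INJ_retract:
  assumes K: "INJ B K" and q: "lin K K q" "\<And>x. x \<in> carrier K \<Longrightarrow> q x \<in> C" "\<And>x. x \<in> C \<Longrightarrow> q x = x"
    and C: "subm R K C"
  shows "INJ B (K\<lparr>carrier := C\<rparr>)"
proof -
  note M = INJ_module[OF K]
  have CK: "C \<subseteq> carrier K" using C by (simp add: subm_def)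
  have "\<exists>h. lin N (K\<lparr>carrier := C\<rparr>) h \<and> (\<forall>x\<in>S. h x = g x)"
    if N: "module R N" "subm R N S" and g: "lin (N\<lparr>carrier := S\<rparr>) (K\<lparr>carrier := C\<rparr>) g"
      and 0: "\<forall>b\<in>B. \<forall>x\<in>carrier N. act N b x \<in> S \<and> g (act N b x) = \<zero>\<^bsub>K\<^esub>"
    for N :: "('a, 'a) module" and S g
  proof -
    have "lin (N\<lparr>carrier := S\<rparr>) K g" using g CK by (auto simp: lin_def)
    then obtain h where h: "lin N K h" "\<forall>x\<in>S. h x = g x" using INJ_ext[OF K N] 0 by blast
    have "lin N (K\<lparr>carrier := C\<rparr>) (\<lambda>x. q (h x))"
      using lin_comp[OF h(1) q(1)] q(2) h(1) by (auto simp: lin_def)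
    moreover have "q (h x) = g x" if "x \<in> S" for x
      using g h(2) q(3) that by (auto simp: lin_def)
    ultimately show ?thesis by blast
  qed
  then show ?thesis unfolding INJ_def using subm_module[OF M C] CK INJ_kill[OF K] by auto
qed

lemma subm_kernel:
  assumes M: "module R M" "module R N" and f: "lin M N f"
  shows "subm R M {x \<in> carrier M. f x = \<zero>\<^bsub>N\<^esub>}"
  by (rule submI)
    (auto simp: mod_zero[OF M(1)] mod_zero[OF M(2)] mod_add_closed[OF M(1)] act_closed[OF M(1)] lin_add[OF f] lin_act[OF f]
       act_zero[OF M(2)] mod_l_zero[OF M(2)] lin_zero[OF M f])

lemma subm_image:
  assumes M: "module R M" "module R N" and f: "lin M N f"
  shows "subm R N (f ` carrier M)"
proof (rule submI)
  show "f ` carrier M \<subseteq> carrier N" using lin_closed[OF f] by auto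
  show "\<zero>\<^bsub>N\<^esub> \<in> f ` carrier M" using lin_zero[OF M f] mod_zero[OF M(1)] by force
  fix x y r assume "x \<in> f ` carrier M"
  then obtain u where u: "x = f u" "u \<in> carrier M" by blast
  then have "act N r x = f (act M r u)" using lin_act[OF f] by simp
  then show "act N r x \<in> f ` carrier M" using act_closed[OF M(1) u(2)] by blast
  assume "y \<in> f ` carrier M"
  then obtain v where v: "y = f v" "v \<in> carrier M" by blast
  then have "x \<oplus>\<^bsub>N\<^esub> y = f (u \<oplus>\<^bsub>M\<^esub> v)" using u lin_add[OF f] by simp
  then show "x \<oplus>\<^bsub>N\<^esub> y \<in> f ` carrier M" using mod_add_closed[OF M(1) u(2) v(2)] by blast
qed

text \<open>Rees: applying \<open>Hom(S/y, -)\<close> to the resolution and dropping its first term gives a resolution of \<open>S/(B, y)\<close> that is shorter by one.\<close>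

lemma rees:
  assumes PR: "PR B k E e d" and B: "idl B" and n: "\<And>r. p r = \<zero>\<^bsub>R\<^esub> \<Longrightarrow> r \<in> B" and y: "nzd B y"
  shows "\<exists>E' e' d'. PR (adj B y) (k - 1) E' e' d'"
proof -
  have E: "\<And>i. INJ B (E i)" and d: "\<And>i. lin (E i) (E (Suc i)) (d i)" and e: "e \<in> carrier (E 0)"
    and ann: "\<And>r. act (E 0) r e = \<zero>\<^bsub>E 0\<^esub> \<longleftrightarrow> r \<in> B"
    and ker0: "\<And>v. v \<in> carrier (E 0) \<Longrightarrow> d 0 v = \<zero>\<^bsub>E 1\<^esub> \<longleftrightarrow> (\<exists>r. v = act (E 0) r e)"
    and kerS: "\<And>i v. v \<in> carrier (E (Suc i)) \<Longrightarrow> d (Suc i) v = \<zero>\<^bsub>E (Suc (Suc i))\<^esub> \<longleftrightarrow> (\<exists>u\<in>carrier (E i). v = d i u)"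
    and bound: "\<And>i. i > k \<Longrightarrow> carrier (E i) = {\<zero>\<^bsub>E i\<^esub>}"
    using PR unfolding PR_def by blast+
  have M: "\<And>i. module R (E i)" using E INJ_module by blast
  note d0 = d[of 0, folded One_nat_def]
  have yr: "y * r \<in> B \<longleftrightarrow> r \<in> B" for r using y B idl_mult by (auto simp: nzd_def)
  let ?B = "adj B y"
  \<comment> \<open>K i is Hom(S/y, E i), the part of E i killed by y.\<close>
  define K where "K i = (E i)\<lparr>carrier := {x \<in> carrier (E i). act (E i) y x = \<zero>\<^bsub>E i\<^esub>}\<rparr>" for i
  have K: "INJ ?B (K i)" for i unfolding K_def by (rule INJ_killed[OF E B])
  have KM: "module R (K i)" for i using K INJ_module by blast
  have cK: "x \<in> carrier (K i) \<longleftrightarrow> x \<in> carrier (E i) \<and> act (E i) y x = \<zero>\<^bsub>E i\<^esub>"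
    and aK: "act (K i) = act (E i)" and sK: "sub (K i) = sub (E i)" and zK: "\<zero>\<^bsub>K i\<^esub> = \<zero>\<^bsub>E i\<^esub>"
    and plK: "x \<oplus>\<^bsub>K i\<^esub> x' = x \<oplus>\<^bsub>E i\<^esub> x'" for i x x' by (auto simp: K_def)
  have dK: "lin (K i) (K (Suc i)) (d i)" for i
  proof -
    have "act (E (Suc i)) y (d i x) = \<zero>\<^bsub>E (Suc i)\<^esub>" if "x \<in> carrier (E i)" "act (E i) y x = \<zero>\<^bsub>E i\<^esub>" for x
      using lin_act[OF d that(1), of y] that(2) lin_zero[OF M M d, of i] by simp
    then show ?thesis using d[of i] by (simp add: lin_def cK aK plK)
  qed
  note dK0 = dK[of 0, folded One_nat_def]
  have dd0: "d 1 (d 0 v) = \<zero>\<^bsub>E 2\<^esub>" if "v \<in> carrier (E 0)" for v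
    using kerS[of "d 0 v" 0] lin_closed[OF d0 that] that by (auto simp: numeral_2_eq_2)
  have div: "\<exists>u'\<in>carrier (E i). act (E i) y u' = u" if "u \<in> carrier (E i)" for i u
    using divisible[OF E B n that, of y] yr INJ_kill[OF E _ that] by blast
  \<comment> \<open>Hom(S/y, S/B) = 0 because y is regular, so K 0 embeds into K 1. Being injective
    it splits off; h below is the resulting retraction.\<close>
  have inj: "inj_on (d 0) (carrier (K 0))"
  proof (rule inj_onI)
    fix u v assume uv: "u \<in> carrier (K 0)" "v \<in> carrier (K 0)" "d 0 u = d 0 v"
    let ?w = "sub (E 0) u v"
    have w: "?w \<in> carrier (K 0)" using sub_closed[OF KM uv(1,2)] by (simp add: sK)
    have uvE: "u \<in> carrier (E 0)" "v \<in> carrier (E 0)" using uv by (auto simp: cK)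
    have "d 0 ?w = \<zero>\<^bsub>E 1\<^esub>" using lin_sub[OF M d0 uvE] uv(3) sub_self[OF M lin_closed[OF d0 uvE(2)]] by simp
    then obtain r where r: "?w = act (E 0) r e" using ker0 w cK by blast
    then have "act (E 0) (y * r) e = \<zero>\<^bsub>E 0\<^esub>" using w act_mult[OF M e] by (simp add: cK)
    then have "?w = \<zero>\<^bsub>E 0\<^esub>" using ann yr r by metis
    then show "u = v" using sub_0_iff[OF M uvE] by blast
  qed
  define S g where "S = d 0 ` carrier (K 0)" and "g = inv_into (carrier (K 0)) (d 0)"
  have g: "g (d 0 v) = v" if "v \<in> carrier (K 0)" for v using inj that by (simp add: g_def)
  have S: "subm R (K 1) S" unfolding S_def by (rule subm_image[OF KM KM dK0])
  have g_lin: "lin ((K 1)\<lparr>carrier := S\<rparr>) (K 0) g"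
    unfolding lin_def
  proof (intro conjI ballI allI; simp del: One_nat_def)
    show "g x \<in> carrier (K 0)" if "x \<in> S" for x using that g by (auto simp: S_def)
    show "g (x \<oplus>\<^bsub>K 1\<^esub> x') = g x \<oplus>\<^bsub>K 0\<^esub> g x'" if xx: "x \<in> S" "x' \<in> S" for x x'
    proof -
      obtain u v where uv: "u \<in> carrier (K 0)" "v \<in> carrier (K 0)" "x = d 0 u" "x' = d 0 v" using xx by (auto simp: S_def)
      then have "x \<oplus>\<^bsub>K 1\<^esub> x' = d 0 (u \<oplus>\<^bsub>K 0\<^esub> v)" using lin_add[OF dK0] by simp
      then show ?thesis using g uv mod_add_closed[OF KM uv(1,2)] by simp
    qed
    show "g (act (K 1) r x) = act (K 0) r (g x)" if x: "x \<in> S" for r x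
    proof -
      obtain u where u: "u \<in> carrier (K 0)" "x = d 0 u" using x by (auto simp: S_def)
      then have "act (K 1) r x = d 0 (act (K 0) r u)" using lin_act[OF dK0] by simp
      then show ?thesis using g u act_closed[OF KM u(1)] by simp
    qed
  qed
  have "\<exists>h. lin (K 1) (K 0) h \<and> (\<forall>x\<in>S. h x = g x)"
  proof (rule INJ_ext[OF K KM S g_lin])
    fix b x assume b: "b \<in> ?B" and x: "x \<in> carrier (K 1)"
    have "act (K 1) b x = \<zero>\<^bsub>K 1\<^esub>" by (rule INJ_kill[OF K b x])
    moreover have "\<zero>\<^bsub>K 1\<^esub> \<in> S" using S by (simp add: subm_def)
    moreover have "g \<zero>\<^bsub>K 1\<^esub> = \<zero>\<^bsub>K 0\<^esub>" using g[of "\<zero>\<^bsub>K 0\<^esub>"] mod_zero[OF KM] lin_zero[OF KM KM dK0] by simp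
    ultimately show "act (K 1) b x \<in> S \<and> g (act (K 1) b x) = \<zero>\<^bsub>K 0\<^esub>" by simp
  qed
  then obtain h where h: "lin (K 1) (K 0) h" "\<And>v. v \<in> carrier (K 0) \<Longrightarrow> h (d 0 v) = v"
    using g unfolding S_def by auto
  \<comment> \<open>The projection of K 1 along the image of K 0 onto the kernel C of h. This C, a
    copy of K 1 modulo K 0, becomes the first term of the new resolution.\<close>
  define q where "q x = sub (E 1) x (d 0 (h x))" for x
  define C where "C = {x \<in> carrier (K 1). h x = \<zero>\<^bsub>K 0\<^esub>}"
  have C: "subm R (K 1) C" unfolding C_def by (rule subm_kernel[OF KM KM h(1)])
  have dh: "lin (K 1) (K 1) (\<lambda>x. d 0 (h x))" by (rule lin_comp[OF h(1) dK0])
  have q_lin: "lin (K 1) (K 1) q"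
    using lin_diff[OF KM KM _ dh, of "\<lambda>x. x"] unfolding q_def sK by (simp add: lin_def)
  have qC: "q x \<in> C" if x: "x \<in> carrier (K 1)" for x
  proof -
    have hx: "h x \<in> carrier (K 0)" by (rule lin_closed[OF h(1) x])
    have "h (q x) = sub (K 0) (h x) (h (d 0 (h x)))"
      unfolding q_def using lin_sub[OF KM h(1) x lin_closed[OF dK0 hx]] by (simp add: sK)
    also have "\<dots> = \<zero>\<^bsub>K 0\<^esub>" using h(2)[OF hx] sub_self[OF KM hx] by simp
    finally show ?thesis unfolding C_def using lin_closed[OF q_lin x] by blast
  qed
  have q_id: "q x = x" if "x \<in> C" for x
  proof -
    have "d 0 (h x) = \<zero>\<^bsub>E 1\<^esub>" "x \<in> carrier (E 1)"
      using that lin_zero[OF KM KM dK0] by (auto simp: C_def zK cK)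
    then show ?thesis unfolding q_def using sub_zero[OF M] by simp
  qed
  \<comment> \<open>The connecting homomorphism: divide the image e of 1 by y and apply d. The
    projection to C of the result generates the copy of S/(B, y).\<close>
  obtain e1 where e1: "e1 \<in> carrier (E 0)" "act (E 0) y e1 = e" using div[OF e] by blast
  define z where "z = d 0 e1"
  have "act (E 1) y z = \<zero>\<^bsub>E 1\<^esub>"
    using lin_act[OF d0 e1(1), of y] e1(2) ker0[OF e] act_1[OF M e] unfolding z_def by metis
  then have z: "z \<in> carrier (K 1)" using lin_closed[OF d0 e1(1)] by (simp add: cK z_def)
  have zE: "z \<in> carrier (E 1)" using z cK by blast
  define e' where "e' = q z"
  have e': "e' \<in> C" using qC[OF z] e'_def by simp
  have e'E: "e' \<in> carrier (E 1)" using e' by (simp add: C_def cK)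
  have hz: "h z \<in> carrier (K 0)" by (rule lin_closed[OF h(1) z])
  have act_e': "act (E 1) r e' = q (act (E 1) r z)" for r
    using lin_act[OF q_lin z, of r] by (simp add: e'_def aK)
  have ann': "act (E 1) r e' = \<zero>\<^bsub>E 1\<^esub> \<longleftrightarrow> r \<in> ?B" for r
  proof
    assume r: "r \<in> ?B"
    show "act (E 1) r e' = \<zero>\<^bsub>E 1\<^esub>" using INJ_kill[OF K r, of e' 1] e' by (auto simp: C_def aK zK)
  next
    assume 0: "act (E 1) r e' = \<zero>\<^bsub>E 1\<^esub>"
    let ?i = "h (act (E 1) r z)"
    have rz: "act (E 1) r z \<in> carrier (K 1)" using act_closed[OF KM z, of r] by (simp add: aK)
    have i: "?i \<in> carrier (K 0)" by (rule lin_closed[OF h(1) rz])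
    then have iE: "?i \<in> carrier (E 0)" "act (E 0) y ?i = \<zero>\<^bsub>E 0\<^esub>" by (auto simp: cK)
    have re1: "act (E 0) r e1 \<in> carrier (E 0)" by (rule act_closed[OF M e1(1)])
    have "sub (E 1) (act (E 1) r z) (d 0 ?i) = \<zero>\<^bsub>E 1\<^esub>" using 0 unfolding act_e' q_def .
    then have "d 0 (sub (E 0) (act (E 0) r e1) ?i) = \<zero>\<^bsub>E 1\<^esub>"
      using lin_sub[OF M d0 re1 iE(1)] lin_act[OF d0 e1(1), of r] by (simp add: z_def)
    then obtain c where c: "sub (E 0) (act (E 0) r e1) ?i = act (E 0) c e" using ker0 sub_closed[OF M re1 iE(1)] by blast
    have "act (E 0) y (sub (E 0) (act (E 0) r e1) ?i) = act (E 0) r e"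
      using act_sub[OF M re1 iE(1)] iE(2) act_swap[OF M e1(1), of y r] e1(2) sub_zero[OF M act_closed[OF M e]] by simp
    then have "act (E 0) r e = act (E 0) (y * c) e" using c act_mult[OF M e] by simp
    then have "act (E 0) (r - y * c) e = \<zero>\<^bsub>E 0\<^esub>"
      using act_diff_left[OF M e] sub_self[OF M act_closed[OF M e]] by simp
    then show "r \<in> ?B" using ann adj_memI[OF B] by blast
  qed
  \<comment> \<open>Since K 0 has been split off, index i now stands for the old index i +
    1.\<close>
  define E' where "E' i = (case i of 0 \<Rightarrow> (K 1)\<lparr>carrier := C\<rparr> | Suc j \<Rightarrow> K (Suc i))" for i
  have E'0: "E' 0 = (K 1)\<lparr>carrier := C\<rparr>" and E'S: "E' (Suc j) = K (Suc (Suc j))" for j by (simp_all add: E'_def)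
  have CK: "x \<in> C \<Longrightarrow> x \<in> carrier (K 1)" for x by (simp add: C_def)
  have E'inj: "INJ ?B (E' i)" for i
  proof (cases i)
    case 0 show ?thesis unfolding 0 E'0 by (rule INJ_retract[OF K q_lin qC q_id C])
  next
    case (Suc j) then show ?thesis unfolding Suc E'S by (simp add: K)
  qed
  have E'lin: "lin (E' i) (E' (Suc i)) (d (Suc i))" for i
  proof (cases i)
    case 0
    have "lin ((K 1)\<lparr>carrier := C\<rparr>) (K 2) (d 1)"
      using dK[of 1] CK by (auto simp: lin_def numeral_2_eq_2)
    then show ?thesis unfolding 0 E'0 E'S by (simp add: numeral_2_eq_2)
  next
    case (Suc j) then show ?thesis unfolding Suc E'S by (simp add: dK)
  qed
  have ker0': "d 1 v = \<zero>\<^bsub>E 2\<^esub> \<longleftrightarrow> (\<exists>r. v = act (E 1) r e')" if v: "v \<in> C" for v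
  proof
    have vE: "v \<in> carrier (E 1)" "act (E 1) y v = \<zero>\<^bsub>E 1\<^esub>" using v CK cK by blast+
    assume "d 1 v = \<zero>\<^bsub>E 2\<^esub>"
    then obtain u where u: "u \<in> carrier (E 0)" "v = d 0 u" using kerS[of v 0] vE by (auto simp: numeral_2_eq_2)
    have "d 0 (act (E 0) y u) = \<zero>\<^bsub>E 1\<^esub>" using lin_act[OF d0 u(1), of y] u(2) vE by simp
    then obtain c where c: "act (E 0) y u = act (E 0) c e" using ker0 act_closed[OF M u(1)] by blast
    let ?i = "sub (E 0) u (act (E 0) c e1)"
    have ce1: "act (E 0) c e1 \<in> carrier (E 0)" by (rule act_closed[OF M e1(1)])
    have "act (E 0) y ?i = \<zero>\<^bsub>E 0\<^esub>"
      using act_sub[OF M u(1) ce1, of y] act_swap[OF M e1(1), of y c] e1(2) c sub_self[OF M act_closed[OF M e]] by simp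
    then have i: "?i \<in> carrier (K 0)" using sub_closed[OF M u(1) ce1] by (simp add: cK)
    have "q (d 0 ?i) = \<zero>\<^bsub>E 1\<^esub>" unfolding q_def using h(2)[OF i] sub_self[OF M] lin_closed[OF dK0 i] by (simp add: cK)
    moreover have "d 0 ?i = sub (K 1) v (act (K 1) c z)"
      using lin_sub[OF M d0 u(1) ce1] lin_act[OF d0 e1(1), of c] u(2) by (simp add: z_def sK aK)
    ultimately have "sub (K 1) (q v) (q (act (K 1) c z)) = \<zero>\<^bsub>K 1\<^esub>"
      using lin_sub[OF KM q_lin CK[OF v] act_closed[OF KM z, of c]] by (simp add: zK)
    then have "q v = q (act (K 1) c z)"
      using sub_0_iff[OF KM] lin_closed[OF q_lin] CK[OF v] act_closed[OF KM z] by blast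
    then have "v = act (E 1) c e'" using q_id[OF v] act_e' by (simp add: aK)
    then show "\<exists>r. v = act (E 1) r e'" by blast
  next
    assume "\<exists>r. v = act (E 1) r e'"
    then obtain r where r: "v = act (E 1) r e'" by blast
    have hzE: "h z \<in> carrier (E 0)" using hz cK by blast
    have "e' = d 0 (sub (E 0) e1 (h z))"
      unfolding e'_def q_def z_def using lin_sub[OF M d0 e1(1)] hzE by (simp add: z_def)
    then have "d 1 e' = \<zero>\<^bsub>E 2\<^esub>" using dd0 sub_closed[OF M e1(1) hzE] by simp
    then show "d 1 v = \<zero>\<^bsub>E 2\<^esub>"
      using lin_act[OF d[of 1] e'E, of r] act_zero[OF M] r by (simp add: numeral_2_eq_2)
  qed
  have kerS': "d (Suc (Suc i)) v = \<zero>\<^bsub>E (Suc (Suc (Suc i)))\<^esub> \<longleftrightarrow> (\<exists>u\<in>carrier (K (Suc i)). v = d (Suc i) u)"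
    if v: "v \<in> carrier (K (Suc (Suc i)))" for i v
  proof
    have vE: "v \<in> carrier (E (Suc (Suc i)))" "act (E (Suc (Suc i))) y v = \<zero>\<^bsub>E (Suc (Suc i))\<^esub>" using v cK by blast+
    assume "d (Suc (Suc i)) v = \<zero>\<^bsub>E (Suc (Suc (Suc i)))\<^esub>"
    then obtain u where u: "u \<in> carrier (E (Suc i))" "v = d (Suc i) u" using kerS vE by blast
    have "d (Suc i) (act (E (Suc i)) y u) = \<zero>\<^bsub>E (Suc (Suc i))\<^esub>" using lin_act[OF d u(1), of y] u(2) vE by simp
    then obtain w where w: "w \<in> carrier (E i)" "act (E (Suc i)) y u = d i w"
      using kerS act_closed[OF M u(1)] by blast
    obtain w' where w': "w' \<in> carrier (E i)" "act (E i) y w' = w" using div[OF w(1)] by blast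
    have dw': "d i w' \<in> carrier (E (Suc i))" by (rule lin_closed[OF d w'(1)])
    let ?u = "sub (E (Suc i)) u (d i w')"
    have "act (E (Suc i)) y ?u = \<zero>\<^bsub>E (Suc i)\<^esub>"
      using act_sub[OF M u(1) dw', of y] lin_act[OF d w'(1), of y] w'(2) w(2) sub_self[OF M lin_closed[OF d w(1)]] by simp
    then have "?u \<in> carrier (K (Suc i))" using sub_closed[OF M u(1) dw'] by (simp add: cK)
    moreover have "d (Suc i) (d i w') = \<zero>\<^bsub>E (Suc (Suc i))\<^esub>" using kerS[OF dw'] w'(1) by blast
    then have "d (Suc i) ?u = v" using lin_sub[OF M d u(1) dw'] u(2) sub_zero[OF M vE(1)] by simp
    ultimately show "\<exists>u\<in>carrier (K (Suc i)). v = d (Suc i) u" by blast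
  next
    assume "\<exists>u\<in>carrier (K (Suc i)). v = d (Suc i) u"
    then show "d (Suc (Suc i)) v = \<zero>\<^bsub>E (Suc (Suc (Suc i)))\<^esub>" using kerS v cK by blast
  qed
  have kerS'': "d (Suc (Suc i)) v = \<zero>\<^bsub>E (Suc (Suc (Suc i)))\<^esub> \<longleftrightarrow> (\<exists>u\<in>carrier (E' i). v = d (Suc i) u)"
    if v: "v \<in> carrier (K (Suc (Suc i)))" for i v
  proof (cases i)
    case 0
    have "\<exists>u\<in>C. v = d 1 u" if u: "u \<in> carrier (K 1)" "v = d 1 u" for u
    proof -
      have uE: "u \<in> carrier (E 1)" using u cK by blast
      have hu: "h u \<in> carrier (E 0)" using lin_closed[OF h(1) u(1)] cK by blast
      have "d 1 (q u) = sub (E 2) (d 1 u) (d 1 (d 0 (h u)))"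
        unfolding q_def using lin_sub[OF M d[of 1] uE lin_closed[OF d0 hu]] by (simp add: numeral_2_eq_2)
      also have "\<dots> = d 1 u" using dd0[OF hu] sub_zero[OF M] lin_closed[OF d[of 1] uE] by (simp add: numeral_2_eq_2)
      finally show ?thesis using qC[OF u(1)] u(2) by metis
    qed
    then show ?thesis using kerS'[OF v] CK unfolding 0 E'0 by auto
  next
    case (Suc j) then show ?thesis using kerS'[OF v] unfolding Suc E'S by simp
  qed
  have "PR ?B (k - 1) E' e' (\<lambda>i. d (Suc i))"
    unfolding PR_def
  proof (intro conjI allI ballI impI)
    show "INJ ?B (E' i)" for i by (rule E'inj)
    show "lin (E' i) (E' (Suc i)) (d (Suc i))" for i by (rule E'lin)
    show "e' \<in> carrier (E' 0)" using e' by (simp add: E'0)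
    show "act (E' 0) r e' = \<zero>\<^bsub>E' 0\<^esub> \<longleftrightarrow> r \<in> ?B" for r using ann' by (simp add: E'0 aK zK)
    show "d (Suc 0) v = \<zero>\<^bsub>E' 1\<^esub> \<longleftrightarrow> (\<exists>r. v = act (E' 0) r e')" if "v \<in> carrier (E' 0)" for v
      using ker0'[of v] that by (simp add: E'0 E'S aK zK numeral_2_eq_2)
    show "d (Suc (Suc i)) v = \<zero>\<^bsub>E' (Suc (Suc i))\<^esub> \<longleftrightarrow> (\<exists>u\<in>carrier (E' i). v = d (Suc i) u)"
      if "v \<in> carrier (E' (Suc i))" for i v
      using kerS''[of v i] that by (simp add: E'S zK)
    show "carrier (E' i) = {\<zero>\<^bsub>E' i\<^esub>}" if i: "k - 1 < i" for i
    proof -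
      obtain j where j: "i = Suc j" using i by (cases i) auto
      have "carrier (E (Suc i)) = {\<zero>\<^bsub>E (Suc i)\<^esub>}" using bound[of "Suc i"] i by simp
      then have "carrier (K (Suc i)) = {\<zero>\<^bsub>E (Suc i)\<^esub>}" using cK[of _ "Suc i"] act_zero[OF M] by auto
      then show ?thesis by (simp add: j E'S zK)
    qed
  qed
  then show ?thesis by blast
qed

text \<open>Length zero makes S/B injective over itself, hence divisible by regular elements, and
  dividing 1 by y gives a.\<close>

lemma PR_0:
  assumes PR: "PR B 0 E e d" and B: "idl B" and n: "\<And>r. p r = \<zero>\<^bsub>R\<^esub> \<Longrightarrow> r \<in> B" and y: "nzd B y"
  shows "\<exists>a. 1 - y * a \<in> B"
proof -
  have E: "INJ B (E 0)" and e: "e \<in> carrier (E 0)" and d: "lin (E 0) (E 1) (d 0)"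
    and ann: "\<And>r. act (E 0) r e = \<zero>\<^bsub>E 0\<^esub> \<longleftrightarrow> r \<in> B"
    and ker0: "\<And>v. v \<in> carrier (E 0) \<Longrightarrow> d 0 v = \<zero>\<^bsub>E 1\<^esub> \<longleftrightarrow> (\<exists>r. v = act (E 0) r e)"
    and bound: "carrier (E 1) = {\<zero>\<^bsub>E 1\<^esub>}"
    using PR unfolding PR_def by auto
  have "\<exists>e'\<in>carrier (E 0). act (E 0) y e' = e"
    by (rule divisible[OF E B n e]) (use ann y nzd_def in blast)+
  then obtain e' where e': "e' \<in> carrier (E 0)" "act (E 0) y e' = e" by blast
  note M = INJ_module[OF E]
  have "d 0 e' = \<zero>\<^bsub>E 1\<^esub>" using lin_closed[OF d e'(1)] bound by auto
  then obtain a where a: "e' = act (E 0) a e" using ker0 e' by blast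
  have "act (E 0) (1 - y * a) e = sub (E 0) e (act (E 0) (y * a) e)"
    using act_diff_left[OF M e, of 1 "y * a"] act_1[OF M e] by simp
  also have "\<dots> = \<zero>\<^bsub>E 0\<^esub>" using e' a act_mult[OF M e, of y a] sub_self[OF M e] by simp
  finally show ?thesis using ann by blast
qed

text \<open>The span of V together with the evaluations at elements of C, so that membership is a
  statement modulo evaluations.\<close>

inductive_set espan :: "('a, 'a) module \<Rightarrow> 'a set \<Rightarrow> 'b set \<Rightarrow> ('b \<Rightarrow> 'a) set \<Rightarrow> ('b \<Rightarrow> 'a) set"
  for M C J V where
  base: "f \<in> V \<Longrightarrow> f \<in> espan M C J V"
| mult: "c \<in> C \<Longrightarrow> (\<lambda>a. act M a c) \<in> espan M C J V"
| add: "f \<in> espan M C J V \<Longrightarrow> g \<in> espan M C J V \<Longrightarrow> (\<lambda>a. f a \<oplus>\<^bsub>M\<^esub> g a) \<in> espan M C J V"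
| scale: "f \<in> espan M C J V \<Longrightarrow> (\<lambda>a. act M r (f a)) \<in> espan M C J V"
| congr: "f \<in> espan M C J V \<Longrightarrow> (\<And>a. a \<in> J \<Longrightarrow> g a = f a) \<Longrightarrow> g \<in> espan M C J V"

lemma espan_trans: "f \<in> espan M C J V \<Longrightarrow> V \<subseteq> espan M C J W \<Longrightarrow> f \<in> espan M C J W"
  by (induction rule: espan.induct) (auto intro: espan.intros)

lemma espan_mono: "V \<subseteq> W \<Longrightarrow> f \<in> espan M C J V \<Longrightarrow> f \<in> espan M C J W"
  using espan_trans[of f M C J V W] espan.base by blast

lemma espan_lift:
  assumes "K' \<subseteq> J" "f \<in> espan M C K' V"
  shows "\<exists>f'\<in>espan M C J V. \<forall>a\<in>K'. f' a = f a"
  using assms(2)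
proof induction
  case (base f) show ?case by (rule bexI[OF _ espan.base[OF base]]) simp
next
  case (mult c) show ?case by (rule bexI[OF _ espan.mult[OF mult]]) simp
next
  case (add f g)
  then obtain f' g' where "f' \<in> espan M C J V" "g' \<in> espan M C J V" "\<forall>a\<in>K'. f' a = f a" "\<forall>a\<in>K'. g' a = g a" by blast
  then show ?case by (intro bexI[of _ "\<lambda>a. f' a \<oplus>\<^bsub>M\<^esub> g' a"]) (auto intro: espan.add)
next
  case (scale f r)
  then obtain f' where "f' \<in> espan M C J V" "\<forall>a\<in>K'. f' a = f a" by blast
  then show ?case by (intro bexI[of _ "\<lambda>a. act M r (f' a)"]) (auto intro: espan.scale)
next
  case (congr f g) then show ?case by auto
qed

lemma hm_add:
  assumes M: "module R M" and C: "subm R M C" and f: "hm B M J C f" and g: "hm B M J C g"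
  shows "hm B M J C (\<lambda>a. f a \<oplus>\<^bsub>M\<^esub> g a)"
  unfolding hm_def
proof (intro conjI ballI allI)
  have fg: "f a \<in> carrier M" "g a \<in> carrier M" if "a \<in> J" for a using f g C that by (auto simp: hm_def subm_def)
  show "f a \<oplus>\<^bsub>M\<^esub> g a \<in> C" if "a \<in> J" for a using f g C that by (auto simp: hm_def subm_def)
  show "f (a + b) \<oplus>\<^bsub>M\<^esub> g (a + b) = (f a \<oplus>\<^bsub>M\<^esub> g a) \<oplus>\<^bsub>M\<^esub> (f b \<oplus>\<^bsub>M\<^esub> g b)" if ab: "a \<in> J" "b \<in> J" for a b
    using f g ab fg[OF ab(1)] fg[OF ab(2)] by (simp add: hm_def mod_assoc[OF M] mod_lcomm[OF M] mod_add_closed[OF M])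
  show "f (r * a) \<oplus>\<^bsub>M\<^esub> g (r * a) = act M r (f a \<oplus>\<^bsub>M\<^esub> g a)" if a: "a \<in> J" for r a
    using f g a fg[OF a] by (simp add: hm_def act_add[OF M])
  show "f b \<oplus>\<^bsub>M\<^esub> g b = \<zero>\<^bsub>M\<^esub>" if "b \<in> B" for b using f g that by (simp add: hm_def mod_l_zero[OF M] mod_zero[OF M])
qed

lemma hm_scale:
  assumes M: "module R M" and C: "subm R M C" and f: "hm B M J C f"
  shows "hm B M J C (\<lambda>a. act M r (f a))"
proof -
  have "f a \<in> carrier M" if "a \<in> J" for a using f C that by (auto simp: hm_def subm_def)
  then show ?thesis using f subm_act[OF C] unfolding hm_def
    by (auto simp: act_add[OF M] act_swap[OF M, of _ r] act_zero[OF M])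
qed

lemma hm_mult:
  assumes M: "module R M" and C: "subm R M C" and c: "c \<in> C" and B: "\<And>b x. b \<in> B \<Longrightarrow> x \<in> carrier M \<Longrightarrow> act M b x = \<zero>\<^bsub>M\<^esub>"
  shows "hm B M J C (\<lambda>a. act M a c)"
proof -
  have "c \<in> carrier M" using c C by (auto simp: subm_def)
  then show ?thesis using subm_act[OF C c] B unfolding hm_def by (simp add: act_add_left[OF M] act_mult[OF M])
qed

lemma hm_cong:
  assumes f: "hm B M J C f" and J: "idl J" "B \<subseteq> J" and g: "\<And>a. a \<in> J \<Longrightarrow> g a = f a"
  shows "hm B M J C g"
  using f g J unfolding hm_def by (auto simp: idl_add idl_mult subset_iff)

lemma espan_hm:
  assumes M: "module R M" and C: "subm R M C" and B: "\<And>b x. b \<in> B \<Longrightarrow> x \<in> carrier M \<Longrightarrow> act M b x = \<zero>\<^bsub>M\<^esub>"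
    and J: "idl J" "B \<subseteq> J" and V: "\<And>f. f \<in> V \<Longrightarrow> hm B M J C f" and f: "f \<in> espan M C J V"
  shows "hm B M J C f"
  using f
proof induction
  case (base f) then show ?case using V by blast
next
  case (mult c) show ?case by (rule hm_mult[OF M C mult B])
next
  case (add f g) show ?case by (rule hm_add[OF M C add.IH])
next
  case (scale f r) show ?case by (rule hm_scale[OF M C scale.IH])
next
  case (congr f g) show ?case by (rule hm_cong[OF congr.IH J]) (rule congr.hyps(2))
qed

lemma hm_sub: "hm B M J C f \<Longrightarrow> K' \<subseteq> J \<Longrightarrow> hm B M K' C f"
  unfolding hm_def by blast

lemma hm_adj:
  assumes M: "module R M" and C: "subm R M C" and f: "hm B M (adj K' z) C f" and K': "idl K'"
    and 0: "\<And>a. a \<in> K' \<Longrightarrow> f a = \<zero>\<^bsub>M\<^esub>" and k: "k \<in> K'"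
  shows "f (k + z * r) = act M r (f z)"
proof -
  have z: "z \<in> adj K' z" by (rule adj_self[OF K'])
  then have fz: "f z \<in> carrier M" using f C by (auto simp: hm_def subm_def)
  have "r * z \<in> adj K' z" "k \<in> adj K' z" using z k sub_adj idl_mult[OF idl_adj[OF K']] by blast+
  then have "f (k + r * z) = f k \<oplus>\<^bsub>M\<^esub> f (r * z)" "f (r * z) = act M r (f z)"
    using f z by (auto simp: hm_def)
  then show ?thesis using 0[OF k] by (simp add: mult.commute mod_l_zero[OF M] act_closed[OF M fz])
qed

end

section \<open>Self-injectivity at associated primes from a finite injective resolution\<close>

locale resol = present R p + nring n
  for R :: "('a, 'm) ring_scheme" and p :: "'b::comm_ring_1 \<Rightarrow> 'a" and n :: "'b set" +
  fixes B :: "'b set" and k :: nat and E :: "nat \<Rightarrow> ('a, 'a) module" and e :: 'a and d :: "nat \<Rightarrow> 'a \<Rightarrow> 'a"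
  assumes ker_p: "p r = \<zero>\<^bsub>R\<^esub> \<longleftrightarrow> r \<in> n" and PR: "PR B k E e d" and idl_B: "idl B" and n_B: "n \<subseteq> B"
begin

lemma E_inj: "INJ B (E i)" and d_lin: "lin (E i) (E (Suc i)) (d i)" and e_E: "e \<in> carrier (E 0)"
  and ann: "act (E 0) r e = \<zero>\<^bsub>E 0\<^esub> \<longleftrightarrow> r \<in> B"
  and ker0: "v \<in> carrier (E 0) \<Longrightarrow> d 0 v = \<zero>\<^bsub>E 1\<^esub> \<longleftrightarrow> (\<exists>r. v = act (E 0) r e)"
  and kerS: "v \<in> carrier (E (Suc i)) \<Longrightarrow> d (Suc i) v = \<zero>\<^bsub>E (Suc (Suc i))\<^esub> \<longleftrightarrow> (\<exists>u\<in>carrier (E i). v = d i u)"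
  and bound: "i > k \<Longrightarrow> carrier (E i) = {\<zero>\<^bsub>E i\<^esub>}"
  using PR unfolding PR_def by blast+

lemma E_mod: "module R (E i)"
  by (rule INJ_module[OF E_inj])

lemma E_kill: "b \<in> B \<Longrightarrow> x \<in> carrier (E i) \<Longrightarrow> act (E i) b x = \<zero>\<^bsub>E i\<^esub>"
  by (rule INJ_kill[OF E_inj])

definition ker_d :: "nat \<Rightarrow> 'a set" where
  "ker_d i = {v \<in> carrier (E i). d i v = \<zero>\<^bsub>E (Suc i)\<^esub>}"

lemma ker_d_subm: "subm R (E i) (ker_d i)"
  unfolding ker_d_def by (rule subm_kernel[OF E_mod E_mod d_lin])

lemma ker_d_carrier: "x \<in> ker_d i \<Longrightarrow> x \<in> carrier (E i)"
  by (simp add: ker_d_def)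

lemma ker_d_0: "ker_d 0 = range (\<lambda>r. act (E 0) r e)"
  using ker0 act_closed[OF E_mod e_E] by (auto simp: ker_d_def)

lemma ker_d_Suc: "ker_d (Suc i) = d i ` carrier (E i)"
  using kerS lin_closed[OF d_lin] by (auto simp: ker_d_def)

lemma baer_E:
  assumes "idl J" "B \<subseteq> J" "hm B (E i) J (carrier (E i)) \<phi>"
  shows "\<exists>x\<in>carrier (E i). \<forall>a\<in>J. \<phi> a = act (E i) a x"
  by (rule baer[OF E_inj assms(1) idl_B assms(2) _ assms(3)]) (use ker_p n_B in blast)

lemma hm_carrier: "hm B (E i) J (ker_d i) \<phi> \<Longrightarrow> hm B (E i) J (carrier (E i)) \<phi>"
  using ker_d_carrier unfolding hm_def by blast

lemma extend_zero:
  assumes K': "idl K'" "B \<subseteq> K'" and t: "t \<in> carrier (E i)" "\<And>r. r * z \<in> K' \<Longrightarrow> act (E i) r t = \<zero>\<^bsub>E i\<^esub>"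
  shows "\<exists>x\<in>carrier (E i). (\<forall>a\<in>K'. act (E i) a x = \<zero>\<^bsub>E i\<^esub>) \<and> act (E i) z x = t"
proof -
  note M = E_mod[of i]
  have "\<exists>g. hm B (E i) (adj K' z) (carrier (E i)) g \<and> (\<forall>a\<in>K'. g a = \<zero>\<^bsub>E i\<^esub>) \<and> g z = t"
    by (rule hm_extend[OF M subm_carrier[OF M] K' hm_zero[OF M subm_carrier[OF M]] t(1)]) (use t(2) in simp)
  then obtain g where g: "hm B (E i) (adj K' z) (carrier (E i)) g" "\<forall>a\<in>K'. g a = \<zero>\<^bsub>E i\<^esub>" "g z = t" by blast
  then obtain x where x: "x \<in> carrier (E i)" "\<forall>a\<in>adj K' z. g a = act (E i) a x"
    using baer_E[of "adj K' z" i] K' sub_adj[of K' z] by blast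
  then show ?thesis using g adj_self[OF K'(1), of z] sub_adj[of K' z] by (metis subsetD)
qed

text \<open>\<open>hom_stable j\<close> says that \<open>Ext\<^sup>1(S/J, ker d\<^sub>j)\<close>, which is \<open>Hom(J, ker d\<^sub>j)\<close> modulo the evaluations at elements of \<open>ker d\<^sub>j\<close>,
  is Noetherian; \<open>cyclic_stable\<close> is the corresponding statement for one step of a cyclic filtration of \<open>J\<close>. Both go up in \<open>j\<close> by dimension shifting.\<close>

definition hom_stable :: "nat \<Rightarrow> bool" where
  "hom_stable j \<longleftrightarrow> (\<forall>ks \<phi>. (\<forall>i::nat. hm B (E j) (gen B ks) (ker_d j) (\<phi> i)) \<longrightarrow>
     (\<exists>l. \<phi> l \<in> espan (E j) (ker_d j) (gen B ks) (\<phi> ` {..<l})))"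

definition cyclic_stable :: "nat \<Rightarrow> bool" where
  "cyclic_stable j \<longleftrightarrow> (\<forall>K' z w. idl K' \<longrightarrow> B \<subseteq> K' \<longrightarrow> (\<forall>i::nat. hm B (E j) (adj K' z) (ker_d j) (w i) \<and> (\<forall>a\<in>K'. w i a = \<zero>\<^bsub>E j\<^esub>)) \<longrightarrow>
     (\<exists>l. w l \<in> espan (E j) (ker_d j) (adj K' z) (w ` {..<l})))"

lemma hm_eq_adj:
  assumes f: "hm B (E j) (adj K' z) (ker_d j) f" "\<And>a. a \<in> K' \<Longrightarrow> f a = \<zero>\<^bsub>E j\<^esub>"
    and g: "hm B (E j) (adj K' z) (ker_d j) g" "\<And>a. a \<in> K' \<Longrightarrow> g a = \<zero>\<^bsub>E j\<^esub>"
    and K': "idl K'" and eq: "f z = g z" and a: "a \<in> adj K' z"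
  shows "f a = g a"
proof -
  obtain c r where "a = c + z * r" "c \<in> K'" using a adjE by blast
  then show ?thesis
    using hm_adj[OF E_mod ker_d_subm f(1) K' f(2), of c r] hm_adj[OF E_mod ker_d_subm g(1) K' g(2), of c r] eq by simp
qed

text \<open>Since ker d_0 = S e, a map vanishing on K' is given by the coefficient r of its value r
  e at z, and \<open>seqN\<close> applies to these coefficients.\<close>

lemma cyclic_stable_0: "cyclic_stable 0"
  unfolding cyclic_stable_def
proof (intro allI impI)
  fix K' z and w :: "nat \<Rightarrow> 'b \<Rightarrow> 'a"
  assume K': "idl K'" "B \<subseteq> K'" and w: "\<forall>i. hm B (E 0) (adj K' z) (ker_d 0) (w i) \<and> (\<forall>a\<in>K'. w i a = \<zero>\<^bsub>E 0\<^esub>)"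
  note M = E_mod[of 0]
  let ?J = "adj K' z"
  have z: "z \<in> ?J" by (rule adj_self[OF K'(1)])
  have "\<forall>i. \<exists>r. w i z = act (E 0) r e" using w z ker_d_0 unfolding hm_def by blast
  then obtain r where r: "\<And>i. w i z = act (E 0) (r i) e" by metis
  have "\<exists>g\<in>espan (E 0) (ker_d 0) ?J (w ` {..<l}). (\<forall>a\<in>K'. g a = \<zero>\<^bsub>E 0\<^esub>) \<and> g z = act (E 0) x e"
    if "x \<in> gen B (map r [0..<l])" for x l
    using that
  proof (induction l arbitrary: x)
    case 0
    have "\<zero>\<^bsub>E 0\<^esub> \<in> ker_d 0" using ker_d_subm by (simp add: subm_def)
    then have "(\<lambda>a. act (E 0) a \<zero>\<^bsub>E 0\<^esub>) \<in> espan (E 0) (ker_d 0) ?J (w ` {..<0})" by (rule espan.mult)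
    moreover have "act (E 0) x e = \<zero>\<^bsub>E 0\<^esub>" using 0 ann by simp
    ultimately show ?case by (metis (no_types, lifting) act_zero[OF M])
  next
    case (Suc l)
    have "x \<in> adj (gen B (map r [0..<l])) (r l)" using Suc.prems by (simp add: gen_append)
    then obtain x1 s where x1: "x = x1 + r l * s" "x1 \<in> gen B (map r [0..<l])" using adjE by blast
    obtain g where g: "g \<in> espan (E 0) (ker_d 0) ?J (w ` {..<l})" "\<forall>a\<in>K'. g a = \<zero>\<^bsub>E 0\<^esub>" "g z = act (E 0) x1 e"
      using Suc.IH[OF x1(2)] by blast
    have "g \<in> espan (E 0) (ker_d 0) ?J (w ` {..<Suc l})" by (rule espan_mono[OF _ g(1)]) auto
    moreover have "w l \<in> espan (E 0) (ker_d 0) ?J (w ` {..<Suc l})" by (rule espan.base) auto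
    ultimately have 1: "(\<lambda>a. g a \<oplus>\<^bsub>E 0\<^esub> act (E 0) s (w l a)) \<in> espan (E 0) (ker_d 0) ?J (w ` {..<Suc l})"
      by (rule espan.add[OF _ espan.scale])
    have 2: "g a \<oplus>\<^bsub>E 0\<^esub> act (E 0) s (w l a) = \<zero>\<^bsub>E 0\<^esub>" if "a \<in> K'" for a
      using g(2) w that by (simp add: act_zero[OF M] mod_l_zero[OF M] mod_zero[OF M])
    have 3: "g z \<oplus>\<^bsub>E 0\<^esub> act (E 0) s (w l z) = act (E 0) x e"
    proof -
      have "x = x1 + s * r l" using x1(1) by (simp add: mult.commute)
      then show ?thesis using g(3) r[of l] act_add_left[OF M e_E, of x1 "s * r l"] act_mult[OF M e_E, of s "r l"] by simp
    qed
    show ?case by (rule bexI[OF _ 1]) (use 2 3 in blast)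
  qed
  note span = this
  obtain l where l: "r l \<in> gen B (map r [0..<l])" using seqN[OF idl_B n_B] by blast
  obtain g where g: "g \<in> espan (E 0) (ker_d 0) ?J (w ` {..<l})" "\<forall>a\<in>K'. g a = \<zero>\<^bsub>E 0\<^esub>" "g z = w l z"
    using span[OF l] r by metis
  have J: "idl ?J" "B \<subseteq> ?J" using K' sub_adj[of K' z] by auto
  have gh: "hm B (E 0) ?J (ker_d 0) g" by (rule espan_hm[OF M ker_d_subm E_kill J _ g(1)]) (use w in auto)
  have "w l a = g a" if "a \<in> ?J" for a
    by (rule hm_eq_adj[OF _ _ gh _ K'(1) _ that]) (use w g in auto)
  then show "\<exists>l. w l \<in> espan (E 0) (ker_d 0) ?J (w ` {..<l})" using espan.congr[OF g(1)] by blast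
qed

text \<open>Write w_i(z) = d x_i. The maps r \<mapsto> r x_i send (K' : z) into ker d_j, where
  \<open>hom_stable\<close> applies; the relation found there is carried back to the w_i, up to an
  evaluation.\<close>

lemma cyclic_stable_Suc:
  assumes hom_stable: "hom_stable j" shows "cyclic_stable (Suc j)"
  unfolding cyclic_stable_def
proof (intro allI impI)
  fix K' z and w :: "nat \<Rightarrow> 'b \<Rightarrow> 'a"
  assume K': "idl K'" "B \<subseteq> K'"
    and w: "\<forall>i. hm B (E (Suc j)) (adj K' z) (ker_d (Suc j)) (w i) \<and> (\<forall>a\<in>K'. w i a = \<zero>\<^bsub>E (Suc j)\<^esub>)"
  note M = E_mod[of j] and MS = E_mod[of "Suc j"]
  let ?J = "adj K' z" and ?F = "E (Suc j)" and ?D = "ker_d (Suc j)"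
  have z: "z \<in> ?J" by (rule adj_self[OF K'(1)])
  have J: "idl ?J" "B \<subseteq> ?J" using K' sub_adj[of K' z] by auto
  have "\<forall>i. \<exists>x. x \<in> carrier (E j) \<and> w i z = d j x" using w z ker_d_Suc unfolding hm_def by blast
  then obtain x where x: "\<And>i. x i \<in> carrier (E j)" "\<And>i. w i z = d j (x i)" by metis
  define Q where "Q = quo K' z"
  have Q: "idl Q" "B \<subseteq> Q" using K' quo_sub[OF K'(1), of z] by (auto simp: Q_def)
  obtain ks where ks: "Q = gen B ks" using fg[OF Q(1) idl_B n_B Q(2)] by blast
  define \<psi> where "\<psi> i r = act (E j) r (x i)" for i r
  have \<psi>: "hm B (E j) Q (ker_d j) (\<psi> i)" for i
    unfolding hm_def
  proof (intro conjI ballI allI)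
    show "\<psi> i a \<in> ker_d j" if a: "a \<in> Q" for a
    proof -
      have "a * z \<in> K'" using a by (simp add: Q_def quo_def)
      then have "w i (a * z) = \<zero>\<^bsub>?F\<^esub>" using w by blast
      moreover have "w i (a * z) = act ?F a (w i z)" using w z by (simp add: hm_def)
      ultimately have "d j (\<psi> i a) = \<zero>\<^bsub>?F\<^esub>" using x lin_act[OF d_lin x(1)] by (simp add: \<psi>_def)
      then show ?thesis by (simp add: ker_d_def \<psi>_def act_closed[OF M x(1)])
    qed
  qed (auto simp: \<psi>_def act_add_left[OF M x(1)] act_mult[OF M x(1)] E_kill x(1))
  then obtain l where l: "\<psi> l \<in> espan (E j) (ker_d j) Q (\<psi> ` {..<l})" using hom_stable ks unfolding hom_stable_def by blast
  have "\<exists>y\<in>carrier (E j). \<exists>g\<in>espan ?F ?D ?J (w ` {..<l}). (\<forall>r\<in>Q. f r = act (E j) r y) \<and> g z = d j y \<and> (\<forall>a\<in>K'. g a = \<zero>\<^bsub>?F\<^esub>)"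
    if "f \<in> espan (E j) (ker_d j) Q (\<psi> ` {..<l})" for f
    using that
  proof induction
    case (base f)
    then obtain i where i: "i < l" "f = \<psi> i" by auto
    have "w i \<in> espan ?F ?D ?J (w ` {..<l})" by (rule espan.base) (use i in auto)
    then show ?case using x w i \<psi>_def by (intro bexI[of _ "x i"] bexI[of _ "w i"]) auto
  next
    case (mult c)
    have "\<zero>\<^bsub>?F\<^esub> \<in> ?D" using ker_d_subm by (simp add: subm_def)
    then have "(\<lambda>a. act ?F a \<zero>\<^bsub>?F\<^esub>) \<in> espan ?F ?D ?J (w ` {..<l})" by (rule espan.mult)
    moreover have "c \<in> carrier (E j)" "d j c = \<zero>\<^bsub>?F\<^esub>" using mult by (auto simp: ker_d_def)
    moreover have "act ?F a \<zero>\<^bsub>?F\<^esub> = \<zero>\<^bsub>?F\<^esub>" for a by (rule act_zero[OF MS])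
    ultimately show ?case by (intro bexI[of _ c] bexI[of _ "\<lambda>a. act ?F a \<zero>\<^bsub>?F\<^esub>"]) simp_all
  next
    case (add f f')
    then obtain y g y' g' where *: "y \<in> carrier (E j)" "g \<in> espan ?F ?D ?J (w ` {..<l})" "\<forall>r\<in>Q. f r = act (E j) r y" "g z = d j y"
      "\<forall>a\<in>K'. g a = \<zero>\<^bsub>?F\<^esub>" "y' \<in> carrier (E j)" "g' \<in> espan ?F ?D ?J (w ` {..<l})" "\<forall>r\<in>Q. f' r = act (E j) r y'" "g' z = d j y'"
      "\<forall>a\<in>K'. g' a = \<zero>\<^bsub>?F\<^esub>" by blast
    have "(\<lambda>a. g a \<oplus>\<^bsub>?F\<^esub> g' a) \<in> espan ?F ?D ?J (w ` {..<l})" using * espan.add by blast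
    moreover have "y \<oplus>\<^bsub>E j\<^esub> y' \<in> carrier (E j)" using * mod_add_closed[OF M] by blast
    ultimately show ?case using *
      by (intro bexI[of _ "y \<oplus>\<^bsub>E j\<^esub> y'"] bexI[of _ "\<lambda>a. g a \<oplus>\<^bsub>?F\<^esub> g' a"])
        (auto simp: act_add[OF M] lin_add[OF d_lin] mod_l_zero[OF MS] mod_zero[OF MS])
  next
    case (scale f r)
    then obtain y g where *: "y \<in> carrier (E j)" "g \<in> espan ?F ?D ?J (w ` {..<l})" "\<forall>r\<in>Q. f r = act (E j) r y" "g z = d j y"
      "\<forall>a\<in>K'. g a = \<zero>\<^bsub>?F\<^esub>" by blast
    have "(\<lambda>a. act ?F r (g a)) \<in> espan ?F ?D ?J (w ` {..<l})" using * espan.scale by blast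
    moreover have "act (E j) r y \<in> carrier (E j)" using * act_closed[OF M] by blast
    ultimately show ?case using *
      by (intro bexI[of _ "act (E j) r y"] bexI[of _ "\<lambda>a. act ?F r (g a)"])
        (auto simp: act_swap[OF M, of _ r] lin_act[OF d_lin] act_zero[OF MS])
  next
    case (congr f f') then show ?case by auto
  qed
  then obtain y g where y: "y \<in> carrier (E j)" and g: "g \<in> espan ?F ?D ?J (w ` {..<l})" "g z = d j y" "\<And>a. a \<in> K' \<Longrightarrow> g a = \<zero>\<^bsub>?F\<^esub>"
    and yx: "\<forall>r\<in>Q. \<psi> l r = act (E j) r y" using l by blast
  \<comment> \<open>The relation holds on (K' : z), so t is killed there and equals z s for some s
    killed by K'. Adding the evaluation at d s changes the value at z from d y to d x_l.\<close>
  let ?t = "sub (E j) (x l) y"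
  have t: "?t \<in> carrier (E j)" by (rule sub_closed[OF M x(1) y])
  have "act (E j) r ?t = \<zero>\<^bsub>E j\<^esub>" if "r * z \<in> K'" for r
  proof -
    have "r \<in> Q" using that by (simp add: Q_def quo_def)
    then show ?thesis using yx act_sub[OF M x(1) y] sub_self[OF M act_closed[OF M y]] by (simp add: \<psi>_def)
  qed
  then obtain s where s: "s \<in> carrier (E j)" "\<forall>a\<in>K'. act (E j) a s = \<zero>\<^bsub>E j\<^esub>" "act (E j) z s = ?t"
    using extend_zero[OF K' t] by blast
  have dsE: "d j s \<in> ?D" using s(1) ker_d_Suc by blast
  have ds: "d j s \<in> carrier ?F" by (rule lin_closed[OF d_lin s(1)])
  let ?g = "\<lambda>a. g a \<oplus>\<^bsub>?F\<^esub> act ?F a (d j s)"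
  have g': "?g \<in> espan ?F ?D ?J (w ` {..<l})" by (rule espan.add[OF g(1) espan.mult[OF dsE]])
  have gh: "hm B ?F ?J ?D ?g" by (rule espan_hm[OF MS ker_d_subm E_kill J _ g']) (use w in auto)
  have g'0: "?g a = \<zero>\<^bsub>?F\<^esub>" if "a \<in> K'" for a
  proof -
    have "act ?F a (d j s) = d j (act (E j) a s)" using lin_act[OF d_lin s(1), of a] by simp
    also have "\<dots> = \<zero>\<^bsub>?F\<^esub>" using s(2) that lin_zero[OF M MS d_lin] by simp
    finally show ?thesis using g(3)[OF that] mod_l_zero[OF MS mod_zero[OF MS]] by simp
  qed
  have g'z: "?g z = w l z"
  proof -
    have "act ?F z (d j s) = sub ?F (d j (x l)) (d j y)" using lin_act[OF d_lin s(1), of z] s(3) lin_sub[OF M d_lin x(1) y] by simp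
    then have "?g z = sub ?F (d j (x l)) (d j y) \<oplus>\<^bsub>?F\<^esub> d j y"
      using g(2) mod_comm[OF MS lin_closed[OF d_lin y] act_closed[OF MS ds, of z]] by simp
    then show ?thesis using sub_add[OF MS lin_closed[OF d_lin x(1)] lin_closed[OF d_lin y]] x(2) by simp
  qed
  have "w l a = ?g a" if "a \<in> ?J" for a
    by (rule hm_eq_adj[where f = "w l" and g = ?g, OF _ _ gh g'0 K'(1) g'z[symmetric] that]) (use w in auto)
  then show "\<exists>l. w l \<in> espan ?F ?D ?J (w ` {..<l})" using espan.congr[OF g'] by blast
qed

text \<open>Induction on the generators of J as in \<open>mhom_seqN\<close>: subtracting from \<phi>
  a combination that agrees with it on K' leaves a map vanishing on K', the case of
  \<open>cyclic_stable\<close>.\<close>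

lemma hom_stable_cyclic:
  assumes cyclic_stable: "cyclic_stable j" shows "hom_stable j"
  unfolding hom_stable_def
proof (intro allI impI)
  fix ks and \<phi> :: "nat \<Rightarrow> 'b \<Rightarrow> 'a"
  assume "\<forall>i. hm B (E j) (gen B ks) (ker_d j) (\<phi> i)"
  then show "\<exists>l. \<phi> l \<in> espan (E j) (ker_d j) (gen B ks) (\<phi> ` {..<l})"
  proof (induction ks arbitrary: \<phi> rule: rev_induct)
    case Nil
    have 0: "\<zero>\<^bsub>E j\<^esub> \<in> ker_d j" using ker_d_subm by (simp add: subm_def)
    have "\<phi> 0 \<in> espan (E j) (ker_d j) (gen B []) (\<phi> ` {..<0})"
      by (rule espan.congr[OF espan.mult[OF 0]]) (use Nil act_zero[OF E_mod] in \<open>auto simp: hm_def\<close>)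
    then show ?case by blast
  next
    case (snoc z ks)
    note M = E_mod[of j]
    define K' K where "K' = gen B ks" and "K = adj K' z"
    let ?sp = "espan (E j) (ker_d j)"
    have K': "idl K'" "B \<subseteq> K'" "idl K" "B \<subseteq> K" "K' \<subseteq> K" "z \<in> K"
      using idl_B sub_gen[of B ks] sub_adj[of K' z] adj_self[of K' z] by (auto simp: K'_def K_def)
    have \<phi>: "\<And>i. hm B (E j) K (ker_d j) (\<phi> i)" using snoc.prems by (simp add: K_def K'_def gen_append)
    define Q where "Q N l w \<longleftrightarrow> N \<le> l \<and> hm B (E j) K (ker_d j) w \<and> (\<forall>x\<in>K'. w x = \<zero>\<^bsub>E j\<^esub>) \<and> w \<in> ?sp K (\<phi> ` {..l})
      \<and> (\<exists>f\<in>?sp K (\<phi> ` {..<l}). \<forall>x\<in>K. \<phi> l x = f x \<oplus>\<^bsub>E j\<^esub> w x)" for N :: nat and l w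
    have "\<exists>l w. Q N l w" for N
    proof -
      have "\<forall>i. hm B (E j) (gen B ks) (ker_d j) (\<phi> (N + i))" using hm_sub[OF \<phi> K'(5)] K'_def by blast
      then obtain l where "\<phi> (N + l) \<in> ?sp K' ((\<lambda>i. \<phi> (N + i)) ` {..<l})"
        using snoc.IH[of "\<lambda>i. \<phi> (N + i)"] K'_def by blast
      then have "\<phi> (N + l) \<in> ?sp K' (\<phi> ` {..<N + l})"
        by (rule espan_mono[rotated]) auto
      then obtain f where f: "f \<in> ?sp K (\<phi> ` {..<N + l})" "\<forall>x\<in>K'. f x = \<phi> (N + l) x"
        using espan_lift[OF K'(5)] by blast
      define w where "w x = \<phi> (N + l) x \<oplus>\<^bsub>E j\<^esub> act (E j) (-1) (f x)" for x
      have fm: "hm B (E j) K (ker_d j) f" by (rule espan_hm[OF M ker_d_subm E_kill K'(3,4) _ f(1)]) (use \<phi> in auto)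
      have \<phi>E: "\<phi> i x \<in> carrier (E j)" "f x \<in> carrier (E j)" if "x \<in> K" for i x
        using \<phi> fm ker_d_carrier that by (auto simp: hm_def)
      have "hm B (E j) K (ker_d j) w" unfolding w_def by (rule hm_add[OF M ker_d_subm \<phi> hm_scale[OF M ker_d_subm fm]])
      moreover have "\<forall>x\<in>K'. w x = \<zero>\<^bsub>E j\<^esub>"
      proof
        fix x assume x: "x \<in> K'"
        then have "w x = sub (E j) (f x) (f x)" using f(2) by (simp add: w_def sub_def)
        then show "w x = \<zero>\<^bsub>E j\<^esub>" using sub_self[OF M \<phi>E(2)] x K'(5) by auto
      qed
      moreover have "w \<in> ?sp K (\<phi> ` {..N + l})" unfolding w_def
      proof (rule espan.add[OF espan.base espan.scale])
        show "f \<in> ?sp K (\<phi> ` {..N + l})" by (rule espan_mono[OF _ f(1)]) auto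
      qed auto
      moreover have "\<phi> (N + l) x = f x \<oplus>\<^bsub>E j\<^esub> w x" if "x \<in> K" for x
      proof -
        have "w x = sub (E j) (\<phi> (N + l) x) (f x)" by (simp add: w_def sub_def)
        then show ?thesis
          using sub_add[OF M \<phi>E[OF that]] mod_comm[OF M] \<phi>E[OF that] sub_closed[OF M \<phi>E[OF that]] by metis
      qed
      ultimately have "Q N (N + l) w" unfolding Q_def using f(1) by (simp add: Bex_def) blast
      then show ?thesis by blast
    qed
    then obtain kk ww where Q: "\<And>N. Q N (kk N) (ww N)" by metis
    define N where "N i = ((\<lambda>N. Suc (kk N)) ^^ i) 0" for i
    have N_Suc: "N (Suc i) = Suc (kk (N i))" for i by (simp add: N_def)
    have kk: "M \<le> kk M" for M using Q unfolding Q_def by blast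
    have N_mono: "Suc (kk (N i)) \<le> N j" if "i < j" for i j
      using that
    proof (induction j)
      case (Suc j)
      then show ?case using N_Suc[of j] kk[of "N j"] N_Suc[of i] by (cases "i = j") auto
    qed simp
    have "\<forall>i. hm B (E j) K (ker_d j) (ww (N i)) \<and> (\<forall>a\<in>K'. ww (N i) a = \<zero>\<^bsub>E j\<^esub>)" using Q unfolding Q_def by blast
    then obtain i where i: "ww (N i) \<in> ?sp K ((\<lambda>i. ww (N i)) ` {..<i})"
      using cyclic_stable[unfolded cyclic_stable_def, rule_format, of K' z "\<lambda>i. ww (N i)"] K' K_def by auto
    have "(\<lambda>j. ww (N j)) ` {..<i} \<subseteq> ?sp K (\<phi> ` {..<kk (N i)})"
    proof
      fix f assume "f \<in> (\<lambda>j. ww (N j)) ` {..<i}"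
      then obtain l where l: "f = ww (N l)" "l < i" by blast
      have "kk (N l) < kk (N i)" using N_mono[OF l(2)] kk[of "N i"] by linarith
      then have "\<phi> ` {..kk (N l)} \<subseteq> \<phi> ` {..<kk (N i)}" by auto
      moreover have "ww (N l) \<in> ?sp K (\<phi> ` {..kk (N l)})" using Q unfolding Q_def by blast
      ultimately show "f \<in> ?sp K (\<phi> ` {..<kk (N i)})" using espan_mono l by blast
    qed
    then have 1: "ww (N i) \<in> ?sp K (\<phi> ` {..<kk (N i)})" using espan_trans[OF i] by blast
    obtain f where f: "f \<in> ?sp K (\<phi> ` {..<kk (N i)})" "\<forall>x\<in>K. \<phi> (kk (N i)) x = f x \<oplus>\<^bsub>E j\<^esub> ww (N i) x"
      using Q[of "N i"] unfolding Q_def by blast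
    have "\<phi> (kk (N i)) \<in> ?sp K (\<phi> ` {..<kk (N i)})"
      by (rule espan.congr[OF espan.add[OF f(1) 1]]) (use f(2) in blast)
    then show ?case by (auto simp: K_def K'_def gen_append)
  qed
qed

lemma hom_stable_all: "hom_stable j"
  by (induction j) (auto intro: hom_stable_cyclic cyclic_stable_0 cyclic_stable_Suc)

text \<open>Vanishing at \<open>Q\<close> of the class of \<open>\<phi>\<close> in \<open>Ext\<^sup>1(S/J, ker d\<^sub>j)\<close>. This is trivial for large \<open>j\<close> and is proved by descending induction on \<open>j\<close>.\<close>

definition locally_eval :: "'b set \<Rightarrow> nat \<Rightarrow> 'b set \<Rightarrow> ('b \<Rightarrow> 'a) \<Rightarrow> bool" where
  "locally_eval Q j J \<phi> \<longleftrightarrow> (\<exists>u. u \<notin> Q \<and> (\<exists>c\<in>ker_d j. \<forall>a\<in>J. act (E j) u (\<phi> a) = act (E j) a c))"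

text \<open>By injectivity \<phi> is evaluation at some x in E_j. Sending q to d x and K to 0 gives
  a map into ker d_(j+1), at Q the evaluation at some d y. So u x - q y lies in ker d_j, and modulo
  evaluations u \<phi> is q times the map a \<mapsto> a y. The two uses are K = J and K = B.\<close>

lemma lift_shift:
  assumes locally_eval: "\<And>J \<phi>. idl J \<Longrightarrow> B \<subseteq> J \<Longrightarrow> hm B (E (Suc j)) J (ker_d (Suc j)) \<phi> \<Longrightarrow> locally_eval Q (Suc j) J \<phi>"
    and J: "idl J" "B \<subseteq> J" and K: "idl K" "B \<subseteq> K" and \<phi>: "hm B (E j) J (ker_d j) \<phi>" and q: "\<And>r. r * q \<in> K \<Longrightarrow> r \<in> J"
  shows "\<exists>u x y. u \<notin> Q \<and> x \<in> carrier (E j) \<and> y \<in> carrier (E j) \<and> (\<forall>a\<in>J. \<phi> a = act (E j) a x) \<and>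
    sub (E j) (act (E j) u x) (act (E j) q y) \<in> ker_d j \<and> (\<forall>a\<in>K. act (E j) a y \<in> ker_d j)"
proof -
  note M = E_mod[of j] and MS = E_mod[of "Suc j"]
  obtain x where x: "x \<in> carrier (E j)" "\<forall>a\<in>J. \<phi> a = act (E j) a x"
    using baer_E[OF J hm_carrier[OF \<phi>]] by blast
  let ?w = "d j x"
  have w: "?w \<in> ker_d (Suc j)" using x(1) ker_d_Suc by blast
  have wE: "?w \<in> carrier (E (Suc j))" by (rule ker_d_carrier[OF w])
  have Jw: "act (E (Suc j)) a ?w = \<zero>\<^bsub>E (Suc j)\<^esub>" if "a \<in> J" for a
  proof -
    have "\<phi> a \<in> ker_d j" using \<phi> that by (simp add: hm_def)
    then show ?thesis using x that lin_act[OF d_lin x(1), of a] by (simp add: ker_d_def)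
  qed
  have "\<exists>g. hm B (E (Suc j)) (adj K q) (ker_d (Suc j)) g \<and> (\<forall>a\<in>K. g a = \<zero>\<^bsub>E (Suc j)\<^esub>) \<and> g q = ?w"
    by (rule hm_extend[OF MS ker_d_subm K hm_zero[OF MS ker_d_subm] w]) (use Jw q in simp)
  then obtain g where g: "hm B (E (Suc j)) (adj K q) (ker_d (Suc j)) g" "\<forall>a\<in>K. g a = \<zero>\<^bsub>E (Suc j)\<^esub>" "g q = ?w" by blast
  have "locally_eval Q (Suc j) (adj K q) g" using locally_eval[OF idl_adj[OF K(1)] _ g(1)] K sub_adj[of K q] by blast
  then obtain u c where u: "u \<notin> Q" and c: "c \<in> ker_d (Suc j)" "\<forall>a\<in>adj K q. act (E (Suc j)) u (g a) = act (E (Suc j)) a c"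
    unfolding locally_eval_def by blast
  obtain y where y: "y \<in> carrier (E j)" "c = d j y" using c(1) ker_d_Suc by blast
  have ux: "act (E j) u x \<in> carrier (E j)" "act (E j) q y \<in> carrier (E j)" by (rule act_closed[OF M x(1)] act_closed[OF M y(1)])+
  have "act (E (Suc j)) u ?w = act (E (Suc j)) q c" using c(2) g(3) adj_self[OF K(1), of q] by auto
  then have "d j (sub (E j) (act (E j) u x) (act (E j) q y)) = \<zero>\<^bsub>E (Suc j)\<^esub>"
    using lin_sub[OF M d_lin ux] lin_act[OF d_lin x(1), of u] lin_act[OF d_lin y(1), of q] y(2)
      sub_self[OF MS act_closed[OF MS ker_d_carrier[OF c(1)]]] by simp
  then have "sub (E j) (act (E j) u x) (act (E j) q y) \<in> ker_d j" using sub_closed[OF M ux] by (simp add: ker_d_def)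
  moreover have "act (E j) a y \<in> ker_d j" if a: "a \<in> K" for a
  proof -
    have "d j (act (E j) a y) = act (E (Suc j)) a c" using lin_act[OF d_lin y(1)] y(2) by simp
    also have "\<dots> = act (E (Suc j)) u (g a)" using c(2) a sub_adj[of K q] by auto
    also have "\<dots> = \<zero>\<^bsub>E (Suc j)\<^esub>" using g(2) a act_zero[OF MS] by simp
    finally show ?thesis using act_closed[OF M y(1)] by (simp add: ker_d_def)
  qed
  ultimately show ?thesis using u x y(1) by blast
qed

text \<open>A maximal counterexample J is a prime inside Q. If J = Q = (B : b), multiplication by b
  embeds S/Q into S/B, and \<open>lift_shift\<close> with K = B settles it, as B kills E_j.
  Otherwise an element q of Q outside J acts surjectively on the classes at Q, and Nakayama,
  available through \<open>hom_stable_all\<close>, makes them vanish.\<close>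

lemma locally_eval_step:
  assumes Q: "prm Q" "Q = quo B b"
    and locally_eval: "\<And>J \<phi>. idl J \<Longrightarrow> B \<subseteq> J \<Longrightarrow> hm B (E (Suc j)) J (ker_d (Suc j)) \<phi> \<Longrightarrow> locally_eval Q (Suc j) J \<phi>"
    and J0: "idl J0" "B \<subseteq> J0" and \<phi>0: "hm B (E j) J0 (ker_d j) \<phi>0"
  shows "locally_eval Q j J0 \<phi>0"
proof (rule ccontr)
  assume bad0: "\<not> locally_eval Q j J0 \<phi>0"
  note M = E_mod[of j]
  let ?F = "{J. idl J \<and> B \<subseteq> J \<and> (\<exists>\<phi>. hm B (E j) J (ker_d j) \<phi> \<and> \<not> locally_eval Q j J \<phi>)}"
  have "\<exists>J\<in>?F. \<forall>J'\<in>?F. J \<subseteq> J' \<longrightarrow> J' = J"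
  proof (rule max_ex)
    show "?F \<noteq> {}" using J0 \<phi>0 bad0 by blast
    show "idl J \<and> n \<subseteq> J" if "J \<in> ?F" for J using that n_B by blast
  qed
  then obtain J where JF: "J \<in> ?F" and max0: "\<forall>J'\<in>?F. J \<subseteq> J' \<longrightarrow> J' = J" by (rule bexE)
  have max: "J' = J" if "idl J'" "B \<subseteq> J'" "hm B (E j) J' (ker_d j) \<psi>" "\<not> locally_eval Q j J' \<psi>" "J \<subseteq> J'" for J' \<psi>
    using bspec[OF max0, of J'] that by blast
  obtain \<phi> where J: "idl J" "B \<subseteq> J" and \<phi>: "hm B (E j) J (ker_d j) \<phi>" and bad: "\<not> locally_eval Q j J \<phi>"
    using JF by blast
  have big: "locally_eval Q j J' \<psi>" if "idl J'" "J \<subseteq> J'" "J' \<noteq> J" "hm B (E j) J' (ker_d j) \<psi>" for J' \<psi>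
    using max[of J' \<psi>] that J(2) by blast
  have \<phi>E: "\<phi> a \<in> carrier (E j)" if "a \<in> J" for a using \<phi> that ker_d_carrier by (auto simp: hm_def)
  \<comment> \<open>Any u in J outside Q makes u \<phi> the evaluation at \<phi>(u).\<close>
  have JQ: "J \<subseteq> Q"
  proof (rule ccontr)
    assume "\<not> J \<subseteq> Q"
    then obtain u where u: "u \<in> J" "u \<notin> Q" by blast
    have "act (E j) u (\<phi> a) = act (E j) a (\<phi> u)" if "a \<in> J" for a
      using \<phi> u that unfolding hm_def by (metis mult.commute)
    then show False using bad u \<phi> unfolding locally_eval_def hm_def by blast
  qed
  have uQ: "u \<notin> Q \<Longrightarrow> v \<notin> Q \<Longrightarrow> u * v \<notin> Q" for u v using Q(1) prm_mult by blast
  \<comment> \<open>S/J is filtered by S/(J : z) and S/(J, z). Both ideals would be strictly larger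
    than J, and their two solutions combine to one for J.\<close>
  have prime: "v \<in> J" if vz: "v * z \<in> J" and z: "z \<notin> J" for v z
  proof (rule ccontr)
    assume v: "v \<notin> J"
    let ?J' = "quo J z"
    define \<psi> where "\<psi> r = \<phi> (r * z)" for r
    have \<psi>: "hm B (E j) ?J' (ker_d j) \<psi>"
      unfolding hm_def
    proof (intro conjI ballI allI)
      show "\<psi> a \<in> ker_d j" if "a \<in> ?J'" for a using \<phi> that by (auto simp: \<psi>_def quo_def hm_def)
      show "\<psi> (a + b) = \<psi> a \<oplus>\<^bsub>E j\<^esub> \<psi> b" if "a \<in> ?J'" "b \<in> ?J'" for a b
        using \<phi> that by (auto simp: \<psi>_def quo_def hm_def distrib_right)
      show "\<psi> (r * a) = act (E j) r (\<psi> a)" if "a \<in> ?J'" for r a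
        using \<phi> that by (auto simp: \<psi>_def quo_def hm_def mult.assoc)
      show "\<psi> c = \<zero>\<^bsub>E j\<^esub>" if "c \<in> B" for c
        using \<phi> idl_mult2[OF idl_B that, of z] by (simp add: \<psi>_def hm_def)
    qed
    have J': "idl ?J'" "J \<subseteq> ?J'" "?J' \<noteq> J"
    proof -
      have "v \<in> ?J'" using vz by (simp add: quo_def)
      then show "?J' \<noteq> J" using v by blast
    qed (use J quo_sub[OF J(1), of z] in auto)
    obtain u c where u: "u \<notin> Q" and c: "c \<in> ker_d j" "\<forall>r\<in>?J'. act (E j) u (\<psi> r) = act (E j) r c"
      using big[OF J' \<psi>] unfolding locally_eval_def by blast
    have "\<exists>g. hm B (E j) (adj J z) (ker_d j) g \<and> (\<forall>a\<in>J. g a = act (E j) u (\<phi> a)) \<and> g z = c"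
      by (rule hm_extend[OF M ker_d_subm J hm_scale[OF M ker_d_subm \<phi>] c(1)]) (use c(2) in \<open>simp add: \<psi>_def quo_def\<close>)
    then obtain g where g: "hm B (E j) (adj J z) (ker_d j) g" "\<forall>a\<in>J. g a = act (E j) u (\<phi> a)" by blast
    have "adj J z \<noteq> J" using adj_self[OF J(1), of z] z by blast
    then have "locally_eval Q j (adj J z) g" using big[OF idl_adj[OF J(1)] sub_adj _ g(1)] by blast
    then obtain u' c' where u': "u' \<notin> Q" and c': "c' \<in> ker_d j" "\<forall>a\<in>adj J z. act (E j) u' (g a) = act (E j) a c'"
      unfolding locally_eval_def by blast
    have "act (E j) (u' * u) (\<phi> a) = act (E j) a c'" if "a \<in> J" for a
    proof -
      have "act (E j) u' (g a) = act (E j) a c'" using c'(2) that sub_adj[of J z] by blast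
      then show ?thesis using g(2) that act_mult[OF M \<phi>E[OF that], of u' u] by simp
    qed
    then show False using bad uQ[OF u' u] c'(1) unfolding locally_eval_def by blast
  qed
  show False
  proof (cases "J = Q")
    case True
    have "r \<in> J" if "r * b \<in> B" for r using that True Q(2) by (simp add: quo_def)
    then obtain u x y where *: "u \<notin> Q" "x \<in> carrier (E j)" "y \<in> carrier (E j)" "\<forall>a\<in>J. \<phi> a = act (E j) a x"
      "sub (E j) (act (E j) u x) (act (E j) b y) \<in> ker_d j"
      using lift_shift[OF locally_eval J idl_B order_refl \<phi>] by blast
    have "act (E j) u (\<phi> a) = act (E j) a (sub (E j) (act (E j) u x) (act (E j) b y))" if a: "a \<in> J" for a
    proof -
      have "a * b \<in> B" using a True Q(2) by (simp add: quo_def)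
      then have "act (E j) a (act (E j) b y) = \<zero>\<^bsub>E j\<^esub>" using act_mult[OF M *(3), of a b] E_kill[OF _ *(3)] by simp
      then show ?thesis
        using act_sub[OF M act_closed[OF M *(2)] act_closed[OF M *(3)], of a u b] *(4) a
          sub_zero[OF M act_closed[OF M act_closed[OF M *(2)]]] act_swap[OF M *(2), of a u] by simp
    qed
    then show False using bad *(1,5) unfolding locally_eval_def by blast
  next
    case False
    then obtain q where q: "q \<in> Q" "q \<notin> J" using JQ by blast
    have qJ: "r \<in> J" if "r * q \<in> J" for r using prime[OF that q(2)] .
    have step: "\<exists>\<phi>'. hm B (E j) J (ker_d j) \<phi>' \<and> (\<exists>u c. u \<notin> Q \<and> c \<in> ker_d j \<and>
        (\<forall>a\<in>J. act (E j) u (\<phi> a) = act (E j) q (\<phi>' a) \<oplus>\<^bsub>E j\<^esub> act (E j) a c))"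
      if \<phi>: "hm B (E j) J (ker_d j) \<phi>" for \<phi>
    proof -
      obtain u x y where *: "u \<notin> Q" "x \<in> carrier (E j)" "y \<in> carrier (E j)" "\<forall>a\<in>J. \<phi> a = act (E j) a x"
        "sub (E j) (act (E j) u x) (act (E j) q y) \<in> ker_d j" "\<forall>a\<in>J. act (E j) a y \<in> ker_d j"
        using lift_shift[OF locally_eval J J \<phi> qJ] by blast
      have "hm B (E j) J (ker_d j) (\<lambda>a. act (E j) a y)"
        unfolding hm_def using *(6) by (auto simp: act_add_left[OF M *(3)] act_mult[OF M *(3)] E_kill *(3))
      moreover have "act (E j) u (\<phi> a) = act (E j) q (act (E j) a y) \<oplus>\<^bsub>E j\<^esub> act (E j) a (sub (E j) (act (E j) u x) (act (E j) q y))"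
        if a: "a \<in> J" for a
      proof -
        have cl: "act (E j) a (act (E j) u x) \<in> carrier (E j)" "act (E j) a (act (E j) q y) \<in> carrier (E j)"
          "act (E j) u x \<in> carrier (E j)" "act (E j) q y \<in> carrier (E j)"
          using *(2,3) act_closed[OF M] by auto
        have "act (E j) u (\<phi> a) = act (E j) a (act (E j) u x)" using *(4) a act_swap[OF M *(2), of a u] by simp
        also have "\<dots> = sub (E j) (act (E j) a (act (E j) u x)) (act (E j) a (act (E j) q y)) \<oplus>\<^bsub>E j\<^esub> act (E j) a (act (E j) q y)"
          using sub_add[OF M cl(1,2)] by simp
        also have "\<dots> = act (E j) a (act (E j) q y) \<oplus>\<^bsub>E j\<^esub> act (E j) a (sub (E j) (act (E j) u x) (act (E j) q y))"
          using mod_comm[OF M sub_closed[OF M cl(1,2)] cl(2)] act_sub[OF M cl(3,4), of a] by simp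
        finally show ?thesis using act_swap[OF M *(3), of a q] by simp
      qed
      ultimately show ?thesis using *(1,5) by blast
    qed
    define s where "s \<phi> = (SOME \<phi>'. hm B (E j) J (ker_d j) \<phi>' \<and> (\<exists>u c. u \<notin> Q \<and> c \<in> ker_d j \<and>
        (\<forall>a\<in>J. act (E j) u (\<phi> a) = act (E j) q (\<phi>' a) \<oplus>\<^bsub>E j\<^esub> act (E j) a c)))" for \<phi>
    have s: "hm B (E j) J (ker_d j) (s \<phi>) \<and> (\<exists>u c. u \<notin> Q \<and> c \<in> ker_d j \<and>
        (\<forall>a\<in>J. act (E j) u (\<phi> a) = act (E j) q (s \<phi> a) \<oplus>\<^bsub>E j\<^esub> act (E j) a c))"
      if "hm B (E j) J (ker_d j) \<phi>" for \<phi>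
      unfolding s_def by (rule someI_ex[OF step[OF that]])
    define F where "F i = (s ^^ i) \<phi>" for i
    have F: "hm B (E j) J (ker_d j) (F i)" for i by (induction i) (auto simp: F_def \<phi> s)
    have FE: "F i a \<in> carrier (E j)" if "a \<in> J" for i a using F[of i] that ker_d_carrier by (auto simp: hm_def)
    have Fs: "\<exists>u c. u \<notin> Q \<and> c \<in> ker_d j \<and>
        (\<forall>a\<in>J. act (E j) u (F i a) = act (E j) q (F (Suc i) a) \<oplus>\<^bsub>E j\<^esub> act (E j) a c)" for i
      using s[OF F[of i]] by (simp add: F_def)
    obtain ks where ks: "J = gen B ks" using fg[OF J(1) idl_B n_B J(2)] by blast
    then obtain l where l: "F l \<in> espan (E j) (ker_d j) J (F ` {..<l})"
      using hom_stable_all[of j] F unfolding hom_stable_def by blast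
    \<comment> \<open>U f equals t F_l plus the evaluation at c. Each F_i with i < l satisfies this
      with t divisible by q, hence so does F_l, which lies in their span; then (U - q t) F_l is an
      evaluation and U - q t is outside Q.\<close>
    define rel where "rel f U t c \<longleftrightarrow> U \<notin> Q \<and> c \<in> ker_d j \<and>
      (\<forall>a\<in>J. act (E j) U (f a) = act (E j) t (F l a) \<oplus>\<^bsub>E j\<^esub> act (E j) a c)" for f U t c
    have low: "\<exists>U t c. rel (F i) U (q * t) c" if "i < l" for i
      using that
    proof (induction "l - i" arbitrary: i)
      case 0 then show ?case by simp
    next
      case (Suc m)
      obtain u c where u: "u \<notin> Q" "c \<in> ker_d j"
        "\<forall>a\<in>J. act (E j) u (F i a) = act (E j) q (F (Suc i) a) \<oplus>\<^bsub>E j\<^esub> act (E j) a c" using Fs by blast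
      show ?case
      proof (cases "Suc i = l")
        case True
        then have "rel (F i) u (q * 1) c" unfolding rel_def using u by simp
        then show ?thesis by blast
      next
        case False
        have "m = l - Suc i" "Suc i < l" using False Suc.hyps(2) Suc.prems by auto
        then obtain U t c' where U: "rel (F (Suc i)) U (q * t) c'" using Suc.hyps(1) by blast
        let ?c = "act (E j) q c' \<oplus>\<^bsub>E j\<^esub> act (E j) U c"
        have c: "?c \<in> ker_d j" using U u subm_act[OF ker_d_subm] ker_d_subm[of j] by (simp add: rel_def subm_def)
        have "act (E j) (U * u) (F i a) = act (E j) (q * (q * t)) (F l a) \<oplus>\<^bsub>E j\<^esub> act (E j) a ?c" if a: "a \<in> J" for a
        proof -
          have cE: "c \<in> carrier (E j)" "c' \<in> carrier (E j)" using u U ker_d_carrier by (auto simp: rel_def)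
          have "act (E j) (U * u) (F i a) = act (E j) U (act (E j) q (F (Suc i) a) \<oplus>\<^bsub>E j\<^esub> act (E j) a c)"
            using act_mult[OF M FE[OF a], of U u] u(3) a by simp
          also have "\<dots> = act (E j) q (act (E j) U (F (Suc i) a)) \<oplus>\<^bsub>E j\<^esub> act (E j) U (act (E j) a c)"
            using act_add[OF M act_closed[OF M FE[OF a]] act_closed[OF M cE(1)], of U] act_swap[OF M FE[OF a], of U q] by simp
          also have "act (E j) U (F (Suc i) a) = act (E j) (q * t) (F l a) \<oplus>\<^bsub>E j\<^esub> act (E j) a c'"
            using U a by (simp add: rel_def)
          finally show ?thesis
            using FE[OF a] cE by (simp add: act_add[OF M] act_mult[OF M] act_closed[OF M] mod_assoc[OF M] mod_add_closed[OF M]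
                act_swap[OF M, of _ a])
        qed
        then have "rel (F i) (U * u) (q * (q * t)) ?c" using U u uQ c by (simp add: rel_def)
        then show ?thesis by blast
      qed
    qed
    have "\<exists>U t c. rel f U (q * t) c" if "f \<in> espan (E j) (ker_d j) J (F ` {..<l})" for f
      using that
    proof induction
      case (base f) then show ?case using low by auto
    next
      case (mult c)
      have "rel (\<lambda>a. act (E j) a c) 1 (q * 0) c"
        unfolding rel_def using mult ker_d_carrier prm_1[OF Q(1)] FE
        by (simp add: act_1[OF M] act_0[OF M] mod_l_zero[OF M] act_closed[OF M])
      then show ?case by blast
    next
      case (add f g)
      then obtain U t c U' t' c' where *: "rel f U (q * t) c" "rel g U' (q * t') c'" by blast
      have fg: "hm B (E j) J (ker_d j) f" "hm B (E j) J (ker_d j) g"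
        by (rule espan_hm[OF M ker_d_subm E_kill J]; use F add.hyps in auto)+
      let ?c = "act (E j) U' c \<oplus>\<^bsub>E j\<^esub> act (E j) U c'"
      have c: "?c \<in> ker_d j" using * subm_act[OF ker_d_subm] ker_d_subm[of j] by (simp add: rel_def subm_def)
      have "act (E j) (U * U') (f a \<oplus>\<^bsub>E j\<^esub> g a) = act (E j) (q * (U' * t + U * t')) (F l a) \<oplus>\<^bsub>E j\<^esub> act (E j) a ?c" if a: "a \<in> J" for a
      proof -
        have cl: "c \<in> carrier (E j)" "c' \<in> carrier (E j)" "f a \<in> carrier (E j)" "g a \<in> carrier (E j)" "F l a \<in> carrier (E j)"
          using * ker_d_carrier fg FE a by (auto simp: rel_def hm_def)
        have "act (E j) (U * U') (f a \<oplus>\<^bsub>E j\<^esub> g a) = act (E j) U' (act (E j) U (f a)) \<oplus>\<^bsub>E j\<^esub> act (E j) U (act (E j) U' (g a))"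
          using cl by (simp add: act_add[OF M] act_mult[OF M] act_closed[OF M] act_swap[OF M, of _ U U'])
        also have "\<dots> = act (E j) U' (act (E j) (q * t) (F l a) \<oplus>\<^bsub>E j\<^esub> act (E j) a c) \<oplus>\<^bsub>E j\<^esub>
            act (E j) U (act (E j) (q * t') (F l a) \<oplus>\<^bsub>E j\<^esub> act (E j) a c')"
          using * a by (simp add: rel_def)
        also have "\<dots> = act (E j) (U' * (q * t)) (F l a) \<oplus>\<^bsub>E j\<^esub> act (E j) a (act (E j) U' c) \<oplus>\<^bsub>E j\<^esub>
            (act (E j) (U * (q * t')) (F l a) \<oplus>\<^bsub>E j\<^esub> act (E j) a (act (E j) U c'))"
          using cl by (simp add: act_add[OF M] act_mult[OF M] act_closed[OF M] act_swap[OF M, of _ a])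
        also have "\<dots> = act (E j) (U' * (q * t) + U * (q * t')) (F l a) \<oplus>\<^bsub>E j\<^esub> act (E j) a ?c"
          using cl by (simp add: act_add[OF M] act_add_left[OF M] act_closed[OF M] mod_assoc[OF M] mod_lcomm[OF M] mod_add_closed[OF M])
        finally show ?thesis by (simp add: algebra_simps)
      qed
      then have "rel (\<lambda>a. f a \<oplus>\<^bsub>E j\<^esub> g a) (U * U') (q * (U' * t + U * t')) ?c" using * uQ c by (simp add: rel_def)
      then show ?case by blast
    next
      case (scale f r)
      then obtain U t c where *: "rel f U (q * t) c" by blast
      have f: "hm B (E j) J (ker_d j) f" by (rule espan_hm[OF M ker_d_subm E_kill J]; use F scale.hyps in auto)
      let ?c = "act (E j) r c"
      have c: "?c \<in> ker_d j" using * subm_act[OF ker_d_subm] by (simp add: rel_def)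
      have "act (E j) U (act (E j) r (f a)) = act (E j) (q * (r * t)) (F l a) \<oplus>\<^bsub>E j\<^esub> act (E j) a ?c" if a: "a \<in> J" for a
      proof -
        have cl: "c \<in> carrier (E j)" "f a \<in> carrier (E j)" "F l a \<in> carrier (E j)"
          using * ker_d_carrier f FE a by (auto simp: rel_def hm_def)
        have "act (E j) U (act (E j) r (f a)) = act (E j) r (act (E j) (q * t) (F l a) \<oplus>\<^bsub>E j\<^esub> act (E j) a c)"
          using act_swap[OF M cl(2), of U r] * a by (simp add: rel_def)
        also have "\<dots> = act (E j) (r * (q * t)) (F l a) \<oplus>\<^bsub>E j\<^esub> act (E j) a ?c"
          using cl by (simp add: act_add[OF M] act_mult[OF M] act_closed[OF M] act_swap[OF M, of _ a])
        finally show ?thesis by (simp add: algebra_simps)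
      qed
      then have "rel (\<lambda>a. act (E j) r (f a)) U (q * (r * t)) ?c" using * c by (simp add: rel_def)
      then show ?case by blast
    next
      case (congr f g) then show ?case unfolding rel_def by auto
    qed
    then obtain U t c where rel: "rel (F l) U (q * t) c" using l by blast
    have "locally_eval Q j J (F l)"
    proof -
      have "U - q * t \<notin> Q"
      proof
        assume "U - q * t \<in> Q"
        then have "(U - q * t) + q * t \<in> Q" using q(1) prm_idl[OF Q(1)] idl_add idl_mult2 by blast
        then show False using rel by (simp add: rel_def)
      qed
      moreover have "act (E j) (U - q * t) (F l a) = act (E j) a c" if a: "a \<in> J" for a
      proof -
        have cl: "F l a \<in> carrier (E j)" "act (E j) (q * t) (F l a) \<in> carrier (E j)" "act (E j) a c \<in> carrier (E j)"
          using FE[OF a] rel ker_d_carrier act_closed[OF M] by (auto simp: rel_def)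
        have "act (E j) (U - q * t) (F l a) = sub (E j) (act (E j) (q * t) (F l a) \<oplus>\<^bsub>E j\<^esub> act (E j) a c) (act (E j) (q * t) (F l a))"
          using act_diff_left[OF M cl(1), of U "q * t"] rel a by (simp add: rel_def)
        also have "\<dots> = act (E j) a c \<oplus>\<^bsub>E j\<^esub> sub (E j) (act (E j) (q * t) (F l a)) (act (E j) (q * t) (F l a))"
          using cl by (simp add: sub_def mod_assoc[OF M] mod_lcomm[OF M] act_closed[OF M])
        also have "\<dots> = act (E j) a c" using sub_self[OF M cl(2)] mod_r_zero[OF M cl(3)] by simp
        finally show ?thesis .
      qed
      ultimately show ?thesis using rel unfolding locally_eval_def rel_def by blast
    qed
    then obtain v c' where v: "v \<notin> Q" "c' \<in> ker_d j" "\<forall>a\<in>J. act (E j) v (F l a) = act (E j) a c'" unfolding locally_eval_def by blast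
    have "\<exists>U t c. rel (F 0) U t c"
    proof (cases "l = 0")
      case True
      have "\<zero>\<^bsub>E j\<^esub> \<in> ker_d j" using ker_d_subm by (simp add: subm_def)
      then have "rel (F 0) 1 1 \<zero>\<^bsub>E j\<^esub>" unfolding rel_def using prm_1[OF Q(1)] FE True
        by (simp add: act_1[OF M] act_zero[OF M] mod_r_zero[OF M])
      then show ?thesis by blast
    next
      case False then show ?thesis using low[of 0] by blast
    qed
    then obtain U t c where rel: "rel (F 0) U t c" by blast
    let ?c = "act (E j) t c' \<oplus>\<^bsub>E j\<^esub> act (E j) v c"
    have "act (E j) (v * U) (\<phi> a) = act (E j) a ?c" if a: "a \<in> J" for a
    proof -
      have cl: "F l a \<in> carrier (E j)" "c \<in> carrier (E j)" "c' \<in> carrier (E j)" "\<phi> a \<in> carrier (E j)"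
        using FE[OF a] rel v \<phi>E[OF a] ker_d_carrier by (auto simp: rel_def)
      have "act (E j) (v * U) (\<phi> a) = act (E j) v (act (E j) t (F l a) \<oplus>\<^bsub>E j\<^esub> act (E j) a c)"
        using act_mult[OF M cl(4), of v U] rel a by (simp add: rel_def F_def)
      also have "\<dots> = act (E j) t (act (E j) v (F l a)) \<oplus>\<^bsub>E j\<^esub> act (E j) v (act (E j) a c)"
        using act_add[OF M act_closed[OF M cl(1)] act_closed[OF M cl(2)], of v] act_swap[OF M cl(1), of v t] by simp
      also have "\<dots> = act (E j) a ?c"
        using v(3) a cl by (simp add: act_add[OF M] act_closed[OF M] act_swap[OF M, of _ a])
      finally show ?thesis .
    qed
    moreover have "?c \<in> ker_d j" using v rel subm_act[OF ker_d_subm] ker_d_subm[of j] by (simp add: rel_def subm_def)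
    ultimately show False using bad uQ[OF v(1)] rel unfolding locally_eval_def rel_def by blast
  qed
qed

lemma locally_eval_all:
  assumes Q: "prm Q" "Q = quo B b" and J: "idl J" "B \<subseteq> J" and \<phi>: "hm B (E j) J (ker_d j) \<phi>"
  shows "locally_eval Q j J \<phi>"
proof -
  have top: "locally_eval Q i J \<phi>" if "i > k" "hm B (E i) J (ker_d i) \<phi>" for i J \<phi>
  proof -
    note M = E_mod[of i]
    have 0: "\<zero>\<^bsub>E i\<^esub> \<in> ker_d i" using ker_d_subm by (simp add: subm_def)
    have "\<phi> a = \<zero>\<^bsub>E i\<^esub>" if "a \<in> J" for a using \<open>hm B (E i) J (ker_d i) \<phi>\<close> that bound[OF \<open>i > k\<close>] by (auto simp: hm_def ker_d_def)
    then have "\<forall>a\<in>J. act (E i) 1 (\<phi> a) = act (E i) a \<zero>\<^bsub>E i\<^esub>" by (simp add: act_zero[OF M])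
    then show ?thesis unfolding locally_eval_def using 0 prm_1[OF Q(1)] by blast
  qed
  have "\<forall>J \<phi>. idl J \<longrightarrow> B \<subseteq> J \<longrightarrow> hm B (E j) J (ker_d j) \<phi> \<longrightarrow> locally_eval Q j J \<phi>" if "Suc k - j = m" for m j
    using that
  proof (induction m arbitrary: j)
    case 0 then show ?case using top by simp
  next
    case (Suc m)
    then have "Suc k - Suc j = m" by simp
    then show ?case using Suc.IH[of "Suc j"] locally_eval_step[OF Q] by blast
  qed
  then show ?thesis using J \<phi> by blast
qed

text \<open>The level j = 0 of \<open>locally_eval_all\<close>: there ker d_0 = S e is a copy of
  S/B, and evaluation at h e is multiplication by h.\<close>

theorem local_self_injective:
  assumes Q: "prm Q" "Q = quo B b" and J: "idl J" "B \<subseteq> J" and \<phi>: "mhom J B \<phi>"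
  shows "\<exists>u h. u \<notin> Q \<and> (\<forall>a\<in>J. u * \<phi> a - h * a \<in> B)"
proof -
  note M = E_mod[of 0]
  have eq: "act (E 0) r e = act (E 0) s e \<longleftrightarrow> r - s \<in> B" for r s
    using act_diff_left[OF M e_E, of r s] sub_0_iff[OF M act_closed[OF M e_E] act_closed[OF M e_E]] ann by metis
  have "hm B (E 0) J (ker_d 0) (\<lambda>a. act (E 0) (\<phi> a) e)"
    unfolding hm_def
  proof (intro conjI ballI allI)
    show "act (E 0) (\<phi> a) e \<in> ker_d 0" for a using ker_d_0 by blast
    show "act (E 0) (\<phi> (a + b)) e = act (E 0) (\<phi> a) e \<oplus>\<^bsub>E 0\<^esub> act (E 0) (\<phi> b) e" if "a \<in> J" "b \<in> J" for a b
      using \<phi> that eq[of "\<phi> (a + b)" "\<phi> a + \<phi> b"] act_add_left[OF M e_E] by (simp add: mhom_def)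
    show "act (E 0) (\<phi> (r * a)) e = act (E 0) r (act (E 0) (\<phi> a) e)" if "a \<in> J" for r a
      using \<phi> that eq[of "\<phi> (r * a)" "r * \<phi> a"] act_mult[OF M e_E] by (simp add: mhom_def)
    show "act (E 0) (\<phi> b) e = \<zero>\<^bsub>E 0\<^esub>" if "b \<in> B" for b using \<phi> that ann by (simp add: mhom_def)
  qed
  then obtain u c where u: "u \<notin> Q" "c \<in> ker_d 0" "\<forall>a\<in>J. act (E 0) u (act (E 0) (\<phi> a) e) = act (E 0) a c"
    using locally_eval_all[OF Q J] unfolding locally_eval_def by blast
  obtain h where h: "c = act (E 0) h e" using u(2) ker_d_0 by blast
  have "u * \<phi> a - h * a \<in> B" if "a \<in> J" for a
    using u(3) that h eq[of "u * \<phi> a" "a * h"] by (simp add: act_mult[OF M e_E] mult.commute)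
  then show ?thesis using u(1) by blast
qed

end

section \<open>Linkage of Cohen-Macaulay ideals in a Gorenstein ring\<close>

text \<open>N is the kernel of the localization of S/B at P. A maximal annihilator (N : c) is prime
  and lies in P; as N is finitely generated, one s outside P multiplies N into B, and (N : c) = (B :
  s c).\<close>

lemma (in nring) chain_below:
  assumes B: "idl B" "n \<subseteq> B" "B \<subseteq> P" and P: "prm P"
  shows "\<exists>c. c \<notin> B \<and> prm (quo B c) \<and> quo B c \<subseteq> P"
proof -
  define N where "N = {b. \<exists>s. s \<notin> P \<and> s * b \<in> B}"
  have N: "idl N"
    unfolding idl_def
  proof (intro conjI ballI allI)
    show "0 \<in> N" using prm_1[OF P] B by (auto simp: N_def intro!: exI[of _ 1])
    fix a b r assume "a \<in> N"
    then obtain s where s: "s \<notin> P" "s * a \<in> B" by (auto simp: N_def)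
    have "s * (r * a) \<in> B" using idl_mult[OF B(1) s(2), of r] by (simp add: algebra_simps)
    then show "r * a \<in> N" using s unfolding N_def by blast
    assume "b \<in> N"
    then obtain t where t: "t \<notin> P" "t * b \<in> B" by (auto simp: N_def)
    have "s * t * (a + b) = t * (s * a) + s * (t * b)" by (simp add: algebra_simps)
    then have "s * t * (a + b) \<in> B" using s t B by (simp add: idl_add idl_mult)
    moreover have "s * t \<notin> P" using s t P prm_mult by blast
    ultimately show "a + b \<in> N" unfolding N_def by blast
  qed
  have BN: "B \<subseteq> N" using prm_1[OF P] by (auto simp: N_def intro!: exI[of _ 1])
  have N1: "1 \<notin> N" using B(3) by (auto simp: N_def)
  let ?F = "{quo N c | c. c \<notin> N}"
  have "\<exists>M\<in>?F. \<forall>J\<in>?F. M \<subseteq> J \<longrightarrow> J = M"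
  proof (rule max_ex)
    show "?F \<noteq> {}" using N1 by blast
    show "idl J \<and> n \<subseteq> J" if "J \<in> ?F" for J using that N BN B(2) quo_sub[OF N] by auto
  qed
  then obtain M where "M \<in> ?F" and M: "\<forall>J\<in>?F. M \<subseteq> J \<longrightarrow> J = M" by (rule bexE)
  then obtain c where c: "c \<notin> N" "M = quo N c" by blast
  have mx: "quo N d = quo N c" if "d \<notin> N" "quo N c \<subseteq> quo N d" for d
    using bspec[OF M, of "quo N d"] that c(2) by blast
  have "v \<in> quo N c" if uv: "u * v \<in> quo N c" and u: "u \<notin> quo N c" for u v
  proof -
    have "u * c \<notin> N" using u by (simp add: quo_def)
    moreover have "quo N c \<subseteq> quo N (u * c)"
    proof
      fix r assume "r \<in> quo N c"
      then have "u * (r * c) \<in> N" using N idl_mult by (auto simp: quo_def)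
      then show "r \<in> quo N (u * c)" by (simp add: quo_def algebra_simps)
    qed
    ultimately have "quo N (u * c) = quo N c" using mx by blast
    moreover have "v \<in> quo N (u * c)" using uv by (simp add: quo_def algebra_simps)
    ultimately show ?thesis by blast
  qed
  then have pr: "prm (quo N c)" unfolding prm_def using N c(1) by (auto simp: quo_1)
  have sub: "quo N c \<subseteq> P"
  proof
    fix r assume "r \<in> quo N c"
    then obtain s where s: "s \<notin> P" "s * (r * c) \<in> B" by (auto simp: quo_def N_def)
    show "r \<in> P"
    proof (rule ccontr)
      assume "r \<notin> P"
      then have "s * r \<notin> P" using s P prm_mult by blast
      moreover have "s * r * c \<in> B" using s by (simp add: algebra_simps)
      ultimately show False using c unfolding N_def by blast
    qed
  qed
  obtain ys where ys: "set ys \<subseteq> N" "N = gen B ys" using fg[OF N B(1,2) BN] by blast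
  have "\<exists>s. s \<notin> P \<and> (\<forall>y\<in>set zs. s * y \<in> B)" if "set zs \<subseteq> N" for zs
    using that
  proof (induction zs)
    case Nil then show ?case using prm_1[OF P] by auto
  next
    case (Cons z zs)
    then obtain s t where s: "s \<notin> P" "\<forall>y\<in>set zs. s * y \<in> B" and t: "t \<notin> P" "t * z \<in> B" by (auto simp: N_def)
    have "s * t \<notin> P" using s t P prm_mult by blast
    moreover have "s * t * z \<in> B" using idl_mult[OF B(1) t(2), of s] by (simp add: algebra_simps)
    moreover have "s * t * y \<in> B" if "y \<in> set zs" for y
    proof -
      have "t * (s * y) \<in> B" using s(2) that idl_mult[OF B(1)] by blast
      then show ?thesis by (simp add: algebra_simps)
    qed
    ultimately show ?case by (intro exI[of _ "s * t"]) simp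
  qed
  then obtain s where s: "s \<notin> P" "\<forall>y\<in>set ys. s * y \<in> B" using ys by blast
  have "gen B ys \<subseteq> quo B s" by (rule gen_least[OF idl_quo[OF B(1)] quo_sub[OF B(1)]]) (use s(2) in \<open>auto simp: quo_def mult.commute\<close>)
  then have sN: "b * s \<in> B" if "b \<in> N" for b using that ys by (auto simp: quo_def)
  have "quo B (s * c) = quo N c"
  proof
    show "quo B (s * c) \<subseteq> quo N c"
    proof
      fix r assume "r \<in> quo B (s * c)"
      then have "s * (r * c) \<in> B" by (simp add: quo_def algebra_simps)
      then show "r \<in> quo N c" using s by (auto simp: quo_def N_def)
    qed
    show "quo N c \<subseteq> quo B (s * c)"
    proof
      fix r assume "r \<in> quo N c"
      then have "(r * c) * s \<in> B" using sN by (simp add: quo_def)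
      then show "r \<in> quo B (s * c)" by (simp add: quo_def algebra_simps)
    qed
  qed
  moreover have "s * c \<notin> B" using c s unfolding N_def by blast
  ultimately show ?thesis using pr sub by metis
qed

text \<open>The map k + z r \<mapsto> r s is well defined because (K : z) s lies in B.\<close>

lemma mhom_ext:
  assumes B: "idl B" "B \<subseteq> K" and K: "idl K" and z: "\<And>r. z * r \<in> K \<Longrightarrow> r * s \<in> B"
  shows "\<exists>\<phi>. mhom (adj K z) B \<phi> \<and> (\<forall>k\<in>K. \<phi> k \<in> B) \<and> \<phi> z - s \<in> B"
proof -
  define c where "c a = (SOME r. a - z * r \<in> K)" for a
  have c: "a - z * c a \<in> K" if a: "a \<in> adj K z" for a
  proof -
    have "\<exists>r. a - z * r \<in> K" using adj_memb_cong[OF K a] by blast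
    then show ?thesis unfolding c_def by (rule someI_ex)
  qed
  have uniq: "c a * s - r * s \<in> B" if a: "a \<in> adj K z" and r: "a - z * r \<in> K" for a r
  proof -
    have "(a - z * r) - (a - z * c a) \<in> K" using r c[OF a] K idl_diff by blast
    then have "z * (c a - r) \<in> K" by (simp add: algebra_simps)
    from z[OF this] show ?thesis by (simp add: left_diff_distrib)
  qed
  have "mhom (adj K z) B (\<lambda>a. c a * s)"
    unfolding mhom_def
  proof (intro conjI ballI allI)
    show "c (a + b) * s - (c a * s + c b * s) \<in> B" if ab: "a \<in> adj K z" "b \<in> adj K z" for a b
    proof -
      have "(a - z * c a) + (b - z * c b) \<in> K" using c ab K idl_add by blast
      then have "(a + b) - z * (c a + c b) \<in> K" by (simp add: algebra_simps)
      then show ?thesis using uniq[of "a + b" "c a + c b"] ab K by (simp add: idl_add distrib_right)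
    qed
    show "c (r * a) * s - r * (c a * s) \<in> B" if a: "a \<in> adj K z" for a r
    proof -
      have "r * (a - z * c a) \<in> K" using c a K idl_mult by blast
      then have "r * a - z * (r * c a) \<in> K" by (simp add: algebra_simps)
      then show ?thesis using uniq[of "r * a" "r * c a"] a K by (simp add: idl_mult mult.assoc)
    qed
    show "c b * s \<in> B" if "b \<in> B" for b using uniq[of b 0] that B sub_adj[of K z] by auto
  qed
  moreover have "c k * s \<in> B" if "k \<in> K" for k using uniq[of k 0] that sub_adj[of K z] by auto
  moreover have "c z * s - s \<in> B" using uniq[OF adj_self[OF K], of 1] K by simp
  ultimately show ?thesis by (intro exI[of _ "\<lambda>a. c a * s"]) blast
qed

text \<open>Here \<phi> is multiplication by f divided by y; cancelling the regular y transfers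
  additivity and linearity.\<close>

lemma mhom_divide:
  assumes B: "idl B" and K: "idl K" "B \<subseteq> K" and y: "nzd B y" and f: "\<And>k. k \<in> K \<Longrightarrow> f * k - y * \<phi> k \<in> B"
  shows "mhom K B \<phi>"
  unfolding mhom_def
proof (intro conjI ballI allI)
  fix a b assume ab: "a \<in> K" "b \<in> K"
  have "y * (\<phi> (a + b) - (\<phi> a + \<phi> b)) = (f * a - y * \<phi> a) + (f * b - y * \<phi> b) - (f * (a + b) - y * \<phi> (a + b))"
    by (simp add: algebra_simps)
  also have "\<dots> \<in> B" using f[OF ab(1)] f[OF ab(2)] f[OF idl_add[OF K(1) ab]] B by (simp only: idl_add idl_diff)
  finally show "\<phi> (a + b) - (\<phi> a + \<phi> b) \<in> B" using y nzd_def by blast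
next
  fix a r assume a: "a \<in> K"
  have "y * (\<phi> (r * a) - r * \<phi> a) = r * (f * a - y * \<phi> a) - (f * (r * a) - y * \<phi> (r * a))"
    by (simp add: algebra_simps)
  also have "\<dots> \<in> B" using f[OF a] f[OF idl_mult[OF K(1) a]] B by (simp only: idl_mult idl_diff)
  finally show "\<phi> (r * a) - r * \<phi> a \<in> B" using y nzd_def by blast
next
  fix b assume b: "b \<in> B"
  have "y * \<phi> b = f * b - (f * b - y * \<phi> b)" by simp
  also have "\<dots> \<in> B" using idl_diff[OF B idl_mult[OF B b] f[OF subsetD[OF K(2) b]]] .
  finally show "\<phi> b \<in> B" using y nzd_def by blast
qed

lemma nzd_colon: "nzd B y \<Longrightarrow> nzd (colon B K) y"
  unfolding nzd_def colon_def by (simp add: mult.assoc)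

text \<open>The axiom \<open>GOR\<close> says that the localization of \<open>S/(ys)\<close> at an associated prime \<open>Q\<close> is self-injective.\<close>

locale gor = nloc n m for n :: "'b::comm_ring_1 set" and m +
  fixes dim :: nat
  assumes GOR: "rs n ys \<Longrightarrow> set ys \<subseteq> m \<Longrightarrow> prm Q \<Longrightarrow> Q = quo (gen n ys) b \<Longrightarrow> idl J \<Longrightarrow> gen n ys \<subseteq> J \<Longrightarrow>
      mhom J (gen n ys) \<phi> \<Longrightarrow> \<exists>u h. u \<notin> Q \<and> (\<forall>a\<in>J. u * \<phi> a - h * a \<in> gen n ys)"
    and dim: "dge m dim n" "\<not> dge m (Suc dim) n"
begin

definition reg :: "'b set \<Rightarrow> nat \<Rightarrow> bool" where
  "reg B k \<longleftrightarrow> (\<exists>ys. length ys = k \<and> set ys \<subseteq> m \<and> rs n ys \<and> B = gen n ys)"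

lemma reg_idl: "reg B k \<Longrightarrow> idl B" and reg_n: "reg B k \<Longrightarrow> n \<subseteq> B" and reg_m: "reg B k \<Longrightarrow> B \<subseteq> m"
  using idl_n n_m idl_m sub_gen gen_least unfolding reg_def by blast+

lemma reg_le: "reg B k \<Longrightarrow> k \<le> dim"
proof (rule ccontr)
  assume "reg B k" "\<not> k \<le> dim"
  then have "dge m k n" unfolding reg_def dge_def by blast
  then have "dge m (Suc dim) n" using \<open>\<not> k \<le> dim\<close> dge_mono by (metis not_less_eq_eq)
  then show False using dim by blast
qed

lemma reg_dge: "reg B k \<Longrightarrow> dge m (dim - k) B"
proof -
  assume B: "reg B k"
  then obtain ys where ys: "length ys = k" "set ys \<subseteq> m" "rs n ys" "B = gen n ys" unfolding reg_def by blast
  have "dge m (length ys + (dim - k)) n" using dim ys reg_le[OF B] by simp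
  then show ?thesis using dge_gen[OF idl_n order_refl idl_m _ ys(2,3)] ys by blast
qed

lemma reg_max: "reg B k \<Longrightarrow> \<not> dge m (Suc (dim - k)) B"
proof
  assume B: "reg B k" and "dge m (Suc (dim - k)) B"
  obtain ys where ys: "length ys = k" "set ys \<subseteq> m" "rs n ys" "B = gen n ys" using B unfolding reg_def by blast
  obtain zs where zs: "length zs = Suc (dim - k)" "set zs \<subseteq> m" "rs B zs"
    using \<open>dge m (Suc (dim - k)) B\<close> unfolding dge_def by blast
  have "rs n (ys @ zs)" using ys zs by (simp add: rs_append)
  moreover have "length (ys @ zs) = Suc dim" using ys zs reg_le[OF B] by simp
  moreover have "set (ys @ zs) \<subseteq> m" using ys zs by simp
  ultimately show False using dim(2) unfolding dge_def by blast
qed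

lemma reg_adj: "reg B k \<Longrightarrow> y \<in> m \<Longrightarrow> nzd B y \<Longrightarrow> reg (adj B y) (Suc k)"
proof -
  assume "reg B k" "y \<in> m" "nzd B y"
  then obtain ys where "length ys = k" "set ys \<subseteq> m" "rs n ys" "B = gen n ys" unfolding reg_def by blast
  then show ?thesis using \<open>y \<in> m\<close> \<open>nzd B y\<close> unfolding reg_def
    by (intro exI[of _ "ys @ [y]"]) (simp add: rs_append gen_append)
qed

lemma GOR_reg:
  "reg B k \<Longrightarrow> prm Q \<Longrightarrow> Q = quo B b \<Longrightarrow> idl J \<Longrightarrow> B \<subseteq> J \<Longrightarrow> mhom J B \<phi> \<Longrightarrow>
    \<exists>u h. u \<notin> Q \<and> (\<forall>a\<in>J. u * \<phi> a - h * a \<in> B)"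
  using GOR unfolding reg_def by blast

lemma unit_mult_hom:
  assumes B: "idl B" "n \<subseteq> B" and u: "u \<notin> m" "\<forall>a\<in>K. u * \<phi> a - h * a \<in> B"
  shows "\<exists>h. \<forall>a\<in>K. \<phi> a - h * a \<in> B"
proof -
  obtain v where v: "1 - u * v \<in> n" using unit_ex u by blast
  have "\<phi> a - (v * h) * a \<in> B" if a: "a \<in> K" for a
  proof -
    have eq: "\<phi> a - (v * h) * a = (1 - u * v) * \<phi> a + v * (u * \<phi> a - h * a)" by (simp add: algebra_simps)
    show ?thesis by (subst eq)
      (rule idl_add[OF B(1) idl_mult2[OF B(1) subsetD[OF B(2) v]] idl_mult[OF B(1) u(2)[rule_format, OF a]]])
  qed
  then show ?thesis by blast
qed

text \<open>A regular sequence of maximal length leaves no regular element in \<open>m\<close>, so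
  \<open>m\<close> annihilates some s that is nonzero modulo B.\<close>

lemma socle:
  assumes B: "reg B dim" shows "\<exists>s. s \<notin> B \<and> m = quo B s"
proof -
  have "\<not> (\<exists>x\<in>m. nzd B x)" using reg_max[OF B] by (auto simp: dge_Suc)
  then obtain c where c: "c \<notin> B" "prm (quo B c)" "m \<subseteq> quo B c"
    using no_nzd[OF reg_idl[OF B] reg_n[OF B] idl_m] by blast
  then have "quo B c \<subseteq> m" using proper_sub_m[of "quo B c"] n_m prm_idl prm_1 by blast
  then show ?thesis using c by blast
qed

text \<open>For \<open>dim S/K = dim S/B\<close> every homomorphism \<open>K/B \<rightarrow> S/B\<close> is a multiplication, that is \<open>Ext\<^sup>1(S/K, S/B) = 0\<close>; induction on the dimension by cutting
  with an element regular modulo \<open>B\<close> and \<open>K\<close>.\<close>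

lemma ext_mult:
  assumes "reg B k" "idl K" "B \<subseteq> K" "dge m (dim - k) K" "mhom K B \<phi>"
  shows "\<exists>h. \<forall>a\<in>K. \<phi> a - h * a \<in> B"
  using assms
proof (induction "dim - k" arbitrary: k B K \<phi>)
  case 0
  note B = 0(2)
  have "reg B dim" using B reg_le[OF B] 0(1) by simp
  then obtain s where s: "s \<notin> B" "m = quo B s" using socle by blast
  \<comment> \<open>In dimension zero \<open>m\<close> itself is an associated prime of B, and u
    outside \<open>m\<close> is a unit.\<close>
  obtain u h where "u \<notin> m" "\<forall>a\<in>K. u * \<phi> a - h * a \<in> B"
    using GOR_reg[OF B prm_m s(2) 0(3,4,6)] by blast
  then show ?case using unit_mult_hom[OF reg_idl[OF B] reg_n[OF B]] by blast
next
  case (Suc r)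
  note B = Suc(3) and K = Suc(4,5) and \<phi> = Suc(7)
  note Bi = reg_idl[OF B] reg_n[OF B]
  have nK: "n \<subseteq> K" using Bi K by blast
  have kd: "dim - Suc k = r" using Suc(2) by simp
  have "dge m (Suc r) B" "dge m (Suc r) K" using reg_dge[OF B] Suc by auto
  then have "\<exists>x\<in>m. nzd B x" "\<exists>x\<in>m. nzd K x" by (auto simp: dge_Suc)
  then have "\<exists>x\<in>m. \<forall>I\<in>{B, K}. nzd I x" by (intro common_nzd) (use Bi K nK idl_m in auto)
  then obtain y where y: "y \<in> m" "nzd B y" "nzd K y" by blast
  \<comment> \<open>\<phi> induces a map \<psi> from (K, y)/(B, y) to S/(B, y). It is well defined
    since y r in K forces r in K, hence \<phi>(y r) = y \<phi>(r) modulo B. The induction hypothesis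
    applies to \<psi>.\<close>
  have red: "\<exists>h. \<forall>k\<in>K. \<phi> k - h * k \<in> adj B y" if \<phi>: "mhom K B \<phi>" for \<phi>
  proof -
    define c where "c a = (SOME r. a - y * r \<in> K)" for a
    have c: "a - y * c a \<in> K" if a: "a \<in> adj K y" for a
    proof -
      have "\<exists>r. a - y * r \<in> K" using adj_memb_cong[OF K(1) a] by blast
      then show ?thesis unfolding c_def by (rule someI_ex)
    qed
    define \<psi> where "\<psi> a = \<phi> (a - y * c a)" for a
    have sB: "x \<in> B \<Longrightarrow> x \<in> adj B y" for x using sub_adj by blast
    note aB = idl_adj[OF Bi(1), of y]
    have uniq: "\<psi> a - \<phi> (a - y * r) \<in> adj B y" if a: "a \<in> adj K y" and r: "a - y * r \<in> K" for a r
    proof -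
      have "(a - y * c a) - (a - y * r) \<in> K" using r c[OF a] K(1) idl_diff by blast
      then have yr: "y * (r - c a) \<in> K" by (simp add: algebra_simps)
      then have rK: "r - c a \<in> K" using y nzd_def by blast
      have "\<phi> ((a - y * r) + y * (r - c a)) - (\<phi> (a - y * r) + \<phi> (y * (r - c a))) \<in> B"
        using \<phi> r yr by (simp add: mhom_def)
      moreover have eq1: "(a - y * r) + y * (r - c a) = a - y * c a" by (simp add: algebra_simps)
      ultimately have 1: "\<psi> a - (\<phi> (a - y * r) + \<phi> (y * (r - c a))) \<in> B" unfolding \<psi>_def by (simp only: eq1)
      have 2: "\<phi> (y * (r - c a)) - y * \<phi> (r - c a) \<in> B" using \<phi> rK by (simp add: mhom_def)
      have eq: "\<psi> a - \<phi> (a - y * r) = (\<psi> a - (\<phi> (a - y * r) + \<phi> (y * (r - c a)))) + (\<phi> (y * (r - c a)) - y * \<phi> (r - c a))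
          + y * \<phi> (r - c a)" by (simp add: algebra_simps)
      have 3: "y * \<phi> (r - c a) \<in> adj B y" using adjI[OF idl_0[OF Bi(1)], of y "\<phi> (r - c a)"] by simp
      show ?thesis by (subst eq) (rule idl_add[OF aB idl_add[OF aB sB[OF 1] sB[OF 2]] 3])
    qed
    have "mhom (adj K y) (adj B y) \<psi>"
      unfolding mhom_def
    proof (intro conjI ballI allI)
      show "\<psi> (a + b) - (\<psi> a + \<psi> b) \<in> adj B y" if ab: "a \<in> adj K y" "b \<in> adj K y" for a b
      proof -
        have "(a - y * c a) + (b - y * c b) \<in> K" using c ab K idl_add by blast
        moreover have eq: "(a - y * c a) + (b - y * c b) = (a + b) - y * (c a + c b)" by (simp add: algebra_simps)
        ultimately have m: "(a + b) - y * (c a + c b) \<in> K" by simp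
        have "\<psi> (a + b) - \<phi> ((a + b) - y * (c a + c b)) \<in> adj B y" by (rule uniq[OF _ m]) (use ab K in \<open>simp add: idl_add\<close>)
        then have 1: "\<psi> (a + b) - \<phi> ((a - y * c a) + (b - y * c b)) \<in> adj B y" by (simp only: eq)
        have 2: "\<phi> ((a - y * c a) + (b - y * c b)) - (\<psi> a + \<psi> b) \<in> adj B y"
          using \<phi> c ab sB unfolding mhom_def \<psi>_def by blast
        show ?thesis using idl_add[OF aB 1 2] by (simp add: algebra_simps)
      qed
      show "\<psi> (t * a) - t * \<psi> a \<in> adj B y" if a: "a \<in> adj K y" for a t
      proof -
        have "t * (a - y * c a) \<in> K" using c a K idl_mult by blast
        moreover have eq: "t * (a - y * c a) = t * a - y * (t * c a)" by (simp add: algebra_simps)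
        ultimately have m: "t * a - y * (t * c a) \<in> K" by simp
        have "\<psi> (t * a) - \<phi> (t * a - y * (t * c a)) \<in> adj B y" by (rule uniq[OF _ m]) (use a K in \<open>simp add: idl_mult\<close>)
        then have 1: "\<psi> (t * a) - \<phi> (t * (a - y * c a)) \<in> adj B y" by (simp only: eq)
        have 2: "\<phi> (t * (a - y * c a)) - t * \<psi> a \<in> adj B y"
          using \<phi> c a sB unfolding mhom_def \<psi>_def by blast
        show ?thesis using idl_add[OF aB 1 2] by (simp add: algebra_simps)
      qed
      show "\<psi> b \<in> adj B y" if b: "b \<in> adj B y" for b
      proof -
        obtain e r where e: "b - y * r = e" "e \<in> B" using adj_memb_cong[OF Bi(1) b] by blast
        have "b \<in> adj K y" using b adj_mono[OF K(2)] by blast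
        then have "\<psi> b - \<phi> (b - y * r) \<in> adj B y" using uniq e K(2) by blast
        moreover have "\<phi> (b - y * r) \<in> adj B y" using e \<phi> sB by (auto simp: mhom_def)
        ultimately show ?thesis using idl_cong[OF aB] by blast
      qed
    qed
    moreover have "dge m r (adj K y)" using dge_adj[OF K(1) nK idl_m _ y(1,3)] Suc by metis
    ultimately obtain h where h: "\<forall>a\<in>adj K y. \<psi> a - h * a \<in> adj B y"
      using Suc(1)[of "Suc k" "adj B y" "adj K y" \<psi>] reg_adj[OF B y(1,2)] K(1) adj_mono[OF K(2)] kd by auto
    have "\<phi> a - h * a \<in> adj B y" if a: "a \<in> K" for a
    proof -
      have aK: "a \<in> adj K y" using a sub_adj by blast
      have "\<psi> a - \<phi> a \<in> adj B y" using uniq[OF aK, of 0] a by simp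
      then have "(\<psi> a - h * a) - (\<psi> a - \<phi> a) \<in> adj B y" using h aK idl_diff[OF aB] by blast
      then show ?thesis by simp
    qed
    then show ?thesis by blast
  qed
  obtain a h where "\<forall>k\<in>K. (1 - y * a) * \<phi> k - h * k \<in> B"
    using mhom_nak[OF Bi K(2) K(1) y(2) red \<phi>] by blast
  then show ?case using unit_mult_hom[OF Bi one_minus_unit[OF y(1)]] by blast
qed

text \<open>For f in the colon on the left, multiplication by f on K is divisible by y modulo B. The
  quotient is a homomorphism from K/B to S/B, by \<open>ext_mult\<close> multiplication by some h,
  and f - y h lies in B : K. So linking commutes with hyperplane sections.\<close>

lemma colon_adj:
  assumes B: "reg B k" and K: "idl K" "B \<subseteq> K" "dge m (dim - k) K" and y: "nzd B y" "nzd K y"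
  shows "colon (adj B y) (adj K y) = adj (colon B K) y"
proof
  note Bi = reg_idl[OF B] reg_n[OF B]
  have "f \<in> colon (adj B y) (adj K y)" if f: "f \<in> colon B K" for f
    unfolding colon_def
  proof (intro CollectI ballI)
    fix a assume "a \<in> adj K y"
    then obtain b r where a: "a = b + y * r" "b \<in> K" using adjE by blast
    have "f * a = f * b + y * (f * r)" by (simp add: a algebra_simps)
    moreover have "f * b \<in> B" using f a by (simp add: colon_def)
    ultimately show "f * a \<in> adj B y" using adjI[of "f * b" B y "f * r"] by simp
  qed
  moreover have "y \<in> colon (adj B y) (adj K y)"
    using idl_mult2[OF idl_adj[OF Bi(1)] adj_self[OF Bi(1)], of y] by (simp add: colon_def)
  ultimately show "adj (colon B K) y \<subseteq> colon (adj B y) (adj K y)"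
    using Bi by (intro adj_least) auto
  show "colon (adj B y) (adj K y) \<subseteq> adj (colon B K) y"
  proof
    fix f assume f: "f \<in> colon (adj B y) (adj K y)"
    have "\<forall>a\<in>K. \<exists>q. f * a - y * q \<in> B"
    proof
      fix a assume "a \<in> K"
      then have "f * a \<in> adj B y" using f sub_adj[of K y] by (auto simp: colon_def)
      then show "\<exists>q. f * a - y * q \<in> B" using adj_memb_cong[OF Bi(1)] by blast
    qed
    then obtain \<phi> where \<phi>: "\<And>a. a \<in> K \<Longrightarrow> f * a - y * \<phi> a \<in> B" by metis
    have "mhom K B \<phi>" by (rule mhom_divide[OF Bi(1) K(1,2) y(1) \<phi>])
    then obtain h where h: "\<forall>a\<in>K. \<phi> a - h * a \<in> B" using ext_mult[OF B K] by blast
    have "(f - y * h) * a \<in> B" if a: "a \<in> K" for a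
    proof -
      have eq: "(f - y * h) * a = (f * a - y * \<phi> a) + y * (\<phi> a - h * a)" by (simp add: algebra_simps)
      show ?thesis by (subst eq) (use \<phi>[OF a] h a Bi in \<open>simp only: idl_add idl_mult\<close>)
    qed
    then have "f - y * h \<in> colon B K" by (simp add: colon_def)
    then show "f \<in> adj (colon B K) y" using adj_memI[OF idl_colon[OF Bi(1)]] by blast
  qed
qed

lemma common_pair:
  assumes B: "reg B k" and K: "idl K" "B \<subseteq> K" "dge m (dim - k) K" and r: "Suc r = dim - k"
  shows "\<exists>y\<in>m. nzd B y \<and> nzd K y \<and> dge m r (adj K y) \<and> reg (adj B y) (Suc k) \<and> dim - Suc k = r"
proof -
  note Bi = reg_idl[OF B] reg_n[OF B]
  have nK: "n \<subseteq> K" using Bi K by blast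
  have dg: "dge m (Suc r) B" "dge m (Suc r) K" using reg_dge[OF B] K r by auto
  then have "\<exists>x\<in>m. nzd B x" "\<exists>x\<in>m. nzd K x" by (auto simp: dge_Suc)
  then have "\<exists>x\<in>m. \<forall>I\<in>{B, K}. nzd I x" by (intro common_nzd) (use Bi K nK idl_m in auto)
  then obtain y where y: "y \<in> m" "nzd B y" "nzd K y" by blast
  then show ?thesis using dge_adj[OF K(1) nK idl_m dg(2) y(1,3)] reg_adj[OF B y(1,2)] r by auto
qed

text \<open>In dimension zero the socle element detects K. In general a regular y lowers the
  dimension through \<open>colon_adj\<close>, and Nakayama lifts the equality back.\<close>

lemma double_colon:
  assumes "reg B k" "idl K" "B \<subseteq> K" "dge m (dim - k) K"
  shows "colon B (colon B K) = K"
  using assms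
proof (induction "dim - k" arbitrary: k B K)
  case 0
  note B = 0(2) and K = 0(3,4)
  note Bi = reg_idl[OF B] reg_n[OF B]
  have "reg B dim" using B reg_le[OF B] 0(1) by simp
  then obtain s where s: "s \<notin> B" "m = quo B s" using socle by blast
  have "z \<in> K" if z: "z \<in> colon B (colon B K)" for z
  proof (rule ccontr)
    assume zK: "z \<notin> K"
    \<comment> \<open>As (K : z) lies in m = (B : s), sending z to s and K to 0 is a homomorphism.
      It is multiplication by some h, which lies in B : K; so h z lies in B although it represents
      s.\<close>
    have "r * s \<in> B" if r: "z * r \<in> K" for r
    proof -
      have "r \<in> m" using unit_cancel[OF K(1), of r z] r Bi K zK by (auto simp: mult.commute)
      then show ?thesis using s by (simp add: quo_def)
    qed
    then obtain \<phi> where \<phi>: "mhom (adj K z) B \<phi>" "\<forall>k\<in>K. \<phi> k \<in> B" "\<phi> z - s \<in> B"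
      using mhom_ext[OF Bi(1) K(2,1)] by blast
    have "\<exists>h. \<forall>a\<in>adj K z. \<phi> a - h * a \<in> B"
      by (rule ext_mult[OF B _ _ _ \<phi>(1)]) (use K sub_adj[of K z] 0(1)[symmetric] in auto)
    then obtain h where h: "\<forall>a\<in>adj K z. \<phi> a - h * a \<in> B" by blast
    have "h * a \<in> B" if a: "a \<in> K" for a
    proof -
      have "\<phi> a - h * a \<in> B" using h a sub_adj[of K z] by blast
      then show ?thesis using \<phi>(2) a idl_cong[OF Bi(1), of "\<phi> a" "h * a"] by blast
    qed
    then have "h \<in> colon B K" by (simp add: colon_def)
    then have "h * z \<in> B" using z by (auto simp: colon_def mult.commute)
    moreover have "\<phi> z - h * z \<in> B" using h adj_self[OF K(1)] by blast
    ultimately have "\<phi> z \<in> B" using idl_cong[OF Bi(1)] by blast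
    then have "s \<in> B" using \<phi>(3) idl_cong[OF Bi(1)] by blast
    then show False using s by blast
  qed
  then show ?case using colon_colon[of K B] by blast
next
  case (Suc r)
  note B = Suc(3) and K = Suc(4,5,6)
  note Bi = reg_idl[OF B] reg_n[OF B]
  obtain y where y: "y \<in> m" "nzd B y" "nzd K y" "dge m r (adj K y)" "reg (adj B y) (Suc k)" "dim - Suc k = r"
    using common_pair[OF B K Suc(2)] by blast
  let ?L = "colon B K"
  have IH: "colon (adj B y) (colon (adj B y) (adj K y)) = adj K y"
    using Suc(1)[of "Suc k" "adj B y" "adj K y"] y K(1) adj_mono[OF K(2)] by auto
  have "colon B ?L \<subseteq> K"
  proof (rule loc_nak[OF K(1) _ _ _ _ y(1)])
    show "n \<subseteq> K" using Bi K by blast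
    show "K \<subseteq> colon B ?L" by (rule colon_colon)
    show "idl (colon B ?L)" using Bi by blast
    fix h assume h: "h \<in> colon B ?L"
    have "h \<in> colon (adj B y) (adj ?L y)"
      unfolding colon_def[of "adj B y"]
    proof (intro CollectI ballI)
      fix a assume "a \<in> adj ?L y"
      then obtain b t where a: "a = b + y * t" "b \<in> ?L" using adjE by blast
      then have "h * a = h * b + y * (h * t)" by (simp add: algebra_simps)
      moreover have "h * b \<in> B" using h a(2) unfolding colon_def[of B ?L] by blast
      ultimately show "h * a \<in> adj B y" using adjI[of "h * b" B y "h * t"] by simp
    qed
    then have "h \<in> adj K y" using IH colon_adj[OF B K y(2,3)] by simp
    then obtain t where t: "h - y * t \<in> K" using adj_memb_cong[OF K(1)] by blast
    then have "h - y * t \<in> colon B ?L" using colon_colon by blast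
    then have "h - (h - y * t) \<in> colon B ?L" using h Bi idl_diff idl_colon by blast
    then have "y * t \<in> colon B ?L" by simp
    then have "t \<in> colon B ?L" using nzd_colon[OF y(2)] nzd_def by blast
    then show "\<exists>t\<in>colon B ?L. h - y * t \<in> K" using t by blast
  qed
  then show ?case using colon_colon[of K B] by blast
qed

text \<open>B : K is a section-compatible colon by \<open>colon_adj\<close>, and an element regular
  modulo B is regular modulo B : K; so depth is counted one hyperplane at a time.\<close>

lemma link_dge:
  assumes "reg B k" "idl K" "B \<subseteq> K" "dge m (dim - k) K"
  shows "dge m (dim - k) (colon B K)"
  using assms
proof (induction "dim - k" arbitrary: k B K)
  case (Suc r)
  note B = Suc(3) and K = Suc(4,5,6)
  obtain y where y: "y \<in> m" "nzd B y" "nzd K y" "dge m r (adj K y)" "reg (adj B y) (Suc k)" "dim - Suc k = r"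
    using common_pair[OF B K Suc(2)] by blast
  have "dge m r (colon (adj B y) (adj K y))"
    using Suc(1)[of "Suc k" "adj B y" "adj K y"] y K(1) adj_mono[OF K(2)] by auto
  then have "dge m (Suc r) (colon B K)"
    unfolding dge_Suc using y(1) nzd_colon[OF y(2)] colon_adj[OF B K y(2,3)] by auto
  then show ?case using Suc(2) by simp
qed auto

text \<open>At Q the ring S/B is Noetherian and self-injective, so it behaves like an Artinian ring.
  Once the annihilators of the powers of x are stationary, x^(l+1) \<mapsto> x^l is a homomorphism,
  at Q multiplication by h/u. Then x^l (u - x h) lies in B, and regularity of x modulo K puts u into
  Q.\<close>

lemma no_embedded:
  assumes B: "reg B k" and K: "idl K" "B \<subseteq> K" "K \<subseteq> Q" and x: "nzd K x" "x \<in> Q" and Q: "prm Q" "Q = quo B c"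
  shows False
proof -
  note Bi = reg_idl[OF B] reg_n[OF B]
  have "\<exists>l. \<forall>i\<ge>l. quo B (x ^ i) = quo B (x ^ l)"
  proof (rule chain_stable)
    show "quo B (x ^ i) \<subseteq> quo B (x ^ Suc i)" for i
    proof
      fix r assume "r \<in> quo B (x ^ i)"
      then have "x * (r * x ^ i) \<in> B" using idl_mult[OF Bi(1)] by (simp add: quo_def)
      then show "r \<in> quo B (x ^ Suc i)" by (simp add: quo_def algebra_simps)
    qed
    show "n \<subseteq> quo B (x ^ i)" for i using Bi quo_sub by blast
  qed (use Bi in blast)
  then obtain l where "\<And>i. i \<ge> l \<Longrightarrow> quo B (x ^ i) = quo B (x ^ l)" by blast
  then have l: "quo B (x ^ Suc l) = quo B (x ^ l)" by (metis le_add2 plus_1_eq_Suc)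
  have "r * x ^ l \<in> B" if "x ^ Suc l * r \<in> B" for r
    using l that by (auto simp: quo_def algebra_simps)
  then obtain \<phi> where \<phi>: "mhom (adj B (x ^ Suc l)) B \<phi>" "\<phi> (x ^ Suc l) - x ^ l \<in> B"
    using mhom_ext[OF Bi(1) order_refl Bi(1), of "x ^ Suc l" "x ^ l"] by blast
  obtain u h where u: "u \<notin> Q" "\<forall>a\<in>adj B (x ^ Suc l). u * \<phi> a - h * a \<in> B"
    using GOR_reg[OF B Q idl_adj[OF Bi(1)] sub_adj \<phi>(1)] by blast
  have "u * \<phi> (x ^ Suc l) - h * x ^ Suc l \<in> B" using u(2) adj_self[OF Bi(1)] by blast
  then have "(u * \<phi> (x ^ Suc l) - h * x ^ Suc l) - u * (\<phi> (x ^ Suc l) - x ^ l) \<in> B" using \<phi>(2) Bi idl_diff idl_mult by blast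
  moreover have eq: "(u * \<phi> (x ^ Suc l) - h * x ^ Suc l) - u * (\<phi> (x ^ Suc l) - x ^ l) = x ^ l * (u - x * h)"
    by (simp add: algebra_simps)
  ultimately have "x ^ l * (u - x * h) \<in> B" by (simp only: eq)
  then have xl: "x ^ l * (u - x * h) \<in> K" using K by blast
  have "nzd K (x ^ l)"
  proof (induction l)
    case (Suc i)
    have "x ^ Suc i * r = x * (x ^ i * r)" for r by (simp add: mult.assoc)
    then show ?case using x(1) Suc unfolding nzd_def by metis
  qed (simp add: nzd_def)
  then have "u - x * h \<in> K" using xl unfolding nzd_def by blast
  then have "u - x * h \<in> Q" using K(3) by blast
  then have "(u - x * h) + x * h \<in> Q" using x(2) prm_idl[OF Q(1)] idl_add idl_mult2 by blast
  then show False using u by simp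
qed

text \<open>The condition \<open>dge m (dim - k) K\<close> bounds the depth of \<open>S/K\<close> below by the dimension: \<open>cmI k K\<close> are the Cohen-Macaulay ideals of height \<open>k\<close>.\<close>

definition cmI :: "nat \<Rightarrow> 'b set \<Rightarrow> bool" where
  "cmI k K \<longleftrightarrow> idl K \<and> n \<subseteq> K \<and> 1 \<notin> K \<and> (\<exists>B. reg B k \<and> B \<subseteq> K) \<and> dge m (dim - k) K"

lemma cmI_idl: "cmI k K \<Longrightarrow> idl K" and cmI_n: "cmI k K \<Longrightarrow> n \<subseteq> K" and cmI_1: "cmI k K \<Longrightarrow> 1 \<notin> K"
  and cmI_dge: "cmI k K \<Longrightarrow> dge m (dim - k) K" and cmI_m: "cmI k K \<Longrightarrow> K \<subseteq> m"
  using proper_sub_m unfolding cmI_def by blast+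

lemma cmI_reg: "cmI k K \<Longrightarrow> \<exists>ys. length ys = k \<and> set ys \<subseteq> K \<and> rs n ys \<and> reg (gen n ys) k \<and> gen n ys \<subseteq> K"
proof -
  assume "cmI k K"
  then obtain B where B: "reg B k" "B \<subseteq> K" unfolding cmI_def by blast
  then obtain ys where ys: "length ys = k" "set ys \<subseteq> m" "rs n ys" "B = gen n ys" unfolding reg_def by blast
  then show ?thesis using B gen_set[OF idl_n, of ys] by blast
qed

lemma regI: "cmI k K \<Longrightarrow> length ys = l \<Longrightarrow> set ys \<subseteq> K \<Longrightarrow> rs n ys \<Longrightarrow> reg (gen n ys) l"
  unfolding reg_def using cmI_m by blast

text \<open>A longer sequence in P would, by \<open>dge_gen\<close>, leave an element of P regular
  modulo \<open>gen n bs\<close>, but P kills c there.\<close>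

lemma grade_bound:
  assumes P: "idl P" "dge P j n" and bs: "set bs \<subseteq> P" "rs n bs" and c: "c \<notin> gen n bs" "\<And>r. r \<in> P \<Longrightarrow> r * c \<in> gen n bs"
  shows "j \<le> length bs"
proof (rule ccontr)
  assume "\<not> j \<le> length bs"
  then have "dge P (length bs + 1) n" using dge_mono[OF P(2), of "length bs + 1"] by simp
  then have "dge P 1 (gen n bs)" by (rule dge_gen[OF idl_n order_refl P(1) _ bs])
  then obtain y where "y \<in> P" "nzd (gen n bs) y" using dge_Suc[of P 0] by auto
  then show False using c unfolding nzd_def by blast
qed

lemma cmI_socle:
  assumes K: "cmI k K" and B: "reg B k" "B \<subseteq> K"
  shows "\<exists>c. c \<notin> B \<and> c \<in> colon B K"
proof (rule ccontr)
  assume "\<not> ?thesis"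
  then have "colon B K \<subseteq> B" by blast
  then have "1 \<in> colon B (colon B K)" by (auto simp: colon_def)
  then show False using double_colon[OF B(1) cmI_idl[OF K] B(2) cmI_dge[OF K]] cmI_1[OF K] by simp
qed

lemma cmI_grade:
  assumes K: "cmI k K" and ys: "set ys \<subseteq> K" "rs n ys" shows "length ys \<le> k"
proof -
  obtain bs where bs: "length bs = k" "set bs \<subseteq> K" "rs n bs" "reg (gen n bs) k" "gen n bs \<subseteq> K"
    using cmI_reg[OF K] by blast
  obtain c where c: "c \<notin> gen n bs" "c \<in> colon (gen n bs) K" using cmI_socle[OF K bs(4,5)] by blast
  have "dge K (length ys) n" using ys unfolding dge_def by blast
  then have "length ys \<le> length bs"
    by (rule grade_bound[OF cmI_idl[OF K] _ bs(2,3) c(1)]) (use c(2) in \<open>auto simp: colon_def mult.commute\<close>)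
  then show ?thesis using bs by simp
qed

text \<open>K kills the nonzero class of c, so the sequence generating B is maximal in K and its
  length is the grade k. Hence every link of K goes through a complete intersection of height
  k.\<close>

lemma cmI_grade_eq:
  assumes K: "cmI k K" and B: "reg B l" "B \<subseteq> K" and c: "c \<notin> B" "c \<in> colon B K" shows "l = k"
proof -
  obtain ys where ys: "length ys = l" "rs n ys" "B = gen n ys" using B unfolding reg_def by blast
  then have ysK: "set ys \<subseteq> K" using B gen_set[OF idl_n, of ys] by blast
  have "dge K k n" using cmI_reg[OF K] unfolding dge_def by blast
  then have "k \<le> length ys"
    by (rule grade_bound[OF cmI_idl[OF K] _ ysK ys(2)]) (use c ys in \<open>auto simp: colon_def mult.commute\<close>)
  then show ?thesis using cmI_grade[OF K ysK ys(2)] ys by simp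
qed

definition dlink :: "'b set \<Rightarrow> 'b set \<Rightarrow> bool" where
  "dlink K L \<longleftrightarrow> 1 \<notin> K \<and> 1 \<notin> L \<and> (\<exists>B l. reg B l \<and> B \<subseteq> K \<and> B \<subseteq> L \<and> K = colon B L \<and> L = colon B K)"

lemma dlink_sym: "dlink K L \<Longrightarrow> dlink L K"
  unfolding dlink_def by blast

lemma dlink_cmI:
  assumes K: "cmI k K" and "dlink K L"
  shows "\<exists>B. reg B k \<and> B \<subseteq> K \<and> L = colon B K" "cmI k L"
proof -
  obtain B l where B: "reg B l" "B \<subseteq> K" "B \<subseteq> L" "K = colon B L" "L = colon B K" "1 \<notin> L"
    using assms unfolding dlink_def by blast
  have "\<exists>c. c \<in> L \<and> c \<notin> B"
  proof (rule ccontr)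
    assume "\<not> ?thesis"
    then have "1 \<in> colon B L" by (auto simp: colon_def)
    then show False using B(4) cmI_1[OF K] by blast
  qed
  then have lk: "l = k" using cmI_grade_eq[OF K B(1,2)] B(5) by blast
  then show "\<exists>B. reg B k \<and> B \<subseteq> K \<and> L = colon B K" using B by blast
  have "dge m (dim - k) L" using link_dge[OF _ cmI_idl[OF K] B(2) cmI_dge[OF K]] B(1,5) lk by blast
  moreover have "idl L" using idl_colon[OF reg_idl[OF B(1)], of K] B(5) by (rule ssubst[rotated])
  ultimately show "cmI k L" unfolding cmI_def using B lk reg_n[OF B(1)] by blast
qed

lemma dlinkI:
  assumes K: "cmI k K" and B: "reg B k" "B \<subseteq> K" and 1: "1 \<notin> colon B K"
  shows "dlink K (colon B K)"
  unfolding dlink_def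
  using cmI_1[OF K] 1 B colon_sub[OF reg_idl[OF B(1)], of K] double_colon[OF B(1) cmI_idl[OF K] B(2) cmI_dge[OF K]] by blast

text \<open>What has to be found is an element of (K, x) regular modulo a complete intersection of
  height k inside K. Otherwise (K, x) lies in an associated prime of that ideal, which
  \<open>no_embedded\<close> forbids.\<close>

lemma cmI_adj:
  assumes K: "cmI k K" and x: "x \<in> m" "nzd K x" shows "cmI (Suc k) (adj K x)"
proof -
  obtain bs where bs: "reg (gen n bs) k" "gen n bs \<subseteq> K" using cmI_reg[OF K] by blast
  note Bi = reg_idl[OF bs(1)] reg_n[OF bs(1)]
  note Ki = cmI_idl[OF K]
  have "\<exists>z\<in>adj K x. nzd (gen n bs) z"
  proof (rule ccontr)
    assume "\<not> ?thesis"
    then obtain c where c: "prm (quo (gen n bs) c)" "adj K x \<subseteq> quo (gen n bs) c"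
      using no_nzd[OF Bi idl_adj[OF Ki]] by blast
    then show False
      using no_embedded[OF bs(1) Ki bs(2) _ x(2) _ c(1) refl] sub_adj[of K x] adj_self[OF Ki, of x] by blast
  qed
  then obtain z where z: "z \<in> adj K x" "nzd (gen n bs) z" by blast
  have Km: "adj K x \<subseteq> m" using adj_least[OF idl_m cmI_m[OF K] x(1)] .
  then have r: "reg (adj (gen n bs) z) (Suc k)" using reg_adj[OF bs(1) _ z(2)] z(1) by blast
  have sub: "adj (gen n bs) z \<subseteq> adj K x" using z(1) bs(2) sub_adj[of K x] Ki by (intro adj_least) auto
  have "dim - k = Suc (dim - Suc k)" using reg_le[OF r] by simp
  then have "dge m (dim - Suc k) (adj K x)" using dge_adj[OF Ki cmI_n[OF K] idl_m _ x] cmI_dge[OF K] by simp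
  then show ?thesis unfolding cmI_def using Ki r sub Km m1 cmI_n[OF K] sub_adj[of K x] by blast
qed

text \<open>Steinitz exchange: W contains \<open>m\<close> times each of the generators
  \<open>cs\<close>, so an x outside W has a coefficient outside \<open>m\<close> and replaces the
  corresponding generator.\<close>

lemma exchange_generator:
  assumes W: "idl W" "B \<subseteq> W" and B: "idl B" "n \<subseteq> B" and cs: "\<And>c \<mu>. c \<in> set cs \<Longrightarrow> \<mu> \<in> m \<Longrightarrow> c * \<mu> \<in> W"
    and x: "x \<in> gen B cs" "x \<notin> W"
  shows "\<exists>cs'. length cs = Suc (length cs') \<and> gen B cs = gen B (x # cs')"
  using cs x
proof (induction cs arbitrary: x)
  case Nil then show ?case using W by auto
next
  case (Cons c cs)
  have "x \<in> adj (gen B cs) c" using Cons.prems(2) by (simp add: gen_adj)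
  then obtain w r where x: "x = w + c * r" "w \<in> gen B cs" using adjE by blast
  show ?case
  proof (cases "r \<in> m")
    case False
    have "gen B (c # cs) = gen B (x # cs)"
    proof (rule gen_eqI[OF B(1)])
      note G = idl_gen[OF B(1), of "x # cs"]
      have "x \<in> gen B (x # cs)" "w \<in> gen B (x # cs)"
        using gen_set[OF B(1), of "x # cs"] x(2) gen_mono[OF sub_adj, of B cs x] by auto
      then have "x - w \<in> gen B (x # cs)" using G idl_diff by blast
      then have "r * c \<in> gen B (x # cs)" using x(1) by (simp add: mult.commute)
      then have "c \<in> gen B (x # cs)" using unit_cancel[OF G _ False] B(2) sub_gen[of B "x # cs"] by blast
      then show "set (c # cs) \<subseteq> gen B (x # cs)" using gen_set[OF B(1), of "x # cs"] by auto
      show "set (x # cs) \<subseteq> gen B (c # cs)" using gen_set[OF B(1), of "c # cs"] Cons.prems(2) by auto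
    qed
    then show ?thesis by (intro exI[of _ cs]) simp
  next
    case True
    then have cr: "c * r \<in> W" using Cons.prems(1) by simp
    have "w \<notin> W" using Cons.prems(3) x(1) cr idl_add[OF W(1)] by blast
    then obtain cs' where cs': "length cs = Suc (length cs')" "gen B cs = gen B (w # cs')"
      using Cons.IH[of w] Cons.prems(1) x(2) by auto
    have "gen B (c # cs) = adj (gen B (w # cs')) c" using cs'(2) by (simp add: gen_adj)
    also have "\<dots> = gen (adj (adj B c) w) cs'" by (simp add: gen_adj adj_swap)
    also have "adj (adj B c) w = adj (adj B c) x"
    proof (rule adj_cong[OF idl_adj[OF B(1)]])
      show "w - x \<in> adj B c" using x(1) idl_uminus[OF idl_adj[OF B(1)] idl_mult2[OF idl_adj[OF B(1)] adj_self[OF B(1)]], of c r] by simp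
    qed
    also have "gen (adj (adj B c) x) cs' = gen B (x # c # cs')" by (simp add: adj_swap)
    finally show ?thesis using cs'(1) by (intro exI[of _ "c # cs'"]) simp
  qed
qed

lemma gen_replace:
  assumes B: "idl B" and "\<And>c. c \<in> set cs \<Longrightarrow> c - f c \<in> B"
  shows "gen B (map f cs) = gen B cs"
  using assms(2)
proof (induction cs)
  case (Cons c cs)
  have "f c - c \<in> gen B cs" using Cons.prems[of c] idl_uminus[OF B] sub_gen[of B cs] by fastforce
  then have "adj (gen B cs) (f c) = adj (gen B cs) c" by (rule adj_cong[OF idl_gen[OF B]])
  then show ?case using Cons by (simp add: gen_adj)
qed simp

text \<open>As x is a minimal generator of (I, x), it can be exchanged into a generating sequence.
  Subtracting multiples of x moves the other k generators into I, and they generate I by Nakayama.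
  Since I has grade k, \<open>gens_regular\<close> applies.\<close>

lemma ci_of_section:
  assumes I: "cmI k I" and x: "x \<in> m" "nzd I x" and C: "reg (adj I x) l"
  shows "reg I k"
proof -
  note Ii = cmI_idl[OF I] cmI_n[OF I]
  have cmx: "cmI (Suc k) (adj I x)" by (rule cmI_adj[OF I x])
  have "\<exists>c. c \<notin> adj I x \<and> c \<in> colon (adj I x) (adj I x)"
    using cmI_1[OF cmx] Ii idl_mult[OF idl_adj[OF Ii(1)]] by (intro exI[of _ 1]) (auto simp: colon_def)
  then have l: "l = Suc k" using cmI_grade_eq[OF cmx C order_refl] by blast
  then obtain cs where cs: "length cs = Suc k" "adj I x = gen n cs" using C unfolding reg_def by blast
  \<comment> \<open>W = I + x m. It contains m (I, x), while x lies outside it because x is regular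
    modulo I and I lies in \<open>m\<close>.\<close>
  define W where "W = {w. \<exists>\<mu>\<in>m. w - x * \<mu> \<in> I}"
  have W: "idl W"
    unfolding idl_def
  proof (intro conjI ballI allI)
    show "0 \<in> W" using Ii idl_m by (auto simp: W_def intro!: bexI[of _ 0])
    fix a b r assume "a \<in> W"
    then obtain \<mu> where \<mu>: "\<mu> \<in> m" "a - x * \<mu> \<in> I" by (auto simp: W_def)
    have "r * a - x * (r * \<mu>) \<in> I" using idl_mult[OF Ii(1) \<mu>(2), of r] by (simp add: algebra_simps)
    then show "r * a \<in> W" using \<mu> idl_mult[OF idl_m] unfolding W_def by blast
    assume "b \<in> W"
    then obtain \<nu> where \<nu>: "\<nu> \<in> m" "b - x * \<nu> \<in> I" by (auto simp: W_def)
    have "(a + b) - x * (\<mu> + \<nu>) \<in> I" using idl_add[OF Ii(1) \<mu>(2) \<nu>(2)] by (simp add: algebra_simps)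
    then show "a + b \<in> W" using \<mu> \<nu> idl_add[OF idl_m] unfolding W_def by blast
  qed
  have nW: "n \<subseteq> W" using Ii idl_m by (auto simp: W_def intro!: bexI[of _ 0])
  have "c * \<mu> \<in> W" if c: "c \<in> set cs" and \<mu>: "\<mu> \<in> m" for c \<mu>
  proof -
    have "c \<in> adj I x" using c cs gen_set[OF idl_n, of cs] by auto
    then obtain s where "c - x * s \<in> I" using adj_memb_cong[OF Ii(1)] by blast
    then have "c * \<mu> - x * (s * \<mu>) \<in> I" using idl_mult[OF Ii(1), of "c - x * s" \<mu>] by (simp add: algebra_simps)
    then show ?thesis unfolding W_def using idl_mult[OF idl_m \<mu>] by blast
  qed
  moreover have "x \<notin> W"
  proof
    assume "x \<in> W"
    then obtain \<mu> where \<mu>: "\<mu> \<in> m" "x - x * \<mu> \<in> I" by (auto simp: W_def)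
    then have "x * (1 - \<mu>) \<in> I" by (simp add: algebra_simps)
    then have "1 - \<mu> \<in> I" using x nzd_def by blast
    then have "1 - \<mu> * 1 \<in> m" using cmI_m[OF I] by auto
    then show False using one_minus_unit[OF \<mu>(1)] by blast
  qed
  ultimately obtain cs' where cs': "length cs = Suc (length cs')" "gen n cs = gen n (x # cs')"
    using exchange_generator[OF W nW idl_n order_refl, of cs x] adj_self[OF Ii(1)] cs(2) by blast
  have "\<forall>c\<in>set cs'. \<exists>a. a \<in> I \<and> c - a \<in> adj n x"
  proof
    fix c assume "c \<in> set cs'"
    then have "c \<in> adj I x" using cs(2) cs'(2) gen_set[OF idl_n, of "x # cs'"] by auto
    then obtain a r where "c = a + x * r" "a \<in> I" using adjE by blast
    then show "\<exists>a. a \<in> I \<and> c - a \<in> adj n x" using adjI[OF idl_0[OF idl_n], of x r] by auto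
  qed
  then obtain f where f: "\<And>c. c \<in> set cs' \<Longrightarrow> f c \<in> I \<and> c - f c \<in> adj n x" by metis
  let ?as = "map f cs'"
  have eq: "adj I x = adj (gen n ?as) x"
    using cs(2) cs'(2) gen_replace[OF idl_adj[OF idl_n], of cs' f x] f by (simp add: gen_adj)
  have asI: "gen n ?as \<subseteq> I" using f Ii by (intro gen_least) auto
  have "I \<subseteq> gen n ?as"
  proof (rule loc_nak[OF idl_gen[OF idl_n] sub_gen asI Ii(1) _ x(1)])
    fix i assume i: "i \<in> I"
    then have "i \<in> adj (gen n ?as) x" using eq sub_adj[of I x] by blast
    then obtain r where r: "i - x * r \<in> gen n ?as" using adj_memb_cong[OF idl_gen[OF idl_n]] by blast
    then have "i - (i - x * r) \<in> I" using i asI Ii idl_diff by blast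
    then have "r \<in> I" using x unfolding nzd_def by simp
    then show "\<exists>z\<in>I. i - x * z \<in> gen n ?as" using r by blast
  qed
  then have Ieq: "gen n ?as = I" using asI by blast
  have "dge I (length ?as) n" using cmI_reg[OF I] cs(1) cs'(1) unfolding dge_def by auto
  then obtain bs where bs: "length bs = length ?as" "rs n bs" "gen n bs = I"
    using gens_regular[OF idl_n order_refl Ieq] by blast
  then have "set bs \<subseteq> m" using gen_set[OF idl_n, of bs] cmI_m[OF I] by blast
  then show ?thesis unfolding reg_def using bs cs(1) cs'(1) by (intro exI[of _ bs]) auto
qed

text \<open>With K = B : L and L generated over B by finitely many l, the prime P = (K : b) is the
  intersection of the ideals (B : b l), and a prime that is a finite intersection equals one of its
  members.\<close>

lemma assoc_prime_colon:
  assumes K: "cmI k K" and B: "reg B k" "B \<subseteq> K" and P: "prm P" "P = quo K b"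
  shows "\<exists>c. P = quo B c"
proof -
  note Bi = reg_idl[OF B(1)] reg_n[OF B(1)]
  let ?L = "colon B K"
  obtain ls where ls: "set ls \<subseteq> ?L" "?L = gen B ls" using fg[OF idl_colon[OF Bi(1)] Bi colon_sub[OF Bi(1)]] by blast
  have KL: "K = colon B ?L" using double_colon[OF B(1) cmI_idl[OF K] B(2) cmI_dge[OF K]] by simp
  have sub: "P \<subseteq> quo B (b * l)" if "l \<in> ?L" for l
  proof
    fix r assume "r \<in> P"
    then have "r * b \<in> colon B ?L" using P KL by (simp add: quo_def)
    then show "r \<in> quo B (b * l)" using that by (auto simp: colon_def quo_def mult.assoc)
  qed
  have "\<exists>l\<in>set ls. quo B (b * l) \<subseteq> P"
  proof (rule ccontr)
    assume "\<not> ?thesis"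
    then have "\<forall>l\<in>set ls. \<exists>r. r * (b * l) \<in> B \<and> r \<notin> P" by (auto simp: quo_def)
    then obtain r where r: "\<And>l. l \<in> set ls \<Longrightarrow> r l * (b * l) \<in> B \<and> r l \<notin> P" by metis
    define p where "p = prod_list (map r ls)"
    have pP: "p \<notin> P"
    proof -
      have "prod_list (map r zs) \<notin> P" if "set zs \<subseteq> set ls" for zs
        using that by (induction zs) (use prm_1[OF P(1)] prm_mult[OF P(1)] r in auto)
      then show ?thesis by (simp add: p_def)
    qed
    have pl: "p * (b * l) \<in> B" if lls: "l \<in> set ls" for l
    proof -
      have ex: "\<exists>q. prod_list (map r zs) = q * r l" if "l \<in> set zs" for zs
        using that
      proof (induction zs)
        case (Cons z zs)
        show ?case
        proof (cases "l = z")
          case True then show ?thesis by (intro exI[of _ "prod_list (map r zs)"]) (simp add: mult.commute)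
        next
          case False
          then obtain q where "prod_list (map r zs) = q * r l" using Cons by auto
          then show ?thesis by (intro exI[of _ "r z * q"]) (simp add: mult.assoc)
        qed
      qed simp
      obtain q where "p = q * r l" using ex[OF lls] p_def by blast
      then show ?thesis using r[OF lls] idl_mult[OF Bi(1), of "r l * (b * l)" q] by (simp add: mult.assoc)
    qed
    have "gen B ls \<subseteq> quo B (p * b)"
      by (rule gen_least[OF idl_quo[OF Bi(1)] quo_sub[OF Bi(1)]]) (use pl in \<open>auto simp: quo_def algebra_simps\<close>)
    then have "p * b \<in> colon B ?L" using ls by (auto simp: quo_def colon_def mult.commute)
    then have "p \<in> P" using KL P by (simp add: quo_def)
    then show False using pP by blast
  qed
  then show ?thesis using sub ls by blast
qed

definition pchain :: "(nat \<Rightarrow> 'b set) \<Rightarrow> nat \<Rightarrow> bool" where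
  "pchain F j \<longleftrightarrow> (\<forall>i\<le>j. prm (F i) \<and> n \<subseteq> F i) \<and> (\<forall>i<j. F i \<subset> F (Suc i))"

text \<open>Along the chain a regular sequence is extended one element at a time: by
  \<open>no_embedded\<close> the next prime lies in no associated prime of the sequence so far. As P
  is associated to B, its grade is at most k.\<close>

lemma height_upper:
  assumes B: "reg B k" and P: "prm P" "P = quo B c" and F: "pchain F j" "F j = P"
  shows "j \<le> k"
proof -
  have sub: "\<exists>qs. length qs = i \<and> set qs \<subseteq> F i \<and> rs n qs" if "i \<le> j" for i
    using that
  proof (induction i)
    case 0 then show ?case by auto
  next
    case (Suc i)
    then obtain qs where qs: "length qs = i" "set qs \<subseteq> F i" "rs n qs" by auto
    have Fi: "prm (F i)" "n \<subseteq> F i" "prm (F (Suc i))" "n \<subseteq> F (Suc i)" "F i \<subset> F (Suc i)"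
      using F Suc.prems unfolding pchain_def by auto
    let ?B = "gen n qs"
    have BF: "?B \<subseteq> F i" using qs Fi prm_idl by (intro gen_least) auto
    have "F i \<subseteq> m" using proper_sub_m[of "F i"] Fi prm_idl prm_1 by blast
    then have rB: "reg ?B i" unfolding reg_def using qs by blast
    have "\<exists>q\<in>F (Suc i). nzd ?B q"
    proof (rule ccontr)
      assume "\<not> ?thesis"
      then obtain c where c: "prm (quo ?B c)" "F (Suc i) \<subseteq> quo ?B c"
        using no_nzd[OF idl_gen[OF idl_n] sub_gen prm_idl[OF Fi(3)]] by blast
      obtain x where x: "x \<in> F (Suc i)" "x \<notin> F i" using Fi by blast
      have "nzd (F i) x" unfolding nzd_def using x prm_mult[OF Fi(1)] by blast
      then show False using no_embedded[OF rB prm_idl[OF Fi(1)] BF _ _ _ c(1) refl] Fi(5) x c(2) by blast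
    qed
    then obtain q where "q \<in> F (Suc i)" "nzd ?B q" by blast
    then show ?case using qs Fi(5) by (intro exI[of _ "qs @ [q]"]) (auto simp: rs_append)
  qed
  then obtain qs where qs: "length qs = j" "set qs \<subseteq> P" "rs n qs" using F by blast
  obtain bs where bs: "length bs = k" "set bs \<subseteq> m" "rs n bs" "B = gen n bs" using B unfolding reg_def by blast
  have "set bs \<subseteq> P" using gen_set[OF idl_n, of bs] quo_sub[OF reg_idl[OF B], of c] P bs by blast
  moreover have "c \<notin> gen n bs" using prm_1[OF P(1)] P(2) bs by (auto simp: quo_def)
  moreover have "dge P j n" using qs unfolding dge_def by blast
  ultimately have "j \<le> length bs" by (intro grade_bound[OF prm_idl[OF P(1)]]) (use P bs bs in \<open>auto simp: quo_def\<close>)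
  then show ?thesis using bs by simp
qed

text \<open>After removal of the last element y, \<open>chain_below\<close> finds inside P an
  associated prime of the shorter sequence. The inclusion is strict, because y lies in P and is
  regular modulo that sequence.\<close>

lemma height_lower:
  assumes "length bs = k" "set bs \<subseteq> m" "rs n bs" "prm P" "P = quo (gen n bs) c"
  shows "\<exists>F. pchain F k \<and> F k = P"
  using assms
proof (induction bs arbitrary: P c k rule: rev_induct)
  case Nil
  have "n \<subseteq> P" using Nil quo_sub[OF idl_n] by auto
  then have "pchain (\<lambda>_. P) 0" using Nil by (simp add: pchain_def)
  then show ?case using Nil by auto
next
  case (snoc y bs)
  let ?B = "gen n bs"
  have Bi: "idl ?B" "n \<subseteq> ?B" using idl_n sub_gen by auto
  have y: "nzd ?B y" "rs n bs" using snoc.prems by (auto simp: rs_append)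
  have BP: "adj ?B y \<subseteq> P" using snoc.prems(5) quo_sub[OF idl_adj[OF Bi(1)]] by (simp add: gen_append)
  then have "?B \<subseteq> P" using sub_adj by blast
  then obtain c' where c': "c' \<notin> ?B" "prm (quo ?B c')" "quo ?B c' \<subseteq> P"
    using chain_below[OF Bi _ snoc.prems(4)] by blast
  have "\<exists>F. pchain F (length bs) \<and> F (length bs) = quo ?B c'"
    by (rule snoc.IH) (use snoc.prems y c' in auto)
  then obtain F where F: "pchain F (length bs)" "F (length bs) = quo ?B c'" by blast
  have "y \<in> P" using BP adj_self[OF Bi(1)] by blast
  moreover have "y \<notin> quo ?B c'" using y(1) c'(1) by (auto simp: quo_def nzd_def)
  ultimately have st: "quo ?B c' \<subset> P" using c'(3) by blast
  have k: "k = Suc (length bs)" using snoc.prems by simp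
  have nP: "n \<subseteq> P" using \<open>?B \<subseteq> P\<close> Bi by blast
  have "pchain (F(k := P)) k"
    using F st snoc.prems(4) nP unfolding pchain_def k by (auto simp: less_Suc_eq le_Suc_eq)
  moreover have "(F(k := P)) k = P" by simp
  ultimately show ?case by blast
qed

theorem cmI_heights:
  assumes K: "cmI k K" and P: "prm P" "P = quo K b"
  shows "\<exists>F. pchain F k \<and> F k = P" "pchain F j \<Longrightarrow> F j = P \<Longrightarrow> j \<le> k"
proof -
  obtain bs where bs: "length bs = k" "set bs \<subseteq> K" "rs n bs" "reg (gen n bs) k" "gen n bs \<subseteq> K" using cmI_reg[OF K] by blast
  obtain c where c: "P = quo (gen n bs) c" using assoc_prime_colon[OF K bs(4,5) P] by blast
  show "\<exists>F. pchain F k \<and> F k = P" using height_lower[OF bs(1) _ bs(3) P(1) c] bs(2) cmI_m[OF K] by blast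
  show "pchain F j \<Longrightarrow> F j = P \<Longrightarrow> j \<le> k" using height_upper[OF bs(4) P(1) c] by blast
qed

text \<open>Among the elements that P multiplies into B one lies outside (B, y), by Nakayama. So P
  is contained in an associated prime of (B, y), strictly, as y is regular modulo B. This is the
  inequality between the depth of S/B and the dimension of S/P.\<close>

lemma chain_above:
  assumes "idl B" "n \<subseteq> B" "dge m r B" "prm (quo B c)"
  shows "\<exists>F. pchain F r \<and> F 0 = quo B c"
  using assms
proof (induction r arbitrary: B c)
  case 0
  have "pchain (\<lambda>_. quo B c) 0" using 0 quo_sub[OF 0(1), of c] by (auto simp: pchain_def)
  then show ?case by blast
next
  case (Suc r)
  note B = Suc.prems(1,2) and P = Suc.prems(4)
  obtain y where y: "y \<in> m" "nzd B y" "dge m r (adj B y)" using Suc.prems(3) dge_Suc by blast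
  let ?P = "quo B c"
  have cB: "c \<notin> B" using prm_1[OF P] by (auto simp: quo_def)
  define N where "N = colon B ?P"
  have N: "idl N" "B \<subseteq> N" using B colon_sub by (auto simp: N_def)
  have cN: "c \<in> N" by (auto simp: N_def colon_def quo_def mult.commute)
  have "\<exists>c'\<in>N. c' \<notin> adj B y"
  proof (rule ccontr)
    assume no: "\<not> ?thesis"
    have "N \<subseteq> B"
    proof (rule loc_nak[OF B N(2) N(1) _ y(1)])
      fix z assume z: "z \<in> N"
      then have "z \<in> adj B y" using no by blast
      then obtain w where w: "z - y * w \<in> B" using adj_memb_cong[OF B(1)] by blast
      have "z - (z - y * w) \<in> N" using z w N idl_diff by blast
      then have "y * w \<in> N" by simp
      then have "w \<in> N" using nzd_colon[OF y(2)] unfolding N_def nzd_def by blast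
      then show "\<exists>w\<in>N. z - y * w \<in> B" using w by blast
    qed
    then show False using cN cB by blast
  qed
  then obtain c' where c': "c' \<in> N" "c' \<notin> adj B y" by blast
  have aB: "idl (adj B y)" "n \<subseteq> adj B y" using B sub_adj[of B y] by auto
  obtain e where e: "quo (adj B y) c' \<subseteq> quo (adj B y) e" "prm (quo (adj B y) e)" using quo_prime[OF aB c'(2)] by blast
  obtain F where F: "pchain F r" "F 0 = quo (adj B y) e" using Suc.IH[OF aB y(3) e(2)] by blast
  have "?P \<subseteq> quo (adj B y) c'"
  proof
    fix r assume "r \<in> ?P"
    then have "r * c' \<in> B" using c'(1) by (auto simp: N_def colon_def mult.commute)
    then show "r \<in> quo (adj B y) c'" using sub_adj[of B y] by (auto simp: quo_def)
  qed
  then have "?P \<subseteq> F 0" using e F by blast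
  moreover have "y \<in> F 0" using F quo_sub[OF aB(1), of e] adj_self[OF B(1), of y] by blast
  moreover have "y \<notin> ?P" using y(2) cB by (auto simp: quo_def nzd_def)
  ultimately have st: "?P \<subset> F 0" by blast
  have nP: "n \<subseteq> ?P" using quo_sub[OF B(1)] B(2) by blast
  define G where "G i = (case i of 0 \<Rightarrow> ?P | Suc i \<Rightarrow> F i)" for i
  have "pchain G (Suc r)"
    unfolding pchain_def
  proof (intro conjI allI impI)
    show "prm (G i)" "n \<subseteq> G i" if "i \<le> Suc r" for i
      using that F(1) P nP by (auto simp: G_def pchain_def split: nat.splits)
    show "G i \<subset> G (Suc i)" if "i < Suc r" for i
      using that F(1) st by (cases i) (auto simp: G_def pchain_def)
  qed
  moreover have "G 0 = quo B c" by (simp add: G_def)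
  ultimately show ?case by blast
qed

text \<open>This supplies the complete intersection in \<open>cmI\<close>; the associated prime
  above I gives, through \<open>chain_above\<close>, a lower bound for the dimension of S/I.\<close>

lemma max_regular:
  assumes I: "idl I" "n \<subseteq> I" "1 \<notin> I"
  shows "\<exists>k B c. reg B k \<and> B \<subseteq> I \<and> prm (quo B c) \<and> I \<subseteq> quo B c"
proof -
  have Im: "I \<subseteq> m" using proper_sub_m[OF I] .
  have bound: "k \<le> dim" if "dge I k n" for k
  proof (rule ccontr)
    assume "\<not> k \<le> dim"
    then have "dge m (Suc dim) n" using dge_mono[OF dge_sub[OF that Im], of "Suc dim"] by simp
    then show False using dim by blast
  qed
  have "\<exists>k. dge I k n \<and> \<not> dge I (Suc k) n"
  proof (rule ccontr)
    assume "\<not> ?thesis"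
    then have "dge I k n" for k by (induction k) auto
    then show False using bound[of "Suc dim"] by auto
  qed
  then obtain k where k: "dge I k n" "\<not> dge I (Suc k) n" by blast
  then obtain ys where ys: "length ys = k" "set ys \<subseteq> I" "rs n ys" unfolding dge_def by blast
  let ?B = "gen n ys"
  have "\<not> (\<exists>x\<in>I. nzd ?B x)"
  proof
    assume "\<exists>x\<in>I. nzd ?B x"
    then obtain x where "x \<in> I" "nzd ?B x" by blast
    then have "dge I (Suc k) n" using ys unfolding dge_def by (intro exI[of _ "ys @ [x]"]) (auto simp: rs_append)
    then show False using k by blast
  qed
  then obtain c where "prm (quo ?B c)" "I \<subseteq> quo ?B c" using no_nzd[OF idl_gen[OF idl_n] sub_gen I(1)] by blast
  moreover have "?B \<subseteq> I" using ys I by (intro gen_least) auto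
  moreover have "reg ?B k" unfolding reg_def using ys Im by blast
  ultimately show ?thesis by blast
qed

end

section \<open>Families of ideals over a polynomial ring\<close>

text \<open>\<open>pn K\<close> is the extension of \<open>K\<close> to \<open>S[T]\<close> and \<open>fib \<K> t\<close> the specialization of \<open>\<K>\<close> at \<open>T = t\<close>.\<close>

definition pn :: "'b::comm_ring_1 set \<Rightarrow> 'b poly set" where
  "pn K = {F. \<forall>i. coeff F i \<in> K}"

definition fib :: "'b::comm_ring_1 poly set \<Rightarrow> 'b \<Rightarrow> 'b set" where
  "fib \<K> t = (\<lambda>F. poly F t) ` \<K>"

definition X :: "'b::comm_ring_1 \<Rightarrow> 'b poly" where
  "X t = [:- t, 1:]"

text \<open>\<open>X t\<close> is T - t, so this expresses flatness at t of the one-parameter family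
  with total space S[T]/\<K>.\<close>

definition flat :: "'b::comm_ring_1 poly set \<Rightarrow> 'b \<Rightarrow> bool" where
  "flat \<K> t \<longleftrightarrow> nzd \<K> (X t)"

lemma idl_pn [simp, intro]: "idl K \<Longrightarrow> idl (pn K)"
  unfolding idl_def[of "pn K"] by (auto simp: pn_def idl_add coeff_mult intro!: idl_sum idl_mult)

lemma pn_mono: "K \<subseteq> L \<Longrightarrow> pn K \<subseteq> pn L"
  by (auto simp: pn_def)

lemma const_pn: "idl K \<Longrightarrow> [:c:] \<in> pn K \<longleftrightarrow> c \<in> K"
proof
  assume "idl K" "[:c:] \<in> pn K"
  then have "coeff [:c:] 0 \<in> K" unfolding pn_def by blast
  then show "c \<in> K" by simp
qed (auto simp: pn_def coeff_pCons split: nat.splits)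

lemma poly_pn: "idl K \<Longrightarrow> F \<in> pn K \<Longrightarrow> poly F t \<in> K"
  unfolding poly_altdef by (rule idl_sum) (auto simp: pn_def idl_mult2)

lemma poly_X [simp]: "poly (X t) t = 0"
  by (simp add: X_def)

lemma poly_root_X: assumes "poly F t = 0" shows "\<exists>G. F = X t * G"
proof -
  have "[:- t, 1:] dvd F" using assms by (simp add: poly_eq_0_iff_dvd)
  then show ?thesis unfolding X_def dvd_def .
qed

lemma idl_fib [simp, intro]: assumes K: "idl \<K>" shows "idl (fib \<K> t)"
  unfolding idl_def
proof (intro conjI ballI allI)
  show "0 \<in> fib \<K> t" using K by (auto simp: fib_def intro!: image_eqI[of _ _ 0])
  fix a b r assume "a \<in> fib \<K> t"
  then obtain F where F: "F \<in> \<K>" "a = poly F t" by (auto simp: fib_def)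
  then show "r * a \<in> fib \<K> t" using idl_mult[OF K F(1), of "[:r:]"] by (auto simp: fib_def intro!: image_eqI[of _ _ "[:r:] * F"])
  assume "b \<in> fib \<K> t"
  then obtain G where G: "G \<in> \<K>" "b = poly G t" by (auto simp: fib_def)
  then show "a + b \<in> fib \<K> t" using F idl_add[OF K F(1) G(1)] by (auto simp: fib_def intro!: image_eqI[of _ _ "F + G"])
qed

lemma fib_pn: assumes K: "idl K" shows "fib (pn K) t = K"
proof
  show "fib (pn K) t \<subseteq> K" using poly_pn[OF K] by (auto simp: fib_def)
  show "K \<subseteq> fib (pn K) t" unfolding fib_def using const_pn[OF K] by (auto intro!: image_eqI[of _ _ "[:_:]"])
qed

lemma fib_mono: "\<K> \<subseteq> \<L> \<Longrightarrow> fib \<K> t \<subseteq> fib \<L> t"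
  by (auto simp: fib_def)

text \<open>S[T]/(\<K>, T - t) is S modulo the specialization, so that questions about a fibre
  become questions modulo \<open>X t\<close>.\<close>

lemma fib_iff: assumes K: "idl \<K>" shows "poly F t \<in> fib \<K> t \<longleftrightarrow> F \<in> adj \<K> (X t)"
proof
  assume "poly F t \<in> fib \<K> t"
  then obtain G where G: "G \<in> \<K>" "poly F t = poly G t" by (auto simp: fib_def)
  then have "poly (F - G) t = 0" by simp
  then obtain H where "F - G = X t * H" using poly_root_X by blast
  then have "F = G + X t * H" by (simp add: algebra_simps)
  then show "F \<in> adj \<K> (X t)" using G adjI by blast
next
  assume "F \<in> adj \<K> (X t)"
  then obtain G H where "F = G + X t * H" "G \<in> \<K>" using adjE by blast
  then show "poly F t \<in> fib \<K> t" by (auto simp: fib_def)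
qed

lemma fib_adj: "fib (adj \<K> F) t = adj (fib \<K> t) (poly F t)"
proof
  show "fib (adj \<K> F) t \<subseteq> adj (fib \<K> t) (poly F t)" by (force simp: fib_def adj_def)
  show "adj (fib \<K> t) (poly F t) \<subseteq> fib (adj \<K> F) t"
  proof
    fix a assume "a \<in> adj (fib \<K> t) (poly F t)"
    then obtain G r where "a = poly G t + poly F t * r" "G \<in> \<K>" by (auto simp: fib_def adj_def)
    then have "a = poly (G + F * [:r:]) t" "G + F * [:r:] \<in> adj \<K> F" using adjI[of G \<K> F "[:r:]"] by simp_all
    then show "a \<in> fib (adj \<K> F) t" unfolding fib_def by blast
  qed
qed

lemma fib_gen: "fib (gen \<K> Fs) t = gen (fib \<K> t) (map (\<lambda>F. poly F t) Fs)"
  by (induction Fs arbitrary: \<K>) (auto simp: fib_adj)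

lemma nzd_fib: assumes K: "idl \<K>" shows "nzd (fib \<K> t) (poly F t) \<longleftrightarrow> nzd (adj \<K> (X t)) F"
proof
  assume *: "nzd (fib \<K> t) (poly F t)"
  show "nzd (adj \<K> (X t)) F"
    unfolding nzd_def
  proof (intro allI impI)
    fix G assume "F * G \<in> adj \<K> (X t)"
    then have "poly F t * poly G t \<in> fib \<K> t" using fib_iff[OF K, of "F * G"] by simp
    then show "G \<in> adj \<K> (X t)" using * fib_iff[OF K] unfolding nzd_def by blast
  qed
next
  assume *: "nzd (adj \<K> (X t)) F"
  show "nzd (fib \<K> t) (poly F t)"
    unfolding nzd_def
  proof (intro allI impI)
    fix r assume "poly F t * r \<in> fib \<K> t"
    then have "F * [:r:] \<in> adj \<K> (X t)" using fib_iff[OF K, of "F * [:r:]"] by (simp add: mult.commute)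
    then have "[:r:] \<in> adj \<K> (X t)" using * unfolding nzd_def by blast
    then show "r \<in> fib \<K> t" using fib_iff[OF K, of "[:r:]" t] by simp
  qed
qed

text \<open>The coefficients of G are found to lie in K from the top down, each from (T - t) G and
  the next higher one.\<close>

lemma flat_pn: assumes K: "idl K" shows "flat (pn K) t"
  unfolding flat_def nzd_def
proof (intro allI impI)
  fix G assume G: "X t * G \<in> pn K"
  have XG: "X t * G = smult (- t) G + pCons 0 G" by (simp add: X_def)
  have *: "coeff G i - t * coeff G (Suc i) \<in> K" for i
  proof -
    have "coeff (X t * G) (Suc i) \<in> K" using G unfolding pn_def by blast
    then show ?thesis unfolding XG by simp
  qed
  have "coeff G i \<in> K" if "Suc (degree G) - i = j" for i j
    using that
  proof (induction j arbitrary: i)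
    case 0 then show ?case using coeff_eq_0[of G i] K by simp
  next
    case (Suc j)
    then have "coeff G (Suc i) \<in> K" by simp
    then have "(coeff G i - t * coeff G (Suc i)) + t * coeff G (Suc i) \<in> K" using * K idl_add idl_mult by blast
    then show ?case by simp
  qed
  then show "G \<in> pn K" by (auto simp: pn_def)
qed

lemma flat_adj:
  assumes K: "idl \<K>" and f: "flat \<K> t" and F: "nzd (fib \<K> t) (poly F t)"
  shows "flat (adj \<K> F) t"
  unfolding flat_def by (rule nzd_swap[OF K f[unfolded flat_def]]) (use F nzd_fib[OF K] in blast)

lemma flat_gen:
  assumes "idl \<K>" "flat \<K> t" "rs (fib \<K> t) (map (\<lambda>F. poly F t) Fs)"
  shows "flat (gen \<K> Fs) t"
  using assms
proof (induction Fs arbitrary: \<K>)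
  case (Cons F Fs)
  then show ?case using flat_adj[of \<K> t F] by (simp add: fib_adj)
qed simp

text \<open>Hilbert's basis theorem for (S/n)[T]: choose each f_k of least degree outside the ideal
  of its predecessors and apply \<open>seqN\<close> to the leading coefficients.\<close>

lemma (in nring) fg_poly:
  assumes I: "idl I" "pn n \<subseteq> I"
  shows "\<exists>fs. set fs \<subseteq> I \<and> I = gen (pn n) fs"
proof (rule ccontr)
  assume no: "\<not> ?thesis"
  note pn = idl_pn[OF idl_n]
  define P where "P fs f \<longleftrightarrow> f \<in> I \<and> f \<notin> gen (pn n) fs" for fs f
  have "\<exists>f. P fs f" if "set fs \<subseteq> I" for fs
    using no that gen_least[OF I(1) I(2) that] unfolding P_def by blast
  then have "\<exists>f. P fs f \<and> (\<forall>f'. P fs f' \<longrightarrow> degree f \<le> degree f')" if "set fs \<subseteq> I" for fs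
    using that ex_has_least_nat[of "P fs" _ degree] by blast
  then obtain g where g: "\<And>fs. set fs \<subseteq> I \<Longrightarrow> P fs (g fs) \<and> (\<forall>f'. P fs f' \<longrightarrow> degree (g fs) \<le> degree f')" by metis
  define l where "l k = ((\<lambda>fs. fs @ [g fs]) ^^ k) []" for k
  define f where "f k = g (l k)" for k
  have l: "l k = map f [0..<k]" for k
    by (induction k) (simp_all add: l_def f_def)
  have lI: "set (l k) \<subseteq> I" for k
    by (induction k) (use g in \<open>auto simp: l_def P_def\<close>)
  have f: "f k \<in> I" "f k \<notin> gen (pn n) (map f [0..<k])" "\<And>h. h \<in> I \<Longrightarrow> h \<notin> gen (pn n) (map f [0..<k]) \<Longrightarrow> degree (f k) \<le> degree h" for k
    using g[OF lI[of k]] unfolding f_def[symmetric] unfolding l P_def by blast+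
  have "degree (f i) \<le> degree (f k)" if "i \<le> k" for i k
  proof (rule f(3)[OF f(1)])
    have "gen (pn n) (map f [0..<i]) \<subseteq> gen (pn n) (map f [0..<k])"
      using that by (intro gen_least idl_gen pn sub_gen) (use gen_set[OF pn, of "map f [0..<k]"] in auto)
    then show "f k \<notin> gen (pn n) (map f [0..<i])" using f(2)[of k] by blast
  qed
  note mono = this
  define a where "a k = coeff (f k) (degree (f k))" for k
  obtain k where k: "a k \<in> gen n (map a [0..<k])" using seqN[OF idl_n order_refl] by blast
  define d where "d = degree (f k)"
  have "\<exists>h\<in>gen (pn n) (map f [0..<j]). degree h \<le> d \<and> coeff h d - x \<in> n" if "x \<in> gen n (map a [0..<j])" "j \<le> k" for x j
    using that
  proof (induction j arbitrary: x)
    case 0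
    then show ?case using idl_uminus[OF idl_n] pn by (intro bexI[of _ 0]) auto
  next
    case (Suc j)
    have "x \<in> adj (gen n (map a [0..<j])) (a j)" using Suc.prems(1) by (simp add: gen_append)
    then obtain x1 r where x: "x = x1 + a j * r" "x1 \<in> gen n (map a [0..<j])" using adjE by blast
    obtain h where h: "h \<in> gen (pn n) (map f [0..<j])" "degree h \<le> d" "coeff h d - x1 \<in> n"
      using Suc.IH[OF x(2)] Suc.prems(2) by auto
    define e where "e = d - degree (f j)"
    have ed: "e + degree (f j) = d" using mono[of j k] Suc.prems(2) by (simp add: e_def d_def)
    let ?h = "h + f j * monom r e"
    have "?h \<in> gen (pn n) (map f [0..<Suc j])" using h(1) adjI by (auto simp: gen_append)
    moreover have "degree (f j * monom r e) \<le> d"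
      using degree_mult_le[of "f j" "monom r e"] degree_monom_le[of r e] ed by linarith
    then have "degree ?h \<le> d" using h(2) degree_add_le by blast
    moreover have "coeff (f j * monom r e) d = a j * r"
      using coeff_monom_mult[of r e "f j" d] unfolding ed[symmetric] a_def by (simp add: mult.commute[of _ "monom r e"] mult.commute[of r])
    then have "coeff ?h d - x = coeff h d - x1" by (simp add: x)
    then have "coeff ?h d - x \<in> n" using h(3) by (simp only:)
    ultimately show ?case by blast
  qed
  from this[OF k] obtain h where h: "h \<in> gen (pn n) (map f [0..<k])" "degree h \<le> d" "coeff h d - a k \<in> n" by blast
  note G = idl_gen[OF pn, of "map f [0..<k]"]
  have hI: "h \<in> I" using h(1) gen_least[OF I, of "map f [0..<k]"] f(1) by auto
  define c where "c = coeff (f k) d - coeff h d"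
  have cn: "c \<in> n" using idl_uminus[OF idl_n h(3)] by (simp add: c_def a_def d_def)
  \<comment> \<open>The coefficients of degree d agree only modulo n; a monomial with coefficient in
    n removes the rest.\<close>
  have mono_pn: "monom c d \<in> pn n" using cn idl_n by (auto simp: pn_def)
  define w where "w = f k - h - monom c d"
  have wI: "w \<in> I" unfolding w_def using f(1) hI mono_pn I idl_diff by blast
  have w: "w \<notin> gen (pn n) (map f [0..<k])"
  proof
    assume "w \<in> gen (pn n) (map f [0..<k])"
    moreover have "monom c d \<in> gen (pn n) (map f [0..<k])" using mono_pn sub_gen by blast
    ultimately have "w + h + monom c d \<in> gen (pn n) (map f [0..<k])" using h(1) G idl_add by blast
    then show False using f(2)[of k] by (simp add: w_def)
  qed
  have w0: "w \<noteq> 0" using w G by auto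
  have "degree w \<le> d" unfolding w_def using h(2) degree_monom_le[of c d] d_def
    by (intro degree_diff_le) auto
  moreover have "coeff w d = 0" by (simp add: w_def c_def)
  ultimately have "degree w < d" using w0 by (metis eq_zero_or_degree_less)
  moreover have "d \<le> degree w" using f(3)[OF wI w] d_def by simp
  ultimately show False by simp
qed

lemma (in nring) nring_poly: "nring (pn n)"
proof
  show "idl (pn n)" using idl_n by blast
  fix F :: "'b poly set set"
  assume F: "F \<noteq> {}" "\<And>I. I \<in> F \<Longrightarrow> idl I \<and> pn n \<subseteq> I"
  show "\<exists>M\<in>F. \<forall>I\<in>F. M \<subseteq> I \<longrightarrow> I = M"
  proof (rule ccontr)
    assume "\<not> ?thesis"
    then have "\<forall>M\<in>F. \<exists>I\<in>F. M \<subset> I" by blast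
    then obtain s where s: "\<And>M. M \<in> F \<Longrightarrow> s M \<in> F \<and> M \<subset> s M" by metis
    obtain M where M: "M \<in> F" using F by blast
    define c where "c i = (s ^^ i) M" for i
    have c: "c i \<in> F" for i by (induction i) (auto simp: c_def M s)
    have cs: "c i \<subset> c (Suc i)" for i using s[OF c[of i]] by (simp add: c_def)
    have cm: "c i \<subseteq> c j" if "i \<le> j" for i j
      using lift_Suc_mono_le[of c, OF _ that] cs by blast
    let ?U = "\<Union>i. c i"
    have U: "idl ?U"
      unfolding idl_def
    proof (intro conjI ballI allI)
      have ci: "idl (c i)" for i using c F by blast
      show "0 \<in> ?U" using idl_0[OF ci] by blast
      fix a b r assume "a \<in> ?U"
      then obtain i where i: "a \<in> c i" by blast
      then show "r * a \<in> ?U" using idl_mult[OF ci] by blast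
      assume "b \<in> ?U"
      then obtain j where j: "b \<in> c j" by blast
      have "a \<in> c (max i j)" "b \<in> c (max i j)" using i j cm[OF max.cobounded1, of i j] cm[OF max.cobounded2, of j i] by blast+
      then have "a + b \<in> c (max i j)" using idl_add[OF ci] by blast
      then show "a + b \<in> ?U" by blast
    qed
    have nU: "pn n \<subseteq> ?U" using c[of 0] F by blast
    obtain fs where fs: "set fs \<subseteq> ?U" "?U = gen (pn n) fs" using fg_poly[OF U nU] by (elim exE conjE)
    have "\<exists>i. set gs \<subseteq> c i" if "set gs \<subseteq> ?U" for gs
      using that
    proof (induction gs)
      case (Cons a gs)
      then obtain i j where "set gs \<subseteq> c i" "a \<in> c j" by auto
      then have "set (a # gs) \<subseteq> c (max i j)" using cm[OF max.cobounded1, of i j] cm[OF max.cobounded2, of j i] by auto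
      then show ?case by blast
    qed simp
    then obtain i where i: "set fs \<subseteq> c i" using fs by blast
    have "?U \<subseteq> c i" unfolding fs(2) by (rule gen_least) (use i c F in auto)
    then show False using cs[of i] by blast
  qed
qed

section \<open>Properties that hold for almost all specializations\<close>

context nloc
begin

text \<open>For one good t_0 write F(t) = (t - t_0) G(t) + F(t_0). Outside the class of t_0 the
  first factor is a unit, so G inherits the hypothesis with smaller degree.\<close>

lemma cofin_interp:
  assumes Z: "idl Z" and F: "cofin (\<lambda>t. poly F t \<in> Z)" and nZ: "n \<subseteq> Z"
  shows "poly F s \<in> Z"
  using F
proof (induction "degree F" arbitrary: F)
  case 0
  then obtain c where "F = [:c:]" by (metis degree_eq_zeroE)
  then show ?case using cofin_ex[OF 0(2)] by auto
next
  case (Suc d)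
  obtain t0 where t0: "poly F t0 \<in> Z" using cofin_ex[OF Suc(3)] by blast
  define G where "G = synthetic_div F t0"
  have FG: "F = X t0 * G + [:poly F t0:]"
    using synthetic_div_correct'[of t0 F] by (simp add: G_def X_def)
  have ev: "poly F t = (t - t0) * poly G t + poly F t0" for t
    by (subst FG) (simp add: X_def algebra_simps)
  have "d = degree G" using Suc(2) by (simp add: G_def degree_synthetic_div)
  moreover have "cofin (\<lambda>t. poly G t \<in> Z)"
  proof (rule cofin_mono[OF cofin_conj[OF Suc(3) cofin_ne[of t0]]])
    fix t assume t: "poly F t \<in> Z \<and> t - t0 \<notin> m"
    then have "(t - t0) * poly G t \<in> Z" using ev[of t] t0 idl_add_cancel[OF Z] by simp
    then show "poly G t \<in> Z" using unit_cancel[OF Z nZ] t by blast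
  qed
  ultimately have "poly G s \<in> Z" using Suc(1) by blast
  then show ?case using ev[of s] t0 Z by (simp add: idl_add idl_mult)
qed

text \<open>A nonzero polynomial over the residue field has finitely many roots; the division step
  is that of \<open>cofin_interp\<close>.\<close>

lemma cofin_poly_unit:
  assumes "poly F s \<notin> m" shows "cofin (\<lambda>t. poly F t \<notin> m)"
  using assms
proof (induction "degree F" arbitrary: F)
  case 0
  then obtain c where "F = [:c:]" by (metis degree_eq_zeroE)
  then show ?case using 0 cofin_True by (auto elim: cofin_mono)
next
  case (Suc d)
  show ?case
  proof (cases "\<exists>t. poly F t \<in> m")
    case False then show ?thesis using cofin_True by (auto elim: cofin_mono)
  next
    case True
    then obtain t0 where t0: "poly F t0 \<in> m" by blast
    define G where "G = synthetic_div F t0"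
    have FG: "F = X t0 * G + [:poly F t0:]"
      using synthetic_div_correct'[of t0 F] by (simp add: G_def X_def)
    have ev: "poly F t = (t - t0) * poly G t + poly F t0" for t
      by (subst FG) (simp add: X_def algebra_simps)
    have "d = degree G" using Suc(2) by (simp add: G_def degree_synthetic_div)
    moreover have "poly G s \<notin> m" using ev[of s] t0 Suc(3) idl_m by (auto simp: idl_add idl_mult)
    ultimately have "cofin (\<lambda>t. poly G t \<notin> m)" using Suc(1) by blast
    then show ?thesis
    proof (rule cofin_mono[OF cofin_conj[OF _ cofin_ne[of t0]]])
      fix t assume "poly G t \<notin> m \<and> t - t0 \<notin> m"
      then have "(t - t0) * poly G t \<notin> m" using m_prime by blast
      then show "poly F t \<notin> m" using ev[of t] t0 idl_add_cancel[OF idl_m] by simp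
    qed
  qed
qed

interpretation P: nring "pn n" by (rule nring_poly)

text \<open>Up to sign conventions T - t is a + \<tau> t b with a = T, b = -1 and \<tau> t the
  constant t, so \<open>nzd_cofinite\<close> over S[T] applies.\<close>

lemma cofin_flat:
  assumes K: "idl \<K>" "pn n \<subseteq> \<K>" shows "cofin (flat \<K>)"
proof -
  have "nzd \<K> (-1)" using idl_uminus[OF K(1)] by (auto simp: nzd_def) (metis minus_minus)
  moreover have "\<exists>v. ([:t:] - [:x:]) * v - 1 \<in> pn n" if tx: "t - x \<notin> m" for t x
  proof -
    obtain v where "(t - x) * v - 1 \<in> n" using unit_differences[OF tx] by blast
    then have "[:(t - x) * v - 1:] \<in> pn n" using const_pn[OF idl_n] by blast
    moreover have "[:(t - x) * v - 1:] = ([:t:] - [:x:]) * [:v:] - 1" by (simp add: one_pCons algebra_simps)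
    ultimately show ?thesis by metis
  qed
  ultimately have "\<exists>S. finite S \<and> (\<forall>t. (\<forall>x\<in>S. t - x \<notin> m) \<longrightarrow> nzd \<K> ([:0, 1:] + [:t:] * (-1)))"
    by (intro P.nzd_cofinite[OF K]) auto
  moreover have eq: "[:0, 1:] + [:t:] * (-1) = X t" for t by (simp add: X_def)
  ultimately show ?thesis unfolding cofin_def flat_def eq by blast
qed

text \<open>Let N be the annihilator of F modulo \<K>. Regularity in the fibre at 0 and flatness
  there give N = T N modulo \<K>, so some D = 1 - T a kills N. Wherever D(t) is a unit and the
  family with F adjoined is flat, F is regular in the fibre at t.\<close>

lemma cofin_nzd:
  assumes K: "idl \<K>" "pn n \<subseteq> \<K>" and f: "flat \<K> 0" and F: "nzd (fib \<K> 0) (poly F 0)"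
  shows "cofin (\<lambda>t. nzd (fib \<K> t) (poly F t))"
proof -
  let ?N = "{G. F * G \<in> \<K>}"
  have N: "idl ?N" using idl_quo[OF K(1), of F] by (simp add: quo_def mult.commute)
  have "\<exists>H\<in>?N. G - X 0 * H \<in> \<K>" if G: "G \<in> ?N" for G
  proof -
    have "F * G \<in> adj \<K> (X 0)" using G sub_adj by blast
    then have "G \<in> adj \<K> (X 0)" using F nzd_fib[OF K(1)] unfolding nzd_def by blast
    then obtain H where H: "G - X 0 * H \<in> \<K>" using adj_memb_cong[OF K(1)] by blast
    have "X 0 * (F * H) = F * G - F * (G - X 0 * H)" by (simp add: algebra_simps)
    also have "\<dots> \<in> \<K>" using G H K by (simp add: idl_diff idl_mult)
    finally have "F * H \<in> \<K>" using f unfolding flat_def nzd_def by blast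
    then show ?thesis using H by blast
  qed
  then obtain a where a: "\<And>G. G \<in> ?N \<Longrightarrow> (1 - X 0 * a) * G \<in> \<K>"
    using P.nak[OF K, of ?N "X 0"] N K(1) idl_mult by (metis (no_types, lifting) mem_Collect_eq subsetI)
  let ?D = "1 - X 0 * a"
  have "poly ?D 0 \<notin> m" using m1 by simp
  then have "cofin (\<lambda>t. poly ?D t \<notin> m \<and> flat (adj \<K> F) t)"
    by (intro cofin_conj cofin_poly_unit[of ?D 0] cofin_flat) (use K sub_adj[of \<K> F] in auto)
  then show ?thesis
  proof (rule cofin_mono)
    fix t assume t: "poly ?D t \<notin> m \<and> flat (adj \<K> F) t"
    have nf: "n \<subseteq> fib \<K> t" using fib_mono[OF K(2)] fib_pn[OF idl_n] by blast
    have "nzd (adj \<K> (X t)) F"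
      unfolding nzd_def
    proof (intro allI impI)
      fix G assume "F * G \<in> adj \<K> (X t)"
      then obtain c where c: "F * G - X t * c \<in> \<K>" using adj_memb_cong[OF K(1)] by blast
      have "- (F * G - X t * c) \<in> \<K>" using c K idl_uminus by blast
      then have "X t * c - F * G \<in> \<K>" by (simp add: algebra_simps)
      then have "X t * c \<in> adj \<K> F" using adj_memI[OF K(1)] by blast
      then have "c \<in> adj \<K> F" using t unfolding flat_def nzd_def by blast
      then obtain c' where c': "c - F * c' \<in> \<K>" using adj_memb_cong[OF K(1)] by blast
      have "F * (G - X t * c') = (F * G - X t * c) + X t * (c - F * c')" by (simp add: algebra_simps)
      also have "\<dots> \<in> \<K>" using c c' K by (simp only: idl_add idl_mult)
      finally have "?D * (G - X t * c') \<in> \<K>" using a by blast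
      then have "poly (?D * (G - X t * c')) t \<in> fib \<K> t" unfolding fib_def by blast
      then have "poly ?D t * poly G t \<in> fib \<K> t" by simp
      then have "poly G t \<in> fib \<K> t" using unit_cancel[OF idl_fib[OF K(1)] nf] t by blast
      then show "G \<in> adj \<K> (X t)" using fib_iff[OF K(1)] by blast
    qed
    then show "nzd (fib \<K> t) (poly F t)" using nzd_fib[OF K(1)] by blast
  qed
qed

lemma cofin_rs:
  assumes "idl \<K>" "pn n \<subseteq> \<K>" "flat \<K> 0" "rs (fib \<K> 0) (map (\<lambda>F. poly F 0) Fs)"
  shows "cofin (\<lambda>t. rs (fib \<K> t) (map (\<lambda>F. poly F t) Fs))"
  using assms
proof (induction Fs arbitrary: \<K>)
  case Nil then show ?case using cofin_True by simp
next
  case (Cons F Fs)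
  have "flat (adj \<K> F) 0" using flat_adj[OF Cons.prems(1,3)] Cons.prems(4) by simp
  then have "cofin (\<lambda>t. rs (fib (adj \<K> F) t) (map (\<lambda>F. poly F t) Fs))"
    using Cons.IH[of "adj \<K> F"] Cons.prems sub_adj[of \<K> F] by (auto simp: fib_adj)
  moreover have "cofin (\<lambda>t. nzd (fib \<K> t) (poly F t))" using cofin_nzd[OF Cons.prems(1-3)] Cons.prems(4) by simp
  ultimately have "cofin (\<lambda>t. rs (fib (adj \<K> F) t) (map (\<lambda>F. poly F t) Fs) \<and> nzd (fib \<K> t) (poly F t))"
    by (rule cofin_conj)
  then show ?case by (rule cofin_mono) (simp add: fib_adj)
qed

end

section \<open>Linkage in families\<close>

context gor
begin

interpretation P: nring "pn n" by (rule nring_poly)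

lemma n_fib: "pn n \<subseteq> \<K> \<Longrightarrow> n \<subseteq> fib \<K> t"
  using fib_mono[of "pn n" \<K> t] fib_pn[OF idl_n] by blast

lemma fib_gen_n: "fib (gen (pn n) Fs) t = gen n (map (\<lambda>F. poly F t) Fs)"
  by (simp add: fib_gen fib_pn[OF idl_n])

lemma flat_gen_n: "rs n (map (\<lambda>F. poly F t) Fs) \<Longrightarrow> flat (gen (pn n) Fs) t"
  by (rule flat_gen) (auto simp: fib_pn[OF idl_n] idl_n flat_pn)

text \<open>The argument of \<open>colon_adj\<close> with y = T - t. Since S[T] is not local,
  \<open>mhom_nak\<close> leaves a factor 1 - (T - t) a, which specializes to 1. Its hypothesis
  \<open>red\<close> holds because a homomorphism on the family induces one on the fibre, and that
  is a multiplication by \<open>ext_mult\<close>.\<close>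

lemma link_fib:
  assumes K: "idl \<K>" "pn n \<subseteq> \<K>" and flat: "flat \<K> t" and Fs: "set Fs \<subseteq> \<K>" "rs n (map (\<lambda>F. poly F t) Fs)"
    and B: "B = gen n (map (\<lambda>F. poly F t) Fs)" "reg B k" and dg: "dge m (dim - k) (fib \<K> t)"
  shows "fib (colon (gen (pn n) Fs) \<K>) t = colon B (fib \<K> t)" and "flat (colon (gen (pn n) Fs) \<K>) t"
proof -
  let ?A = "gen (pn n) Fs"
  let ?K = "fib \<K> t"
  have A: "idl ?A" "pn n \<subseteq> ?A" using idl_n sub_gen by auto
  have AK: "?A \<subseteq> \<K>" using gen_least[OF K Fs(1)] .
  have fA: "fib ?A t = B" by (simp add: B fib_gen_n)
  note flatA = flat_gen_n[OF Fs(2)]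
  have Bi: "idl B" using reg_idl[OF B(2)] .
  have BK: "B \<subseteq> ?K" using fib_mono[OF AK] fA by blast
  show "flat (colon ?A \<K>) t" using flatA nzd_colon unfolding flat_def by blast
  show "fib (colon ?A \<K>) t = colon B ?K"
  proof
    show "fib (colon ?A \<K>) t \<subseteq> colon B ?K"
    proof
      fix f assume "f \<in> fib (colon ?A \<K>) t"
      then obtain F where F: "F \<in> colon ?A \<K>" "f = poly F t" by (auto simp: fib_def)
      have "f * poly G t \<in> B" if "G \<in> \<K>" for G
      proof -
        have "F * G \<in> ?A" using F that by (auto simp: colon_def)
        then have "poly (F * G) t \<in> fib ?A t" unfolding fib_def by blast
        then show ?thesis using fA F by simp
      qed
      then show "f \<in> colon B ?K" by (auto simp: colon_def fib_def)
    qed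
    show "colon B ?K \<subseteq> fib (colon ?A \<K>) t"
    proof
      fix f assume f: "f \<in> colon B ?K"
      have "\<forall>G\<in>\<K>. \<exists>H. [:f:] * G - X t * H \<in> ?A"
      proof
        fix G assume "G \<in> \<K>"
        then have "f * poly G t \<in> fib ?A t" using f fA by (auto simp: colon_def fib_def)
        then have "[:f:] * G \<in> adj ?A (X t)" using fib_iff[OF A(1), of "[:f:] * G" t] by simp
        then show "\<exists>H. [:f:] * G - X t * H \<in> ?A" using adj_memb_cong[OF A(1)] by blast
      qed
      then obtain \<phi> where \<phi>: "\<And>G. G \<in> \<K> \<Longrightarrow> [:f:] * G - X t * \<phi> G \<in> ?A" by metis
      have hom: "mhom \<K> ?A \<phi>" by (rule mhom_divide[OF A(1) K(1) AK flatA[unfolded flat_def] \<phi>])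
      have red: "\<exists>h. \<forall>G\<in>\<K>. \<psi> G - h * G \<in> adj ?A (X t)" if \<psi>: "mhom \<K> ?A \<psi>" for \<psi>
      proof -
        define g where "g k = (SOME G. G \<in> \<K> \<and> poly G t = k)" for k
        have g: "g k \<in> \<K>" "poly (g k) t = k" if "k \<in> ?K" for k
          using someI_ex[of "\<lambda>G. G \<in> \<K> \<and> poly G t = k"] that unfolding g_def fib_def by auto
        define \<rho> where "\<rho> k = poly (\<psi> (g k)) t" for k
        have evA: "poly F t - poly G t \<in> B" if "F - G \<in> ?A" for F G
          using that fA unfolding fib_def by (metis imageI poly_diff)
        \<comment> \<open>Two members of \<K> with the same value at t differ by (T - t) H, and
          flatness puts H into \<K>. Hence \<rho> does not depend, modulo B, on the chosen
          preimage.\<close>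
        have ind: "\<rho> (poly G t) - poly (\<psi> G) t \<in> B" if G: "G \<in> \<K>" for G
        proof -
          have kG: "poly G t \<in> ?K" using G by (auto simp: fib_def)
          have "poly (g (poly G t) - G) t = 0" using g(2)[OF kG] by simp
          then obtain H where H: "g (poly G t) - G = X t * H" using poly_root_X by blast
          have XH: "X t * H \<in> \<K>" using idl_diff[OF K(1) g(1)[OF kG] G] H by simp
          then have HK: "H \<in> \<K>" using flat unfolding flat_def nzd_def by blast
          have "\<psi> (G + X t * H) - (\<psi> G + \<psi> (X t * H)) \<in> ?A" using \<psi> G XH by (simp add: mhom_def)
          moreover have gG: "G + X t * H = g (poly G t)" using H by (simp add: algebra_simps)
          ultimately have 1: "\<rho> (poly G t) - (poly (\<psi> G) t + poly (\<psi> (X t * H)) t) \<in> B"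
            using evA[of "\<psi> (g (poly G t))" "\<psi> G + \<psi> (X t * H)"] by (simp add: \<rho>_def)
          have "\<psi> (X t * H) - X t * \<psi> H \<in> ?A" using \<psi> HK by (simp add: mhom_def)
          then have 2: "poly (\<psi> (X t * H)) t \<in> B" using evA[of "\<psi> (X t * H)" "X t * \<psi> H"] by simp
          show ?thesis using idl_add[OF Bi 1 2] by (simp add: algebra_simps)
        qed
        have "mhom ?K B \<rho>"
          unfolding mhom_def
        proof (intro conjI ballI allI)
          fix a b assume ab: "a \<in> ?K" "b \<in> ?K"
          have s: "g a + g b \<in> \<K>" "poly (g a + g b) t = a + b" using g ab idl_add[OF K(1)] by auto
          have 1: "\<rho> (a + b) - poly (\<psi> (g a + g b)) t \<in> B" using ind[OF s(1)] s(2) by simp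
          have "\<psi> (g a + g b) - (\<psi> (g a) + \<psi> (g b)) \<in> ?A" using \<psi> g ab by (simp add: mhom_def)
          then have 2: "poly (\<psi> (g a + g b)) t - (\<rho> a + \<rho> b) \<in> B"
            using evA[of "\<psi> (g a + g b)" "\<psi> (g a) + \<psi> (g b)"] by (simp add: \<rho>_def)
          show "\<rho> (a + b) - (\<rho> a + \<rho> b) \<in> B" using idl_add[OF Bi 1 2] by (simp add: algebra_simps)
        next
          fix a r assume a: "a \<in> ?K"
          have s: "[:r:] * g a \<in> \<K>" "poly ([:r:] * g a) t = r * a" using g a idl_mult[OF K(1), of "g a" "[:r:]"] by auto
          have 1: "\<rho> (r * a) - poly (\<psi> ([:r:] * g a)) t \<in> B" using ind[OF s(1)] s(2) by simp
          have "\<psi> ([:r:] * g a) - [:r:] * \<psi> (g a) \<in> ?A" using \<psi> g a unfolding mhom_def by blast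
          then have 2: "poly (\<psi> ([:r:] * g a)) t - r * \<rho> a \<in> B"
            using evA[of "\<psi> ([:r:] * g a)" "[:r:] * \<psi> (g a)"] by (simp add: \<rho>_def)
          show "\<rho> (r * a) - r * \<rho> a \<in> B" using idl_add[OF Bi 1 2] by (simp add: algebra_simps)
        next
          fix b assume "b \<in> B"
          then obtain G where G: "G \<in> ?A" "b = poly G t" using fA by (auto simp: fib_def)
          have 1: "\<rho> b - poly (\<psi> G) t \<in> B" using ind[of G] G AK by blast
          have "\<psi> G \<in> ?A" using \<psi> G by (simp add: mhom_def)
          then have "poly (\<psi> G) t \<in> B" using fA unfolding fib_def by blast
          then show "\<rho> b \<in> B" using 1 idl_cong[OF Bi] by blast
        qed
        then obtain h where h: "\<forall>a\<in>?K. \<rho> a - h * a \<in> B" using ext_mult[OF B(2) idl_fib[OF K(1)] BK dg] by blast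
        have "\<psi> G - [:h:] * G \<in> adj ?A (X t)" if G: "G \<in> \<K>" for G
        proof -
          have 1: "\<rho> (poly G t) - h * poly G t \<in> B" using h G by (auto simp: fib_def)
          have "poly (\<psi> G - [:h:] * G) t = (\<rho> (poly G t) - h * poly G t) - (\<rho> (poly G t) - poly (\<psi> G) t)" by simp
          then have "poly (\<psi> G - [:h:] * G) t \<in> fib ?A t" using idl_diff[OF Bi 1 ind[OF G]] fA by simp
          then show ?thesis using fib_iff[OF A(1)] by blast
        qed
        then show ?thesis by blast
      qed
      obtain a h where ah: "\<forall>G\<in>\<K>. (1 - X t * a) * \<phi> G - h * G \<in> ?A"
        using P.mhom_nak[OF A AK K(1) flatA[unfolded flat_def] red hom] by blast
      \<comment> \<open>Chosen so that \<phi> cancels: F multiplies \<K> into \<open>?A\<close> and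
        still specializes to f.\<close>
      define F where "F = (1 - X t * a) * [:f:] - X t * h"
      have "F * G \<in> ?A" if G: "G \<in> \<K>" for G
      proof -
        have "F * G = (1 - X t * a) * ([:f:] * G - X t * \<phi> G) + X t * ((1 - X t * a) * \<phi> G - h * G)"
          by (simp add: F_def algebra_simps)
        also have "\<dots> \<in> ?A" by (rule idl_add[OF A(1) idl_mult[OF A(1) \<phi>[OF G]] idl_mult[OF A(1) ah[rule_format, OF G]]])
        finally show ?thesis .
      qed
      then have "F \<in> colon ?A \<K>" by (simp add: colon_def)
      moreover have "poly F t = f" by (simp add: F_def)
      ultimately show "f \<in> fib (colon ?A \<K>) t" unfolding fib_def by blast
    qed
  qed
qed

lemma lift_list:
  assumes "set bs \<subseteq> fib \<K> t"
  shows "\<exists>Fs. set Fs \<subseteq> \<K> \<and> map (\<lambda>F. poly F t) Fs = bs"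
  using assms
proof (induction bs)
  case (Cons b bs)
  then obtain F Fs where "F \<in> \<K>" "b = poly F t" "set Fs \<subseteq> \<K>" "map (\<lambda>F. poly F t) Fs = bs" by (auto simp: fib_def)
  then show ?case by (intro exI[of _ "F # Fs"]) auto
qed simp

lemma cofin_rs_n: "rs n (map (\<lambda>F. poly F 0) Fs) \<Longrightarrow> cofin (\<lambda>t. rs n (map (\<lambda>F. poly F t) Fs))"
  using cofin_rs[of "pn n" Fs] by (simp add: fib_pn[OF idl_n] idl_n flat_pn)

text \<open>A specialized chain of links can break off, because the link of a complete intersection by itself is the unit ideal; \<open>stops\<close> records that
  the chain has then reached a complete intersection.\<close>

definition stops :: "nat \<Rightarrow> nat \<Rightarrow> 'b set \<Rightarrow> bool" where
  "stops k j K \<longleftrightarrow> (\<exists>i<j. \<exists>C. reg C k \<and> (dlink ^^ i) K C)"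

lemma dlinks_cmI: "(dlink ^^ j) K L \<Longrightarrow> cmI k K \<Longrightarrow> cmI k L"
  by (induction j arbitrary: L) (auto intro: dlink_cmI(2))

text \<open>A deformation of K that is flat at the point 0; flatness at almost all other points then
  comes from \<open>cofin_flat\<close>.\<close>

definition family :: "'b poly set \<Rightarrow> 'b set \<Rightarrow> bool" where
  "family \<K> K \<longleftrightarrow> idl \<K> \<and> pn n \<subseteq> \<K> \<and> fib \<K> 0 = K \<and> flat \<K> 0"

text \<open>Generators of each linking ideal lift arbitrarily to the family reached so far, and the
  colon over S[T] is the next family, whose fibres \<open>link_fib\<close> identifies. Regularity of
  the lifted sequence and flatness persist for almost all t.\<close>

lemma deform:
  assumes "cmI k K" "(dlink ^^ j) K L" "family \<K> K" "cofin (\<lambda>t. cmI k (fib \<K> t))"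
  shows "\<exists>\<L>. family \<L> L \<and> cofin (\<lambda>t. ((dlink ^^ j) (fib \<K> t) (fib \<L> t) \<and> cmI k (fib \<L> t)) \<or> stops k j (fib \<K> t))"
  using assms(2)
proof (induction j arbitrary: L)
  case 0
  then have "family \<K> L" using assms by simp
  moreover have "cofin (\<lambda>t. ((dlink ^^ 0) (fib \<K> t) (fib \<K> t) \<and> cmI k (fib \<K> t)) \<or> stops k 0 (fib \<K> t))"
    using assms(4) by (rule cofin_mono) simp
  ultimately show ?case by blast
next
  case (Suc j)
  then obtain M where M: "(dlink ^^ j) K M" "dlink M L" by auto
  obtain \<M> where \<M>: "family \<M> M"
    "cofin (\<lambda>t. ((dlink ^^ j) (fib \<K> t) (fib \<M> t) \<and> cmI k (fib \<M> t)) \<or> stops k j (fib \<K> t))"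
    using Suc.IH[OF M(1)] by blast
  have cM: "cmI k M" using dlinks_cmI[OF M(1) assms(1)] .
  obtain B where B: "reg B k" "B \<subseteq> M" "L = colon B M" using dlink_cmI(1)[OF cM M(2)] by blast
  obtain bs where bs: "length bs = k" "rs n bs" "B = gen n bs" using B(1) unfolding reg_def by blast
  have f: "idl \<M>" "pn n \<subseteq> \<M>" "fib \<M> 0 = M" "flat \<M> 0" using \<M>(1) by (auto simp: family_def)
  have "set bs \<subseteq> fib \<M> 0" using gen_set[OF idl_n, of bs] bs B(2) f(3) by blast
  then obtain Fs where Fs: "set Fs \<subseteq> \<M>" "map (\<lambda>F. poly F 0) Fs = bs" using lift_list by blast
  have rs0: "rs n (map (\<lambda>F. poly F 0) Fs)" using Fs bs by simp
  let ?L = "colon (gen (pn n) Fs) \<M>"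
  have L0: "fib ?L 0 = L" "flat ?L 0"
    using link_fib[OF f(1,2,4) Fs(1) rs0 _ B(1)] f(3) Fs(2) bs(3) B(3) cmI_dge[OF cM] by auto
  have fam: "family ?L L" unfolding family_def using L0 idl_n colon_sub[of "gen (pn n) Fs" \<M>] sub_gen[of "pn n" Fs] by auto
  have "cofin (\<lambda>t. (((dlink ^^ j) (fib \<K> t) (fib \<M> t) \<and> cmI k (fib \<M> t)) \<or> stops k j (fib \<K> t)) \<and>
      rs n (map (\<lambda>F. poly F t) Fs) \<and> flat \<M> t)"
    by (intro cofin_conj \<M>(2) cofin_rs_n[OF rs0] cofin_flat f)
  then have "cofin (\<lambda>t. ((dlink ^^ Suc j) (fib \<K> t) (fib ?L t) \<and> cmI k (fib ?L t)) \<or> stops k (Suc j) (fib \<K> t))"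
  proof (rule cofin_mono, elim conjE disjE)
    fix t assume "stops k j (fib \<K> t)"
    then show "((dlink ^^ Suc j) (fib \<K> t) (fib ?L t) \<and> cmI k (fib ?L t)) \<or> stops k (Suc j) (fib \<K> t)"
      unfolding stops_def by (meson less_SucI)
  next
    fix t assume t: "rs n (map (\<lambda>F. poly F t) Fs)" "flat \<M> t" "(dlink ^^ j) (fib \<K> t) (fib \<M> t)" "cmI k (fib \<M> t)"
    define Bt where "Bt = gen n (map (\<lambda>F. poly F t) Fs)"
    have sub: "set (map (\<lambda>F. poly F t) Fs) \<subseteq> fib \<M> t" using Fs(1) by (auto simp: fib_def)
    have "length Fs = k" using Fs(2) bs(1) by auto
    then have rB: "reg Bt k" unfolding Bt_def using regI[OF t(4) _ sub t(1)] by simp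
    have BtM: "Bt \<subseteq> fib \<M> t" unfolding Bt_def using sub f n_fib by (intro gen_least) auto
    have eq: "fib ?L t = colon Bt (fib \<M> t)" using link_fib(1)[OF f(1,2) t(2) Fs(1) t(1) Bt_def rB cmI_dge[OF t(4)]] .
    show "((dlink ^^ Suc j) (fib \<K> t) (fib ?L t) \<and> cmI k (fib ?L t)) \<or> stops k (Suc j) (fib \<K> t)"
    \<comment> \<open>The link is the unit ideal exactly when the fibre equals Bt; the specialized
      chain has then reached a complete intersection.\<close>
    proof (cases "1 \<in> colon Bt (fib \<M> t)")
      case True
      then have "fib \<M> t = Bt" using BtM by (auto simp: colon_def)
      then have "stops k (Suc j) (fib \<K> t)" unfolding stops_def using rB t(3) by (metis lessI)
      then show ?thesis by blast
    next
      case False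
      have "dlink (fib \<M> t) (fib ?L t)" unfolding eq by (rule dlinkI[OF t(4) rB BtM False])
      then show ?thesis using dlink_cmI(2)[OF t(4)] t(3) by auto
    qed
  qed
  then show ?case using fam by blast
qed

text \<open>Lifted generators of L generate the family modulo T times it, so by Nakayama up to a
  factor 1 - T a, and this is a unit at almost all t.\<close>

lemma cofin_ci:
  assumes fam: "family \<L> L" and L: "reg L k"
  shows "cofin (\<lambda>t. cmI k (fib \<L> t) \<longrightarrow> reg (fib \<L> t) k)"
proof -
  have f: "idl \<L>" "pn n \<subseteq> \<L>" "fib \<L> 0 = L" "flat \<L> 0" using fam by (auto simp: family_def)
  obtain cs where cs: "length cs = k" "rs n cs" "L = gen n cs" using L unfolding reg_def by blast
  have "set cs \<subseteq> fib \<L> 0" using gen_set[OF idl_n, of cs] cs f(3) by blast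
  then obtain Fs where Fs: "set Fs \<subseteq> \<L>" "map (\<lambda>F. poly F 0) Fs = cs" using lift_list by blast
  let ?G = "gen (pn n) Fs"
  have G: "idl ?G" "pn n \<subseteq> ?G" using idl_n sub_gen by auto
  have GL: "?G \<subseteq> \<L>" using gen_least[OF f(1,2) Fs(1)] .
  have "\<exists>H\<in>\<L>. F - X 0 * H \<in> ?G" if F: "F \<in> \<L>" for F
  proof -
    have "fib ?G 0 = fib \<L> 0" using f(3) cs Fs(2) by (simp add: fib_gen_n)
    then have "poly F 0 \<in> fib ?G 0" using F unfolding fib_def by blast
    then have "F \<in> adj ?G (X 0)" using fib_iff[OF G(1)] by blast
    then obtain H where H: "F - X 0 * H \<in> ?G" using adj_memb_cong[OF G(1)] by blast
    then have "F - (F - X 0 * H) \<in> \<L>" using GL F f(1) idl_diff by blast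
    then have "H \<in> \<L>" using f(4) unfolding flat_def nzd_def by simp
    then show ?thesis using H by blast
  qed
  then obtain a where a: "\<And>F. F \<in> \<L> \<Longrightarrow> (1 - X 0 * a) * F \<in> ?G" using P.nak[OF G GL f(1)] by blast
  let ?D = "1 - X 0 * a"
  have rs0: "rs n (map (\<lambda>F. poly F 0) Fs)" using cs Fs by simp
  have "cofin (\<lambda>t. poly ?D t \<notin> m \<and> rs n (map (\<lambda>F. poly F t) Fs))"
    by (intro cofin_conj cofin_poly_unit[of ?D 0] cofin_rs_n[OF rs0]) (use m1 in simp)
  then show ?thesis
  proof (rule cofin_mono, intro impI, elim conjE)
    fix t assume t: "poly ?D t \<notin> m" "rs n (map (\<lambda>F. poly F t) Fs)" and c: "cmI k (fib \<L> t)"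
    have "fib \<L> t \<subseteq> fib ?G t"
    proof
      fix f assume "f \<in> fib \<L> t"
      then obtain F where F: "F \<in> \<L>" "f = poly F t" by (auto simp: fib_def)
      then have "poly (?D * F) t \<in> fib ?G t" using a unfolding fib_def by blast
      then have "poly ?D t * f \<in> fib ?G t" using F by simp
      then show "f \<in> fib ?G t" using unit_cancel[OF idl_fib[OF G(1)] n_fib[OF G(2)] t(1)] by blast
    qed
    then have eq: "fib \<L> t = gen n (map (\<lambda>F. poly F t) Fs)" using fib_mono[OF GL, of t] fib_gen_n by blast
    have sub: "set (map (\<lambda>F. poly F t) Fs) \<subseteq> fib \<L> t" using Fs(1) by (auto simp: fib_def)
    have "reg (gen n (map (\<lambda>F. poly F t) Fs)) k" by (rule regI[OF c _ sub t(2)]) (use Fs(2) cs(1) in auto)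
    then show "reg (fib \<L> t) k" using eq by simp
  qed
qed

text \<open>The first link of a chain is moved explicitly by \<open>Fs\<close> over the constant
  family of K, and \<open>deform\<close> carries the remaining links along. As K is not a complete
  intersection, the moved first link is never the unit ideal.\<close>

lemma perturb:
  assumes K: "cmI k K" "\<not> reg K k" and Fs: "set Fs \<subseteq> pn K" "length Fs = k"
    and bs: "map (\<lambda>F. poly F 0) Fs = bs" "rs n bs"
    and L: "L = colon (gen n bs) K" "dlink K L" and M: "(dlink ^^ j) L M"
  shows "\<exists>\<M>. family \<M> M \<and> cofin (\<lambda>t. \<exists>Lt. rs n (map (\<lambda>F. poly F t) Fs) \<and> Lt = colon (gen n (map (\<lambda>F. poly F t) Fs)) K \<and>
    dlink K Lt \<and> ((((dlink ^^ j) Lt (fib \<M> t) \<and> cmI k (fib \<M> t)) \<and> (reg M k \<longrightarrow> reg (fib \<M> t) k)) \<or> stops k j Lt))"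
proof -
  have Ki: "idl K" "n \<subseteq> K" using cmI_idl[OF K(1)] cmI_n[OF K(1)] .
  have pK: "idl (pn K)" "pn n \<subseteq> pn K" using Ki pn_mono by auto
  note fp = fib_pn[OF Ki(1)]
  have rs0: "rs n (map (\<lambda>F. poly F 0) Fs)" using bs by simp
  have sub: "set (map (\<lambda>F. poly F t) Fs) \<subseteq> K" for t using Fs poly_pn[OF Ki(1)] by auto
  have rB: "reg (gen n (map (\<lambda>F. poly F t) Fs)) k" if "rs n (map (\<lambda>F. poly F t) Fs)" for t
    using regI[OF K(1) _ sub that] Fs(2) by simp
  let ?L = "colon (gen (pn n) Fs) (pn K)"
  have L0: "fib ?L t = colon (gen n (map (\<lambda>F. poly F t) Fs)) K" "flat ?L t" if "rs n (map (\<lambda>F. poly F t) Fs)" for t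
    using link_fib[OF pK flat_pn[OF Ki(1)] Fs(1) that refl rB[OF that]] fp cmI_dge[OF K(1)] by auto
  have fam: "family ?L L" unfolding family_def
    using L0[OF rs0] bs(1) L(1) idl_n colon_sub[of "gen (pn n) Fs" "pn K"] sub_gen[of "pn n" Fs] by auto
  have dl: "dlink K (fib ?L t)" if t: "rs n (map (\<lambda>F. poly F t) Fs)" for t
  proof -
    have BK: "gen n (map (\<lambda>F. poly F t) Fs) \<subseteq> K" using gen_least[OF Ki sub] .
    have "1 \<notin> colon (gen n (map (\<lambda>F. poly F t) Fs)) K"
    proof
      assume "1 \<in> colon (gen n (map (\<lambda>F. poly F t) Fs)) K"
      then have "K = gen n (map (\<lambda>F. poly F t) Fs)" using BK by (auto simp: colon_def)
      then show False using rB[OF t] K(2) by metis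
    qed
    then show ?thesis unfolding L0(1)[OF t] by (rule dlinkI[OF K(1) rB[OF t] BK])
  qed
  have cL: "cmI k L" using dlink_cmI(2)[OF K(1) L(2)] .
  have "cofin (\<lambda>t. cmI k (fib ?L t))"
    using cofin_rs_n[OF rs0] by (rule cofin_mono) (use dl dlink_cmI(2)[OF K(1)] in blast)
  then obtain \<M> where \<M>: "family \<M> M" "cofin (\<lambda>t. ((dlink ^^ j) (fib ?L t) (fib \<M> t) \<and> cmI k (fib \<M> t)) \<or> stops k j (fib ?L t))"
    using deform[OF cL M fam] by blast
  have "cofin (\<lambda>t. reg M k \<longrightarrow> cmI k (fib \<M> t) \<longrightarrow> reg (fib \<M> t) k)"
  proof (cases "reg M k")
    case True then show ?thesis using cofin_ci[OF \<M>(1) True] by simp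
  next
    case False show ?thesis by (rule cofin_mono[OF cofin_True]) (use False in simp)
  qed
  then have "cofin (\<lambda>t. rs n (map (\<lambda>F. poly F t) Fs) \<and> ((((dlink ^^ j) (fib ?L t) (fib \<M> t) \<and> cmI k (fib \<M> t)) \<or> stops k j (fib ?L t)) \<and>
      (reg M k \<longrightarrow> cmI k (fib \<M> t) \<longrightarrow> reg (fib \<M> t) k)))"
    by (intro cofin_conj cofin_rs_n[OF rs0] \<M>(2))
  then have "cofin (\<lambda>t. \<exists>Lt. rs n (map (\<lambda>F. poly F t) Fs) \<and> Lt = colon (gen n (map (\<lambda>F. poly F t) Fs)) K \<and>
    dlink K Lt \<and> ((((dlink ^^ j) Lt (fib \<M> t) \<and> cmI k (fib \<M> t)) \<and> (reg M k \<longrightarrow> reg (fib \<M> t) k)) \<or> stops k j Lt))"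
    by (rule cofin_mono) (use dl L0(1) in blast)
  then show ?thesis using \<M>(1) by blast
qed

definition ci_linked :: "'b set \<Rightarrow> bool" where
  "ci_linked I \<longleftrightarrow> (\<exists>C l. reg C l \<and> dlink\<^sup>*\<^sup>* I C)"

lemma family_sub:
  assumes fam: "family \<M> M" and Z: "idl Z" "n \<subseteq> Z" and c: "cofin (\<lambda>t. fib \<M> t \<subseteq> Z)"
  shows "M \<subseteq> Z"
proof
  fix f assume "f \<in> M"
  then obtain F where F: "F \<in> \<M>" "f = poly F 0" using fam by (auto simp: family_def fib_def)
  have "cofin (\<lambda>t. poly F t \<in> Z)" using c by (rule cofin_mono) (use F in \<open>auto simp: fib_def\<close>)
  then show "f \<in> Z" using cofin_interp[OF Z(1) _ Z(2)] F by blast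
qed

lemma rs_replace:
  assumes "idl B" "\<And>c. c \<in> set cs \<Longrightarrow> c - f c \<in> B"
  shows "rs B (map f cs) \<longleftrightarrow> rs B cs"
  using assms
proof (induction cs arbitrary: B)
  case (Cons c cs)
  have eq: "adj B c = adj B (f c)" "nzd B c \<longleftrightarrow> nzd B (f c)"
    using adj_cong[OF Cons.prems(1)] nzd_iff_cong[OF Cons.prems(1)] Cons.prems(2) by auto
  have "rs (adj B c) (map f cs) \<longleftrightarrow> rs (adj B c) cs"
    by (rule Cons.IH) (use Cons.prems sub_adj[of B c] in auto)
  then show ?case using eq by simp
qed simp

section \<open>Linkage classes and hyperplane sections\<close>

text \<open>In the first link the last generator b is moved to z = b + t x. For almost all t one has
  (I, z) = (I, x), the other generators can be taken in I modulo z, and the link becomes (I1, z)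
  with I1 linked to I; induction applies to I1 and z. That K is no complete intersection is part of
  the induction, because for shorter chains it excludes \<open>stops\<close>.\<close>

lemma section_links:
  assumes "cmI k I" "x \<in> m" "nzd I x" "(dlink ^^ j) (adj I x) K" "\<not> ci_linked I"
  shows "\<not> reg K (Suc k) \<and> (\<forall>Z. idl Z \<longrightarrow> (\<forall>L. dlink\<^sup>*\<^sup>* I L \<longrightarrow> L \<subseteq> Z) \<longrightarrow> x \<in> Z \<longrightarrow> K \<subseteq> Z)"
  using assms
proof (induction j arbitrary: I x K rule: less_induct)
  case (less j)
  note I = less.prems(1) and x = less.prems(2,3) and nl = less.prems(5)
  have nr: "\<not> reg I k" using nl unfolding ci_linked_def by blast
  have nrx: "\<not> reg (adj I x) (Suc k)" using ci_of_section[OF I x] nr by blast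
  have cx: "cmI (Suc k) (adj I x)" by (rule cmI_adj[OF I x])
  note Ii = cmI_idl[OF I] cmI_n[OF I]
  show ?case
  proof (cases j)
    case 0
    then have K: "K = adj I x" using less.prems(4) by simp
    have "adj I x \<subseteq> Z" if "idl Z" "\<forall>L. dlink\<^sup>*\<^sup>* I L \<longrightarrow> L \<subseteq> Z" "x \<in> Z" for Z
      using that by (intro adj_least) auto
    then show ?thesis using K nrx by blast
  next
    case (Suc i)
    obtain K1 where K1: "dlink (adj I x) K1" "(dlink ^^ i) K1 K" using less.prems(4) unfolding Suc by (meson relpowp_Suc_E2)
    obtain B where B: "reg B (Suc k)" "B \<subseteq> adj I x" "K1 = colon B (adj I x)" using dlink_cmI(1)[OF cx K1(1)] by blast
    obtain bs where bs: "length bs = Suc k" "rs n bs" "B = gen n bs" using B(1) unfolding reg_def by blast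
    then obtain as b where ab: "bs = as @ [b]" "length as = k" by (metis append_butlast_last_id diff_Suc_1 length_0_conv length_butlast nat.simps(3))
    have bsI: "set bs \<subseteq> adj I x" using gen_set[OF idl_n, of bs] bs B(2) by blast
    have xI: "x \<in> adj I x" by (rule adj_self[OF Ii(1)])
    \<comment> \<open>Only the last generator moves, along b + T x.\<close>
    let ?Fs = "map (\<lambda>a. [:a:]) as @ [[:b, x:]]"
    have ev: "map (\<lambda>F. poly F t) ?Fs = as @ [b + t * x]" for t by (simp add: comp_def)
    have FsK: "set ?Fs \<subseteq> pn (adj I x)"
      using bsI xI const_pn[OF idl_adj[OF Ii(1)]] ab Ii by (auto simp: pn_def coeff_pCons split: nat.splits)
    obtain \<M> where \<M>: "family \<M> K" and cof: "cofin (\<lambda>t. \<exists>Lt. rs n (as @ [b + t * x]) \<and> Lt = colon (gen n (as @ [b + t * x])) (adj I x) \<and>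
      dlink (adj I x) Lt \<and> ((((dlink ^^ i) Lt (fib \<M> t) \<and> cmI (Suc k) (fib \<M> t)) \<and> (reg K (Suc k) \<longrightarrow> reg (fib \<M> t) (Suc k))) \<or> stops (Suc k) i Lt))"
      using perturb[OF cx nrx FsK _ _ bs(2) _ _ K1(2)] B(3) bs(3) K1(1) ab unfolding ev by auto
    \<comment> \<open>Origin of the excluded class -r: z = a0 + (t + r) x with a0 in I, and t + r
      has to be a unit for (I, z) = (I, x).\<close>
    obtain a0 r where b: "b = a0 + x * r" "a0 \<in> I" using bsI ab adjE[of b I x] by auto
    have "cofin (\<lambda>t. (reg K (Suc k) \<longrightarrow> False) \<and> (\<forall>Z. idl Z \<longrightarrow> (\<forall>L. dlink\<^sup>*\<^sup>* I L \<longrightarrow> L \<subseteq> Z) \<longrightarrow> x \<in> Z \<longrightarrow> fib \<M> t \<subseteq> Z))"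
    proof (rule cofin_mono[OF cofin_conj[OF cof cofin_ne[of "- r"]]], elim conjE exE)
      fix t Lt assume u: "t - - r \<notin> m" and rs: "rs n (as @ [b + t * x])" and Lt: "Lt = colon (gen n (as @ [b + t * x])) (adj I x)"
        and dL: "dlink (adj I x) Lt"
        and alt: "(((dlink ^^ i) Lt (fib \<M> t) \<and> cmI (Suc k) (fib \<M> t)) \<and> (reg K (Suc k) \<longrightarrow> reg (fib \<M> t) (Suc k))) \<or> stops (Suc k) i Lt"
      define z where "z = b + t * x"
      have z: "z = a0 + x * (t + r)" by (simp add: z_def b algebra_simps)
      have u': "t + r \<notin> m" using u by simp
      have zx: "z \<in> adj I x" unfolding z using b(2) adjI by blast
      have zm: "z \<in> m" using zx cmI_m[OF cx] by blast
      have adj_eq: "adj I z = adj I x"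
      proof
        show "adj I z \<subseteq> adj I x" using zx Ii sub_adj by (intro adj_least) auto
        have "z - a0 \<in> adj I z" using adj_self[OF Ii(1), of z] b(2) sub_adj[of I z] idl_diff[OF idl_adj[OF Ii(1)]] by blast
        then have "(t + r) * x \<in> adj I z" by (simp add: z mult.commute)
        then have "x \<in> adj I z" using unit_cancel[OF idl_adj[OF Ii(1)] _ u'] Ii(2) sub_adj[of I z] by blast
        then show "adj I x \<subseteq> adj I z" using Ii sub_adj by (intro adj_least) auto
      qed
      have nz: "nzd I z"
      proof -
        have "nzd I (x * (t + r))" using x(2) unit_nzd[OF Ii u'] unfolding nzd_def mult.assoc by blast
        then show ?thesis using nzd_iff_cong[OF Ii(1), of z "x * (t + r)"] b(2) z by simp
      qed
      have asI: "set as \<subseteq> adj I x" using bsI ab by simp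
      have asm: "set as \<subseteq> m" using asI cmI_m[OF cx] by blast
      have "\<forall>c\<in>set as. \<exists>a. a \<in> I \<and> c - a \<in> adj n z"
      proof
        fix c assume "c \<in> set as"
        then have "c \<in> adj I z" using asI adj_eq by blast
        then obtain a s where "c = a + z * s" "a \<in> I" using adjE by blast
        then show "\<exists>a. a \<in> I \<and> c - a \<in> adj n z" using adjI[OF idl_0[OF idl_n], of z s] by auto
      qed
      then obtain f where f: "\<And>c. c \<in> set as \<Longrightarrow> f c \<in> I \<and> c - f c \<in> adj n z" by metis
      let ?as = "map f as"
      have fI: "set ?as \<subseteq> I" using f by auto
      then have fm: "set ?as \<subseteq> m" using cmI_m[OF I] by blast
      have "rs n (z # as)" using rs rs_rotate[OF idl_n order_refl asm zm] unfolding z_def by blast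
      then have "rs n (z # ?as)" using rs_replace[OF idl_adj[OF idl_n], of as f z] f by simp
      then have "rs n (?as @ [z])" using rs_rotate[OF idl_n order_refl fm zm] by blast
      then have rsA: "rs n ?as" "nzd (gen n ?as) z" by (simp_all add: rs_append)
      define A where "A = gen n ?as"
      have A: "reg A k" unfolding A_def using regI[OF I _ fI rsA(1)] ab(2) by simp
      have AI: "A \<subseteq> I" unfolding A_def using gen_least[OF Ii fI] .
      have "gen n (as @ [z]) = gen (adj n z) as" by (simp add: gen_append gen_adj)
      also have "\<dots> = gen (adj n z) ?as" using gen_replace[OF idl_adj[OF idl_n], of as f z] f by simp
      also have "\<dots> = adj A z" by (simp add: A_def gen_adj)
      finally have "Lt = colon (adj A z) (adj I z)" using Lt adj_eq by (simp add: z_def)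
      \<comment> \<open>Here the moved link is recognized as the hyperplane section by z of a link
        of I.\<close>
      then have Lt2: "Lt = adj (colon A I) z" using colon_adj[OF A Ii(1) AI cmI_dge[OF I] _ nz] rsA(2) A_def by simp
      define I1 where "I1 = colon A I"
      have "1 \<notin> Lt" using dL unfolding dlink_def by blast
      then have "1 \<notin> I1" using Lt2 sub_adj[of I1 z] I1_def by blast
      then have dI: "dlink I I1" unfolding I1_def by (intro dlinkI[OF I A AI])
      have I1: "cmI k I1" by (rule dlink_cmI(2)[OF I dI])
      have nz1: "nzd I1 z" unfolding I1_def using rsA(2) nzd_colon A_def by blast
      have cls: "dlink\<^sup>*\<^sup>* I L" if "dlink\<^sup>*\<^sup>* I1 L" for L using converse_rtranclp_into_rtranclp[of dlink, OF dI that] .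
      have nl1: "\<not> ci_linked I1" using nl cls unfolding ci_linked_def by blast
      have nostop: "\<not> stops (Suc k) i Lt"
      proof
        assume "stops (Suc k) i Lt"
        then obtain i' C where C: "i' < i" "reg C (Suc k)" "(dlink ^^ i') Lt C" unfolding stops_def by blast
        then show False using less.IH[of i' I1 z C] Suc I1 zm nz1 nl1 Lt2 I1_def by auto
      qed
      then have alt': "(dlink ^^ i) (adj I1 z) (fib \<M> t)" "reg K (Suc k) \<longrightarrow> reg (fib \<M> t) (Suc k)"
        using alt Lt2 I1_def by auto
      have IH: "\<not> reg (fib \<M> t) (Suc k) \<and> (\<forall>Z. idl Z \<longrightarrow> (\<forall>L. dlink\<^sup>*\<^sup>* I1 L \<longrightarrow> L \<subseteq> Z) \<longrightarrow> z \<in> Z \<longrightarrow> fib \<M> t \<subseteq> Z)"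
        using less.IH[of i I1 z "fib \<M> t"] Suc I1 zm nz1 nl1 alt'(1) by blast
      have "fib \<M> t \<subseteq> Z" if Z: "idl Z" "\<forall>L. dlink\<^sup>*\<^sup>* I L \<longrightarrow> L \<subseteq> Z" "x \<in> Z" for Z
      proof -
        \<comment> \<open>The induction hypothesis speaks of z instead of x; z lies in Z because Z
          contains I and x.\<close>
        have "a0 \<in> Z" using Z(2) b(2) by blast
        then have "z \<in> Z" unfolding z using Z(1,3) idl_add idl_mult2 by blast
        then show ?thesis using IH Z cls by blast
      qed
      then show "(reg K (Suc k) \<longrightarrow> False) \<and> (\<forall>Z. idl Z \<longrightarrow> (\<forall>L. dlink\<^sup>*\<^sup>* I L \<longrightarrow> L \<subseteq> Z) \<longrightarrow> x \<in> Z \<longrightarrow> fib \<M> t \<subseteq> Z)"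
        using alt'(2) IH by blast
    qed
    note c = this
    have "\<not> reg K (Suc k)" using cofin_ex[OF c] by blast
    moreover have "K \<subseteq> Z" if Z: "idl Z" "\<forall>L. dlink\<^sup>*\<^sup>* I L \<longrightarrow> L \<subseteq> Z" "x \<in> Z" for Z
    proof (rule family_sub[OF \<M> Z(1)])
      show "n \<subseteq> Z" using Z(2) Ii(2) by blast
      show "cofin (\<lambda>t. fib \<M> t \<subseteq> Z)" using c by (rule cofin_mono) (use Z in blast)
    qed
    ultimately show ?thesis by blast
  qed
qed

text \<open>A link through \<open>bs\<close> passes to the section by x once \<open>bs\<close>
  followed by x is regular. An inner induction achieves this one generator at a time, as each
  deformation has a single parameter; the outer induction is on the length of the chain.\<close>

lemma section_links_converse:
  assumes "cmI k I" "x \<in> m" "nzd I x" "nzd n x" "(dlink ^^ j) I L" "\<not> ci_linked (adj I x)"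
  shows "\<not> reg L k \<and> (\<forall>Z. idl Z \<longrightarrow> (\<forall>M. dlink\<^sup>*\<^sup>* (adj I x) M \<longrightarrow> M \<subseteq> Z) \<longrightarrow> L \<subseteq> Z)"
  using assms
proof (induction j arbitrary: I L rule: less_induct)
  case (less j)
  note I = less.prems(1) and x = less.prems(2,3) and xn = less.prems(4) and nl = less.prems(6)
  note Ii = cmI_idl[OF I] cmI_n[OF I]
  have cx: "cmI (Suc k) (adj I x)" by (rule cmI_adj[OF I x])
  have nr: "\<not> reg I k" using nl reg_adj[OF _ x] unfolding ci_linked_def by blast
  show ?case
  proof (cases j)
    case 0
    then have L: "L = I" using less.prems(5) by simp
    have "I \<subseteq> Z" if "\<forall>M. dlink\<^sup>*\<^sup>* (adj I x) M \<longrightarrow> M \<subseteq> Z" for Z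
      using that sub_adj[of I x] by blast
    then show ?thesis using L nr by blast
  next
    case (Suc j')
    obtain L1 where L1: "dlink I L1" "(dlink ^^ j') L1 L" using less.prems(5) unfolding Suc by (meson relpowp_Suc_E2)
    obtain B where B: "reg B k" "B \<subseteq> I" "L1 = colon B I" using dlink_cmI(1)[OF I L1(1)] by blast
    obtain bs where bs: "length bs = k" "rs n bs" "B = gen n bs" using B(1) unfolding reg_def by blast
    have bsI: "set bs \<subseteq> I" using gen_set[OF idl_n, of bs] bs B(2) by blast
    \<comment> \<open>The element x and the first i generators already form a regular sequence; e
      generators, from position i on, still have to be moved.\<close>
    have main: "\<not> reg L k \<and> (\<forall>Z. idl Z \<longrightarrow> (\<forall>M. dlink\<^sup>*\<^sup>* (adj I x) M \<longrightarrow> M \<subseteq> Z) \<longrightarrow> L \<subseteq> Z)"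
      if "k - i = e" "i \<le> k" "length bs = k" "set bs \<subseteq> I" "rs n bs" "rs n (x # take i bs)" "L1 = colon (gen n bs) I"
        "dlink I L1" "(dlink ^^ j') L1 L" for i e bs L1 L
      using that
    proof (induction e arbitrary: i bs L1 L)
      case 0
      then have "take i bs = bs" by simp
      then have "rs n (x # bs)" using 0 by simp
      moreover have bm: "set bs \<subseteq> m" using 0 cmI_m[OF I] by blast
      ultimately have "rs n (bs @ [x])" using rs_rotate[OF idl_n order_refl bm x(1)] by blast
      then have xB: "nzd (gen n bs) x" by (simp add: rs_append)
      define A where "A = gen n bs"
      have A: "reg A k" unfolding A_def by (rule regI[OF I 0(3,4,5)])
      have AI: "A \<subseteq> I" unfolding A_def using gen_least[OF Ii 0(4)] .
      have eq: "colon (adj A x) (adj I x) = adj L1 x"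
        using colon_adj[OF A Ii(1) AI cmI_dge[OF I] _ x(2)] xB 0(7) A_def by simp
      have L1: "cmI k L1" by (rule dlink_cmI(2)[OF I 0(8)])
      have x1: "nzd L1 x" using 0(7) nzd_colon xB by blast
      have c1: "cmI (Suc k) (adj L1 x)" by (rule cmI_adj[OF L1 x(1) x1])
      have "dlink (adj I x) (adj L1 x)"
        unfolding eq[symmetric]
        by (rule dlinkI[OF cx reg_adj[OF A x(1)] adj_mono[OF AI]]) (use xB A_def cmI_1[OF c1] eq in auto)
      note dl = converse_rtranclp_into_rtranclp[of dlink, OF this]
      have "\<not> ci_linked (adj L1 x)" using nl dl unfolding ci_linked_def by blast
      then have "\<not> reg L k \<and> (\<forall>Z. idl Z \<longrightarrow> (\<forall>M. dlink\<^sup>*\<^sup>* (adj L1 x) M \<longrightarrow> M \<subseteq> Z) \<longrightarrow> L \<subseteq> Z)"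
        using less.IH[of j' L1 L] Suc L1 x(1) x1 xn 0(9) by blast
      then show ?case using dl by blast
    next
      case (Suc e)
      then have ik: "i < k" by simp
      define B1 where "B1 = gen n (x # take i bs)"
      have ti: "set (x # take i bs) \<subseteq> adj I x" using Suc.prems(4) adj_self[OF Ii(1), of x] sub_adj[of I x] set_take_subset[of i bs] by auto
      have B1: "reg B1 (Suc i)" unfolding B1_def by (rule regI[OF cx _ ti Suc.prems(6)]) (use ik Suc.prems(3) in simp)
      have B1I: "B1 \<subseteq> adj I x" unfolding B1_def using gen_least[OF idl_adj[OF Ii(1)] _ ti] Ii(2) sub_adj[of I x] by blast
      note B1i = reg_idl[OF B1] reg_n[OF B1]
      \<comment> \<open>Otherwise (I, x), of height k + 1, would kill a nonzero class modulo the
        sequence x, b_1, ..., b_i, whose length i + 1 is too small for that.\<close>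
      have "\<exists>c\<in>I. nzd B1 c"
      proof (rule ccontr)
        assume "\<not> ?thesis"
        then obtain e where e: "e \<notin> B1" "I \<subseteq> quo B1 e" using no_nzd[OF B1i Ii(1)] by blast
        have "x \<in> B1" unfolding B1_def using gen_set[OF idl_n, of "x # take i bs"] by auto
        then have "adj I x \<subseteq> quo B1 e" using e quo_sub[OF B1i(1), of e] B1i by (intro adj_least) auto
        then have "e \<in> colon B1 (adj I x)" by (auto simp: colon_def quo_def mult.commute)
        then have "Suc i = Suc k" using cmI_grade_eq[OF cx B1 B1I e(1)] by blast
        then show False using ik by simp
      qed
      then obtain c where c: "c \<in> I" "nzd B1 c" by blast
      \<comment> \<open>Since c is regular modulo B1, so is the moved generator for almost all t,
        while every specialization stays in I.\<close>
      let ?Fs = "(map (\<lambda>a. [:a:]) bs)[i := [:bs ! i, c:]]"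
      have ev: "map (\<lambda>F. poly F t) ?Fs = bs[i := bs ! i + t * c]" for t
        by (simp add: map_update comp_def)
      have FsI: "set ?Fs \<subseteq> pn I"
      proof -
        have "[:bs ! i, c:] \<in> pn I" using Suc.prems(3,4) ik c Ii by (auto simp: pn_def coeff_pCons split: nat.splits)
        moreover have "set (map (\<lambda>a. [:a:]) bs) \<subseteq> pn I" using Suc.prems(4) const_pn[OF Ii(1)] by auto
        ultimately show ?thesis using set_update_subset_insert[of "map (\<lambda>a. [:a:]) bs" i "[:bs ! i, c:]"] by blast
      qed
      have ev0: "map (\<lambda>F. poly F 0) ?Fs = bs" using ev[of 0] by simp
      obtain \<M> where \<M>: "family \<M> L" and cof: "cofin (\<lambda>t. \<exists>Lt. rs n (bs[i := bs ! i + t * c]) \<and> Lt = colon (gen n (bs[i := bs ! i + t * c])) I \<and>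
        dlink I Lt \<and> ((((dlink ^^ j') Lt (fib \<M> t) \<and> cmI k (fib \<M> t)) \<and> (reg L k \<longrightarrow> reg (fib \<M> t) k)) \<or> stops k j' Lt))"
        using perturb[OF I nr FsI _ ev0 Suc.prems(5,7,8,9)] Suc.prems(3) unfolding ev by auto
      have cf: "cofin (\<lambda>t. (reg L k \<longrightarrow> False) \<and> (\<forall>Z. idl Z \<longrightarrow> (\<forall>M. dlink\<^sup>*\<^sup>* (adj I x) M \<longrightarrow> M \<subseteq> Z) \<longrightarrow> fib \<M> t \<subseteq> Z))"
      proof (rule cofin_mono[OF cofin_conj[OF cof nzd_cofin[OF B1i c(2), of "bs ! i"]]], elim conjE exE)
        fix t Lt assume nz: "nzd B1 (bs ! i + t * c)" and rs: "rs n (bs[i := bs ! i + t * c])"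
          and Lt: "Lt = colon (gen n (bs[i := bs ! i + t * c])) I" and dL: "dlink I Lt"
          and alt: "(((dlink ^^ j') Lt (fib \<M> t) \<and> cmI k (fib \<M> t)) \<and> (reg L k \<longrightarrow> reg (fib \<M> t) k)) \<or> stops k j' Lt"
        let ?bs = "bs[i := bs ! i + t * c]"
        have nostop: "\<not> stops k j' Lt"
        proof
          assume "stops k j' Lt"
          then obtain i' C where C: "i' < j'" "reg C k" "(dlink ^^ i') Lt C" unfolding stops_def by blast
          \<comment> \<open>With the link from I to Lt in front, the stopped chain is still shorter
            than j, so the outer induction hypothesis applies.\<close>
          have "(dlink ^^ Suc i') I C" using dL C(3) by (meson relpowp_Suc_I2)
          then show False using less.IH[of "Suc i'" I C] \<open>j = Suc j'\<close> C(1,2) I x xn nl by auto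
        qed
        have "bs ! i \<in> I" using Suc.prems(3,4) ik by auto
        then have "bs ! i + t * c \<in> I" using c Ii by (simp add: idl_add idl_mult)
        then have bI: "set ?bs \<subseteq> I" using Suc.prems(4) set_update_subset_insert[of bs i "bs ! i + t * c"] by blast
        have "take (Suc i) ?bs = take i bs @ [bs ! i + t * c]" using ik Suc.prems(3) by (simp add: take_Suc_conv_app_nth)
        then have rs': "rs n (x # take (Suc i) ?bs)" using Suc.prems(6) nz by (simp add: rs_append B1_def)
        have "\<not> reg (fib \<M> t) k \<and> (\<forall>Z. idl Z \<longrightarrow> (\<forall>M. dlink\<^sup>*\<^sup>* (adj I x) M \<longrightarrow> M \<subseteq> Z) \<longrightarrow> fib \<M> t \<subseteq> Z)"
          by (rule Suc.IH[of "Suc i" ?bs Lt]) (use Suc.prems ik bI rs rs' Lt dL alt nostop in auto)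
        then show "(reg L k \<longrightarrow> False) \<and> (\<forall>Z. idl Z \<longrightarrow> (\<forall>M. dlink\<^sup>*\<^sup>* (adj I x) M \<longrightarrow> M \<subseteq> Z) \<longrightarrow> fib \<M> t \<subseteq> Z)"
          using alt nostop by blast
      qed
      have "\<not> reg L k" using cofin_ex[OF cf] by blast
      moreover have "L \<subseteq> Z" if Z: "idl Z" "\<forall>M. dlink\<^sup>*\<^sup>* (adj I x) M \<longrightarrow> M \<subseteq> Z" for Z
      proof (rule family_sub[OF \<M> Z(1)])
        show "n \<subseteq> Z" using Z(2) Ii(2) sub_adj[of I x] by blast
        show "cofin (\<lambda>t. fib \<M> t \<subseteq> Z)" using cf by (rule cofin_mono) (use Z in blast)
      qed
      ultimately show ?case by blast
    qed
    show ?thesis by (rule main[of 0 k bs L1]) (use bs bsI xn B(3) L1 in auto)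
  qed
qed

end

section \<open>Passage to the ring\<close>

text \<open>The free commutative ring on \<open>'a\<close>, a ring of type class \<open>comm_ring_1\<close> that maps onto \<open>R\<close>.\<close>

datatype 'a rterm = Var 'a | Zero | One | Add "'a rterm" "'a rterm" | Mul "'a rterm" "'a rterm" | Neg "'a rterm"

inductive req :: "'a rterm \<Rightarrow> 'a rterm \<Rightarrow> bool" where
  refl: "req x x"
| sym: "req x y \<Longrightarrow> req y x"
| trans: "req x y \<Longrightarrow> req y z \<Longrightarrow> req x z"
| Add_cong: "req x x' \<Longrightarrow> req y y' \<Longrightarrow> req (Add x y) (Add x' y')"
| Mul_cong: "req x x' \<Longrightarrow> req y y' \<Longrightarrow> req (Mul x y) (Mul x' y')"
| Neg_cong: "req x x' \<Longrightarrow> req (Neg x) (Neg x')"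
| Add_assoc: "req (Add (Add x y) z) (Add x (Add y z))"
| Add_comm: "req (Add x y) (Add y x)"
| Add_zero: "req (Add Zero x) x"
| Add_neg: "req (Add (Neg x) x) Zero"
| Mul_assoc: "req (Mul (Mul x y) z) (Mul x (Mul y z))"
| Mul_comm: "req (Mul x y) (Mul y x)"
| Mul_one: "req (Mul One x) x"
| distrib: "req (Mul (Add x y) z) (Add (Mul x z) (Mul y z))"

quotient_type 'a free_ring = "'a rterm" / req
proof (rule equivpI)
  show "reflp req" by (rule reflpI) (rule req.refl)
  show "symp req" by (rule sympI) (rule req.sym)
  show "transp req" by (rule transpI) (rule req.trans)
qed

text \<open>Separates 0 from 1 in the free ring, by sending all variables to 0 in the
  integers.\<close>

primrec int_eval :: "'a rterm \<Rightarrow> int" where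
  "int_eval (Var a) = 0"
| "int_eval Zero = 0"
| "int_eval One = 1"
| "int_eval (Add x y) = int_eval x + int_eval y"
| "int_eval (Mul x y) = int_eval x * int_eval y"
| "int_eval (Neg x) = - int_eval x"

lemma req_int_eval: "req x y \<Longrightarrow> int_eval x = int_eval y"
  by (induction rule: req.induct) (auto simp: algebra_simps)

instantiation free_ring :: (type) comm_ring_1
begin

lift_definition zero_free_ring :: "'a free_ring" is Zero .
lift_definition one_free_ring :: "'a free_ring" is One .
lift_definition plus_free_ring :: "'a free_ring \<Rightarrow> 'a free_ring \<Rightarrow> 'a free_ring" is Add by (rule req.Add_cong)
lift_definition times_free_ring :: "'a free_ring \<Rightarrow> 'a free_ring \<Rightarrow> 'a free_ring" is Mul by (rule req.Mul_cong)
lift_definition uminus_free_ring :: "'a free_ring \<Rightarrow> 'a free_ring" is Neg by (rule req.Neg_cong)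
definition minus_free_ring :: "'a free_ring \<Rightarrow> 'a free_ring \<Rightarrow> 'a free_ring" where
  "minus_free_ring x y = x + - y"

instance
proof
  fix a b c :: "'a free_ring"
  show "a + b + c = a + (b + c)" by transfer (rule req.Add_assoc)
  show "a + b = b + a" by transfer (rule req.Add_comm)
  show "0 + a = a" by transfer (rule req.Add_zero)
  show "- a + a = 0" by transfer (rule req.Add_neg)
  show "a - b = a + - b" by (rule minus_free_ring_def)
  show "a * b * c = a * (b * c)" by transfer (rule req.Mul_assoc)
  show "a * b = b * a" by transfer (rule req.Mul_comm)
  show "1 * a = a" by transfer (rule req.Mul_one)
  show "(a + b) * c = a * c + b * c" by transfer (rule req.distrib)
  show "(0 :: 'a free_ring) \<noteq> 1" by transfer (use req_int_eval in fastforce)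
qed

end

text \<open>The type may have elements outside \<open>carrier R\<close>; their variables go to zero,
  so that all values lie in R.\<close>

primrec eval_term :: "('a, 'm) ring_scheme \<Rightarrow> 'a rterm \<Rightarrow> 'a" where
  "eval_term R (Var a) = (if a \<in> carrier R then a else \<zero>\<^bsub>R\<^esub>)"
| "eval_term R Zero = \<zero>\<^bsub>R\<^esub>"
| "eval_term R One = \<one>\<^bsub>R\<^esub>"
| "eval_term R (Add x y) = eval_term R x \<oplus>\<^bsub>R\<^esub> eval_term R y"
| "eval_term R (Mul x y) = eval_term R x \<otimes>\<^bsub>R\<^esub> eval_term R y"
| "eval_term R (Neg x) = \<ominus>\<^bsub>R\<^esub> eval_term R x"

definition eval_free :: "('a, 'm) ring_scheme \<Rightarrow> 'a free_ring \<Rightarrow> 'a" where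
  "eval_free R x = eval_term R (rep_free_ring x)"

lemma present_free:
  assumes "cring R" shows "present R (eval_free R)"
proof -
  interpret R: cring R by (rule assms)
  have closed: "eval_term R x \<in> carrier R" for x by (induction x) auto
  have eq: "eval_term R x = eval_term R y" if "req x y" for x y
    using that
    by (induction rule: req.induct)
      (auto simp: closed R.a_assoc R.m_assoc R.l_distr R.l_neg intro: R.a_comm R.m_comm)
  have abs: "eval_free R (abs_free_ring x) = eval_term R x" for x
    unfolding eval_free_def using rep_abs_rsp_left[OF Quotient3_free_ring req.refl] eq by blast
  have plus: "abs_free_ring x + abs_free_ring y = abs_free_ring (Add x y)"
    and times: "abs_free_ring x * abs_free_ring y = abs_free_ring (Mul x y)" for x y :: "'a rterm"
    by (simp_all add: plus_free_ring.abs_eq times_free_ring.abs_eq)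
  have rep: "\<exists>x. r = abs_free_ring x" for r :: "'a free_ring"
    using Quotient3_abs_rep[OF Quotient3_free_ring, of r] by metis
  show ?thesis
  proof
    fix r s :: "'a free_ring"
    show "eval_free R r \<in> carrier R" using closed by (simp add: eval_free_def)
    obtain x y where xy: "r = abs_free_ring x" "s = abs_free_ring y" using rep by metis
    show "eval_free R (r + s) = eval_free R r \<oplus>\<^bsub>R\<^esub> eval_free R s"
      "eval_free R (r * s) = eval_free R r \<otimes>\<^bsub>R\<^esub> eval_free R s"
      by (simp_all add: xy plus times abs)
    show "eval_free R 1 = \<one>\<^bsub>R\<^esub>" by (simp add: one_free_ring.abs_eq abs)
  next
    fix x assume "x \<in> carrier R"
    then have "eval_free R (abs_free_ring (Var x)) = x" by (simp add: abs)
    then show "\<exists>r. eval_free R r = x" by blast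
  qed
qed

section \<open>Correspondence between ideals of R and ideals of S above the kernel\<close>

context present
begin

definition kern :: "'b set" where "kern = {s. p s = \<zero>\<^bsub>R\<^esub>}"

definition pull :: "'a set \<Rightarrow> 'b set" where "pull I = {s. p s \<in> I}"

lemma idl_pull: assumes "ideal I R" shows "idl (pull I)"
proof -
  interpret I: ideal I R by (rule assms)
  show ?thesis unfolding idl_def pull_def by (auto simp: p_0 p_add p_mult I.I_l_closed)
qed

lemma kern_pull: "ideal I R \<Longrightarrow> kern \<subseteq> pull I"
  unfolding kern_def pull_def using additive_subgroup.zero_closed[OF ideal.axioms(1)] by fastforce

lemma ideal_push:
  assumes A: "idl A" shows "ideal (p ` A) R"
proof -
  interpret R: cring R by (rule cring_R)
  have "subgroup (p ` A) (add_monoid R)"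
  proof
    show "p ` A \<subseteq> carrier (add_monoid R)" by auto
    show "\<one>\<^bsub>add_monoid R\<^esub> \<in> p ` A" using A p_0 by (auto intro!: image_eqI[of _ _ 0])
    fix x y assume "x \<in> p ` A"
    then obtain a where a: "x = p a" "a \<in> A" by blast
    have "\<ominus>\<^bsub>R\<^esub> x = p (- a)" using a p_uminus by simp
    then show "inv\<^bsub>add_monoid R\<^esub> x \<in> p ` A" using a idl_uminus[OF A] by (simp flip: a_inv_def)
    assume "y \<in> p ` A"
    then obtain b where b: "y = p b" "b \<in> A" by blast
    have "x \<oplus>\<^bsub>R\<^esub> y = p (a + b)" using a b p_add by simp
    then show "x \<otimes>\<^bsub>add_monoid R\<^esub> y \<in> p ` A" using a b idl_add[OF A] by simp
  qed
  then show ?thesis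
  proof (rule idealI[OF R.ring_axioms])
    fix x y assume "x \<in> p ` A" "y \<in> carrier R"
    then obtain a b where ab: "x = p a" "a \<in> A" "y = p b" using p_surj by blast
    then have "y \<otimes>\<^bsub>R\<^esub> x = p (b * a)" "x \<otimes>\<^bsub>R\<^esub> y = p (a * b)" by (simp_all add: p_mult)
    then show "y \<otimes>\<^bsub>R\<^esub> x \<in> p ` A" "x \<otimes>\<^bsub>R\<^esub> y \<in> p ` A"
      using idl_mult[OF A ab(2), of b] idl_mult2[OF A ab(2), of b] by auto
  qed
qed

lemma pull_push: assumes A: "idl A" "kern \<subseteq> A" shows "pull (p ` A) = A"
proof
  show "A \<subseteq> pull (p ` A)" by (auto simp: pull_def)
  show "pull (p ` A) \<subseteq> A"
  proof
    fix s assume "s \<in> pull (p ` A)"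
    then obtain a where a: "p s = p a" "a \<in> A" by (auto simp: pull_def)
    interpret R: cring R by (rule cring_R)
    have "p (s - a) = \<zero>\<^bsub>R\<^esub>" using a by (simp add: p_diff)
    then have "s - a \<in> A" using A(2) by (auto simp: kern_def)
    then show "s \<in> A" using a idl_cong[OF A(1)] by blast
  qed
qed

lemma push_pull: assumes "I \<subseteq> carrier R" shows "p ` pull I = I"
proof
  show "p ` pull I \<subseteq> I" unfolding pull_def by blast
  show "I \<subseteq> p ` pull I"
  proof
    fix x assume "x \<in> I"
    then have "\<exists>r. p r = x" by (rule p_surj[OF subsetD[OF assms]])
    then obtain r where r: "p r = x" by blast
    show "x \<in> p ` pull I" by (rule image_eqI[of _ _ r]) (use r \<open>x \<in> I\<close> in \<open>simp_all add: pull_def\<close>)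
  qed
qed

lemma ideal_carrier: "ideal I R \<Longrightarrow> I \<subseteq> carrier R"
  by (rule additive_subgroup.a_subset[OF ideal.axioms(1)])

lemma pull_mono_iff: "I \<subseteq> carrier R \<Longrightarrow> pull I \<subseteq> pull J \<longleftrightarrow> I \<subseteq> J"
  using push_pull unfolding pull_def by blast

lemma pull_inj: "I \<subseteq> carrier R \<Longrightarrow> J \<subseteq> carrier R \<Longrightarrow> pull I = pull J \<longleftrightarrow> I = J"
  using push_pull by metis

lemma pull_proper: assumes I: "ideal I R" shows "1 \<in> pull I \<longleftrightarrow> I = carrier R"
proof
  assume "1 \<in> pull I"
  then show "I = carrier R" using ideal.one_imp_carrier[OF I] by (simp add: pull_def p_1)
next
  assume "I = carrier R"
  then show "1 \<in> pull I" by (simp add: pull_def)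
qed

lemma idl_kern: "idl kern"
proof -
  interpret R: cring R by (rule cring_R)
  show ?thesis using idl_pull[OF R.zeroideal] by (simp add: pull_def kern_def)
qed

lemma proper_iff: "ideal I R \<Longrightarrow> proper_ideal R I \<longleftrightarrow> 1 \<notin> pull I"
  using pull_proper by (auto simp: proper_ideal_def)

lemma prime_pull: assumes "primeideal P R" shows "prm (pull P)"
proof -
  interpret P: primeideal P R by (rule assms)
  show ?thesis unfolding prm_def
    using idl_pull[OF P.is_ideal] pull_proper[OF P.is_ideal] P.I_notcarr P.I_prime
    by (auto simp: pull_def p_mult)
qed

lemma prime_push: assumes P: "prm P" "kern \<subseteq> P" shows "primeideal (p ` P) R"
proof -
  note Pi = prm_idl[OF P(1)]
  note pp = pull_push[OF Pi P(2)]
  show ?thesis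
  proof (rule primeidealI[OF ideal_push[OF Pi] cring_R])
    show "carrier R \<noteq> p ` P" using pull_proper[OF ideal_push[OF Pi]] pp prm_1[OF P(1)] by auto
    fix a b assume "a \<in> carrier R" "b \<in> carrier R" and ab: "a \<otimes>\<^bsub>R\<^esub> b \<in> p ` P"
    then obtain r s where rs: "a = p r" "b = p s" using p_surj by metis
    then have "r * s \<in> pull (p ` P)" using ab by (simp add: pull_def p_mult)
    then have "r \<in> P \<or> s \<in> P" using pp prm_mult[OF P(1)] by blast
    then show "a \<in> p ` P \<or> b \<in> p ` P" using rs by blast
  qed
qed

lemma pull_genideal: "pull (genideal R (p ` B)) = gen kern ys" if "idl (gen kern ys)" "set ys \<subseteq> B" "B \<subseteq> gen kern ys"
proof -
  interpret R: cring R by (rule cring_R)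
  have G: "ideal (genideal R (p ` B)) R" by (rule R.genideal_ideal) auto
  show ?thesis
  proof
    have "genideal R (p ` B) \<subseteq> p ` gen kern ys"
      by (rule R.genideal_minimal[OF ideal_push[OF that(1)]]) (use that in blast)
    then show "pull (genideal R (p ` B)) \<subseteq> gen kern ys"
      using pull_push[OF that(1) sub_gen] unfolding pull_def by blast
    have "p ` B \<subseteq> genideal R (p ` B)" by (rule R.genideal_self) auto
    then have "set ys \<subseteq> pull (genideal R (p ` B))" using that(2) by (auto simp: pull_def)
    then show "gen kern ys \<subseteq> pull (genideal R (p ` B))"
      by (intro gen_least idl_pull[OF G] kern_pull[OF G])
  qed
qed

lemma pull_genideal_list: "pull (genideal R (set (map p ys))) = gen kern ys"
  using pull_genideal[OF idl_gen[OF idl_kern], of ys "set ys"] gen_set[OF idl_kern] by simp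

lemma map_p_ex: "set xs \<subseteq> carrier R \<Longrightarrow> \<exists>ys. xs = map p ys"
proof (induction xs)
  case (Cons x xs)
  then obtain y ys where "xs = map p ys" "x = p y" using p_surj by fastforce
  then show ?case by (intro exI[of _ "y # ys"]) simp
qed simp

lemma quot_carrier: "carrier (quot_module R I) = {I +>\<^bsub>R\<^esub> p s | s. True}"
  using p_surj by (force simp: quot_module_def FactRing_def A_RCOSETS_def')

lemma quot_smult:
  assumes "ideal I R" shows "p y \<odot>\<^bsub>quot_module R I\<^esub> (I +>\<^bsub>R\<^esub> p s) = I +>\<^bsub>R\<^esub> p (y * s)"
proof -
  interpret I: ideal I R by (rule assms)
  show ?thesis by (simp add: quot_module_def FactRing_def I.rcoset_mult_add p_mult)
qed

lemma coset_eq: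
  assumes "ideal I R" shows "I +>\<^bsub>R\<^esub> p s = I +>\<^bsub>R\<^esub> p t \<longleftrightarrow> s - t \<in> pull I"
proof -
  interpret R: cring R by (rule cring_R)
  show ?thesis using R.quotient_eq_iff_same_a_r_cos[OF assms, of "p s" "p t"] by (simp add: pull_def p_diff)
qed

lemma coset_zero:
  assumes "ideal I R" shows "I +>\<^bsub>R\<^esub> p s = I \<longleftrightarrow> s \<in> pull I"
proof -
  interpret R: cring R by (rule cring_R)
  have "I +>\<^bsub>R\<^esub> p 0 = I"
    using R.a_rcos_zero[OF assms, of "p 0"] additive_subgroup.zero_closed[OF ideal.axioms(1)[OF assms]] p_0 by simp
  then show ?thesis using coset_eq[OF assms, of s 0] by simp
qed

lemma quot_zero: "\<zero>\<^bsub>quot_module R I\<^esub> = I"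
  by (simp add: quot_module_def FactRing_def)

lemma regular_on_quot:
  assumes I: "ideal I R"
  shows "regular_on R (quot_module R I) (p y) \<longleftrightarrow> nzd (pull I) y \<and> 1 \<notin> adj (pull I) y"
proof -
  note Ii = idl_pull[OF I]
  have 1: "(\<forall>x\<in>carrier (quot_module R I). p y \<odot>\<^bsub>quot_module R I\<^esub> x = \<zero>\<^bsub>quot_module R I\<^esub> \<longrightarrow> x = \<zero>\<^bsub>quot_module R I\<^esub>) \<longleftrightarrow> nzd (pull I) y"
    (is "?L \<longleftrightarrow> _")
  proof -
    have "?L \<longleftrightarrow> (\<forall>s. p y \<odot>\<^bsub>quot_module R I\<^esub> (I +>\<^bsub>R\<^esub> p s) = I \<longrightarrow> I +>\<^bsub>R\<^esub> p s = I)"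
      unfolding quot_carrier quot_zero by blast
    then show ?thesis unfolding nzd_def quot_smult[OF I] coset_zero[OF I] by (simp add: mult.commute)
  qed
  have "(\<lambda>x. p y \<odot>\<^bsub>quot_module R I\<^esub> x) ` carrier (quot_module R I) = carrier (quot_module R I) \<longleftrightarrow> 1 \<in> adj (pull I) y"
  proof
    assume "(\<lambda>x. p y \<odot>\<^bsub>quot_module R I\<^esub> x) ` carrier (quot_module R I) = carrier (quot_module R I)"
    moreover have "I +>\<^bsub>R\<^esub> p 1 \<in> carrier (quot_module R I)" unfolding quot_carrier by blast
    ultimately obtain s where "I +>\<^bsub>R\<^esub> p 1 = I +>\<^bsub>R\<^esub> p (y * s)"
    proof -
      assume *: "(\<lambda>x. p y \<odot>\<^bsub>quot_module R I\<^esub> x) ` carrier (quot_module R I) = carrier (quot_module R I)"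
        and "I +>\<^bsub>R\<^esub> p 1 \<in> carrier (quot_module R I)" 
      then have "I +>\<^bsub>R\<^esub> p 1 \<in> (\<lambda>x. p y \<odot>\<^bsub>quot_module R I\<^esub> x) ` carrier (quot_module R I)" by simp
      then obtain c where c: "c \<in> carrier (quot_module R I)" "I +>\<^bsub>R\<^esub> p 1 = p y \<odot>\<^bsub>quot_module R I\<^esub> c" by (rule imageE)
      from c(1) obtain s where "c = I +>\<^bsub>R\<^esub> p s" unfolding quot_carrier by blast
      with c(2) show ?thesis using that quot_smult[OF I] by simp
    qed
    then have "1 - y * s \<in> pull I" using coset_eq[OF I] by blast
    then show "1 \<in> adj (pull I) y" using adj_memI[OF Ii] by blast
  next
    assume "1 \<in> adj (pull I) y"
    then obtain s where s: "1 - y * s \<in> pull I" using adj_memb_cong[OF Ii] by blast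
    have "I +>\<^bsub>R\<^esub> p t = p y \<odot>\<^bsub>quot_module R I\<^esub> (I +>\<^bsub>R\<^esub> p (s * t))" for t
    proof -
      have "(1 - y * s) * t \<in> pull I" using s idl_mult2[OF Ii] by blast
      then have "t - y * (s * t) \<in> pull I" by (simp add: algebra_simps)
      then show ?thesis using coset_eq[OF I] quot_smult[OF I] by simp
    qed
    then have "carrier (quot_module R I) \<subseteq> (\<lambda>x. p y \<odot>\<^bsub>quot_module R I\<^esub> x) ` carrier (quot_module R I)"
      unfolding quot_carrier by blast
    moreover have "(\<lambda>x. p y \<odot>\<^bsub>quot_module R I\<^esub> x) ` carrier (quot_module R I) \<subseteq> carrier (quot_module R I)"
      unfolding quot_carrier using quot_smult[OF I] by blast
    ultimately show "(\<lambda>x. p y \<odot>\<^bsub>quot_module R I\<^esub> x) ` carrier (quot_module R I) = carrier (quot_module R I)"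
      by blast
  qed
  then show ?thesis unfolding regular_on_def using 1 by simp
qed

end

lemma rs_nth: "rs B ys \<longleftrightarrow> (\<forall>i<length ys. nzd (gen B (take i ys)) (ys ! i))"
proof (induction ys rule: rev_induct)
  case (snoc y ys)
  show ?case unfolding rs_append using snoc by (auto simp: less_Suc_eq nth_append)
qed simp

context present
begin

lemma regular_sequence_iff:
  "regular_sequence R (map p ys) \<longleftrightarrow> rs kern ys \<and> (\<forall>i<length ys. 1 \<notin> gen kern (take (Suc i) ys))"
proof -
  interpret R: cring R by (rule cring_R)
  have G: "ideal (genideal R (set (map p zs))) R" for zs by (rule R.genideal_ideal) auto
  have "regular_on R (quot_module R (genideal R (set (take i (map p ys))))) (map p ys ! i) \<longleftrightarrow>
      nzd (gen kern (take i ys)) (ys ! i) \<and> 1 \<notin> gen kern (take (Suc i) ys)" if i: "i < length ys" for i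
  proof -
    have "take i (map p ys) = map p (take i ys)" by (simp add: take_map)
    moreover have "map p ys ! i = p (ys ! i)" using i by simp
    moreover have "gen kern (take (Suc i) ys) = adj (gen kern (take i ys)) (ys ! i)"
      using i by (simp add: take_Suc_conv_app_nth gen_append)
    ultimately show ?thesis using regular_on_quot[OF G, of "take i ys" "ys ! i"] pull_genideal_list by simp
  qed
  then show ?thesis unfolding regular_sequence_def rs_nth by auto
qed

lemma pull_colon:
  assumes "J \<subseteq> carrier R" shows "pull (ideal_colon R I J) = colon (pull I) (pull J)"
proof -
  have "(\<forall>j\<in>J. p r \<otimes>\<^bsub>R\<^esub> j \<in> I) \<longleftrightarrow> (\<forall>s\<in>pull J. r * s \<in> pull I)" for r
  proof -
    have "(\<forall>j\<in>J. p r \<otimes>\<^bsub>R\<^esub> j \<in> I) \<longleftrightarrow> (\<forall>s\<in>pull J. p r \<otimes>\<^bsub>R\<^esub> p s \<in> I)"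
      using push_pull[OF assms] by (metis image_eqI imageE)
    then show ?thesis by (simp add: pull_def p_mult)
  qed
  then show ?thesis by (simp add: pull_def ideal_colon_def colon_def)
qed

lemma krull_dim_ge:
  assumes F: "\<And>i. i \<le> r \<Longrightarrow> prm (F i) \<and> kern \<subseteq> F i" "\<And>i. i < r \<Longrightarrow> F i \<subset> F (Suc i)"
  shows "enat r \<le> krull_dim R"
  unfolding krull_dim_def
proof (rule Sup_upper, intro CollectI exI conjI)
  show "\<forall>i\<le>r. primeideal (p ` F i) R" using F(1) prime_push by blast
  show "\<forall>i<r. p ` F i \<subset> p ` F (Suc i)"
  proof (intro allI impI)
    fix i assume i: "i < r"
    have "pull (p ` F j) = F j" if "j \<le> r" for j using F(1)[OF that] pull_push prm_idl by blast
    then have "p ` F i \<noteq> p ` F (Suc i)" using F(2)[OF i] i by (metis Suc_leI less_imp_le psubsetE)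
    then show "p ` F i \<subset> p ` F (Suc i)" using F(2)[OF i] by blast
  qed
qed simp

lemma nring_kern:
  assumes "noetherian_ring R" shows "nring kern"
proof
  show "idl kern" by (rule idl_kern)
  fix F :: "'b set set"
  assume F: "F \<noteq> {}" "\<And>I. I \<in> F \<Longrightarrow> idl I \<and> kern \<subseteq> I"
  show "\<exists>M\<in>F. \<forall>I\<in>F. M \<subseteq> I \<longrightarrow> I = M"
  proof (rule ccontr)
    assume "\<not> ?thesis"
    then have "\<forall>M\<in>F. \<exists>I\<in>F. M \<subset> I" by blast
    then obtain s where s: "\<And>M. M \<in> F \<Longrightarrow> s M \<in> F \<and> M \<subset> s M" by metis
    obtain M where M: "M \<in> F" using F by blast
    define c where "c i = (s ^^ i) M" for i
    have c: "c i \<in> F" for i by (induction i) (auto simp: c_def M s)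
    have cs: "c i \<subset> c (Suc i)" for i using s[OF c[of i]] by (simp add: c_def)
    have cm: "c i \<subseteq> c j" if "i \<le> j" for i j
      using lift_Suc_mono_le[of c, OF _ that] cs by blast
    let ?C = "range (\<lambda>i. p ` c i)"
    have "\<Union>?C \<in> ?C"
    proof (rule noetherian_ring.ideal_chain_is_trivial[OF assms])
      show "subset.chain {I. ideal I R} ?C"
      proof (rule subset_chain_def[THEN iffD2], intro conjI ballI)
        show "?C \<subseteq> {I. ideal I R}" using c F(2) ideal_push by blast
        fix A B assume "A \<in> ?C" "B \<in> ?C"
        then obtain i j where "A = p ` c i" "B = p ` c j" by blast
        then show "A \<subseteq> B \<or> B \<subseteq> A" using cm[of i j] cm[of j i] by (cases "i \<le> j") auto
      qed
    qed simp
    then obtain i where "\<Union>?C = p ` c i" by blast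
    then have "p ` c (Suc i) \<subseteq> p ` c i" by blast
    moreover have "pull (p ` c j) = c j" for j using c F(2) pull_push by blast
    ultimately have "c (Suc i) \<subseteq> c i" unfolding pull_def by blast
    then show False using cs[of i] by blast
  qed
qed

end

section \<open>Injective resolutions over R read over S\<close>

context present
begin

lemma range_p: "range p = carrier R"
  using p_closed p_surj by (metis rangeI image_subsetI subsetI subset_antisym)

lemma mod_hom_lin: "f \<in> mod_hom R M N \<longleftrightarrow> lin M N f"
proof -
  have "(\<forall>r\<in>carrier R. \<forall>x\<in>carrier M. f (r \<odot>\<^bsub>M\<^esub> x) = r \<odot>\<^bsub>N\<^esub> f x) \<longleftrightarrow>
      (\<forall>r. \<forall>x\<in>carrier M. f (act M r x) = act N r (f x))"
    unfolding act_def using p_closed p_surj by metis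
  then show ?thesis by (auto simp: mod_hom_def hom_def lin_def)
qed

lemma injective_INJ:
  fixes E :: "('a, 'a) module"
  assumes "injective_module R E" shows "INJ kern E"
proof -
  have E: "module R E" and ext: "\<And>(M :: ('a, 'a) module) (N :: ('a, 'a) module) f g.
      module R M \<Longrightarrow> module R N \<Longrightarrow> f \<in> mod_hom R M N \<Longrightarrow> inj_on f (carrier M) \<Longrightarrow> g \<in> mod_hom R M E \<Longrightarrow>
      \<exists>h\<in>mod_hom R N E. \<forall>m\<in>carrier M. h (f m) = g m"
    using assms unfolding injective_module_def by blast+
  show ?thesis unfolding INJ_def
  proof (intro conjI allI impI ballI)
    show "module R E" by (rule E)
    fix b x assume "b \<in> kern" "x \<in> carrier E"
    then show "act E b x = \<zero>\<^bsub>E\<^esub>" using module.smult_l_null[OF E] by (simp add: act_def kern_def)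
  next
    fix N :: "('a, 'a) module" and S g
    assume *: "module R N \<and> subm R N S \<and> lin (N\<lparr>carrier := S\<rparr>) E g \<and>
        (\<forall>b\<in>kern. \<forall>x\<in>carrier N. act N b x \<in> S \<and> g (act N b x) = \<zero>\<^bsub>E\<^esub>)"
    then have N: "module R N" and S: "subm R N S" and g: "lin (N\<lparr>carrier := S\<rparr>) E g" by blast+
    have "lin (N\<lparr>carrier := S\<rparr>) N (\<lambda>x. x)"
      using S by (auto simp: lin_def subm_def)
    then obtain h where "h \<in> mod_hom R N E" "\<forall>x\<in>S. h x = g x"
      using ext[OF subm_module[OF N S] N, of "\<lambda>x. x" g] g by (auto simp: mod_hom_lin)
    then show "\<exists>h. lin N E h \<and> (\<forall>x\<in>S. h x = g x)" using mod_hom_lin by blast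
  qed
qed

lemma resolution_PR:
  fixes E :: "nat \<Rightarrow> ('a, 'a) module"
  assumes "injective_resolution R (self_module R) k E \<epsilon> d" shows "PR kern k E (\<epsilon> \<one>\<^bsub>R\<^esub>) d"
proof -
  interpret R: cring R by (rule cring_R)
  have inj: "\<And>i. injective_module R (E i)" and bound: "\<And>i. i > k \<Longrightarrow> carrier (E i) = {\<zero>\<^bsub>E i\<^esub>}"
    and \<epsilon>: "lin (self_module R) (E 0) \<epsilon>" "inj_on \<epsilon> (carrier R)" and d: "\<And>i. lin (E i) (E (Suc i)) (d i)"
    and k0: "\<epsilon> ` carrier R = a_kernel (E 0) (E 1) (d 0)"
    and kS: "\<And>i. d i ` carrier (E i) = a_kernel (E (Suc i)) (E (Suc (Suc i))) (d (Suc i))"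
    using assms unfolding injective_resolution_def mod_hom_lin by (auto simp: self_module_def)
  have E: "\<And>i. INJ kern (E i)" using inj injective_INJ by blast
  have app: "act (E 0) r (\<epsilon> \<one>\<^bsub>R\<^esub>) = \<epsilon> (p r)" for r
  proof -
    have "\<epsilon> (act (self_module R) r \<one>\<^bsub>R\<^esub>) = act (E 0) r (\<epsilon> \<one>\<^bsub>R\<^esub>)"
      using \<epsilon>(1) by (simp add: lin_def self_module_def)
    then show ?thesis by (simp add: act_def self_module_def)
  qed
  have \<epsilon>0: "\<epsilon> \<zero>\<^bsub>R\<^esub> = \<zero>\<^bsub>E 0\<^esub>"
    using lin_zero[OF self_module INJ_module[OF E] \<epsilon>(1)] by (simp add: self_module_def)
  show ?thesis unfolding PR_def
  proof (intro conjI allI ballI impI)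
    fix i show "INJ kern (E i)" by (rule E)
    show "lin (E i) (E (Suc i)) (d i)" by (rule d)
    show "\<epsilon> \<one>\<^bsub>R\<^esub> \<in> carrier (E 0)" using \<epsilon>(1) by (simp add: lin_def self_module_def)
    fix r show "act (E 0) r (\<epsilon> \<one>\<^bsub>R\<^esub>) = \<zero>\<^bsub>E 0\<^esub> \<longleftrightarrow> r \<in> kern"
      using inj_on_eq_iff[OF \<epsilon>(2) p_closed R.zero_closed, of r] by (simp add: app \<epsilon>0 kern_def)
  next
    fix v assume v: "v \<in> carrier (E 0)"
    have "d 0 v = \<zero>\<^bsub>E 1\<^esub> \<longleftrightarrow> v \<in> \<epsilon> ` carrier R" unfolding k0 using v by (simp add: a_kernel_def')
    also have "\<dots> \<longleftrightarrow> (\<exists>r. v = act (E 0) r (\<epsilon> \<one>\<^bsub>R\<^esub>))"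
      by (simp only: app range_p[symmetric] image_image image_iff bex_UNIV)
    finally show "d 0 v = \<zero>\<^bsub>E 1\<^esub> \<longleftrightarrow> (\<exists>r. v = act (E 0) r (\<epsilon> \<one>\<^bsub>R\<^esub>))" .
  next
    fix i v assume v: "v \<in> carrier (E (Suc i))"
    have "d (Suc i) v = \<zero>\<^bsub>E (Suc (Suc i))\<^esub> \<longleftrightarrow> v \<in> d i ` carrier (E i)"
      unfolding kS using v by (simp add: a_kernel_def')
    then show "d (Suc i) v = \<zero>\<^bsub>E (Suc (Suc i))\<^esub> \<longleftrightarrow> (\<exists>u\<in>carrier (E i). v = d i u)" by blast
  next
    fix i assume "k < i" then show "carrier (E i) = {\<zero>\<^bsub>E i\<^esub>}" by (rule bound)
  qed
qed

text \<open>Each entry uses up one step of the resolution through \<open>rees\<close>. By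
  \<open>PR_0\<close> a step is always left, because an element of m is no unit modulo an ideal
  inside m. The inequality therefore bounds the length of regular sequences in m by N.\<close>

lemma PR_gen:
  assumes PR: "PR kern N E e d" and m: "idl m" "1 \<notin> m" "kern \<subseteq> m" and ys: "rs kern ys" "set ys \<subseteq> m"
  shows "\<exists>k E' e' d'. PR (gen kern ys) k E' e' d' \<and> k + length ys \<le> N"
  using ys
proof (induction ys rule: rev_induct)
  case Nil
  then show ?case using PR by fastforce
next
  case (snoc y ys)
  let ?B = "gen kern ys"
  have B: "idl ?B" using idl_kern by blast
  have ker: "p r = \<zero>\<^bsub>R\<^esub> \<Longrightarrow> r \<in> ?B" for r
    by (rule subsetD[OF sub_gen]) (simp add: kern_def)
  have y: "nzd ?B y" "y \<in> m" using snoc.prems by (auto simp: rs_append)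
  have ys: "rs kern ys" "set ys \<subseteq> m" using snoc.prems by (auto simp: rs_append)
  obtain k E' e' d' where k: "PR ?B k E' e' d'" "k + length ys \<le> N" using snoc.IH[OF ys] by blast
  have Bm: "?B \<subseteq> m" by (rule gen_least[OF m(1) m(3) ys(2)])
  have "k \<noteq> 0"
  proof
    assume "k = 0"
    then obtain a where "1 - y * a \<in> ?B" using PR_0[OF _ B ker y(1)] k(1) by blast
    then have "1 - y * a \<in> m" using Bm by blast
    moreover have "y * a \<in> m" by (rule idl_mult2[OF m(1) y(2)])
    ultimately show False using idl_cong[OF m(1)] m(2) by blast
  qed
  moreover obtain E2 e2 d2 where "PR (adj ?B y) (k - 1) E2 e2 d2" using rees[OF k(1) B ker y(1)] by blast
  ultimately have "PR (gen kern (ys @ [y])) (k - 1) E2 e2 d2 \<and> (k - 1) + length (ys @ [y]) \<le> N"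
    using k(2) by (simp add: gen_append)
  then show ?case by blast
qed

end

section \<open>Gorenstein local rings: comparison of linkage in R and in S\<close>

locale local_gorenstein = present R p for R :: "('a, 'm) ring_scheme" and p :: "'b::comm_ring_1 \<Rightarrow> 'a" +
  assumes gorenstein: "gorenstein_local R" and infinite_residue: "infinite (carrier (residue_field R))"
begin

definition max_pull :: "'b set" where "max_pull = pull (max_ideal R)"

lemma noeth: "noetherian_ring R" and unique_max: "\<exists>!M. maximalideal M R"
  using gorenstein unfolding gorenstein_local_def noetherian_local_def by blast+

lemma max_ideal: "maximalideal (max_ideal R) R"
  unfolding max_ideal_def by (rule theI'[OF unique_max])

lemma max_ideal_eq: "maximalideal M R \<Longrightarrow> M = max_ideal R"
  using max_ideal unique_max by blast

lemma ideal_max: "ideal (max_ideal R) R"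
  by (rule maximalideal.axioms(1)[OF max_ideal])

lemma nloc_kern: "nloc kern max_pull"
proof -
  interpret nring kern by (rule nring_kern[OF noeth])
  show ?thesis
  proof
    show "idl max_pull" unfolding max_pull_def by (rule idl_pull[OF ideal_max])
    show "1 \<notin> max_pull" unfolding max_pull_def pull_proper[OF ideal_max] using maximalideal.I_notcarr[OF max_ideal] by simp
    show "kern \<subseteq> max_pull" unfolding max_pull_def by (rule kern_pull[OF ideal_max])
  next
    fix u assume u: "u \<notin> max_pull"
    show "\<exists>v. 1 - u * v \<in> kern"
    proof (rule ccontr)
      assume no: "\<not> ?thesis"
      have "1 \<notin> adj kern u" using no adj_memb_cong[OF idl_kern] by blast
      \<comment> \<open>A maximal proper ideal containing u corresponds to a maximal ideal of R, and
        R has only one.\<close>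
      let ?F = "{I. idl I \<and> adj kern u \<subseteq> I \<and> 1 \<notin> I}"
      have "\<exists>M\<in>?F. \<forall>I\<in>?F. M \<subseteq> I \<longrightarrow> I = M"
      proof (rule max_ex)
        show "?F \<noteq> {}" using \<open>1 \<notin> adj kern u\<close> idl_adj[OF idl_kern] by blast
        show "idl I \<and> kern \<subseteq> I" if "I \<in> ?F" for I using that sub_adj[of kern u] by blast
      qed
      then obtain M where M: "M \<in> ?F" and max: "\<forall>I\<in>?F. M \<subseteq> I \<longrightarrow> I = M" by (rule bexE)
      have Mi: "idl M" "kern \<subseteq> M" "adj kern u \<subseteq> M" "1 \<notin> M" using M sub_adj[of kern u] by blast+
      have pM: "pull (p ` M) = M" by (rule pull_push[OF Mi(1,2)])
      have "maximalideal (p ` M) R"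
      proof (rule maximalidealI[OF ideal_push[OF Mi(1)]])
        show "carrier R \<noteq> p ` M" using pull_proper[OF ideal_push[OF Mi(1)]] pM Mi(4) by auto
        fix J assume J: "ideal J R" "p ` M \<subseteq> J" "J \<subseteq> carrier R"
        have MJ: "M \<subseteq> pull J" using J(2) unfolding pull_def by blast
        show "J = p ` M \<or> J = carrier R"
        proof (cases "1 \<in> pull J")
          case True
          then show ?thesis using pull_proper[OF J(1)] by blast
        next
          case False
          have "pull J \<in> ?F" using False idl_pull[OF J(1)] MJ Mi(3) by blast
          then have "pull J = M" using max MJ by blast
          then show ?thesis using push_pull[OF J(3)] by blast
        qed
      qed
      then have "max_pull = M" unfolding max_pull_def using max_ideal_eq pM by metis
      then show False using u Mi(3) adj_self[OF idl_kern] by blast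
    qed
  next
    fix X :: "'b set" assume X: "finite X"
    show "\<exists>t. \<forall>x\<in>X. t - x \<notin> max_pull"
    proof (rule ccontr)
      assume "\<not> ?thesis"
      then have "\<And>t. \<exists>x\<in>X. t - x \<in> max_pull" by blast
      then have "\<And>t. \<exists>x\<in>X. max_ideal R +>\<^bsub>R\<^esub> p t = max_ideal R +>\<^bsub>R\<^esub> p x"
        unfolding max_pull_def coset_eq[OF ideal_max] .
      then have "carrier (quot_module R (max_ideal R)) \<subseteq> (\<lambda>x. max_ideal R +>\<^bsub>R\<^esub> p x) ` X"
        unfolding quot_carrier by blast
      then have "finite (carrier (quot_module R (max_ideal R)))" using X finite_surj by blast
      then show False using infinite_residue by (simp add: residue_field_def quot_module_def)
    qed
  qed
qed

lemma gor_kern: "\<exists>dim. gor kern max_pull dim"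
proof -
  interpret nloc kern max_pull by (rule nloc_kern)
  obtain N and E :: "nat \<Rightarrow> ('a, 'a) module" and \<epsilon> d where "injective_resolution R (self_module R) N E \<epsilon> d"
    using gorenstein unfolding gorenstein_local_def by blast
  then have PR: "PR kern N E (\<epsilon> \<one>\<^bsub>R\<^esub>) d" by (rule resolution_PR)
  note PRg = PR_gen[OF PR idl_m m1 n_m]
  let ?D = "\<lambda>r. dge max_pull r kern"
  have bound: "r \<le> N" if r: "?D r" for r
  proof -
    obtain ys where "length ys = r" "set ys \<subseteq> max_pull" "rs kern ys" using r unfolding dge_def by blast
    then show ?thesis using PRg[of ys] by auto
  qed
  \<comment> \<open>The dimension parameter is taken to be the depth, which is finite because the
    resolution bounds it by N.\<close>
  have D: "?D (Greatest ?D)" by (rule GreatestI_nat[of ?D 0 N]) (use bound in auto)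
  have nD: "\<not> ?D (Suc (Greatest ?D))"
  proof
    assume "?D (Suc (Greatest ?D))"
    then have "Suc (Greatest ?D) \<le> Greatest ?D" by (rule Greatest_le_nat[of ?D _ N]) (use bound in auto)
    then show False by simp
  qed
  have "gor kern max_pull (Greatest ?D)"
  proof (intro gor.intro nloc_kern gor_axioms.intro D nD)
    fix ys Q b J \<phi>
    assume ys: "rs kern ys" "set ys \<subseteq> max_pull" and Q: "prm Q" "Q = quo (gen kern ys) b"
      and J: "idl J" "gen kern ys \<subseteq> J" and \<phi>: "mhom J (gen kern ys) \<phi>"
    obtain k and E' :: "nat \<Rightarrow> ('a, 'a) module" and e' d' where k: "PR (gen kern ys) k E' e' d'"
      using PRg[OF ys] by blast
    interpret resol R p kern "gen kern ys" k E' e' d'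
    proof
      show "p r = \<zero>\<^bsub>R\<^esub> \<longleftrightarrow> r \<in> kern" for r by (simp add: kern_def)
      show "PR (gen kern ys) k E' e' d'" by (rule k)
      show "idl (gen kern ys)" by (rule idl_gen[OF idl_kern])
      show "kern \<subseteq> gen kern ys" by (rule sub_gen)
    qed
    show "\<exists>u h. u \<notin> Q \<and> (\<forall>a\<in>J. u * \<phi> a - h * a \<in> gen kern ys)"
      by (rule local_self_injective[OF Q J \<phi>])
  qed
  then show ?thesis by blast
qed

definition gor_dim :: nat where "gor_dim = (SOME d. gor kern max_pull d)"

end

sublocale local_gorenstein \<subseteq> gor kern max_pull gor_dim
  unfolding gor_dim_def by (rule someI_ex[OF gor_kern])

lemma (in present) regular_on_self:
  "regular_on R (self_module R) (p y) \<Longrightarrow> nzd kern y"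
  unfolding regular_on_def nzd_def by (simp add: self_module_def kern_def p_mult)

context local_gorenstein
begin

lemma cmI_grade_unique: "cmI k K \<Longrightarrow> reg K l \<Longrightarrow> l = k"
  using cmI_grade_eq[where k=k and l=l and K=K and B=K and c=1] cmI_1[of k K] by (auto simp: colon_def)

lemma ci_iff:
  assumes I: "ideal I R" shows "complete_intersection R I \<longleftrightarrow> (\<exists>k. reg (pull I) k)"
proof
  assume "complete_intersection R I"
  then obtain xs where I1: "1 \<notin> pull I" and xs: "regular_sequence R xs" "I = genideal R (set xs)"
    unfolding complete_intersection_def using proper_iff[OF I] by blast
  have "set xs \<subseteq> carrier R" using xs(1) unfolding regular_sequence_def by blast
  then obtain ys where ys: "xs = map p ys" using map_p_ex by blast
  have P: "pull I = gen kern ys" unfolding xs(2) ys by (rule pull_genideal_list)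
  have "rs kern ys" using xs(1) unfolding ys regular_sequence_iff by blast
  moreover have "set ys \<subseteq> max_pull"
    using gen_set[OF idl_kern, of ys] proper_sub_m[OF idl_pull[OF I] kern_pull[OF I] I1] unfolding P by (rule subset_trans)
  ultimately show "\<exists>k. reg (pull I) k" unfolding reg_def P by blast
next
  assume "\<exists>k. reg (pull I) k"
  then obtain ys where ys: "set ys \<subseteq> max_pull" "rs kern ys" and P: "pull I = gen kern ys" unfolding reg_def by blast
  have nm: "1 \<notin> gen kern (take i ys)" for i
  proof -
    have "set (take i ys) \<subseteq> max_pull" using ys(1) set_take_subset by fastforce
    then show ?thesis using gen_least[OF idl_m n_m] m1 by blast
  qed
  have "regular_sequence R (map p ys)" unfolding regular_sequence_iff using ys(2) nm by blast
  moreover have "I = genideal R (set (map p ys))"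
  proof -
    interpret R: cring R by (rule cring_R)
    have G: "ideal (genideal R (set (map p ys))) R" by (rule R.genideal_ideal) auto
    show ?thesis
      using pull_inj[OF ideal_carrier[OF I] ideal_carrier[OF G]] P pull_genideal_list[of ys] by simp
  qed
  moreover have "proper_ideal R I" using proper_iff[OF I] P nm[of "length ys"] by simp
  ultimately show "complete_intersection R I" unfolding complete_intersection_def by blast
qed

lemma directly_linked_iff:
  assumes I: "ideal I R" and J: "ideal J R"
  shows "directly_linked R I J \<longleftrightarrow> dlink (pull I) (pull J)"
proof -
  note cI = ideal_carrier[OF I] and cJ = ideal_carrier[OF J]
  have key: "complete_intersection R A \<and> A \<subseteq> I \<inter> J \<and> I = ideal_colon R A J \<and> J = ideal_colon R A I \<longleftrightarrow>
      (\<exists>l. reg (pull A) l) \<and> pull A \<subseteq> pull I \<and> pull A \<subseteq> pull J \<and> pull I = colon (pull A) (pull J) \<and> pull J = colon (pull A) (pull I)"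
    if A: "ideal A R" for A
  proof -
    have "I = ideal_colon R A J \<longleftrightarrow> pull I = colon (pull A) (pull J)"
      using pull_inj[OF cI, of "ideal_colon R A J"] pull_colon[OF cJ, of A] by (simp add: ideal_colon_def)
    moreover have "J = ideal_colon R A I \<longleftrightarrow> pull J = colon (pull A) (pull I)"
      using pull_inj[OF cJ, of "ideal_colon R A I"] pull_colon[OF cI, of A] by (simp add: ideal_colon_def)
    ultimately show ?thesis using ci_iff[OF A] pull_mono_iff[OF ideal_carrier[OF A]] by simp
  qed
  show ?thesis
  proof
    assume "directly_linked R I J"
    then obtain A where pr: "proper_ideal R I" "proper_ideal R J" and
      A: "complete_intersection R A \<and> A \<subseteq> I \<inter> J \<and> I = ideal_colon R A J \<and> J = ideal_colon R A I"
      unfolding directly_linked_def by blast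
    have "ideal A R" using A unfolding complete_intersection_def proper_ideal_def by blast
    note key[OF this, THEN iffD1, OF A]
    then show "dlink (pull I) (pull J)" using pr proper_iff[OF I] proper_iff[OF J] unfolding dlink_def by blast
  next
    assume L: "dlink (pull I) (pull J)"
    then obtain B l where B: "reg B l" "B \<subseteq> pull I" "B \<subseteq> pull J" "pull I = colon B (pull J)" "pull J = colon B (pull I)"
      unfolding dlink_def by blast
    have "pull (p ` B) = B" by (rule pull_push[OF reg_idl[OF B(1)] reg_n[OF B(1)]])
    then have "complete_intersection R (p ` B) \<and> p ` B \<subseteq> I \<inter> J \<and> I = ideal_colon R (p ` B) J \<and> J = ideal_colon R (p ` B) I"
      using key[OF ideal_push[OF reg_idl[OF B(1)]]] B by metis
    moreover have "proper_ideal R I" "proper_ideal R J"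
      using L proper_iff[OF I] proper_iff[OF J] unfolding dlink_def by blast+
    ultimately show "directly_linked R I J" unfolding directly_linked_def by blast
  qed
qed

lemma prime_height_eq:
  assumes P: "primeideal P R" and ex: "\<exists>F. pchain F k \<and> F k = pull P"
    and le: "\<And>F j. pchain F j \<Longrightarrow> F j = pull P \<Longrightarrow> j \<le> k"
  shows "prime_height R P = enat k"
  unfolding prime_height_def
proof (rule antisym)
  let ?S = "{enat n | n. \<exists>Q :: nat \<Rightarrow> 'a set. (\<forall>i\<le>n. primeideal (Q i) R) \<and> (\<forall>i<n. Q i \<subset> Q (Suc i)) \<and> Q n = P}"
  show "Sup ?S \<le> enat k"
  proof (rule Sup_least)
    fix z assume "z \<in> ?S"
    then obtain j Q where z: "z = enat j" and Q: "\<And>i. i \<le> j \<Longrightarrow> primeideal (Q i) R" "\<And>i. i < j \<Longrightarrow> Q i \<subset> Q (Suc i)" "Q j = P"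
      by blast
    have c: "ideal (Q i) R" if "i \<le> j" for i by (rule primeideal.axioms(1)[OF Q(1)[OF that]])
    have "pchain (\<lambda>i. pull (Q i)) j" unfolding pchain_def
    proof (intro conjI allI impI)
      fix i assume "i \<le> j" then show "prm (pull (Q i))" "kern \<subseteq> pull (Q i)"
        using prime_pull[OF Q(1)] kern_pull[OF c] by blast+
    next
      fix i assume i: "i < j"
      then show "pull (Q i) \<subset> pull (Q (Suc i))"
        using pull_mono_iff[OF ideal_carrier[OF c], of i "Q (Suc i)"] pull_mono_iff[OF ideal_carrier[OF c], of "Suc i" "Q i"] Q(2)[OF i]
        by (simp add: less_le_not_le)
    qed
    then show "z \<le> enat k" using le Q(3) z by simp
  qed
  obtain F where F: "pchain F k" "F k = pull P" using ex by blast
  have pF: "pull (p ` F i) = F i" if "i \<le> k" for i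
    by (rule pull_push) (use F(1) that prm_idl in \<open>auto simp: pchain_def\<close>)
  show "enat k \<le> Sup ?S"
  proof (rule Sup_upper, intro CollectI exI conjI)
    show "\<forall>i\<le>k. primeideal (p ` F i) R" using F(1) prime_push unfolding pchain_def by blast
    show "\<forall>i<k. p ` F i \<subset> p ` F (Suc i)"
    proof (intro allI impI)
      fix i assume i: "i < k"
      have "F i \<subset> F (Suc i)" using F(1) i unfolding pchain_def by blast
      moreover have "p ` F i \<noteq> p ` F (Suc i)" using pF[of i] pF[of "Suc i"] i calculation by (metis Suc_leI less_imp_le psubsetE)
      ultimately show "p ` F i \<subset> p ` F (Suc i)" by blast
    qed
    show "p ` F k = P" unfolding F(2) by (rule push_pull[OF ideal_carrier[OF primeideal.axioms(1)[OF P]]])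
  qed simp
qed

lemma cmI_unmixed:
  assumes I: "ideal I R" and cm: "cmI k (pull I)" shows "unmixed R I"
proof -
  have "prime_height R P = enat k" if P: "P \<in> associated_primes R (quot_module R I)" for P
  proof -
    obtain b where pP: "primeideal P R" and b: "P = {r \<in> carrier R. r \<odot>\<^bsub>quot_module R I\<^esub> (I +>\<^bsub>R\<^esub> p b) = I}"
      using P unfolding associated_primes_def quot_zero quot_carrier by blast
    have "pull P = quo (pull I) b"
      unfolding pull_def[of P] quo_def by (subst b) (simp add: quot_smult[OF I] coset_zero[OF I])
    note heights = cmI_heights[OF cm prime_pull[OF pP] this]
    show ?thesis by (rule prime_height_eq[OF pP heights(1)]) (rule heights(2))
  qed
  then show ?thesis unfolding unmixed_def using proper_iff[OF I] cmI_1[OF cm] by simp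
qed

lemma linked_dlinks:
  assumes "linked R I J" shows "dlink\<^sup>*\<^sup>* (pull I) (pull J)"
proof -
  let ?r = "\<lambda>K L. unmixed R K \<and> unmixed R L \<and> directly_linked R K L"
  have step: "dlink (pull K) (pull L)" if "?r K L" for K L
    using that directly_linked_iff[of K L] unfolding unmixed_def proper_ideal_def by blast
  have "(symclp ?r)\<^sup>*\<^sup>* I J" using assms unfolding linked_def equivclp_def by blast
  then show ?thesis
  proof (induction rule: rtranclp_induct)
    case (step K L)
    then have "dlink (pull K) (pull L)" using step(2) \<open>\<And>K L. ?r K L \<Longrightarrow> _\<close> dlink_sym unfolding symclp_def by blast
    then show ?case using step.IH by simp
  qed simp
qed

text \<open>Linkage in R runs through unmixed ideals. All ideals on the chain are Cohen-Macaulay of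
  height k, hence unmixed by \<open>cmI_unmixed\<close>, so a chain in S gives one in R.\<close>

lemma dlinks_linked:
  assumes I: "ideal I R" and cm: "cmI k (pull I)" and L: "dlink\<^sup>*\<^sup>* (pull I) L"
  shows "cmI k L" "linked R I (p ` L)" "pull (p ` L) = L"
proof -
  let ?r = "\<lambda>K L. unmixed R K \<and> unmixed R L \<and> directly_linked R K L"
  have cmL: "cmI k K" if "dlink\<^sup>*\<^sup>* (pull I) K" for K
    using rtranclp_imp_relpowp[OF that] dlinks_cmI[OF _ cm] by blast
  have pp: "pull (p ` K) = K" if "cmI k K" for K by (rule pull_push[OF cmI_idl[OF that] cmI_n[OF that]])
  have um: "unmixed R (p ` K)" if K: "cmI k K" for K
    by (rule cmI_unmixed[OF ideal_push[OF cmI_idl[OF K]], of k]) (simp add: pp[OF K] K)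
  have "equivclp ?r I (p ` L)" using L
  proof (induction rule: rtranclp_induct)
    case base
    then show ?case using push_pull[OF ideal_carrier[OF I]] by simp
  next
    case (step K L)
    have K: "cmI k K" by (rule cmL[OF step(1)])
    have L: "cmI k L" by (rule dlink_cmI(2)[OF K step(2)])
    have "?r (p ` K) (p ` L)"
      using um[OF K] um[OF L] step(2) directly_linked_iff[OF ideal_push[OF cmI_idl[OF K]] ideal_push[OF cmI_idl[OF L]]]
      by (simp add: pp[OF K] pp[OF L])
    then show ?case using step.IH equivclp_into_equivclp by fast
  qed
  then show "cmI k L" "linked R I (p ` L)" "pull (p ` L) = L"
    using cmL[OF L] um[OF cmL[OF L]] pp[OF cmL[OF L]] cmI_unmixed[OF I cm] unfolding linked_def by blast+
qed

lemma linked_sym: "linked R I J \<Longrightarrow> linked R J I"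
  unfolding linked_def using equivclp_sym by fast

lemma linked_ideal: "linked R I J \<Longrightarrow> ideal J R"
  unfolding linked_def unmixed_def proper_ideal_def by blast

lemma licci_iff:
  assumes I: "ideal I R" and cm: "cmI k (pull I)" shows "licci R I \<longleftrightarrow> ci_linked (pull I)"
proof
  assume "licci R I"
  then obtain C where C: "complete_intersection R C" "linked R C I"
    unfolding licci_def linkage_class_def by blast
  have "ideal C R" by (rule linked_ideal[OF linked_sym[OF C(2)]])
  then obtain l where "reg (pull C) l" using C(1) ci_iff by blast
  moreover have "dlink\<^sup>*\<^sup>* (pull I) (pull C)" by (rule linked_dlinks[OF linked_sym[OF C(2)]])
  ultimately show "ci_linked (pull I)" unfolding ci_linked_def by blast
next
  assume "ci_linked (pull I)"
  then obtain C l where C: "reg C l" "dlink\<^sup>*\<^sup>* (pull I) C" unfolding ci_linked_def by blast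
  note L = dlinks_linked[OF I cm C(2)]
  have "complete_intersection R (p ` C)"
    unfolding ci_iff[OF ideal_push[OF cmI_idl[OF L(1)]]] L(3) using C(1) by blast
  then show "licci R I" unfolding licci_def linkage_class_def using linked_sym[OF L(2)] by blast
qed

lemma pull_class:
  assumes I: "ideal I R" and cm: "cmI k (pull I)" and Z: "ideal Z R"
  shows "\<Union> (linkage_class R I) \<subseteq> Z \<longleftrightarrow> (\<forall>L. dlink\<^sup>*\<^sup>* (pull I) L \<longrightarrow> L \<subseteq> pull Z)"
proof
  assume *: "\<Union> (linkage_class R I) \<subseteq> Z"
  show "\<forall>L. dlink\<^sup>*\<^sup>* (pull I) L \<longrightarrow> L \<subseteq> pull Z"
  proof (intro allI impI)
    fix L assume "dlink\<^sup>*\<^sup>* (pull I) L"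
    then have "p ` L \<in> linkage_class R I" using dlinks_linked(2)[OF I cm] unfolding linkage_class_def by blast
    then show "L \<subseteq> pull Z" using * unfolding pull_def by blast
  qed
next
  assume *: "\<forall>L. dlink\<^sup>*\<^sup>* (pull I) L \<longrightarrow> L \<subseteq> pull Z"
  show "\<Union> (linkage_class R I) \<subseteq> Z"
  proof (rule Union_least)
    fix J assume "J \<in> linkage_class R I"
    then have J: "linked R I J" unfolding linkage_class_def by blast
    then have "pull J \<subseteq> pull Z" using * linked_dlinks by blast
    then show "J \<subseteq> Z" using pull_mono_iff[OF ideal_carrier[OF linked_ideal[OF J]]] by blast
  qed
qed

lemma present_quot: assumes I: "ideal I R"
  shows "present (R Quot I) (\<lambda>s. I +>\<^bsub>R\<^esub> p s)"
proof -
  interpret R: cring R by (rule cring_R)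
  interpret I: ideal I R by (rule I)
  show ?thesis
  proof (rule present.intro)
    show "cring (R Quot I)" by (rule ideal.quotient_is_cring[OF I cring_R])
    fix r s
    show "I +>\<^bsub>R\<^esub> p r \<in> carrier (R Quot I)" using quot_carrier[of I] by (auto simp: quot_module_def)
    show "I +>\<^bsub>R\<^esub> p (r + s) = (I +>\<^bsub>R\<^esub> p r) \<oplus>\<^bsub>R Quot I\<^esub> (I +>\<^bsub>R\<^esub> p s)"
      by (simp add: FactRing_def I.a_rcos_sum p_add)
    show "I +>\<^bsub>R\<^esub> p (r * s) = (I +>\<^bsub>R\<^esub> p r) \<otimes>\<^bsub>R Quot I\<^esub> (I +>\<^bsub>R\<^esub> p s)"
      by (simp add: FactRing_def I.rcoset_mult_add p_mult)
    show "I +>\<^bsub>R\<^esub> p 1 = \<one>\<^bsub>R Quot I\<^esub>" by (simp add: FactRing_def p_1)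
  next
    fix x assume "x \<in> carrier (R Quot I)"
    then show "\<exists>r. I +>\<^bsub>R\<^esub> p r = x" using quot_carrier[of I] by (auto simp: quot_module_def)
  qed
qed

text \<open>Let k be the length of a maximal regular sequence in I. As I lies in an associated prime
  of that sequence, \<open>chain_above\<close> shows that R/I has dimension at least
  \<open>gor_dim - k\<close>, and its depth equals its dimension.\<close>

lemma cohen_macaulay_cmI:
  assumes "cohen_macaulay_ideal R I" shows "\<exists>k. cmI k (pull I)"
proof -
  have pI: "proper_ideal R I" and depth: "ring_depth (R Quot I) = krull_dim (R Quot I)"
    using assms unfolding cohen_macaulay_ideal_def cohen_macaulay_local_def by blast+
  have I: "ideal I R" using pI unfolding proper_ideal_def by blast
  have I1: "1 \<notin> pull I" using proper_iff[OF I] pI by blast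
  note Ii = idl_pull[OF I] kern_pull[OF I]
  obtain k B c where B: "reg B k" "B \<subseteq> pull I" and P: "prm (quo B c)" "pull I \<subseteq> quo B c"
    using max_regular[OF Ii I1] by blast
  let ?r = "gor_dim - k"
  obtain F where F: "pchain F ?r" "F 0 = quo B c"
    using chain_above[OF reg_idl[OF B(1)] reg_n[OF B(1)] reg_dge[OF B(1)] P(1)] by blast
  have F0: "F 0 \<subseteq> F i" if "i \<le> ?r" for i using that
  proof (induction i)
    case (Suc i)
    then have "F i \<subset> F (Suc i)" using F(1) unfolding pchain_def by simp
    then show ?case using Suc by auto
  qed simp
  interpret Q: present "R Quot I" "\<lambda>s. I +>\<^bsub>R\<^esub> p s" by (rule present_quot[OF I])
  have kQ: "Q.kern = pull I" unfolding Q.kern_def by (simp add: FactRing_def coset_zero[OF I])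
  have "enat ?r \<le> krull_dim (R Quot I)"
  proof (rule Q.krull_dim_ge[of _ F])
    fix i assume "i \<le> ?r"
    then show "prm (F i) \<and> Q.kern \<subseteq> F i" using F F0[of i] P(2) unfolding kQ pchain_def by auto
  next
    fix i assume "i < ?r" then show "F i \<subset> F (Suc i)" using F(1) unfolding pchain_def by blast
  qed
  then have le: "enat ?r \<le> ring_depth (R Quot I)" using depth by simp
  have "\<exists>xs. regular_sequence (R Quot I) xs \<and> ?r \<le> length xs"
  proof (rule ccontr)
    assume no: "\<not> ?thesis"
    \<comment> \<open>The empty sequence settles the case \<open>?r = 0\<close>, so that
      \<open>?r - 1\<close> below is a true predecessor.\<close>
    have "regular_sequence (R Quot I) []" by (simp add: regular_sequence_def)
    then have r0: "0 < ?r" using no by fastforce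
    have "ring_depth (R Quot I) \<le> enat (?r - 1)" unfolding ring_depth_def
    proof (rule Sup_least)
      fix z assume "z \<in> {enat (length xs) | xs. regular_sequence (R Quot I) xs \<and> set xs \<subseteq> max_ideal (R Quot I)}"
      then obtain xs where xs: "z = enat (length xs)" "regular_sequence (R Quot I) xs" by blast
      have "length xs < ?r" using no xs(2) by (meson not_le)
      then show "z \<le> enat (?r - 1)" using xs(1) by simp
    qed
    then have "enat ?r \<le> enat (?r - 1)" using le by (rule order_trans[rotated])
    then show False using r0 by simp
  qed
  then obtain xs where xs: "regular_sequence (R Quot I) xs" "?r \<le> length xs" by blast
  have "set xs \<subseteq> carrier (R Quot I)" using xs(1) unfolding regular_sequence_def by blast
  then obtain ys where ys: "xs = map (\<lambda>s. I +>\<^bsub>R\<^esub> p s) ys" using Q.map_p_ex by blast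
  have rs: "rs (pull I) ys" and no1: "\<And>i. i < length ys \<Longrightarrow> 1 \<notin> gen (pull I) (take (Suc i) ys)"
    using xs(1) unfolding ys Q.regular_sequence_iff kQ by blast+
  have "set ys \<subseteq> max_pull"
  proof (cases "ys = []")
    case False
    then have "1 \<notin> gen (pull I) ys" using no1[of "length ys - 1"] by simp
    then have "gen (pull I) ys \<subseteq> max_pull"
      by (rule proper_sub_m[OF idl_gen[OF Ii(1)] subset_trans[OF Ii(2) sub_gen]])
    then show ?thesis using gen_set[OF Ii(1), of ys] by (rule subset_trans[rotated])
  qed simp
  then have "dge max_pull (length ys) (pull I)" using rs unfolding dge_def by blast
  then have "dge max_pull ?r (pull I)" by (rule dge_mono) (use xs(2) ys in simp)
  then show ?thesis unfolding cmI_def using Ii I1 B by blast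
qed

lemma pull_genideal_insert:
  assumes J: "ideal J R" shows "pull (genideal R (J \<union> {p y})) = adj (pull J) y"
proof -
  interpret R: cring R by (rule cring_R)
  note Ji = idl_pull[OF J]
  have c: "J \<union> {p y} \<subseteq> carrier R" using ideal_carrier[OF J] by simp
  have G: "ideal (genideal R (J \<union> {p y})) R" by (rule R.genideal_ideal[OF c])
  have self: "J \<union> {p y} \<subseteq> genideal R (J \<union> {p y})" by (rule R.genideal_self[OF c])
  show ?thesis
  proof
    have "J \<subseteq> p ` adj (pull J) y"
      using image_mono[OF sub_adj, of p "pull J" y] push_pull[OF ideal_carrier[OF J]] by simp
    then have "genideal R (J \<union> {p y}) \<subseteq> p ` adj (pull J) y"
      using adj_self[OF Ji, of y] by (intro R.genideal_minimal ideal_push idl_adj Ji) blast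
    then have "pull (genideal R (J \<union> {p y})) \<subseteq> pull (p ` adj (pull J) y)" unfolding pull_def by blast
    also have "\<dots> = adj (pull J) y"
      by (rule pull_push[OF idl_adj[OF Ji] subset_trans[OF kern_pull[OF J] sub_adj]])
    finally show "pull (genideal R (J \<union> {p y})) \<subseteq> adj (pull J) y" .
    show "adj (pull J) y \<subseteq> pull (genideal R (J \<union> {p y}))"
      by (rule adj_least[OF idl_pull[OF G]]) (use self in \<open>auto simp: pull_def\<close>)
  qed
qed

text \<open>\<open>section_links\<close> with Z the right-hand side and
  \<open>section_links_converse\<close> with Z the left-hand side give the two inclusions. The parts
  on complete intersections show that I is licci exactly when (I, x) is.\<close>

lemma linkage_integral_section:
  assumes I: "cohen_macaulay_ideal R I"
    and x: "regular_on R (self_module R) x" "regular_on R (quot_module R I) x"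
  shows "linkage_integral R (genideal R (I \<union> {x})) = genideal R (linkage_integral R I \<union> {x})"
proof -
  interpret R: cring R by (rule cring_R)
  obtain k where k: "cmI k (pull I)" using cohen_macaulay_cmI[OF I] by blast
  have Ii: "ideal I R" using I unfolding cohen_macaulay_ideal_def proper_ideal_def by blast
  have xc: "x \<in> carrier R" using x(1) unfolding regular_on_def by blast
  then obtain y where xy: "x = p y" using p_surj by metis
  have y0: "nzd kern y" using x(1) unfolding xy by (rule regular_on_self)
  have y: "nzd (pull I) y" and y1: "1 \<notin> adj (pull I) y" using x(2) unfolding xy regular_on_quot[OF Ii] by blast+
  have "adj (pull I) y \<subseteq> max_pull"
    by (rule proper_sub_m[OF idl_adj[OF idl_pull[OF Ii]] subset_trans[OF kern_pull[OF Ii] sub_adj] y1])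
  then have ym: "y \<in> max_pull" using adj_self[OF idl_pull[OF Ii]] by blast
  let ?J = "genideal R (I \<union> {x})"
  have Ji: "ideal ?J R" by (rule R.genideal_ideal) (use ideal_carrier[OF Ii] xc in simp)
  have pJ: "pull ?J = adj (pull I) y" unfolding xy by (rule pull_genideal_insert[OF Ii])
  have kJ: "cmI (Suc k) (pull ?J)" unfolding pJ by (rule cmI_adj[OF k ym y])
  have links: "\<exists>j. (dlink ^^ j) K L" if "dlink\<^sup>*\<^sup>* K L" for K L using rtranclp_imp_relpowp[OF that] by blast
  have lic_iff: "ci_linked (pull I) \<longleftrightarrow> ci_linked (pull ?J)"
  proof (rule iffI; rule ccontr)
    assume "ci_linked (pull I)" and nl: "\<not> ci_linked (pull ?J)"
    then obtain C l j where C: "reg C l" "(dlink ^^ j) (pull I) C" using links unfolding ci_linked_def by blast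
    have "l = k" by (rule cmI_grade_unique[OF dlinks_cmI[OF C(2) k] C(1)])
    then show False using section_links_converse[OF k ym y y0 C(2)] nl C(1) unfolding pJ by blast
  next
    assume "ci_linked (pull ?J)" and nl: "\<not> ci_linked (pull I)"
    then obtain C l j where C: "reg C l" "(dlink ^^ j) (pull ?J) C" using links unfolding ci_linked_def by blast
    have "l = Suc k" by (rule cmI_grade_unique[OF dlinks_cmI[OF C(2) kJ] C(1)])
    then show False using section_links[OF k ym y C(2)[unfolded pJ] nl] C(1) by blast
  qed
  show ?thesis
  proof (cases "ci_linked (pull I)")
    case True
    then have "licci R I" "licci R ?J" using licci_iff[OF Ii k] licci_iff[OF Ji kJ] lic_iff by blast+
    then have int: "linkage_integral R I = carrier R" "linkage_integral R ?J = carrier R"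
      unfolding linkage_integral_def by simp_all
    have c: "carrier R \<union> {x} \<subseteq> carrier R" using xc by simp
    show ?thesis unfolding int
      using R.genideal_self[OF c] ideal_carrier[OF R.genideal_ideal[OF c]] by blast
  next
    case False
    then have nlJ: "\<not> ci_linked (pull ?J)" using lic_iff by blast
    have int: "linkage_integral R I = genideal R (\<Union> (linkage_class R I))"
      "linkage_integral R ?J = genideal R (\<Union> (linkage_class R ?J))"
      using False nlJ licci_iff[OF Ii k] licci_iff[OF Ji kJ] unfolding linkage_integral_def by simp_all
    have cl: "\<Union> (linkage_class R K) \<subseteq> carrier R" for K
      unfolding linkage_class_def using ideal_carrier[OF linked_ideal] by blast
    let ?A = "genideal R (\<Union> (linkage_class R I))" and ?B = "genideal R (\<Union> (linkage_class R ?J))"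
    have Ai: "ideal ?A R" and Bi: "ideal ?B R" by (rule R.genideal_ideal[OF cl])+
    have A: "\<Union> (linkage_class R I) \<subseteq> ?A" and B: "\<Union> (linkage_class R ?J) \<subseteq> ?B" by (rule R.genideal_self[OF cl])+
    have c: "?A \<union> {x} \<subseteq> carrier R" using ideal_carrier[OF Ai] xc by simp
    let ?G = "genideal R (?A \<union> {x})"
    have Gi: "ideal ?G R" by (rule R.genideal_ideal[OF c])
    have G: "?A \<subseteq> ?G" "x \<in> ?G" using R.genideal_self[OF c] by blast+
    have AG: "\<Union> (linkage_class R I) \<subseteq> ?G" by (rule subset_trans[OF A G(1)])
    have "\<Union> (linkage_class R ?J) \<subseteq> ?G" unfolding pull_class[OF Ji kJ Gi]
    proof (intro allI impI)
      fix L assume "dlink\<^sup>*\<^sup>* (pull ?J) L"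
      then obtain j where j: "(dlink ^^ j) (adj (pull I) y) L" using links unfolding pJ by blast
      have "y \<in> pull ?G" using G(2) unfolding xy pull_def by blast
      then show "L \<subseteq> pull ?G"
        using section_links[OF k ym y j False] idl_pull[OF Gi] AG[unfolded pull_class[OF Ii k Gi]] by blast
    qed
    then have "?B \<subseteq> ?G" by (rule R.genideal_minimal[OF Gi])
    moreover have "\<Union> (linkage_class R I) \<subseteq> ?B" unfolding pull_class[OF Ii k Bi]
    proof (intro allI impI)
      fix L assume "dlink\<^sup>*\<^sup>* (pull I) L"
      then obtain j where j: "(dlink ^^ j) (pull I) L" using links by blast
      show "L \<subseteq> pull ?B"
        using section_links_converse[OF k ym y y0 j nlJ[unfolded pJ]] idl_pull[OF Bi] B[unfolded pull_class[OF Ji kJ Bi] pJ] by blast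
    qed
    then have "?A \<subseteq> ?B" by (rule R.genideal_minimal[OF Bi])
    moreover have "x \<in> ?B"
    proof -
      have "pull ?J \<subseteq> pull ?B" using B unfolding pull_class[OF Ji kJ Bi] by blast
      moreover have "y \<in> pull ?J" unfolding pJ by (rule adj_self[OF idl_pull[OF Ii]])
      ultimately show ?thesis unfolding xy pull_def by blast
    qed
    then have "?G \<subseteq> ?B" using \<open>?A \<subseteq> ?B\<close> by (intro R.genideal_minimal[OF Bi]) simp
    ultimately show ?thesis unfolding int by blast
  qed
qed

end

theorem theorem3p1:
  fixes R :: "('a, 'm) ring_scheme" and I :: "'a set" and x :: 'a
  assumes "gorenstein_local R"
    and "infinite (carrier (residue_field R))"
    and "cohen_macaulay_ideal R I"
    and "codim R I > 0"
    and "regular_on R (self_module R) x"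
    and "regular_on R (quot_module R I) x"
  shows "linkage_integral R (genideal R (I \<union> {x})) = genideal R (linkage_integral R I \<union> {x})"
proof -
  have "cring R" using assms(1) unfolding gorenstein_local_def noetherian_local_def by blast
  then have "local_gorenstein R (eval_free R)"
    using present_free assms(1,2) by (intro local_gorenstein.intro local_gorenstein_axioms.intro)
  then show ?thesis by (rule local_gorenstein.linkage_integral_section[OF _ assms(3,5,6)])
qed

end
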